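(* Let $\Omega\subset X$ be a nonempty bounded open set such that: (i) $\limsup_{r\to0}\frac{\mu(B(x,r)\setminus\Omega)}{\mu(B(x,r))}>0$ for $\mathcal H$-a.e. $x\in\partial\Omega$; (ii) for every $u\in\mathrm{BV}(\Omega)$ the trace $Tu(x)$ exists for $\mathcal H$-a.e. $x\in\partial^*\Omega$; (iii) there is $C_A\ge1$ such that $\frac1{C_A}\frac{\mu(B(x,r))}{r}\le\mathcal H(B(x,r)\cap\partial\Omega)\le C_A\frac{\mu(B(x,r))}{r}$ for every $x\in\partial\Omega$ and every $0<r\le\operatorname{diam}(\Omega)$. Let $f\in L^1(\partial^*\Omega,P(\Omega,\cdot))$ with $-1\le f\le 1$ and $\int_{\partial^*\Omega}f\,dP(\Omega,\cdot)=0$. Then the restricted Neumann problem with boundary data $f$ has a solution, i.e. there is $u\in\mathrm{BV}(\Omega)$ with $-1\le u\le1$ and $I(u)\le I(v)$ for all $v\in\mathrm{BV}(\Omega)$ with $-1\le v\le1$.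
   Context: Setting. $(X,d,\mu)$ is a complete metric space with at least two points, with a Borel regular outer measure $\mu$ that is doubling: there is $C_d\ge 1$ with $0<\mu(B(x,2r))\le C_d\,\mu(B(x,r))<\infty$ for all balls. A Borel function $g\ge 0$ is an upper gradient of $u$ if $|u(x)-u(y)|\le\int_\gamma g\,ds$ for every nonconstant rectifiable curve $\gamma$ with end points $x,y$ (the left side is $\infty$ if $u(x)$ or $u(y)$ is infinite); for functions on an open set $U$ only curves in $U$ are considered. $X$ supports a $(1,1)$-Poincaré inequality: there are $C_P>0$, $\lambda\ge 1$ such that for all balls $B(x,r)$, all locally integrable $u$ on $X$ and all upper gradients $g$ of $u$, $\frac1{\mu(B(x,r))}\int_{B(x,r)}|u-u_{B(x,r)}|\,d\mu\le \frac{C_P r}{\mu(B(x,\lambda r))}\int_{B(x,\lambda r)}g\,d\mu$, where $u_{B}$ is the mean of $u$ over $B$. BV functions. For $U\subset X$ open and $u\in L^1_{\rm loc}(U)$, $\|Du\|(U)=\inf\{\liminf_i\int_U g_{u_i}\,d\mu\}$, the infimum over $u_i\in \mathrm{Lip}_{\rm loc}(U)$ (Lipschitz on every open $U'$ with $\overline{U'}$ compact in $U$) with $u_i\to u$ in $L^1_{\rm loc}(U)$ and $g_{u_i}$ an upper gradient of $u_i$ in $U$; for arbitrary $A$, $\|Du\|(A)=\inf\{\|Du\|(U):U\supset A\text{ open}\}$. $u\in\mathrm{BV}(U)$ means $u\in L^1(U)$ and $\|Du\|(U)<\infty$. For $\mu$-measurable $E$, $P(E,A)=\|D\chi_E\|(A)$.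 (Condition (iii) implies $\mathcal H(\partial\Omega)<\infty$ and hence $P(\Omega,X)<\infty$.) $\mathcal H$ is the codimension 1 Hausdorff measure: $\mathcal H(A)=\lim_{R\to0}\inf\{\sum_i \mu(B(x_i,r_i))/r_i: A\subset\bigcup_i B(x_i,r_i),\ r_i\le R\}$. The measure theoretic boundary $\partial^*E$ is the set of $x\in X$ with $\limsup_{r\to0}\mu(B(x,r)\cap E)/\mu(B(x,r))>0$ and $\limsup_{r\to 0}\mu(B(x,r)\setminus E)/\mu(B(x,r))>0$. For $u$ on $\Omega$ and $x\in\partial\Omega$, the number $Tu(x)$ is the trace of $u$ at $x$ if $\lim_{r\to0}\frac{1}{\mu(B(x,r)\cap\Omega)}\int_{B(x,r)\cap\Omega}|u-Tu(x)|\,d\mu=0$. Functional: $I(u)=\|Du\|(\Omega)+\int_{\partial^*\Omega}Tu\,f\,dP(\Omega,\cdot)$ for $u\in\mathrm{BV}(\Omega)$. *)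

theory Defs
  imports "HOL-Analysis.Analysis"
begin

section \<open>Outer measures and doubling\<close>

text \<open>The measure obtained from an outer measure by restriction to its Caratheodory measurable
  sets. It is used both for the given outer measure and for the perimeter measure.\<close>

definition outer_to_measure :: "('a set \<Rightarrow> ennreal) \<Rightarrow> 'a measure" where
  "outer_to_measure \<phi> = measure_of UNIV (lambda_system UNIV UNIV \<phi>) \<phi>"

lemma
  assumes "outer_measure_space UNIV \<phi>"
  shows space_outer_to_measure: "space (outer_to_measure \<phi>) = UNIV"
    and sets_outer_to_measure: "sets (outer_to_measure \<phi>) = lambda_system UNIV UNIV \<phi>"
    and emeasure_outer_to_measure:
      "A \<in> lambda_system UNIV UNIV \<phi> \<Longrightarrow> emeasure (outer_to_measure \<phi>) A = \<phi> A"
proof -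
  interpret sigma_algebra UNIV "UNIV :: 'a set set"
    using sigma_algebra_Pow[of UNIV] by simp
  have ms: "measure_space UNIV (lambda_system UNIV UNIV \<phi>) \<phi>"
    using caratheodory_lemma[OF assms] .
  then interpret L: sigma_algebra UNIV "lambda_system UNIV UNIV \<phi>"
    by (simp add: measure_space_def)
  show "space (outer_to_measure \<phi>) = UNIV"
    by (simp add: outer_to_measure_def space_measure_of_conv)
  show "sets (outer_to_measure \<phi>) = lambda_system UNIV UNIV \<phi>"
    by (simp add: outer_to_measure_def L.sets_measure_of_eq)
  show "emeasure (outer_to_measure \<phi>) A = \<phi> A" if "A \<in> lambda_system UNIV UNIV \<phi>"
    using ms that unfolding outer_to_measure_def
    by (intro emeasure_measure_of_sigma) (auto simp: measure_space_def)
qed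

definition borel_regular_outer_measure :: "('a::topological_space set \<Rightarrow> ennreal) \<Rightarrow> bool" where
  "borel_regular_outer_measure \<mu> \<longleftrightarrow>
     outer_measure_space UNIV \<mu> \<and>
     sets borel \<subseteq> lambda_system UNIV UNIV \<mu> \<and>
     (\<forall>A. \<exists>B\<in>sets borel. A \<subseteq> B \<and> \<mu> B = \<mu> A)"

definition doubling :: "('a::metric_space set \<Rightarrow> ennreal) \<Rightarrow> bool" where
  "doubling \<mu> \<longleftrightarrow> (\<exists>C\<^sub>d\<ge>1. \<forall>x. \<forall>r>0.
     0 < \<mu> (ball x (2 * r)) \<and>
     \<mu> (ball x (2 * r)) \<le> ennreal C\<^sub>d * \<mu> (ball x r) \<and>
     ennreal C\<^sub>d * \<mu> (ball x r) < \<infinity>)"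


section \<open>Curves and upper gradients\<close>

text \<open>Length of the restriction of \<open>\<gamma>\<close> to \<open>[a, b]\<close>. Curves are parametrized by \<open>[0, 1]\<close>, as in the
  library notion \<open>path\<close>; every compact parameter interval is an affine image of it.\<close>

definition curve_length :: "real \<Rightarrow> real \<Rightarrow> (real \<Rightarrow> 'a::metric_space) \<Rightarrow> ennreal" where
  "curve_length a b \<gamma> =
     (SUP (n, t) \<in> {(n::nat, t). mono_on {..n} t \<and> t ` {..n} \<subseteq> {a..b}}.
        \<Sum>i<n. ennreal (dist (\<gamma> (t i)) (\<gamma> (t (Suc i)))))"

definition rectifiable_curve :: "(real \<Rightarrow> 'a::metric_space) \<Rightarrow> bool" where
  "rectifiable_curve \<gamma> \<longleftrightarrow> path \<gamma> \<and> curve_length 0 1 \<gamma> < \<infinity>"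

text \<open>The choice of \<open>t\<close> is immaterial: if the length functions at two parameters agree, then
  \<open>\<gamma>\<close> is constant between them.\<close>

definition arclength_param :: "(real \<Rightarrow> 'a::metric_space) \<Rightarrow> real \<Rightarrow> 'a" where
  "arclength_param \<gamma> s = \<gamma> (SOME t. t \<in> {0..1} \<and> curve_length 0 t \<gamma> = ennreal s)"

definition curve_integral :: "(real \<Rightarrow> 'a::metric_space) \<Rightarrow> ('a \<Rightarrow> ennreal) \<Rightarrow> ennreal" where
  "curve_integral \<gamma> g =
     (\<integral>\<^sup>+ s \<in> {0..enn2real (curve_length 0 1 \<gamma>)}. g (arclength_param \<gamma> s) \<partial>lborel)"

text \<open>In \<open>ereal\<close> one has \<open>\<bar>a - b\<bar> = \<infinity>\<close> whenever \<open>a\<close> or \<open>b\<close> is infinite (also for \<open>\<infinity> - \<infinity>\<close>), which is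
  the convention required for upper gradients of extended real-valued functions.\<close>

definition upper_gradient_on ::
  "'a::metric_space set \<Rightarrow> ('a \<Rightarrow> ereal) \<Rightarrow> ('a \<Rightarrow> ennreal) \<Rightarrow> bool" where
  "upper_gradient_on U u g \<longleftrightarrow>
     g \<in> borel_measurable (restrict_space borel U) \<and>
     (\<forall>\<gamma>. rectifiable_curve \<gamma> \<and> \<not> \<gamma> constant_on {0..1} \<and> path_image \<gamma> \<subseteq> U \<longrightarrow>
        e2ennreal \<bar>u (pathstart \<gamma>) - u (pathfinish \<gamma>)\<bar> \<le> curve_integral \<gamma> g)"

lemma ereal_abs_diff_infinite:
  fixes a b :: ereal
  assumes "\<bar>a\<bar> = \<infinity> \<or> \<bar>b\<bar> = \<infinity>"
  shows "e2ennreal \<bar>a - b\<bar> = \<infinity>"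
  using assms by (cases a; cases b) (auto simp: e2ennreal_infty)


section \<open>Poincare inequality\<close>

definition compactly_contained :: "'a::topological_space set \<Rightarrow> 'a set \<Rightarrow> bool" where
  "compactly_contained V U \<longleftrightarrow> open V \<and> compact (closure V) \<and> closure V \<subseteq> U"

definition locally_integrable ::
  "('a::metric_space set \<Rightarrow> ennreal) \<Rightarrow> ('a \<Rightarrow> ereal) \<Rightarrow> bool" where
  "locally_integrable \<mu> u \<longleftrightarrow>
     u \<in> borel_measurable (outer_to_measure \<mu>) \<and>
     (\<forall>V. compactly_contained V UNIV \<longrightarrow>
        (\<integral>\<^sup>+ x \<in> V. e2ennreal \<bar>u x\<bar> \<partial>outer_to_measure \<mu>) < \<infinity>)"

text \<open>A locally integrable function is finite almost everywhere, so \<open>real_of_ereal\<close> does not affect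
  its mean values.\<close>

definition mean_value :: "('a set \<Rightarrow> ennreal) \<Rightarrow> 'a set \<Rightarrow> ('a \<Rightarrow> ereal) \<Rightarrow> real" where
  "mean_value \<mu> B u = (LINT y:B|outer_to_measure \<mu>. real_of_ereal (u y)) / enn2real (\<mu> B)"

definition poincare_1_1 :: "('a::metric_space set \<Rightarrow> ennreal) \<Rightarrow> bool" where
  "poincare_1_1 \<mu> \<longleftrightarrow> (\<exists>C\<^sub>P>0. \<exists>\<Lambda>\<ge>1. \<forall>x. \<forall>r>0. \<forall>u g.
     locally_integrable \<mu> u \<and> upper_gradient_on UNIV u g \<longrightarrow>
       (\<integral>\<^sup>+ y \<in> ball x r. e2ennreal \<bar>u y - ereal (mean_value \<mu> (ball x r) u)\<bar>
          \<partial>outer_to_measure \<mu>) / \<mu> (ball x r)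
       \<le> ennreal (C\<^sub>P * r) / \<mu> (ball x (\<Lambda> * r)) *
          (\<integral>\<^sup>+ y \<in> ball x (\<Lambda> * r). g y \<partial>outer_to_measure \<mu>))"


section \<open>Functions of bounded variation\<close>

definition lip_loc :: "'a::metric_space set \<Rightarrow> ('a \<Rightarrow> real) \<Rightarrow> bool" where
  "lip_loc U u \<longleftrightarrow> (\<forall>V. compactly_contained V U \<longrightarrow> (\<exists>L. L-lipschitz_on V u))"

definition tendsto_L1_loc ::
  "('a::metric_space set \<Rightarrow> ennreal) \<Rightarrow> 'a set \<Rightarrow> (nat \<Rightarrow> 'a \<Rightarrow> real) \<Rightarrow> ('a \<Rightarrow> real) \<Rightarrow> bool" where
  "tendsto_L1_loc \<mu> U us u \<longleftrightarrow> (\<forall>V. compactly_contained V U \<longrightarrow>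
     (\<lambda>i. \<integral>\<^sup>+ x \<in> V. ennreal \<bar>us i x - u x\<bar> \<partial>outer_to_measure \<mu>) \<longlonglongrightarrow> 0)"

text \<open>\<open>\<parallel>Du\<parallel>(U)\<close> for open \<open>U\<close>; it depends only on the values of \<open>u\<close> on \<open>U\<close>.\<close>

definition total_variation_open ::
  "('a::metric_space set \<Rightarrow> ennreal) \<Rightarrow> ('a \<Rightarrow> real) \<Rightarrow> 'a set \<Rightarrow> ennreal" where
  "total_variation_open \<mu> u U =
     Inf {liminf (\<lambda>i. \<integral>\<^sup>+ x \<in> U. g i x \<partial>outer_to_measure \<mu>) | us g.
            (\<forall>i. lip_loc U (us i) \<and> upper_gradient_on U (\<lambda>x. ereal (us i x)) (g i)) \<and>
            tendsto_L1_loc \<mu> U us u}"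

definition total_variation ::
  "('a::metric_space set \<Rightarrow> ennreal) \<Rightarrow> ('a \<Rightarrow> real) \<Rightarrow> 'a set \<Rightarrow> ennreal" where
  "total_variation \<mu> u A = (INF U \<in> {U. open U \<and> A \<subseteq> U}. total_variation_open \<mu> u U)"

definition BV :: "('a::metric_space set \<Rightarrow> ennreal) \<Rightarrow> 'a set \<Rightarrow> ('a \<Rightarrow> real) set" where
  "BV \<mu> U = {u. set_integrable (outer_to_measure \<mu>) U u \<and> total_variation_open \<mu> u U < \<infinity>}"

definition perimeter :: "('a::metric_space set \<Rightarrow> ennreal) \<Rightarrow> 'a set \<Rightarrow> 'a set \<Rightarrow> ennreal" where
  "perimeter \<mu> E A = total_variation \<mu> (indicator E) A"

definition perimeter_measure :: "('a::metric_space set \<Rightarrow> ennreal) \<Rightarrow> 'a set \<Rightarrow> 'a measure" where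
  "perimeter_measure \<mu> E = outer_to_measure (perimeter \<mu> E)"


section \<open>Codimension one Hausdorff measure, boundaries and traces\<close>

text \<open>The index set \<open>I\<close> makes both finite and countably infinite covers admissible. This matters:
  padding a finite cover to an infinite one may make the sum infinite, since \<open>\<mu>(B(x, r)) / r\<close> need
  not be small for small \<open>r\<close>. The limit as \<open>R \<rightarrow> 0\<close> is a supremum by monotonicity in \<open>R\<close>.\<close>

definition codim1_content ::
  "('a::metric_space set \<Rightarrow> ennreal) \<Rightarrow> real \<Rightarrow> 'a set \<Rightarrow> ennreal" where
  "codim1_content \<mu> R A =
     Inf {(\<Sum>\<^sub>\<infinity>i\<in>I. \<mu> (ball (x i) (r i)) / ennreal (r i)) | (I :: nat set) x r.
            (\<forall>i\<in>I. 0 < r i \<and> r i \<le> R) \<and> A \<subseteq> (\<Union>i\<in>I. ball (x i) (r i))}"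

definition codim1_hausdorff :: "('a::metric_space set \<Rightarrow> ennreal) \<Rightarrow> 'a set \<Rightarrow> ennreal" where
  "codim1_hausdorff \<mu> A = (SUP R \<in> {0<..}. codim1_content \<mu> R A)"

definition mt_boundary :: "('a::metric_space set \<Rightarrow> ennreal) \<Rightarrow> 'a set \<Rightarrow> 'a set" where
  "mt_boundary \<mu> E =
     {x. Limsup (at_right 0) (\<lambda>r. \<mu> (ball x r \<inter> E) / \<mu> (ball x r)) > 0 \<and>
         Limsup (at_right 0) (\<lambda>r. \<mu> (ball x r - E) / \<mu> (ball x r)) > 0}"

definition is_trace ::
  "('a::metric_space set \<Rightarrow> ennreal) \<Rightarrow> 'a set \<Rightarrow> ('a \<Rightarrow> real) \<Rightarrow> 'a \<Rightarrow> real \<Rightarrow> bool" where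
  "is_trace \<mu> \<Omega> u x t \<longleftrightarrow>
     ((\<lambda>r. (\<integral>\<^sup>+ y \<in> ball x r \<inter> \<Omega>. ennreal \<bar>u y - t\<bar> \<partial>outer_to_measure \<mu>) / \<mu> (ball x r \<inter> \<Omega>))
        \<longlongrightarrow> 0) (at_right 0)"

text \<open>At boundary points the trace is unique if it exists; the value is irrelevant elsewhere.\<close>

definition bv_trace ::
  "('a::metric_space set \<Rightarrow> ennreal) \<Rightarrow> 'a set \<Rightarrow> ('a \<Rightarrow> real) \<Rightarrow> 'a \<Rightarrow> real" where
  "bv_trace \<mu> \<Omega> u x = (THE t. is_trace \<mu> \<Omega> u x t)"

definition neumann_functional ::
  "('a::metric_space set \<Rightarrow> ennreal) \<Rightarrow> 'a set \<Rightarrow> ('a \<Rightarrow> real) \<Rightarrow> ('a \<Rightarrow> real) \<Rightarrow> real" where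
  "neumann_functional \<mu> \<Omega> f u =
     enn2real (total_variation_open \<mu> u \<Omega>) +
     (LINT x:mt_boundary \<mu> \<Omega>|perimeter_measure \<mu> \<Omega>. bv_trace \<mu> \<Omega> u x * f x)"

end

theory Submission
  imports Defs
begin

text \<open>The functional is convex, so the almost minimizers of almost minimal \<open>L\<^sup>2\<close> norm form a sequence
  \<open>w\<^sub>i\<close> that converges in \<open>L\<^sup>1(\<Omega>)\<close> to some \<open>u\<close>, and it remains to see that the functional does not jump up in
  the limit. Lower semicontinuity of the variation in \<open>\<Omega>\<close> alone is not enough, because the boundary term
  may lose mass. This mass is controlled by the functions \<open>V\<^sub>i\<close> that are \<open>1 - \<eta> \<bar>w\<^sub>i - u\<bar> / 2\<close> in \<open>\<Omega>\<close>
  and \<open>0\<close> outside, where the cutoff \<open>\<eta>\<close> is \<open>1\<close> near \<open>\<partial>\<Omega>\<close>. They converge to the characteristic function of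
  \<open>\<Omega>\<close>, whose variation is the perimeter, while the variation of \<open>V\<^sub>i\<close> in the whole space is at most its variation
  in \<open>\<Omega>\<close> plus the integral of its trace against the perimeter measure. Hence the perimeter integral of
  \<open>\<bar>Tw\<^sub>i - Tu\<bar>\<close> is at most the variation of \<open>w\<^sub>i\<close> and \<open>u\<close> near \<open>\<partial>\<Omega>\<close>, up to a small error; since \<open>\<bar>f\<bar> \<le> 1\<close>,
  the variation that \<open>w\<^sub>i\<close> has near \<open>\<partial>\<Omega>\<close> pays for the loss in the boundary term.\<close>

section \<open>Curves and upper gradients\<close>

text \<open>As f may take the values 1 and -1, the estimate of the variation across the boundary
  must hold with the constant 1. Covering arguments and the Ahlfors condition only give
  \<open>TV_boundary\<close>, with the constant \<open>Cb\<close>. It is therefore applied to a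
  remainder alone. If \<phi> is Lipschitz and close to the trace of V, then near the boundary V is
  the sum of \<phi> restricted to \<Omega>, whose variation \<open>TV_weight\<close> bounds sharply
  by the perimeter integral of \<phi>, and of V - \<phi>, whose boundary contribution is
  \<open>Cb\<close> times an arbitrarily small number. Closeness is needed in L1 of the Hausdorff
  measure for the remainder, and in L1 of the perimeter measure for the main term. The factor 1/2 in
  the functions \<open>V i\<close> keeps their values in [0, 1]. It halves the trace deficit and the
  variation alike, so it disappears from the final estimate. The argument uses that the variation is
  a Borel measure with little mass near the boundary. Both facts come from gluing local
  approximations; the product rules behind the gluing are proved along curves by freezing
  coefficients on short pieces, without derivatives.\<close>

lemma curve_lengthI:
  assumes "mono_on {..n} t" "t ` {..n} \<subseteq> {a..b}"
  shows "(\<Sum>i<n. ennreal (dist (\<gamma> (t i)) (\<gamma> (t (Suc i))))) \<le> curve_length a b \<gamma>"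
  unfolding curve_length_def using assms by (intro SUP_upper2[of "(n, t)"]) auto

lemma curve_length_leI:
  assumes "\<And>n t. mono_on {..n} t \<Longrightarrow> t ` {..n} \<subseteq> {a..b} \<Longrightarrow>
     (\<Sum>i<n. ennreal (dist (\<gamma> (t i)) (\<gamma> (t (Suc i))))) \<le> C"
  shows "curve_length a b \<gamma> \<le> C"
  unfolding curve_length_def using assms by (auto intro!: SUP_least)

lemma curve_length_mono: "a \<le> a' \<Longrightarrow> b' \<le> b \<Longrightarrow> curve_length a' b' \<gamma> \<le> curve_length a b \<gamma>"
  by (rule curve_length_leI, rule curve_lengthI) auto

lemma dist_le_curve_length:
  assumes "a \<le> s" "s \<le> t" "t \<le> b"
  shows "ennreal (dist (\<gamma> s) (\<gamma> t)) \<le> curve_length a b \<gamma>"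
proof -
  have "mono_on {..Suc 0} (\<lambda>i. if i = 0 then s else t)"
    using assms by (auto simp: mono_on_def)
  moreover have "(\<lambda>i. if i = 0 then s else t) ` {..Suc 0} \<subseteq> {a..b}"
    using assms by auto
  ultimately show ?thesis using curve_lengthI[of "Suc 0" _ a b \<gamma>] by fastforce
qed

lemma mono_on_Suc_le: "mono_on {..n} t \<Longrightarrow> i < n \<Longrightarrow> t i \<le> t (Suc i)"
  by (auto simp: mono_on_def)

text \<open>If m lies between x and y, this is the triangle inequality through
  \<open>\<gamma> m\<close>; otherwise one summand is the whole distance and the other is 0.\<close>

lemma dist_split_min_max:
  fixes x y m :: real
  assumes "x \<le> y"
  shows "ennreal (dist (\<gamma> x) (\<gamma> y)) \<le> ennreal (dist (\<gamma> (min x m)) (\<gamma> (min y m))) +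
     ennreal (dist (\<gamma> (max x m)) (\<gamma> (max y m)))"
proof -
  have "dist (\<gamma> x) (\<gamma> y) \<le> dist (\<gamma> (min x m)) (\<gamma> (min y m)) + dist (\<gamma> (max x m)) (\<gamma> (max y m))"
    using assms dist_triangle[of "\<gamma> x" "\<gamma> y" "\<gamma> m"] by (auto simp: min_def max_def)
  then show ?thesis by (simp add: ennreal_plus[symmetric] del: ennreal_plus)
qed

text \<open>The partition points are clamped at m from above and from below. The part beyond m is
  kept as a sum, so that it can be clamped once more at a second point.\<close>

lemma curve_length_split:
  assumes "mono_on {..n} t" "t ` {..n} \<subseteq> {a..b}" "a \<le> m" "m \<le> b"
  shows "(\<Sum>i<n. ennreal (dist (\<gamma> (t i)) (\<gamma> (t (Suc i))))) \<le> curve_length a m \<gamma> +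
     (\<Sum>i<n. ennreal (dist (\<gamma> (max (t i) m)) (\<gamma> (max (t (Suc i)) m))))"
    and "(\<Sum>i<n. ennreal (dist (\<gamma> (max (t i) m)) (\<gamma> (max (t (Suc i)) m)))) \<le> curve_length m b \<gamma>"
proof -
  have "(\<Sum>i<n. ennreal (dist (\<gamma> (t i)) (\<gamma> (t (Suc i))))) \<le>
     (\<Sum>i<n. ennreal (dist (\<gamma> (min (t i) m)) (\<gamma> (min (t (Suc i)) m)))) +
     (\<Sum>i<n. ennreal (dist (\<gamma> (max (t i) m)) (\<gamma> (max (t (Suc i)) m))))"
    unfolding sum.distrib[symmetric] using assms
    by (intro sum_mono dist_split_min_max mono_on_Suc_le) auto
  moreover have "(\<Sum>i<n. ennreal (dist (\<gamma> (min (t i) m)) (\<gamma> (min (t (Suc i)) m)))) \<le> curve_length a m \<gamma>"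
    using assms by (intro curve_lengthI) (force simp: mono_on_def image_subset_iff)+
  ultimately show "(\<Sum>i<n. ennreal (dist (\<gamma> (t i)) (\<gamma> (t (Suc i))))) \<le> curve_length a m \<gamma> +
     (\<Sum>i<n. ennreal (dist (\<gamma> (max (t i) m)) (\<gamma> (max (t (Suc i)) m))))"
    by (meson add_mono order_refl order_trans)
  show "(\<Sum>i<n. ennreal (dist (\<gamma> (max (t i) m)) (\<gamma> (max (t (Suc i)) m)))) \<le> curve_length m b \<gamma>"
    using assms by (intro curve_lengthI) (force simp: mono_on_def image_subset_iff)+
qed

lemma curve_length_add:
  assumes "a \<le> m" "m \<le> b"
  shows "curve_length a b \<gamma> = curve_length a m \<gamma> + curve_length m b \<gamma>"
proof (rule antisym)
  show "curve_length a b \<gamma> \<le> curve_length a m \<gamma> + curve_length m b \<gamma>"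
  proof (rule curve_length_leI)
    fix n t assume "mono_on {..n::nat} t" "t ` {..n} \<subseteq> {a..b}"
    from curve_length_split[OF this assms, of \<gamma>]
    show "(\<Sum>i<n. ennreal (dist (\<gamma> (t i)) (\<gamma> (t (Suc i))))) \<le> curve_length a m \<gamma> + curve_length m b \<gamma>"
      by (meson add_left_mono order_trans)
  qed
next
  let ?S = "\<lambda>n t. \<Sum>i<n. ennreal (dist (\<gamma> (t i)) (\<gamma> (t (Suc i))))"
  have *: "?S n1 t1 + ?S n2 t2 \<le> curve_length a b \<gamma>"
    if t1: "mono_on {..n1} t1" "t1 ` {..n1} \<subseteq> {a..m}" and t2: "mono_on {..n2} t2" "t2 ` {..n2} \<subseteq> {m..b}"
    for n1 n2 t1 t2
  proof -
    \<comment> \<open>The concatenation has \<open>n1 + Suc n2\<close> steps: the extra one leads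
      from \<open>t1 n1\<close> to \<open>t2 0\<close>, and its contribution is discarded in
      \<open>S2\<close>.\<close>
    define t where "t i = (if i \<le> n1 then t1 i else t2 (i - Suc n1))" for i
    have "t x \<le> t y" if "x \<le> y" "y \<le> n1 + Suc n2" for x y
    proof -
      consider "y \<le> n1" | "x \<le> n1" "n1 < y" | "n1 < x" by linarith
      then show ?thesis
      proof cases
        case 1 then show ?thesis using that t1 by (auto simp: t_def mono_on_def)
      next
        case 2
        then have "t1 x \<le> m" "m \<le> t2 (y - Suc n1)" using that t1 t2 by (auto simp: image_subset_iff)
        then show ?thesis using 2 by (auto simp: t_def)
      next
        case 3
        then have "x - Suc n1 \<le> y - Suc n1" "x - Suc n1 \<le> n2" "y - Suc n1 \<le> n2" using that by auto
        then show ?thesis using 3 that t2(1) unfolding mono_on_def by (auto simp: t_def)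
      qed
    qed
    then have mt: "mono_on {..n1 + Suc n2} t" by (auto simp: mono_on_def)
    have "t i \<in> {a..b}" if "i \<le> n1 + Suc n2" for i
    proof (cases "i \<le> n1")
      case True then have "t1 i \<in> {a..m}" using t1 by auto
      then show ?thesis using True assms by (auto simp: t_def)
    next
      case False then have "i - Suc n1 \<in> {..n2}" using that by auto
      then have "t2 (i - Suc n1) \<in> {m..b}" using t2 by blast
      then show ?thesis using False assms by (auto simp: t_def)
    qed
    then have le: "?S (n1 + Suc n2) t \<le> curve_length a b \<gamma>"
      using mt by (intro curve_lengthI) auto
    have sum_add: "(\<Sum>i<n1 + k. F i) = (\<Sum>i<n1. F i) + (\<Sum>i<k. F (n1 + i))" for F :: "nat \<Rightarrow> ennreal" and k
      by (induction k) (simp_all add: add.assoc)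
    let ?X = "\<Sum>i<Suc n2. ennreal (dist (\<gamma> (t (n1 + i))) (\<gamma> (t (Suc (n1 + i)))))"
    have S1: "?S n1 t = ?S n1 t1" by (rule sum.cong) (auto simp: t_def)
    have S2: "?S n2 t2 \<le> ?X"
      unfolding sum.lessThan_Suc_shift by (simp add: t_def)
    have "?S n1 t1 + ?S n2 t2 \<le> ?S n1 t + ?X"
      unfolding S1 using S2 by (rule add_left_mono)
    also have "\<dots> = ?S (n1 + Suc n2) t" by (rule sum_add[symmetric])
    finally show ?thesis using le by (rule order_trans)
  qed
  have ne: "{(n::nat, t). mono_on {..n} t \<and> t ` {..n} \<subseteq> {c..d}} \<noteq> {}" if "c \<le> d" for c d :: real
    using that by (auto intro!: exI[of _ 0] exI[of _ "\<lambda>_. c"] simp: mono_on_def)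
  have "?S n1 t1 + curve_length m b \<gamma> \<le> curve_length a b \<gamma>"
    if "mono_on {..n1} t1" "t1 ` {..n1} \<subseteq> {a..m}" for n1 t1
    unfolding curve_length_def[of m b] add.commute[of "?S n1 t1"] using * that ne assms
    by (subst ennreal_SUP_add_left[symmetric]) (auto intro!: SUP_least simp: add.commute)
  then show "curve_length a m \<gamma> + curve_length m b \<gamma> \<le> curve_length a b \<gamma>"
    unfolding curve_length_def[of a m] using ne assms
    by (subst ennreal_SUP_add_left[symmetric]) (auto intro!: SUP_least)
qed

text \<open>The map h need not be bijective: k inverts it only up to points that c identifies. This
  covers the arc length parameter, where h may jump over intervals on which the curve rests.\<close>

lemma curve_length_reparam:
  fixes h :: "real \<Rightarrow> real"
  assumes "mono_on {s..t} h" "a = h s" "b = h t" "s \<le> t"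
    and inv: "mono_on {a..b} k" "\<And>y. y \<in> {a..b} \<Longrightarrow> k y \<in> {s..t} \<and> c (h (k y)) = c y"
    and eq: "\<And>x. x \<in> {s..t} \<Longrightarrow> \<gamma> x = c (h x)"
  shows "curve_length s t \<gamma> = curve_length a b c"
proof (rule antisym)
  show "curve_length s t \<gamma> \<le> curve_length a b c"
  proof (rule curve_length_leI)
    fix n \<tau> assume \<tau>: "mono_on {..n::nat} \<tau>" "\<tau> ` {..n} \<subseteq> {s..t}"
    have "mono_on {..n} (h \<circ> \<tau>)" "(h \<circ> \<tau>) ` {..n} \<subseteq> {a..b}"
      using \<tau> assms(1-4) by (auto simp: mono_on_def image_subset_iff)
    from curve_lengthI[OF this, of c] show "(\<Sum>i<n. ennreal (dist (\<gamma> (\<tau> i)) (\<gamma> (\<tau> (Suc i))))) \<le> curve_length a b c"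
      using \<tau>(2) eq by (auto simp: image_subset_iff)
  qed
  show "curve_length a b c \<le> curve_length s t \<gamma>"
  proof (rule curve_length_leI)
    fix n \<tau> assume \<tau>: "mono_on {..n::nat} \<tau>" "\<tau> ` {..n} \<subseteq> {a..b}"
    have k: "mono_on {..n} (k \<circ> \<tau>)" "(k \<circ> \<tau>) ` {..n} \<subseteq> {s..t}"
      using \<tau> inv by (auto simp: mono_on_def image_subset_iff)
    have "\<gamma> (k (\<tau> i)) = c (\<tau> i)" if "i \<le> n" for i
      using that \<tau>(2) eq inv(2)[of "\<tau> i"] by (auto simp: image_subset_iff)
    with curve_lengthI[OF k, of \<gamma>] show "(\<Sum>i<n. ennreal (dist (c (\<tau> i)) (c (\<tau> (Suc i))))) \<le> curve_length s t \<gamma>"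
      by auto
  qed
qed

text \<open>A partition that realizes the length up to \<epsilon>/2 sees a short piece [s, t]
  through n increments only, each of them small by uniform continuity of \<gamma>. The lengths
  before s and after t are finite and cancel, which leaves the length of the piece.\<close>

lemma curve_length_small:
  assumes \<gamma>: "rectifiable_curve \<gamma>" and "\<epsilon> > 0"
  obtains \<delta> where "\<delta> > 0"
    "\<And>s t. 0 \<le> s \<Longrightarrow> s \<le> t \<Longrightarrow> t \<le> 1 \<Longrightarrow> t - s < \<delta> \<Longrightarrow> curve_length s t \<gamma> \<le> ennreal \<epsilon>"
proof -
  have fin: "curve_length 0 1 \<gamma> < \<infinity>" and cont: "continuous_on {0..1} \<gamma>"
    using \<gamma> by (auto simp: rectifiable_curve_def path_def)
  have "\<exists>n \<tau>. mono_on {..n::nat} \<tau> \<and> \<tau> ` {..n} \<subseteq> {0..1} \<and>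
      curve_length 0 1 \<gamma> \<le> (\<Sum>i<n. ennreal (dist (\<gamma> (\<tau> i)) (\<gamma> (\<tau> (Suc i))))) + ennreal (\<epsilon>/2)"
  proof (cases "curve_length 0 1 \<gamma> = 0")
    case True
    then show ?thesis by (intro exI[of _ 0] exI[of _ "\<lambda>_. 0"]) (auto simp: mono_on_def)
  next
    case False
    then have "curve_length 0 1 \<gamma> - ennreal (\<epsilon>/2) < curve_length 0 1 \<gamma>"
      using fin assms by (intro ennreal_between) (auto simp: zero_less_iff_neq_zero)
    then obtain p where p: "p \<in> {(n::nat, t). mono_on {..n} t \<and> t ` {..n} \<subseteq> {0..1}}"
      "curve_length 0 1 \<gamma> - ennreal (\<epsilon>/2) < (case p of (n, t) \<Rightarrow> \<Sum>i<n. ennreal (dist (\<gamma> (t i)) (\<gamma> (t (Suc i)))))"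
      unfolding curve_length_def[of 0 1] less_SUP_iff by auto
    obtain n \<tau> where pn: "p = (n, \<tau>)" by force
    show ?thesis
      using p unfolding pn
      by (intro exI[of _ n] exI[of _ \<tau>]) (auto simp: ennreal_minus_le_iff add.commute dest!: less_imp_le)
  qed
  then obtain n \<tau> where \<tau>: "mono_on {..n::nat} \<tau>" "\<tau> ` {..n} \<subseteq> {0..1}"
      "curve_length 0 1 \<gamma> \<le> (\<Sum>i<n. ennreal (dist (\<gamma> (\<tau> i)) (\<gamma> (\<tau> (Suc i))))) + ennreal (\<epsilon>/2)" by blast
  have "uniformly_continuous_on {0..1} \<gamma>"
    using cont by (simp add: compact_uniformly_continuous)
  moreover have "\<epsilon> / (2 * Suc n) > 0" using assms by simp
  ultimately obtain \<delta> where \<delta>: "\<delta> > 0"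
    "\<And>x y. x \<in> {0..1} \<Longrightarrow> y \<in> {0..1} \<Longrightarrow> dist y x < \<delta> \<Longrightarrow> dist (\<gamma> y) (\<gamma> x) < \<epsilon> / (2 * Suc n)"
    unfolding uniformly_continuous_on_def by metis
  show thesis
  proof (rule that[OF \<delta>(1)])
    fix s t :: real assume st: "0 \<le> s" "s \<le> t" "t \<le> 1" "t - s < \<delta>"
    \<comment> \<open>Clamping to [s, t] gives parameter steps shorter than \<delta>, however coarse
      \<tau> is.\<close>
    define T where "T i = min (max (\<tau> i) s) t" for i
    have m1: "mono_on {..n} (\<lambda>i. max (\<tau> i) s)" "(\<lambda>i. max (\<tau> i) s) ` {..n} \<subseteq> {s..1}"
    proof -
      show "mono_on {..n} (\<lambda>i. max (\<tau> i) s)"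
        using \<tau>(1) unfolding mono_on_def by (meson max.mono order_refl)
      have "\<tau> i \<le> 1" if "i \<le> n" for i using \<tau>(2) that by auto
      then show "(\<lambda>i. max (\<tau> i) s) ` {..n} \<subseteq> {s..1}" using st by auto
    qed
    have Tr: "T i \<in> {s..t}" for i using st by (auto simp: T_def)
    let ?d = "\<lambda>f. \<Sum>i<n. ennreal (dist (\<gamma> (f i)) (\<gamma> (f (Suc i))))"
    have "?d \<tau> \<le> curve_length 0 s \<gamma> + ?d (\<lambda>i. max (\<tau> i) s)"
      using curve_length_split(1)[OF \<tau>(1,2), of s \<gamma>] st by auto
    also have "?d (\<lambda>i. max (\<tau> i) s) \<le> ?d T + ?d (\<lambda>i. max (max (\<tau> i) s) t)"
      unfolding sum.distrib[symmetric] T_def using \<tau>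
      by (intro sum_mono dist_split_min_max mono_on_Suc_le[OF m1(1)]) auto
    also have "?d (\<lambda>i. max (max (\<tau> i) s) t) \<le> curve_length t 1 \<gamma>"
      using curve_length_split(2)[OF m1, of t \<gamma>] st by auto
    also have "?d T \<le> (\<Sum>i<n. ennreal (\<epsilon> / (2 * Suc n)))"
    proof (rule sum_mono)
      fix i
      have "dist (T i) (T (Suc i)) < \<delta>" "T i \<in> {0..1}" "T (Suc i) \<in> {0..1}"
        using Tr[of i] Tr[of "Suc i"] st by (auto simp: dist_real_def)
      then show "ennreal (dist (\<gamma> (T i)) (\<gamma> (T (Suc i)))) \<le> ennreal (\<epsilon> / (2 * Suc n))"
        using \<delta>(2)[of "T (Suc i)" "T i"] by (intro ennreal_leI) auto
    qed
    also have "\<dots> = ennreal (n * (\<epsilon> / (2 * Suc n)))"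
      using assms by (simp add: ennreal_mult[symmetric] ennreal_of_nat_eq_real_of_nat)
    also have "\<dots> \<le> ennreal (\<epsilon>/2)" using assms by (intro ennreal_leI) (auto simp: field_simps)
    finally have "?d \<tau> \<le> curve_length 0 s \<gamma> + (ennreal (\<epsilon>/2) + curve_length t 1 \<gamma>)"
      by (simp add: add_left_mono add_right_mono)
    with \<tau>(3) have "curve_length 0 1 \<gamma> \<le> curve_length 0 s \<gamma> + (ennreal (\<epsilon>/2) + curve_length t 1 \<gamma>) + ennreal (\<epsilon>/2)"
      by (meson add_right_mono order_trans)
    also have "\<dots> = (curve_length 0 s \<gamma> + curve_length t 1 \<gamma>) + ennreal \<epsilon>"
      using assms ennreal_plus[of "\<epsilon>/2" "\<epsilon>/2"] by (simp add: add_ac del: ennreal_plus)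
    finally have "(curve_length 0 s \<gamma> + curve_length t 1 \<gamma>) + curve_length s t \<gamma> \<le>
       (curve_length 0 s \<gamma> + curve_length t 1 \<gamma>) + ennreal \<epsilon>"
      using curve_length_add[of 0 s 1 \<gamma>] curve_length_add[of s t 1 \<gamma>] st by (simp add: add_ac)
    moreover have "curve_length 0 s \<gamma> + curve_length t 1 \<gamma> < \<infinity>"
      using fin curve_length_mono[of 0 0 s 1 \<gamma>] curve_length_mono[of 0 t 1 1 \<gamma>] st
      by (auto simp: ennreal_add_less_top less_top[symmetric] top_unique)
    ultimately show "curve_length s t \<gamma> \<le> ennreal \<epsilon>"
      by (subst (asm) ennreal_add_left_cancel_le) auto
  qed
qed

section \<open>Curves parametrized by arc length\<close>

definition unit_speed :: "real \<Rightarrow> (real \<Rightarrow> 'a::metric_space) \<Rightarrow> bool" where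
  "unit_speed L c \<longleftrightarrow> 0 \<le> L \<and> (\<forall>s t. 0 \<le> s \<longrightarrow> s \<le> t \<longrightarrow> t \<le> L \<longrightarrow> curve_length s t c = ennreal (t - s))"

lemma unit_speed_dist:
  assumes "unit_speed L c" "s \<in> {0..L}" "t \<in> {0..L}"
  shows "dist (c s) (c t) \<le> \<bar>t - s\<bar>"
proof -
  have "dist (c s) (c t) \<le> t - s" if "s \<le> t" "s \<in> {0..L}" "t \<in> {0..L}" for s t
    using dist_le_curve_length[of s s t t c] assms(1) that by (auto simp: unit_speed_def)
  from this[of s t] this[of t s] show ?thesis using assms by (auto simp: dist_commute abs_if)
qed

lemma unit_speed_continuous_on: "unit_speed L c \<Longrightarrow> continuous_on {0..L} c"
  by (rule lipschitz_on_continuous_on[of 1]) (auto simp: lipschitz_on_def dist_real_def abs_minus_commute dest: unit_speed_dist)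

text \<open>The length function l is continuous by \<open>curve_length_small\<close>, so the
  intermediate value theorem provides candidates for the choice in \<open>arclength_param\<close>.
  Two candidates are joined by a piece of length 0, hence have the same image.\<close>

lemma arclength_param_unit_speed:
  fixes \<gamma> :: "real \<Rightarrow> 'a::metric_space"
  assumes \<gamma>: "rectifiable_curve \<gamma>"
  defines "L \<equiv> enn2real (curve_length 0 1 \<gamma>)"
  shows "unit_speed L (arclength_param \<gamma>)" "arclength_param \<gamma> 0 = pathstart \<gamma>"
    "arclength_param \<gamma> L = pathfinish \<gamma>" "arclength_param \<gamma> ` {0..L} \<subseteq> path_image \<gamma>"
proof -
  define c where "c = arclength_param \<gamma>"
  define l where "l t = enn2real (curve_length 0 t \<gamma>)" for t
  have fin: "curve_length 0 1 \<gamma> < \<infinity>"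
    using \<gamma> by (auto simp: rectifiable_curve_def)
  have fin': "curve_length s t \<gamma> < \<infinity>" if "0 \<le> s" "t \<le> 1" for s t
    using curve_length_mono[of 0 s t 1 \<gamma>] fin that by (auto intro: le_less_trans)
  have l: "curve_length 0 t \<gamma> = ennreal (l t)" if "t \<le> 1" for t
    using fin'[of 0 t] that by (simp add: l_def)
  have l0: "0 \<le> l t" for t by (simp add: l_def)
  have cl: "curve_length s t \<gamma> = ennreal (l t - l s)" "l s \<le> l t" if "0 \<le> s" "s \<le> t" "t \<le> 1" for s t
  proof -
    show "l s \<le> l t"
      using curve_length_mono[of 0 0 s t \<gamma>] l[of s] l[of t] l0 that by auto
    have "curve_length s t \<gamma> = ennreal (enn2real (curve_length s t \<gamma>))"
      using fin'[of s t] that by simp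
    moreover have "ennreal (l t) = ennreal (l s) + curve_length s t \<gamma>"
      using curve_length_add[of 0 s t \<gamma>] that l by auto
    ultimately have "ennreal (l t) = ennreal (l s + enn2real (curve_length s t \<gamma>))"
      using l0[of s] by (metis enn2real_nonneg ennreal_plus)
    then have "l t = l s + enn2real (curve_length s t \<gamma>)"
      using l0 by (subst (asm) ennreal_inj) auto
    then show "curve_length s t \<gamma> = ennreal (l t - l s)"
      using fin'[of s t] that by simp
  qed
  have l00: "l 0 = 0"
  proof -
    have "curve_length 0 0 \<gamma> \<le> 0"
    proof (rule curve_length_leI)
      fix n t assume "t ` {..n::nat} \<subseteq> {0..0::real}"
      then have "t i = 0" if "i \<le> n" for i using that by auto
      then show "(\<Sum>i<n. ennreal (dist (\<gamma> (t i)) (\<gamma> (t (Suc i))))) \<le> 0" by simp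
    qed
    then show ?thesis by (simp add: l_def)
  qed
  have l1: "l 1 = L" by (simp add: l_def L_def)
  have "continuous_on {0..1} l"
    unfolding continuous_on_iff
  proof (intro ballI allI impI)
    fix x \<epsilon> :: real assume x: "x \<in> {0..1}" "\<epsilon> > 0"
    obtain \<delta> where \<delta>: "\<delta> > 0"
      "\<And>s t. 0 \<le> s \<Longrightarrow> s \<le> t \<Longrightarrow> t \<le> 1 \<Longrightarrow> t - s < \<delta> \<Longrightarrow> curve_length s t \<gamma> \<le> ennreal (\<epsilon>/2)"
      using curve_length_small[OF \<gamma>, of "\<epsilon>/2"] x by auto
    have "l t - l s \<le> \<epsilon>/2" if "0 \<le> s" "s \<le> t" "t \<le> 1" "t - s < \<delta>" for s t
      using \<delta>(2)[OF that] cl[OF that(1-3)] x by (auto simp: ennreal_le_iff2)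
    then show "\<exists>d>0. \<forall>x'\<in>{0..1}. dist x' x < d \<longrightarrow> dist (l x') (l x) < \<epsilon>"
    proof (intro exI[of _ \<delta>] conjI \<delta> ballI impI)
      fix y assume *: "\<And>s t. 0 \<le> s \<Longrightarrow> s \<le> t \<Longrightarrow> t \<le> 1 \<Longrightarrow> t - s < \<delta> \<Longrightarrow> l t - l s \<le> \<epsilon>/2"
        "y \<in> {0..1}" "dist y x < \<delta>"
      show "dist (l y) (l x) < \<epsilon>"
        using *(1)[of x y] *(1)[of y x] *(2-3) x cl(2)[of x y] cl(2)[of y x]
        by (cases "x \<le> y") (auto simp: dist_real_def)
    qed
  qed
  then have ivt: "\<exists>t. 0 \<le> t \<and> t \<le> 1 \<and> l t = s" if "s \<in> {0..L}" for s
    using IVT'[of l 0 s 1] that l00 l1 by auto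
  define \<sigma> where "\<sigma> s = (SOME t. t \<in> {0..1} \<and> curve_length 0 t \<gamma> = ennreal s)" for s
  have c_def': "c s = \<gamma> (\<sigma> s)" for s by (simp add: c_def arclength_param_def \<sigma>_def)
  have \<sigma>: "\<sigma> s \<in> {0..1} \<and> l (\<sigma> s) = s" if "s \<in> {0..L}" for s
  proof -
    have "\<exists>t. t \<in> {0..1} \<and> curve_length 0 t \<gamma> = ennreal s"
      using ivt[OF that] l by fastforce
    then have "\<sigma> s \<in> {0..1} \<and> curve_length 0 (\<sigma> s) \<gamma> = ennreal s"
      unfolding \<sigma>_def by (rule someI_ex)
    then show ?thesis using that l[of "\<sigma> s"] l0[of "\<sigma> s"] by auto
  qed
  have eq: "\<gamma> x = \<gamma> y" if "x \<in> {0..1}" "y \<in> {0..1}" "l x = l y" for x y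
  proof -
    have *: "\<gamma> x = \<gamma> y" if "x \<le> y" "x \<in> {0..1}" "y \<in> {0..1}" "l x = l y" for x y
      using dist_le_curve_length[of x x y y \<gamma>] cl(1)[of x y] that by auto
    show ?thesis
    proof (cases "x \<le> y")
      case True
      then show ?thesis using that by (intro *)
    next
      case False
      then have "\<gamma> y = \<gamma> x" using that by (intro *) simp_all
      then show ?thesis by (rule sym)
    qed
  qed
  have lr: "l t \<in> {0..L}" if "t \<in> {0..1}" for t using cl(2)[of 0 t] cl(2)[of t 1] that l00 l1 by auto
  have cl': "c (l t) = \<gamma> t" if "t \<in> {0..1}" for t
    unfolding c_def' using \<sigma>[OF lr[OF that]] that by (intro eq) auto
  have \<sigma>m: "\<sigma> s \<le> \<sigma> t" if "s \<in> {0..L}" "t \<in> {0..L}" "s \<le> t" for s t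
    using \<sigma>[OF that(1)] \<sigma>[OF that(2)] cl(2)[of "\<sigma> t" "\<sigma> s"] that by force
  show "unit_speed L (arclength_param \<gamma>)" unfolding unit_speed_def c_def[symmetric]
  proof (intro conjI allI impI)
    show "0 \<le> L" by (simp add: L_def)
    fix s t assume st: "0 \<le> s" "s \<le> t" "t \<le> L"
    \<comment> \<open>The choice \<sigma> may be discontinuous, as it skips intervals on which
      \<gamma> rests; l is monotone and recovers the argument of \<sigma>.\<close>
    have "curve_length s t c = curve_length (\<sigma> s) (\<sigma> t) \<gamma>"
    proof (rule curve_length_reparam[of s t \<sigma> _ _ l])
      show "mono_on {s..t} \<sigma>" using st \<sigma>m by (auto simp: mono_on_def)
      have "{\<sigma> s..\<sigma> t} \<subseteq> {0..1}" using \<sigma>[of s] \<sigma>[of t] st by auto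
      then show "mono_on {\<sigma> s..\<sigma> t} l" using cl(2) by (auto simp: mono_on_def subset_eq)
      fix y assume y: "y \<in> {\<sigma> s..\<sigma> t}"
      then have y01: "y \<in> {0..1}" using \<open>{\<sigma> s..\<sigma> t} \<subseteq> {0..1}\<close> by auto
      have "l y \<in> {s..t}" using cl(2)[of "\<sigma> s" y] cl(2)[of y "\<sigma> t"] y \<sigma>[of s] \<sigma>[of t] st by auto
      then show "l y \<in> {s..t} \<and> \<gamma> (\<sigma> (l y)) = \<gamma> y" using cl'[OF y01] by (simp add: c_def')
    qed (auto simp: c_def' st)
    also have "\<dots> = ennreal (t - s)"
      using cl(1)[of "\<sigma> s" "\<sigma> t"] \<sigma>[of s] \<sigma>[of t] st \<sigma>m[of s t] by auto
    finally show "curve_length s t c = ennreal (t - s)" .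
  qed
  show "arclength_param \<gamma> 0 = pathstart \<gamma>" "arclength_param \<gamma> L = pathfinish \<gamma>"
    using cl'[of 0] cl'[of 1] l00 l1 by (auto simp: c_def pathstart_def pathfinish_def)
  show "arclength_param \<gamma> ` {0..L} \<subseteq> path_image \<gamma>"
    using \<sigma> by (auto simp: c_def[symmetric] c_def' path_image_def)
qed

text \<open>This is the way back to the definition of upper gradients: a piece of a unit speed curve
  is rescaled to [0, 1]. Its length function is strictly increasing because a < b, so the choice in
  \<open>arclength_param\<close> has a single candidate.\<close>

lemma curve_integral_affine:
  assumes c: "unit_speed L c" and ab: "0 \<le> a" "a < b" "b \<le> L"
    and meas: "(\<lambda>s. g (c s) * indicator {a..b} s) \<in> borel_measurable borel"
  defines "\<gamma> \<equiv> \<lambda>t. c (a + t * (b - a))"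
  shows "rectifiable_curve \<gamma>" "\<not> \<gamma> constant_on {0..1}" "path_image \<gamma> \<subseteq> c ` {0..L}"
    "curve_integral \<gamma> g = (\<integral>\<^sup>+ s \<in> {a..b}. g (c s) \<partial>lborel)"
proof -
  have mem: "a + t * (b - a) \<in> {a..b}" if "t \<in> {0..1}" for t
  proof -
    have "0 \<le> t * (b - a)" using that ab by simp
    moreover have "t * (b - a) \<le> 1 * (b - a)" using that ab by (intro mult_right_mono) auto
    ultimately show ?thesis by simp
  qed
  have CL: "curve_length x y \<gamma> = ennreal ((y - x) * (b - a))" if "0 \<le> x" "x \<le> y" "y \<le> 1" for x y
  proof -
    have "curve_length x y \<gamma> = curve_length (a + x * (b - a)) (a + y * (b - a)) c"
    proof (rule curve_length_reparam[of x y "\<lambda>t. a + t * (b - a)" _ _ "\<lambda>s. (s - a) / (b - a)"])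
      fix z assume "z \<in> {a + x * (b - a)..a + y * (b - a)}"
      then show "(z - a) / (b - a) \<in> {x..y} \<and> c (a + (z - a) / (b - a) * (b - a)) = c z"
        using ab by (auto simp: pos_le_divide_eq pos_divide_le_eq)
    qed (use ab that in \<open>auto simp: mono_on_def \<gamma>_def divide_right_mono intro: mult_right_mono\<close>)
    also have "\<dots> = ennreal ((y - x) * (b - a))"
      using c mem[of x] mem[of y] that ab mult_right_mono[of x y "b - a"]
      by (simp add: unit_speed_def algebra_simps)
    finally show ?thesis .
  qed
  have "continuous_on {0..1} \<gamma>" unfolding \<gamma>_def
  proof (rule continuous_on_compose2[OF unit_speed_continuous_on[OF c]])
    show "(\<lambda>t. a + t * (b - a)) ` {0..1} \<subseteq> {0..L}" using mem ab by force
  qed (intro continuous_intros)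
  then show "rectifiable_curve \<gamma>"
    using CL[of 0 1] by (simp add: rectifiable_curve_def path_def)
  show "path_image \<gamma> \<subseteq> c ` {0..L}" using mem ab by (force simp: path_image_def \<gamma>_def)
  show "\<not> \<gamma> constant_on {0..1}"
  proof
    assume "\<gamma> constant_on {0..1}"
    then obtain z where z: "\<And>t. t \<in> {0..1} \<Longrightarrow> \<gamma> t = z" by (auto simp: constant_on_def)
    have "curve_length 0 1 \<gamma> \<le> 0"
      by (rule curve_length_leI) (auto simp: z image_subset_iff)
    then show False using CL[of 0 1] ab by simp
  qed
  have ap: "arclength_param \<gamma> s = c (a + s)" if "s \<in> {0..b - a}" for s
  proof -
    have "t \<in> {0..1} \<and> curve_length 0 t \<gamma> = ennreal s \<longleftrightarrow> t = s / (b - a)" for t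
    proof
      assume t: "t \<in> {0..1} \<and> curve_length 0 t \<gamma> = ennreal s"
      then have "ennreal (t * (b - a)) = ennreal s" using CL[of 0 t] by simp
      then have "t * (b - a) = s" using t that ab by (subst (asm) ennreal_inj) auto
      then show "t = s / (b - a)" using ab by auto
    next
      assume t: "t = s / (b - a)"
      then have "t \<in> {0..1}" using that ab by auto
      then show "t \<in> {0..1} \<and> curve_length 0 t \<gamma> = ennreal s" using CL[of 0 t] t ab by simp
    qed
    then have "(SOME t. t \<in> {0..1} \<and> curve_length 0 t \<gamma> = ennreal s) = s / (b - a)"
      by simp
    then show ?thesis using ab by (simp add: arclength_param_def \<gamma>_def)
  qed
  have "curve_integral \<gamma> g = (\<integral>\<^sup>+ s. g (c (a + s)) * indicator {0..b - a} s \<partial>lborel)"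
    unfolding curve_integral_def using CL[of 0 1] ab ap
    by (intro nn_integral_cong) (auto simp: indicator_def)
  also have "\<dots> = (\<integral>\<^sup>+ s. g (c (a + s)) * indicator {a..b} (a + s) \<partial>lborel)"
    by (intro nn_integral_cong) (auto simp: indicator_def)
  also have "\<dots> = (\<integral>\<^sup>+ s \<in> {a..b}. g (c s) \<partial>lborel)"
    using nn_integral_real_affine[OF meas, of 1 a] by simp
  finally show "curve_integral \<gamma> g = (\<integral>\<^sup>+ s \<in> {a..b}. g (c s) \<partial>lborel)" .
qed

section \<open>Calculus of upper gradients along unit speed curves\<close>

abbreviation ug :: "'a::metric_space set \<Rightarrow> ('a \<Rightarrow> real) \<Rightarrow> ('a \<Rightarrow> ennreal) \<Rightarrow> bool" where
  "ug U u g \<equiv> upper_gradient_on U (\<lambda>x. ereal (u x)) g"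

lemma e2ennreal_abs_diff: "e2ennreal \<bar>ereal a - ereal b\<bar> = ennreal \<bar>a - b\<bar>"
  by simp

lemma ennreal_le_add: "a \<le> b + c \<Longrightarrow> 0 \<le> b \<Longrightarrow> 0 \<le> c \<Longrightarrow> ennreal a \<le> ennreal b + ennreal c"
  by (metis ennreal_leI ennreal_plus)

text \<open>As g is measurable on U only, the composition is formed between subspaces and then
  extended by 0.\<close>

lemma measurable_along_curve:
  assumes g: "g \<in> borel_measurable (restrict_space borel U)" and c: "unit_speed L c" "c ` {0..L} \<subseteq> U"
    and ab: "0 \<le> a" "b \<le> L"
  shows "(\<lambda>s. g (c s) * indicator {a..b} s :: ennreal) \<in> borel_measurable borel"
proof -
  have "c \<in> restrict_space borel {a..b} \<rightarrow>\<^sub>M restrict_space borel U"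
  proof (rule measurable_restrict_space2)
    show "c \<in> space (restrict_space borel {a..b}) \<rightarrow> U"
      using c(2) ab by (auto simp: space_restrict_space)
    have "continuous_on {a..b} c"
      using unit_speed_continuous_on[OF c(1)] by (rule continuous_on_subset) (use ab in auto)
    then show "c \<in> borel_measurable (restrict_space borel {a..b})"
      by (rule borel_measurable_continuous_on_restrict)
  qed
  then have "(\<lambda>s. g (c s)) \<in> borel_measurable (restrict_space borel {a..b})"
    by (rule measurable_compose[OF _ g])
  then show ?thesis
    by (subst (asm) borel_measurable_restrict_space_iff_ennreal) auto
qed

lemma ug_measurable: "ug U u g \<Longrightarrow> g \<in> borel_measurable (restrict_space borel U)"
  by (simp add: upper_gradient_on_def)

lemma ugD:
  assumes u: "ug U u g" and c: "unit_speed L c" "c ` {0..L} \<subseteq> U" and ab: "0 \<le> a" "a \<le> b" "b \<le> L"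
  shows "ennreal \<bar>u (c b) - u (c a)\<bar> \<le> (\<integral>\<^sup>+ s \<in> {a..b}. g (c s) \<partial>lborel)"
proof (cases "a = b")
  case False
  then have ab': "0 \<le> a" "a < b" "b \<le> L" using ab by auto
  define \<gamma> where "\<gamma> t = c (a + t * (b - a))" for t
  note \<gamma> = curve_integral_affine[OF c(1) ab' measurable_along_curve[OF ug_measurable[OF u] c ab(1,3)], folded \<gamma>_def]
  have "e2ennreal \<bar>ereal (u (pathstart \<gamma>)) - ereal (u (pathfinish \<gamma>))\<bar> \<le> curve_integral \<gamma> g"
    using u \<gamma>(1-3) c(2) unfolding upper_gradient_on_def by blast
  then show ?thesis unfolding \<gamma>(4) e2ennreal_abs_diff
    by (simp add: \<gamma>_def pathstart_def pathfinish_def abs_minus_commute)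
qed auto

text \<open>Together with \<open>ugD\<close> this replaces the curves of the definition by unit
  speed curves, whose pieces can be estimated separately.\<close>

lemma ugI:
  assumes g: "g \<in> borel_measurable (restrict_space borel U)"
    and *: "\<And>L c. unit_speed L c \<Longrightarrow> c ` {0..L} \<subseteq> U \<Longrightarrow>
      ennreal \<bar>u (c L) - u (c 0)\<bar> \<le> (\<integral>\<^sup>+ s \<in> {0..L}. g (c s) \<partial>lborel)"
  shows "ug U u g"
  unfolding upper_gradient_on_def
proof (intro conjI g allI impI)
  fix \<gamma> :: "real \<Rightarrow> 'a" assume \<gamma>: "rectifiable_curve \<gamma> \<and> \<not> \<gamma> constant_on {0..1} \<and> path_image \<gamma> \<subseteq> U"
  define L where "L = enn2real (curve_length 0 1 \<gamma>)"
  note c = arclength_param_unit_speed[OF conjunct1[OF \<gamma>], folded L_def]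
  have "arclength_param \<gamma> ` {0..L} \<subseteq> U" using c(4) \<gamma> by blast
  from *[OF c(1) this] show "e2ennreal \<bar>ereal (u (pathstart \<gamma>)) - ereal (u (pathfinish \<gamma>))\<bar> \<le> curve_integral \<gamma> g"
    unfolding curve_integral_def L_def[symmetric] e2ennreal_abs_diff c(2,3)
    by (simp add: abs_minus_commute)
qed

lemma nn_integral_Icc_add:
  fixes f :: "real \<Rightarrow> ennreal"
  assumes "(\<lambda>s. f s * indicator {a..c} s) \<in> borel_measurable borel" "a \<le> b" "b \<le> c"
  shows "(\<integral>\<^sup>+ s \<in> {a..b}. f s \<partial>lborel) + (\<integral>\<^sup>+ s \<in> {b..c}. f s \<partial>lborel) = (\<integral>\<^sup>+ s \<in> {a..c}. f s \<partial>lborel)"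
proof -
  have m: "(\<lambda>s. f s * indicator {x..y} s) \<in> borel_measurable lborel" if "a \<le> x" "y \<le> c" for x y
  proof -
    have "(\<lambda>s. (f s * indicator {a..c} s) * indicator {x..y} s) \<in> borel_measurable lborel"
      using assms(1) by measurable
    also have "(\<lambda>s. (f s * indicator {a..c} s) * indicator {x..y} s) = (\<lambda>s. f s * indicator {x..y} s)"
      using that by (auto simp: fun_eq_iff indicator_def)
    finally show ?thesis .
  qed
  \<comment> \<open>The two intervals share only the point b.\<close>
  have "AE s in lborel. s \<noteq> b" by (rule AE_lborel_singleton)
  then show ?thesis
    using assms(2,3) m by (subst nn_integral_add[symmetric]) (auto intro!: nn_integral_cong_AE elim!: eventually_mono split: split_indicator)
qed

text \<open>Bisection globalises an estimate that holds, up to an error proportional to the length, on all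
  short pieces of the curve.\<close>

lemma ugI_local:
  assumes g: "g \<in> borel_measurable (restrict_space borel U)"
    and *: "\<And>L c \<tau> \<epsilon>. unit_speed L c \<Longrightarrow> c ` {0..L} \<subseteq> U \<Longrightarrow> \<tau> \<in> {0..L} \<Longrightarrow> \<epsilon> > 0 \<Longrightarrow>
      \<exists>\<delta>>0. \<forall>s t. 0 \<le> s \<and> s \<le> \<tau> \<and> \<tau> \<le> t \<and> t \<le> L \<and> t - s < \<delta> \<longrightarrow>
        ennreal \<bar>u (c t) - u (c s)\<bar> \<le> (\<integral>\<^sup>+ s \<in> {s..t}. g (c s) \<partial>lborel) + ennreal (\<epsilon> * (t - s))"
  shows "ug U u g"
proof (rule ugI[OF g])
  fix L and c :: "real \<Rightarrow> 'a" assume c: "unit_speed L c" "c ` {0..L} \<subseteq> U"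
  have L: "0 \<le> L" using c by (simp add: unit_speed_def)
  have eps: "ennreal \<bar>u (c L) - u (c 0)\<bar> \<le> (\<integral>\<^sup>+ s \<in> {0..L}. g (c s) \<partial>lborel) + ennreal (\<epsilon> * L)" if "\<epsilon> > 0" for \<epsilon>
  proof -
    define P where "P s t \<longleftrightarrow> (0 \<le> s \<longrightarrow> t \<le> L \<longrightarrow> s \<le> t \<longrightarrow>
      ennreal \<bar>u (c t) - u (c s)\<bar> \<le> (\<integral>\<^sup>+ s \<in> {s..t}. g (c s) \<partial>lborel) + ennreal (\<epsilon> * (t - s)))" for s t
    have "P 0 L"
    proof (rule Bolzano[OF L])
      fix x y z assume P: "P x y" "P y z" and le: "x \<le> y" "y \<le> z"
      show "P x z" unfolding P_def
      proof (intro impI)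
        assume xz: "0 \<le> x" "z \<le> L" "x \<le> z"
        have "ennreal \<bar>u (c z) - u (c x)\<bar> \<le> ennreal \<bar>u (c y) - u (c x)\<bar> + ennreal \<bar>u (c z) - u (c y)\<bar>"
          by (rule ennreal_le_add) auto
        also have "\<dots> \<le> ((\<integral>\<^sup>+ s \<in> {x..y}. g (c s) \<partial>lborel) + ennreal (\<epsilon> * (y - x))) +
            ((\<integral>\<^sup>+ s \<in> {y..z}. g (c s) \<partial>lborel) + ennreal (\<epsilon> * (z - y)))"
          using P le xz by (intro add_mono) (auto simp: P_def)
        also have "\<dots> = ((\<integral>\<^sup>+ s \<in> {x..y}. g (c s) \<partial>lborel) + (\<integral>\<^sup>+ s \<in> {y..z}. g (c s) \<partial>lborel)) +
            (ennreal (\<epsilon> * (y - x)) + ennreal (\<epsilon> * (z - y)))"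
          by (simp only: add_ac)
        also have "ennreal (\<epsilon> * (y - x)) + ennreal (\<epsilon> * (z - y)) = ennreal (\<epsilon> * (z - x))"
          using le \<open>\<epsilon> > 0\<close> by (subst ennreal_plus[symmetric]) (auto simp: algebra_simps)
        also have "(\<integral>\<^sup>+ s \<in> {x..y}. g (c s) \<partial>lborel) + (\<integral>\<^sup>+ s \<in> {y..z}. g (c s) \<partial>lborel) =
            (\<integral>\<^sup>+ s \<in> {x..z}. g (c s) \<partial>lborel)"
          by (rule nn_integral_Icc_add[OF measurable_along_curve[OF g c]]) (use le xz in auto)
        finally show "ennreal \<bar>u (c z) - u (c x)\<bar> \<le> (\<integral>\<^sup>+ s \<in> {x..z}. g (c s) \<partial>lborel) + ennreal (\<epsilon> * (z - x))" .
      qed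
    next
      fix x assume "0 \<le> x" "x \<le> L"
      then have "x \<in> {0..L}" by simp
      from *[OF c this \<open>\<epsilon> > 0\<close>] obtain \<delta> where \<delta>: "\<delta> > 0"
        "\<And>s t. 0 \<le> s \<and> s \<le> x \<and> x \<le> t \<and> t \<le> L \<and> t - s < \<delta> \<Longrightarrow>
          ennreal \<bar>u (c t) - u (c s)\<bar> \<le> (\<integral>\<^sup>+ s \<in> {s..t}. g (c s) \<partial>lborel) + ennreal (\<epsilon> * (t - s))"
        by blast
      then show "\<exists>d>0. \<forall>a b. a \<le> x \<and> x \<le> b \<and> b - a < d \<longrightarrow> P a b"
        unfolding P_def by (intro exI[of _ \<delta>]) blast
    qed
    then show ?thesis using L by (simp add: P_def)
  qed
  show "ennreal \<bar>u (c L) - u (c 0)\<bar> \<le> (\<integral>\<^sup>+ s \<in> {0..L}. g (c s) \<partial>lborel)"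
  proof (rule ennreal_le_epsilon)
    fix e :: real assume "e > 0"
    \<comment> \<open>The denominator is \<open>L + 1\<close> because the curve may have length
      0.\<close>
    have "e / (L + 1) * L \<le> e" using \<open>e > 0\<close> L by (simp add: field_simps)
    then have "ennreal (e / (L + 1) * L) \<le> ennreal e" by (rule ennreal_leI)
    moreover have "e / (L + 1) > 0" using \<open>e > 0\<close> L by auto
    ultimately show "ennreal \<bar>u (c L) - u (c 0)\<bar> \<le> (\<integral>\<^sup>+ s \<in> {0..L}. g (c s) \<partial>lborel) + ennreal e"
      using eps[of "e / (L + 1)"] by (meson add_left_mono order_trans)
  qed
qed

lemma ug_subset: "ug U u g \<Longrightarrow> V \<subseteq> U \<Longrightarrow> ug V u g"
  unfolding upper_gradient_on_def using measurable_restrict_mono[of g borel U borel V] by blast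

lemma ug_cong:
  assumes "ug U u g" "\<And>x. x \<in> U \<Longrightarrow> u x = v x" "\<And>x. x \<in> U \<Longrightarrow> g x = h x"
  shows "ug U v h"
proof (rule ugI)
  show "h \<in> borel_measurable (restrict_space borel U)"
    using ug_measurable[OF assms(1)] assms(3)
    by (subst measurable_cong[of _ h g]) (auto simp: space_restrict_space)
  fix L and c :: "real \<Rightarrow> 'a" assume c: "unit_speed L c" "c ` {0..L} \<subseteq> U"
  then have L: "0 \<le> L" and cU: "\<And>s. s \<in> {0..L} \<Longrightarrow> c s \<in> U" by (auto simp: unit_speed_def)
  have "(\<integral>\<^sup>+ s \<in> {0..L}. g (c s) \<partial>lborel) = (\<integral>\<^sup>+ s \<in> {0..L}. h (c s) \<partial>lborel)"
    using cU assms(3) by (intro nn_integral_cong) (auto simp: indicator_def)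
  then show "ennreal \<bar>v (c L) - v (c 0)\<bar> \<le> (\<integral>\<^sup>+ s \<in> {0..L}. h (c s) \<partial>lborel)"
    using ugD[OF assms(1) c, of 0 L] assms(2) cU[of 0] cU[of L] L by auto
qed

lemma ug_mono:
  assumes "ug U u g" "\<And>x. x \<in> U \<Longrightarrow> g x \<le> h x" "h \<in> borel_measurable (restrict_space borel U)"
  shows "ug U u h"
proof (rule ugI[OF assms(3)])
  fix L and c :: "real \<Rightarrow> 'a" assume c: "unit_speed L c" "c ` {0..L} \<subseteq> U"
  then have L: "0 \<le> L" and cU: "\<And>s. s \<in> {0..L} \<Longrightarrow> c s \<in> U" by (auto simp: unit_speed_def)
  have "(\<integral>\<^sup>+ s \<in> {0..L}. g (c s) \<partial>lborel) \<le> (\<integral>\<^sup>+ s \<in> {0..L}. h (c s) \<partial>lborel)"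
    using cU assms(2) by (intro nn_integral_mono) (auto simp: indicator_def)
  then show "ennreal \<bar>u (c L) - u (c 0)\<bar> \<le> (\<integral>\<^sup>+ s \<in> {0..L}. h (c s) \<partial>lborel)"
    using ugD[OF assms(1) c, of 0 L] L by (auto intro: order_trans)
qed

lemma ug_contraction:
  assumes "ug U u g" "\<And>a b :: real. \<bar>h a - h b\<bar> \<le> \<bar>a - b\<bar>"
  shows "ug U (\<lambda>x. h (u x)) g"
proof (rule ugI[OF ug_measurable[OF assms(1)]])
  fix L and c :: "real \<Rightarrow> 'a" assume c: "unit_speed L c" "c ` {0..L} \<subseteq> U"
  then have L: "0 \<le> L" by (auto simp: unit_speed_def)
  have "ennreal \<bar>h (u (c L)) - h (u (c 0))\<bar> \<le> ennreal \<bar>u (c L) - u (c 0)\<bar>"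
    using assms(2) by (rule ennreal_leI)
  then show "ennreal \<bar>h (u (c L)) - h (u (c 0))\<bar> \<le> (\<integral>\<^sup>+ s \<in> {0..L}. g (c s) \<partial>lborel)"
    using ugD[OF assms(1) c, of 0 L] L order_trans by blast
qed

lemma ug_const: "g \<in> borel_measurable (restrict_space borel U) \<Longrightarrow> ug U (\<lambda>_. k) g"
  by (rule ugI) auto

lemma nn_integral_along_add:
  assumes "g \<in> borel_measurable (restrict_space borel U)" "h \<in> borel_measurable (restrict_space borel U)"
   "unit_speed L c" "c ` {0..L} \<subseteq> U" "0 \<le> a" "b \<le> L"
  shows "(\<integral>\<^sup>+ s \<in> {a..b}. (g (c s) + h (c s)) \<partial>lborel) =
     (\<integral>\<^sup>+ s \<in> {a..b}. g (c s) \<partial>lborel) + (\<integral>\<^sup>+ s \<in> {a..b}. h (c s) \<partial>lborel)"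
  unfolding distrib_right
  by (rule nn_integral_add) (use measurable_along_curve[OF _ assms(3-6)] assms(1,2) in auto)

lemma ug_add:
  assumes "ug U u g" "ug U v h"
  shows "ug U (\<lambda>x. u x + v x) (\<lambda>x. g x + h x)"
proof (rule ugI)
  note m = ug_measurable[OF assms(1)] ug_measurable[OF assms(2)]
  show "(\<lambda>x. g x + h x) \<in> borel_measurable (restrict_space borel U)"
    using m by measurable
  fix L and c :: "real \<Rightarrow> 'a" assume c: "unit_speed L c" "c ` {0..L} \<subseteq> U"
  then have L: "0 \<le> L" by (auto simp: unit_speed_def)
  have "ennreal \<bar>u (c L) + v (c L) - (u (c 0) + v (c 0))\<bar> \<le>
      ennreal \<bar>u (c L) - u (c 0)\<bar> + ennreal \<bar>v (c L) - v (c 0)\<bar>"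
    by (rule ennreal_le_add) auto
  also have "\<dots> \<le> (\<integral>\<^sup>+ s \<in> {0..L}. g (c s) \<partial>lborel) + (\<integral>\<^sup>+ s \<in> {0..L}. h (c s) \<partial>lborel)"
    using L by (intro add_mono ugD[OF _ c] assms) auto
  finally show "ennreal \<bar>u (c L) + v (c L) - (u (c 0) + v (c 0))\<bar> \<le>
      (\<integral>\<^sup>+ s \<in> {0..L}. (g (c s) + h (c s)) \<partial>lborel)"
    using nn_integral_along_add[OF m c, of 0 L] by simp
qed

lemma ug_cmult:
  assumes "ug U u g"
  shows "ug U (\<lambda>x. k * u x) (\<lambda>x. ennreal \<bar>k\<bar> * g x)"
proof (rule ugI)
  note m = ug_measurable[OF assms]
  show "(\<lambda>x. ennreal \<bar>k\<bar> * g x) \<in> borel_measurable (restrict_space borel U)"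
    using m by measurable
  fix L and c :: "real \<Rightarrow> 'a" assume c: "unit_speed L c" "c ` {0..L} \<subseteq> U"
  then have L: "0 \<le> L" by (auto simp: unit_speed_def)
  have "ennreal \<bar>k * u (c L) - k * u (c 0)\<bar> = ennreal \<bar>k\<bar> * ennreal \<bar>u (c L) - u (c 0)\<bar>"
    by (simp add: right_diff_distrib[symmetric] abs_mult ennreal_mult)
  also have "\<dots> \<le> ennreal \<bar>k\<bar> * (\<integral>\<^sup>+ s \<in> {0..L}. g (c s) \<partial>lborel)"
    using L by (intro mult_left_mono ugD[OF _ c] assms) auto
  also have "\<dots> = (\<integral>\<^sup>+ s \<in> {0..L}. (ennreal \<bar>k\<bar> * g (c s)) \<partial>lborel)"
    unfolding mult.assoc using measurable_along_curve[OF m c, of 0 L] by (intro nn_integral_cmult[symmetric]) auto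
  finally show "ennreal \<bar>k * u (c L) - k * u (c 0)\<bar> \<le> (\<integral>\<^sup>+ s \<in> {0..L}. (ennreal \<bar>k\<bar> * g (c s)) \<partial>lborel)" .
qed

text \<open>Unit speed curves are 1-Lipschitz, so a piece through \<open>c \<tau>\<close> of
  parameter length less than d stays in the ball of radius d around \<open>c \<tau>\<close>. There
  the estimate holds without any error.\<close>

lemma ug_local:
  assumes g: "g \<in> borel_measurable (restrict_space borel U)"
    and *: "\<And>x. x \<in> U \<Longrightarrow> \<exists>V. open V \<and> x \<in> V \<and> ug (V \<inter> U) u g"
  shows "ug U u g"
proof (rule ugI_local[OF g])
  fix L \<tau> \<epsilon> :: real and c :: "real \<Rightarrow> 'a"
  assume c: "unit_speed L c" "c ` {0..L} \<subseteq> U" and \<tau>: "\<tau> \<in> {0..L}" and "\<epsilon> > 0"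
  have "c \<tau> \<in> U" using c \<tau> by auto
  from *[OF this] obtain V where V: "open V" "c \<tau> \<in> V" "ug (V \<inter> U) u g" by auto
  obtain d where d: "d > 0" "ball (c \<tau>) d \<subseteq> V" using V by (auto simp: open_contains_ball)
  show "\<exists>\<delta>>0. \<forall>s t. 0 \<le> s \<and> s \<le> \<tau> \<and> \<tau> \<le> t \<and> t \<le> L \<and> t - s < \<delta> \<longrightarrow>
        ennreal \<bar>u (c t) - u (c s)\<bar> \<le> (\<integral>\<^sup>+ s \<in> {s..t}. g (c s) \<partial>lborel) + ennreal (\<epsilon> * (t - s))"
  proof (intro exI[of _ d] conjI d allI impI)
    fix s t assume st: "0 \<le> s \<and> s \<le> \<tau> \<and> \<tau> \<le> t \<and> t \<le> L \<and> t - s < d"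
    define c' where "c' x = c (s + x)" for x
    have c': "unit_speed (t - s) c'" unfolding unit_speed_def
    proof (intro conjI allI impI)
      fix x y assume xy: "0 \<le> x" "x \<le> y" "y \<le> t - s"
      have "curve_length x y c' = curve_length (s + x) (s + y) c"
        by (rule curve_length_reparam[of _ _ "\<lambda>x. s + x" _ _ "\<lambda>x. x - s"])
          (use xy in \<open>auto simp: mono_on_def c'_def\<close>)
      also have "\<dots> = ennreal (y - x)" using c(1) xy st by (simp add: unit_speed_def)
      finally show "curve_length x y c' = ennreal (y - x)" .
    qed (use st in auto)
    have "c' ` {0..t - s} \<subseteq> V \<inter> U"
    proof
      fix y assume "y \<in> c' ` {0..t - s}"
      then obtain x where x: "x \<in> {0..t - s}" "y = c (s + x)" by (auto simp: c'_def)
      then have "dist (c \<tau>) y < d" using unit_speed_dist[OF c(1) \<tau>, of "s + x"] st by auto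
      then show "y \<in> V \<inter> U" using d c x st by (auto simp: subset_eq)
    qed
    from ugD[OF V(3) c' this, of 0 "t - s"] st
    have "ennreal \<bar>u (c t) - u (c s)\<bar> \<le> (\<integral>\<^sup>+ x \<in> {0..t - s}. g (c (s + x)) \<partial>lborel)"
      by (simp add: c'_def)
    also have "\<dots> = (\<integral>\<^sup>+ x. g (c (s + x)) * indicator {s..t} (s + x) \<partial>lborel)"
      by (intro nn_integral_cong) (auto simp: indicator_def)
    also have "\<dots> = (\<integral>\<^sup>+ s \<in> {s..t}. g (c s) \<partial>lborel)"
      using nn_integral_real_affine[OF measurable_along_curve[OF g c, of s t], of 1 s] st by simp
    finally show "ennreal \<bar>u (c t) - u (c s)\<bar> \<le> (\<integral>\<^sup>+ s \<in> {s..t}. g (c s) \<partial>lborel) + ennreal (\<epsilon> * (t - s))"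
      by (rule order_trans) simp
  qed
qed

lemma measurable_abs_restrict:
  fixes u :: "'a::metric_space \<Rightarrow> real"
  shows "continuous_on U u \<Longrightarrow> (\<lambda>x. ennreal (u x)) \<in> borel_measurable (restrict_space borel U)"
  by (intro measurable_compose[OF _ measurable_ennreal] borel_measurable_continuous_on_restrict)

text \<open>On a short piece a continuous coefficient may be treated as a constant. In the product
  rules below this causes errors proportional to the length of the piece, which
  \<open>ugI_local\<close> admits.\<close>

lemma frozen_coefficient:
  assumes u: "continuous_on U (u :: 'a::metric_space \<Rightarrow> real)" and c: "unit_speed L c" "c ` {0..L} \<subseteq> U" and \<tau>: "\<tau> \<in> {0..L}" and "\<epsilon> > 0"
  obtains \<delta> where "\<delta> > 0" "\<And>s t. s \<in> {0..L} \<Longrightarrow> t \<in> {0..L} \<Longrightarrow> \<bar>s - \<tau>\<bar> < \<delta> \<Longrightarrow> \<bar>t - \<tau>\<bar> < \<delta> \<Longrightarrow> \<bar>u (c s) - u (c t)\<bar> < \<epsilon>"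
proof -
  have "continuous_on {0..L} (\<lambda>s. u (c s))"
    using c by (intro continuous_on_compose2[OF u unit_speed_continuous_on])
  moreover have "\<epsilon>/2 > 0" using \<open>\<epsilon> > 0\<close> by simp
  ultimately obtain \<delta> where \<delta>: "\<delta> > 0" "\<forall>y\<in>{0..L}. dist y \<tau> < \<delta> \<longrightarrow> dist (u (c y)) (u (c \<tau>)) < \<epsilon>/2"
    using \<tau> unfolding continuous_on_iff by blast
  have "\<bar>u (c s) - u (c t)\<bar> < \<epsilon>" if "s \<in> {0..L}" "t \<in> {0..L}" "\<bar>s - \<tau>\<bar> < \<delta>" "\<bar>t - \<tau>\<bar> < \<delta>" for s t
  proof -
    have "\<bar>u (c s) - u (c \<tau>)\<bar> < \<epsilon>/2" "\<bar>u (c t) - u (c \<tau>)\<bar> < \<epsilon>/2"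
      using \<delta>(2) that by (auto simp: dist_real_def)
    then show ?thesis by arith
  qed
  with \<delta>(1) that show thesis by blast
qed

lemma nn_integral_frozen_le:
  assumes "\<And>x. x \<in> {s..t} \<Longrightarrow> ennreal k \<le> f x + ennreal \<epsilon>" "s \<le> t" "0 \<le> \<epsilon>"
    "(\<lambda>x. f x * indicator {s..t} x) \<in> borel_measurable borel" "0 \<le> k"
  shows "ennreal (k * (t - s)) \<le> (\<integral>\<^sup>+ x \<in> {s..t}. f x \<partial>lborel) + ennreal (\<epsilon> * (t - s))"
proof -
  have "ennreal (k * (t - s)) = (\<integral>\<^sup>+ x \<in> {s..t}. ennreal k \<partial>lborel)"
    using assms by (simp add: nn_integral_cmult_indicator ennreal_mult)
  also have "\<dots> \<le> (\<integral>\<^sup>+ x. f x * indicator {s..t} x + ennreal \<epsilon> * indicator {s..t} x \<partial>lborel)"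
    using assms(1) by (intro nn_integral_mono) (auto simp: indicator_def)
  also have "\<dots> = (\<integral>\<^sup>+ x \<in> {s..t}. f x \<partial>lborel) + ennreal (\<epsilon> * (t - s))"
    using assms by (subst nn_integral_add) (auto simp: nn_integral_cmult_indicator ennreal_mult)
  finally show ?thesis .
qed

text \<open>The weights of g and h are estimated by 1, which is enough for gluing, where the bounds
  of the pieces are added anyway. The term with the slope of \<theta> becomes small there because u
  and v approximate the same function.\<close>

lemma ug_blend:
  assumes u: "ug U u g" "continuous_on U u" and v: "ug U v h" "continuous_on U v"
    and \<theta>: "K-lipschitz_on U \<theta>" "\<And>x. x \<in> U \<Longrightarrow> 0 \<le> \<theta> x \<and> \<theta> x \<le> 1"
  shows "ug U (\<lambda>x. (1 - \<theta> x) * u x + \<theta> x * v x) (\<lambda>x. g x + h x + ennreal (K * \<bar>u x - v x\<bar>))"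
proof -
  have K: "0 \<le> K" using \<theta>(1) by (rule lipschitz_on_nonneg)
  have cont: "continuous_on U (\<lambda>x. K * \<bar>u x - v x\<bar>)" using u v by (intro continuous_intros)
  note m = ug_measurable[OF u(1)] ug_measurable[OF v(1)] measurable_abs_restrict[OF cont]
  have mgh: "(\<lambda>x. g x + h x) \<in> borel_measurable (restrict_space borel U)" using m by measurable
  show ?thesis
  proof (rule ugI_local)
    show "(\<lambda>x. g x + h x + ennreal (K * \<bar>u x - v x\<bar>)) \<in> borel_measurable (restrict_space borel U)"
      using m by measurable
    fix L \<tau> \<epsilon> :: real and c :: "real \<Rightarrow> 'a"
    assume c: "unit_speed L c" "c ` {0..L} \<subseteq> U" and \<tau>: "\<tau> \<in> {0..L}" and \<epsilon>: "\<epsilon> > 0"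
    obtain \<delta> where \<delta>: "\<delta> > 0" "\<And>s t. s \<in> {0..L} \<Longrightarrow> t \<in> {0..L} \<Longrightarrow> \<bar>s - \<tau>\<bar> < \<delta> \<Longrightarrow> \<bar>t - \<tau>\<bar> < \<delta> \<Longrightarrow>
       \<bar>K * \<bar>u (c s) - v (c s)\<bar> - K * \<bar>u (c t) - v (c t)\<bar>\<bar> < \<epsilon>"
      using frozen_coefficient[OF cont c \<tau> \<epsilon>] by blast
    show "\<exists>\<delta>>0. \<forall>s t. 0 \<le> s \<and> s \<le> \<tau> \<and> \<tau> \<le> t \<and> t \<le> L \<and> t - s < \<delta> \<longrightarrow>
        ennreal \<bar>((1 - \<theta> (c t)) * u (c t) + \<theta> (c t) * v (c t)) - ((1 - \<theta> (c s)) * u (c s) + \<theta> (c s) * v (c s))\<bar> \<le>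
          (\<integral>\<^sup>+ s \<in> {s..t}. (g (c s) + h (c s) + ennreal (K * \<bar>u (c s) - v (c s)\<bar>)) \<partial>lborel) + ennreal (\<epsilon> * (t - s))"
    proof (intro exI[of _ \<delta>] conjI \<delta>(1) allI impI)
      fix s t assume st: "0 \<le> s \<and> s \<le> \<tau> \<and> \<tau> \<le> t \<and> t \<le> L \<and> t - s < \<delta>"
      have U: "c s \<in> U" "c t \<in> U" using c st by auto
      let ?D = "K * \<bar>u (c s) - v (c s)\<bar>"
      have "\<bar>((1 - \<theta> (c t)) * u (c t) + \<theta> (c t) * v (c t)) - ((1 - \<theta> (c s)) * u (c s) + \<theta> (c s) * v (c s))\<bar> =
         \<bar>(1 - \<theta> (c t)) * (u (c t) - u (c s)) + \<theta> (c t) * (v (c t) - v (c s)) + (\<theta> (c t) - \<theta> (c s)) * (v (c s) - u (c s))\<bar>"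
        by (simp add: algebra_simps)
      also have "\<dots> \<le> \<bar>1 - \<theta> (c t)\<bar> * \<bar>u (c t) - u (c s)\<bar> + \<bar>\<theta> (c t)\<bar> * \<bar>v (c t) - v (c s)\<bar> + \<bar>\<theta> (c t) - \<theta> (c s)\<bar> * \<bar>v (c s) - u (c s)\<bar>"
        unfolding abs_mult[symmetric] by linarith
      also have "\<dots> \<le> 1 * \<bar>u (c t) - u (c s)\<bar> + 1 * \<bar>v (c t) - v (c s)\<bar> + (K * (t - s)) * \<bar>v (c s) - u (c s)\<bar>"
      proof (intro add_mono mult_right_mono)
        have "\<bar>\<theta> (c t) - \<theta> (c s)\<bar> \<le> K * dist (c t) (c s)"
          using lipschitz_onD[OF \<theta>(1) U(2,1)] by (simp add: dist_real_def)
        also have "\<dots> \<le> K * (t - s)"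
          using unit_speed_dist[OF c(1), of t s] st K by (intro mult_left_mono) auto
        finally show "\<bar>\<theta> (c t) - \<theta> (c s)\<bar> \<le> K * (t - s)" .
      qed (use \<theta>(2)[OF U(2)] in auto)
      finally have "ennreal \<bar>((1 - \<theta> (c t)) * u (c t) + \<theta> (c t) * v (c t)) - ((1 - \<theta> (c s)) * u (c s) + \<theta> (c s) * v (c s))\<bar>
          \<le> ennreal (\<bar>u (c t) - u (c s)\<bar> + \<bar>v (c t) - v (c s)\<bar> + ?D * (t - s))"
        by (intro ennreal_leI) (simp add: mult_ac abs_minus_commute)
      also have "\<dots> = ennreal \<bar>u (c t) - u (c s)\<bar> + ennreal \<bar>v (c t) - v (c s)\<bar> + ennreal (?D * (t - s))"
        using K st by (simp add: ennreal_plus)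
      also have "\<dots> \<le> (\<integral>\<^sup>+ s \<in> {s..t}. g (c s) \<partial>lborel) + (\<integral>\<^sup>+ s \<in> {s..t}. h (c s) \<partial>lborel) +
          ((\<integral>\<^sup>+ s \<in> {s..t}. ennreal (K * \<bar>u (c s) - v (c s)\<bar>) \<partial>lborel) + ennreal (\<epsilon> * (t - s)))"
      proof (intro add_mono ugD[OF u(1) c] ugD[OF v(1) c] nn_integral_frozen_le)
        fix x assume x: "x \<in> {s..t}"
        then have "\<bar>?D - K * \<bar>u (c x) - v (c x)\<bar>\<bar> < \<epsilon>" using st by (intro \<delta>(2)) auto
        then have "?D \<le> K * \<bar>u (c x) - v (c x)\<bar> + \<epsilon>" by linarith
        then have "ennreal ?D \<le> ennreal (K * \<bar>u (c x) - v (c x)\<bar> + \<epsilon>)" by (rule ennreal_leI)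
        then show "ennreal ?D \<le> ennreal (K * \<bar>u (c x) - v (c x)\<bar>) + ennreal \<epsilon>"
          using K \<epsilon> by (subst ennreal_plus[symmetric]) auto
      next
        show "(\<lambda>x. ennreal (K * \<bar>u (c x) - v (c x)\<bar>) * indicator {s..t} x) \<in> borel_measurable borel"
          using st by (intro measurable_along_curve[OF m(3) c]) auto
      qed (use st K \<epsilon> in auto)
      also have "\<dots> = (\<integral>\<^sup>+ s \<in> {s..t}. (g (c s) + h (c s) + ennreal (K * \<bar>u (c s) - v (c s)\<bar>)) \<partial>lborel) + ennreal (\<epsilon> * (t - s))"
        using nn_integral_along_add[OF m(1,2) c, of s t] nn_integral_along_add[OF mgh m(3) c, of s t] st
        by (simp add: add_ac)
      finally show "ennreal \<bar>((1 - \<theta> (c t)) * u (c t) + \<theta> (c t) * v (c t)) - ((1 - \<theta> (c s)) * u (c s) + \<theta> (c s) * v (c s))\<bar> \<le>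
        (\<integral>\<^sup>+ s \<in> {s..t}. (g (c s) + h (c s) + ennreal (K * \<bar>u (c s) - v (c s)\<bar>)) \<partial>lborel) + ennreal (\<epsilon> * (t - s))" .
    qed
  qed
qed

text \<open>Unlike in \<open>ug_blend\<close>, the weight in front of g is retained, since
  \<open>TV_weight\<close> needs the integral of \<open>\<phi> * g\<close>. On a short piece
  \<open>\<phi> (c t)\<close> is at most \<open>\<phi> (c x) + \<eta>\<close>. This error multiplies
  the integral of g and is not proportional to the length of the piece, so it has to appear in the
  upper gradient itself.\<close>

lemma ug_weight:
  assumes v: "ug U v g" "continuous_on U v"
    and \<phi>: "K-lipschitz_on U \<phi>" "\<And>x. x \<in> U \<Longrightarrow> 0 \<le> \<phi> x" and \<eta>: "\<eta> > 0"
  shows "ug U (\<lambda>x. \<phi> x * v x) (\<lambda>x. ennreal (\<phi> x + \<eta>) * g x + ennreal (K * \<bar>v x\<bar>))"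
proof -
  have K: "0 \<le> K" using \<phi>(1) by (rule lipschitz_on_nonneg)
  have cont: "continuous_on U (\<lambda>x. K * \<bar>v x\<bar>)" using v by (intro continuous_intros)
  have cont\<phi>: "continuous_on U (\<lambda>x. \<phi> x + \<eta>)" "continuous_on U \<phi>"
    using \<phi> by (intro continuous_intros lipschitz_on_continuous_on; blast)+
  note m = ug_measurable[OF v(1)] measurable_abs_restrict[OF cont] measurable_abs_restrict[OF cont\<phi>(1)]
  have mg: "(\<lambda>x. ennreal (\<phi> x + \<eta>) * g x) \<in> borel_measurable (restrict_space borel U)" using m by measurable
  show ?thesis
  proof (rule ugI_local)
    show "(\<lambda>x. ennreal (\<phi> x + \<eta>) * g x + ennreal (K * \<bar>v x\<bar>)) \<in> borel_measurable (restrict_space borel U)"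
      using m by measurable
    fix L \<tau> \<epsilon> :: real and c :: "real \<Rightarrow> 'a"
    assume c: "unit_speed L c" "c ` {0..L} \<subseteq> U" and \<tau>: "\<tau> \<in> {0..L}" and \<epsilon>: "\<epsilon> > 0"
    obtain \<delta>1 where \<delta>1: "\<delta>1 > 0" "\<And>s t. s \<in> {0..L} \<Longrightarrow> t \<in> {0..L} \<Longrightarrow> \<bar>s - \<tau>\<bar> < \<delta>1 \<Longrightarrow> \<bar>t - \<tau>\<bar> < \<delta>1 \<Longrightarrow>
       \<bar>K * \<bar>v (c s)\<bar> - K * \<bar>v (c t)\<bar>\<bar> < \<epsilon>"
      using frozen_coefficient[OF cont c \<tau> \<epsilon>] by blast
    obtain \<delta>2 where \<delta>2: "\<delta>2 > 0" "\<And>s t. s \<in> {0..L} \<Longrightarrow> t \<in> {0..L} \<Longrightarrow> \<bar>s - \<tau>\<bar> < \<delta>2 \<Longrightarrow> \<bar>t - \<tau>\<bar> < \<delta>2 \<Longrightarrow>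
       \<bar>\<phi> (c s) - \<phi> (c t)\<bar> < \<eta>"
      using frozen_coefficient[OF cont\<phi>(2) c \<tau> \<eta>] by blast
    show "\<exists>\<delta>>0. \<forall>s t. 0 \<le> s \<and> s \<le> \<tau> \<and> \<tau> \<le> t \<and> t \<le> L \<and> t - s < \<delta> \<longrightarrow>
        ennreal \<bar>\<phi> (c t) * v (c t) - \<phi> (c s) * v (c s)\<bar> \<le>
          (\<integral>\<^sup>+ s \<in> {s..t}. (ennreal (\<phi> (c s) + \<eta>) * g (c s) + ennreal (K * \<bar>v (c s)\<bar>)) \<partial>lborel) + ennreal (\<epsilon> * (t - s))"
    proof (intro exI[of _ "min \<delta>1 \<delta>2"] conjI allI impI)
      show "min \<delta>1 \<delta>2 > 0" using \<delta>1 \<delta>2 by auto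
      fix s t assume st: "0 \<le> s \<and> s \<le> \<tau> \<and> \<tau> \<le> t \<and> t \<le> L \<and> t - s < min \<delta>1 \<delta>2"
      have U: "c s \<in> U" "c t \<in> U" using c st by auto
      let ?D = "K * \<bar>v (c s)\<bar>"
      have "\<bar>\<phi> (c t) * v (c t) - \<phi> (c s) * v (c s)\<bar> =
         \<bar>\<phi> (c t) * (v (c t) - v (c s)) + (\<phi> (c t) - \<phi> (c s)) * v (c s)\<bar>"
        by (simp add: algebra_simps)
      also have "\<dots> \<le> \<bar>\<phi> (c t)\<bar> * \<bar>v (c t) - v (c s)\<bar> + \<bar>\<phi> (c t) - \<phi> (c s)\<bar> * \<bar>v (c s)\<bar>"
        unfolding abs_mult[symmetric] by linarith
      also have "\<dots> \<le> \<phi> (c t) * \<bar>v (c t) - v (c s)\<bar> + (K * (t - s)) * \<bar>v (c s)\<bar>"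
      proof (intro add_mono mult_right_mono)
        have "\<bar>\<phi> (c t) - \<phi> (c s)\<bar> \<le> K * dist (c t) (c s)"
          using lipschitz_onD[OF \<phi>(1) U(2,1)] by (simp add: dist_real_def)
        also have "\<dots> \<le> K * (t - s)"
          using unit_speed_dist[OF c(1), of t s] st K by (intro mult_left_mono) auto
        finally show "\<bar>\<phi> (c t) - \<phi> (c s)\<bar> \<le> K * (t - s)" .
      qed (use \<phi>(2)[OF U(2)] in auto)
      finally have "ennreal \<bar>\<phi> (c t) * v (c t) - \<phi> (c s) * v (c s)\<bar>
          \<le> ennreal (\<phi> (c t) * \<bar>v (c t) - v (c s)\<bar> + ?D * (t - s))"
        by (intro ennreal_leI) (simp add: mult_ac)
      also have "\<dots> = ennreal (\<phi> (c t)) * ennreal \<bar>v (c t) - v (c s)\<bar> + ennreal (?D * (t - s))"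
        using K st \<phi>(2)[OF U(2)] by (simp add: ennreal_plus ennreal_mult)
      also have "\<dots> \<le> (\<integral>\<^sup>+ s \<in> {s..t}. (ennreal (\<phi> (c s) + \<eta>) * g (c s)) \<partial>lborel) +
          ((\<integral>\<^sup>+ s \<in> {s..t}. ennreal (K * \<bar>v (c s)\<bar>) \<partial>lborel) + ennreal (\<epsilon> * (t - s)))"
      proof (intro add_mono nn_integral_frozen_le)
        have "ennreal (\<phi> (c t)) * ennreal \<bar>v (c t) - v (c s)\<bar> \<le> ennreal (\<phi> (c t)) * (\<integral>\<^sup>+ s \<in> {s..t}. g (c s) \<partial>lborel)"
          using st by (intro mult_left_mono ugD[OF v(1) c]) auto
        also have "\<dots> = (\<integral>\<^sup>+ x. ennreal (\<phi> (c t)) * (g (c x) * indicator {s..t} x) \<partial>lborel)"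
          using measurable_along_curve[OF m(1) c, of s t] st by (subst nn_integral_cmult) auto
        also have "\<dots> \<le> (\<integral>\<^sup>+ s \<in> {s..t}. (ennreal (\<phi> (c s) + \<eta>) * g (c s)) \<partial>lborel)"
        proof (rule nn_integral_mono)
          fix x
          have "\<bar>\<phi> (c t) - \<phi> (c x)\<bar> < \<eta>" if "x \<in> {s..t}" using that st by (intro \<delta>2(2)) auto
          then have "ennreal (\<phi> (c t)) \<le> ennreal (\<phi> (c x) + \<eta>)" if "x \<in> {s..t}" 
            using that by (intro ennreal_leI) fastforce
          then show "ennreal (\<phi> (c t)) * (g (c x) * indicator {s..t} x) \<le> ennreal (\<phi> (c x) + \<eta>) * g (c x) * indicator {s..t} x"
            by (auto simp: indicator_def intro!: mult_right_mono)
        qed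
        finally show "ennreal (\<phi> (c t)) * ennreal \<bar>v (c t) - v (c s)\<bar> \<le> (\<integral>\<^sup>+ s \<in> {s..t}. (ennreal (\<phi> (c s) + \<eta>) * g (c s)) \<partial>lborel)" .
      next
        fix x assume x: "x \<in> {s..t}"
        then have "\<bar>?D - K * \<bar>v (c x)\<bar>\<bar> < \<epsilon>" using st by (intro \<delta>1(2)) auto
        then have "?D \<le> K * \<bar>v (c x)\<bar> + \<epsilon>" by linarith
        then have "ennreal ?D \<le> ennreal (K * \<bar>v (c x)\<bar> + \<epsilon>)" by (rule ennreal_leI)
        then show "ennreal ?D \<le> ennreal (K * \<bar>v (c x)\<bar>) + ennreal \<epsilon>"
          using K \<epsilon> by (subst ennreal_plus[symmetric]) auto
      next
        show "(\<lambda>x. ennreal (K * \<bar>v (c x)\<bar>) * indicator {s..t} x) \<in> borel_measurable borel"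
          using st by (intro measurable_along_curve[OF m(2) c]) auto
      qed (use st K \<epsilon> in auto)
      also have "\<dots> = (\<integral>\<^sup>+ s \<in> {s..t}. (ennreal (\<phi> (c s) + \<eta>) * g (c s) + ennreal (K * \<bar>v (c s)\<bar>)) \<partial>lborel) + ennreal (\<epsilon> * (t - s))"
        using nn_integral_along_add[OF mg m(2) c, of s t] st
        by (simp add: add_ac)
      finally show "ennreal \<bar>\<phi> (c t) * v (c t) - \<phi> (c s) * v (c s)\<bar> \<le>
        (\<integral>\<^sup>+ s \<in> {s..t}. (ennreal (\<phi> (c s) + \<eta>) * g (c s) + ennreal (K * \<bar>v (c s)\<bar>)) \<partial>lborel) + ennreal (\<epsilon> * (t - s))" .
    qed
  qed
qed

section \<open>Doubling spaces and the total variation\<close>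

lemma ennreal_liminf_add:
  fixes a b :: "nat \<Rightarrow> ennreal"
  shows "liminf a + liminf b \<le> liminf (\<lambda>i. a i + b i)"
proof -
  have "liminf a + liminf b = (SUP n. (INF m\<in>{n..}. a m) + (INF m\<in>{n..}. b m))"
    unfolding liminf_SUP_INF by (intro ennreal_SUP_add[symmetric] monoI INF_superset_mono) auto
  also have "\<dots> \<le> (SUP n. INF m\<in>{n..}. a m + b m)"
    by (intro SUP_mono) (auto intro!: INF_greatest add_mono INF_lower exI)
  finally show ?thesis by (simp add: liminf_SUP_INF)
qed

lemma frequently_less_liminf:
  fixes a :: "nat \<Rightarrow> 'b::complete_linorder"
  assumes "liminf a < c"
  shows "frequently (\<lambda>i. a i < c) sequentially"
  using assms Liminf_bounded[of c a sequentially] unfolding frequently_def not_less by auto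

text \<open>A pointwise form of \<open>lip_loc\<close> that can be checked near each point and
  therefore suits gluing. On open sets the two notions agree by \<open>lip_loc_iff\<close>.\<close>

definition loc_lip :: "'a::metric_space set \<Rightarrow> ('a \<Rightarrow> real) \<Rightarrow> bool" where
  "loc_lip U u \<longleftrightarrow> (\<forall>x\<in>U. \<exists>r>0. \<exists>L. L-lipschitz_on (ball x r \<inter> U) u)"

lemma loc_lip_continuous: "loc_lip U u \<Longrightarrow> open U \<Longrightarrow> continuous_on U u"
  unfolding loc_lip_def
  by (meson Int_iff centre_in_ball continuous_at_imp_continuous_on continuous_on_eq_continuous_at
      lipschitz_on_continuous_on open_Int open_ball)

lemma loc_lip_compact:
  assumes "loc_lip U u" "compact K" "K \<subseteq> U"
  obtains L where "L-lipschitz_on K u"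
proof -
  \<comment> \<open>The notion \<open>local_lipschitz\<close> concerns functions of time and space;
    here time is a single point.\<close>
  have "local_lipschitz {0::real} K (\<lambda>_. u)"
    unfolding local_lipschitz_def
  proof (intro ballI)
    fix x and t :: real assume "x \<in> K"
    then obtain r L where r: "r > 0" "L-lipschitz_on (ball x r \<inter> U) u"
      using assms(1,3) unfolding loc_lip_def by (meson subsetD)
    show "\<exists>r>0. \<exists>L. \<forall>t\<in>cball t r \<inter> {0}. L-lipschitz_on (cball x r \<inter> K) u"
      using r assms(3) by (intro exI[of _ "r/2"] conjI exI[of _ L] ballI lipschitz_on_subset[OF r(2)]) auto
  qed
  from local_lipschitz_compact_implies_lipschitz[OF this assms(2)] show thesis
    using that by (metis compact_sing continuous_on_const singletonI)
qed

lemma loc_lip_imp_lip_loc: "loc_lip U u \<Longrightarrow> lip_loc U u"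
  unfolding lip_loc_def compactly_contained_def
  by (meson closure_subset lipschitz_on_subset loc_lip_compact)

lemma loc_lip_subset: "loc_lip U u \<Longrightarrow> V \<subseteq> U \<Longrightarrow> loc_lip V u"
  unfolding loc_lip_def by (meson Int_mono lipschitz_on_subset order_refl subset_iff)

lemma loc_lip_local:
  assumes "\<And>x. x \<in> U \<Longrightarrow> \<exists>V. open V \<and> x \<in> V \<and> loc_lip (V \<inter> U) u"
  shows "loc_lip U u"
  unfolding loc_lip_def
proof
  fix x assume x: "x \<in> U"
  then obtain V where V: "open V" "x \<in> V" "loc_lip (V \<inter> U) u" using assms by blast
  obtain r L where r: "r > 0" "L-lipschitz_on (ball x r \<inter> (V \<inter> U)) u"
    using V x unfolding loc_lip_def by blast
  obtain s where s: "s > 0" "ball x s \<subseteq> V" using V by (auto simp: open_contains_ball)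
  show "\<exists>r>0. \<exists>L. L-lipschitz_on (ball x r \<inter> U) u"
    using r s by (intro exI[of _ "min r s"] conjI exI[of _ L] lipschitz_on_subset[OF r(2)]) auto
qed

lemma loc_lip_cong: "loc_lip U u \<Longrightarrow> (\<And>x. x \<in> U \<Longrightarrow> u x = v x) \<Longrightarrow> loc_lip U v"
  unfolding loc_lip_def by (metis Int_iff lipschitz_on_transform)

lemma lipschitz_imp_loc_lip: "L-lipschitz_on U u \<Longrightarrow> loc_lip U u"
  unfolding loc_lip_def by (meson Int_lower2 lipschitz_on_subset zero_less_one)

lemma loc_lip_contraction:
  assumes "loc_lip U u" "\<And>a b :: real. \<bar>h a - h b\<bar> \<le> \<bar>a - b\<bar>"
  shows "loc_lip U (\<lambda>x. h (u x))"
proof -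
  have "L-lipschitz_on V (\<lambda>x. h (u x))" if "L-lipschitz_on V u" for L V
    using that assms(2) unfolding lipschitz_on_def dist_real_def by (meson order_trans)
  then show ?thesis using assms(1) unfolding loc_lip_def by blast
qed

lemma loc_lip_bounded:
  assumes "loc_lip U u" "x \<in> U"
  obtains r L B where "r > 0" "L-lipschitz_on (ball x r \<inter> U) u" "\<And>y. y \<in> ball x r \<inter> U \<Longrightarrow> \<bar>u y\<bar> \<le> B"
proof -
  obtain r L where r: "r > 0" "L-lipschitz_on (ball x r \<inter> U) u" using assms unfolding loc_lip_def by blast
  have "\<bar>u y\<bar> \<le> \<bar>u x\<bar> + L * r" if "y \<in> ball x r \<inter> U" for y
  proof -
    have "dist (u y) (u x) \<le> L * dist y x" using r that assms by (intro lipschitz_onD[OF r(2)]) auto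
    also have "\<dots> \<le> L * r" using that lipschitz_on_nonneg[OF r(2)] by (intro mult_left_mono) (auto simp: dist_commute)
    finally show ?thesis by (auto simp: dist_real_def)
  qed
  then show thesis using that r by blast
qed

lemma loc_lip_add:
  assumes "loc_lip U u" "loc_lip U v"
  shows "loc_lip U (\<lambda>x. u x + v x)"
  unfolding loc_lip_def
proof
  fix x assume "x \<in> U"
  then obtain r s L K where *: "r > 0" "L-lipschitz_on (ball x r \<inter> U) u" "s > 0" "K-lipschitz_on (ball x s \<inter> U) v"
    using assms unfolding loc_lip_def by metis
  then show "\<exists>r>0. \<exists>L. L-lipschitz_on (ball x r \<inter> U) (\<lambda>x. u x + v x)"
    by (intro exI[of _ "min r s"] conjI exI[of _ "L + K"] lipschitz_on_add lipschitz_on_subset[OF *(2)] lipschitz_on_subset[OF *(4)]) auto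
qed

lemma loc_lip_mult:
  assumes "loc_lip U u" "loc_lip U v"
  shows "loc_lip U (\<lambda>x. u x * v x :: real)"
  unfolding loc_lip_def
proof
  fix x assume x: "x \<in> U"
  obtain r L B where r: "r > 0" "L-lipschitz_on (ball x r \<inter> U) u" "\<And>y. y \<in> ball x r \<inter> U \<Longrightarrow> \<bar>u y\<bar> \<le> B"
    using loc_lip_bounded[OF assms(1) x] by blast
  obtain s K C where s: "s > 0" "K-lipschitz_on (ball x s \<inter> U) v" "\<And>y. y \<in> ball x s \<inter> U \<Longrightarrow> \<bar>v y\<bar> \<le> C"
    using loc_lip_bounded[OF assms(2) x] by blast
  have B: "0 \<le> B" "0 \<le> C" using r(3)[of x] s(3)[of x] x r s by force+
  note nn = lipschitz_on_nonneg[OF r(2)] lipschitz_on_nonneg[OF s(2)]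
  have "(B * K + C * L)-lipschitz_on (ball x (min r s) \<inter> U) (\<lambda>x. u x * v x)"
  proof (rule lipschitz_onI)
    fix y z assume yz: "y \<in> ball x (min r s) \<inter> U" "z \<in> ball x (min r s) \<inter> U"
    have "dist (u y * v y) (u z * v z) = \<bar>u y * (v y - v z) + v z * (u y - u z)\<bar>"
      by (simp add: dist_real_def algebra_simps)
    also have "\<dots> \<le> \<bar>u y\<bar> * \<bar>v y - v z\<bar> + \<bar>v z\<bar> * \<bar>u y - u z\<bar>"
      unfolding abs_mult[symmetric] by linarith
    also have "\<dots> \<le> B * (K * dist y z) + C * (L * dist y z)"
      using yz r(3)[of y] s(3)[of z] lipschitz_onD[OF r(2), of y z] lipschitz_onD[OF s(2), of y z] B nn
      by (intro add_mono mult_mono) (auto simp: dist_real_def)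
    finally show "dist (u y * v y) (u z * v z) \<le> (B * K + C * L) * dist y z" by (simp add: algebra_simps)
  qed (use B nn in auto)
  then show "\<exists>r>0. \<exists>L. L-lipschitz_on (ball x r \<inter> U) (\<lambda>x. u x * v x)"
    using r s by (intro exI[of _ "min r s"]) auto
qed

lemma loc_lip_const: "loc_lip U (\<lambda>_. k)"
  using lipschitz_on_constant by (rule lipschitz_imp_loc_lip)

lemma cc_subset: "compactly_contained V U \<Longrightarrow> V \<subseteq> U"
  unfolding compactly_contained_def using closure_subset by blast

lemma cc_mono: "compactly_contained V U \<Longrightarrow> U \<subseteq> W \<Longrightarrow> compactly_contained V W"
  unfolding compactly_contained_def by blast

lemma cc_open: "compactly_contained V U \<Longrightarrow> open V"
  by (simp add: compactly_contained_def)

lemma cc_Un: "compactly_contained V U \<Longrightarrow> compactly_contained W U \<Longrightarrow> compactly_contained (V \<union> W) U"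
  unfolding compactly_contained_def by (auto simp: compact_Un)

lemma cc_empty: "compactly_contained {} U"
  by (simp add: compactly_contained_def)

lemma cc_UN: "finite I \<Longrightarrow> (\<And>i. i \<in> I \<Longrightarrow> compactly_contained (V i) U) \<Longrightarrow> compactly_contained (\<Union>i\<in>I. V i) U"
  by (induction I rule: finite_induct) (auto intro: cc_Un cc_empty)

section \<open>Consequences of doubling: nets, properness, exhaustion\<close>

locale doubling_measure =
  fixes \<mu> :: "'a::complete_space set \<Rightarrow> ennreal"
  assumes regular: "borel_regular_outer_measure \<mu>" and doubling: "doubling \<mu>"
begin

abbreviation M :: "'a measure" where "M \<equiv> outer_to_measure \<mu>"
abbreviation TV :: "('a \<Rightarrow> real) \<Rightarrow> 'a set \<Rightarrow> ennreal" where "TV \<equiv> total_variation_open \<mu>"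

lemma outer_measure_mu: "outer_measure_space UNIV \<mu>"
  using regular by (simp add: borel_regular_outer_measure_def)

lemma space_M [simp]: "space M = UNIV"
  by (rule space_outer_to_measure[OF outer_measure_mu])

lemma borel_sets_M: "A \<in> sets borel \<Longrightarrow> A \<in> sets M"
  using regular by (auto simp: sets_outer_to_measure[OF outer_measure_mu] borel_regular_outer_measure_def)

lemma emeasure_M: "A \<in> sets borel \<Longrightarrow> emeasure M A = \<mu> A"
  using borel_sets_M by (intro emeasure_outer_to_measure[OF outer_measure_mu]) (simp add: sets_outer_to_measure[OF outer_measure_mu])

lemma sets_M_open [measurable]: "open A \<Longrightarrow> A \<in> sets M" by (rule borel_sets_M) auto
lemma borel_measurable_M: "f \<in> borel_measurable borel \<Longrightarrow> f \<in> borel_measurable M"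
  using borel_sets_M by (auto simp: measurable_def)

text \<open>The constant is fixed once, so that \<open>Cb\<close> below is a definite
  number.\<close>

definition "Cd = (SOME C. 1 \<le> C \<and> (\<forall>x r. r > 0 \<longrightarrow> 0 < \<mu> (ball x (2 * r)) \<and>
     \<mu> (ball x (2 * r)) \<le> ennreal C * \<mu> (ball x r) \<and> ennreal C * \<mu> (ball x r) < \<infinity>))"

lemma Cd: "1 \<le> Cd" "r > 0 \<Longrightarrow> 0 < \<mu> (ball x r)" "r > 0 \<Longrightarrow> \<mu> (ball x r) < \<infinity>"
  "r > 0 \<Longrightarrow> \<mu> (ball x (2 * r)) \<le> ennreal Cd * \<mu> (ball x r)"
proof -
  have *: "1 \<le> Cd \<and> (\<forall>x r. r > 0 \<longrightarrow> 0 < \<mu> (ball x (2 * r)) \<and>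
     \<mu> (ball x (2 * r)) \<le> ennreal Cd * \<mu> (ball x r) \<and> ennreal Cd * \<mu> (ball x r) < \<infinity>)"
    unfolding Cd_def by (rule someI_ex) (use doubling in \<open>auto simp: doubling_def\<close>)
  show "1 \<le> Cd" "r > 0 \<Longrightarrow> \<mu> (ball x (2 * r)) \<le> ennreal Cd * \<mu> (ball x r)" using * by auto
  \<comment> \<open>Positivity is stipulated for radii of the form 2r, hence the use of r/2.\<close>
  show "0 < \<mu> (ball x r)" if "r > 0"
    using conjunct2[OF *, rule_format, of "r/2" x] that by auto
  show "\<mu> (ball x r) < \<infinity>" if "r > 0"
  proof -
    have "\<mu> (ball x (2 * (r/2))) \<le> ennreal Cd * \<mu> (ball x (r/2))" "ennreal Cd * \<mu> (ball x (r/2)) < \<infinity>"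
      using * that by (metis half_gt_zero)+
    then show ?thesis by simp
  qed
qed

lemma emeasure_ball: "emeasure M (ball x r) = \<mu> (ball x r)"
  by (intro emeasure_M) auto

lemma doubling_power: "r > 0 \<Longrightarrow> \<mu> (ball x (2 ^ n * r)) \<le> ennreal (Cd ^ n) * \<mu> (ball x r)"
proof (induction n)
  case (Suc n)
  have "\<mu> (ball x (2 * (2 ^ n * r))) \<le> ennreal Cd * \<mu> (ball x (2 ^ n * r))"
    using Suc by (intro Cd) auto
  also have "\<dots> \<le> ennreal Cd * (ennreal (Cd ^ n) * \<mu> (ball x r))"
    using Suc by (intro mult_left_mono) auto
  finally show ?case using Cd(1) by (simp add: ennreal_mult mult_ac)
qed simp

lemma finite_measure_bounded: "bounded A \<Longrightarrow> emeasure M A < \<infinity>"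
proof -
  assume "bounded A"
  then obtain x r where "A \<subseteq> ball x r" "r > 0"
    by (metis bounded_subset_ballD)
  then have "emeasure M A \<le> emeasure M (ball x r)" by (intro emeasure_mono) auto
  also have "\<dots> < \<infinity>" using Cd(3)[OF \<open>r > 0\<close>] by (simp add: emeasure_ball)
  finally show ?thesis .
qed

text \<open>Volume counting: the balls of radius s/2 around a separated set are disjoint and lie in
  one ball of measure D, while doubling bounds the measure of each from below by a fixed fraction of
  D. So the cardinality of separated sets is bounded, and one of maximal cardinality is a
  net.\<close>

lemma separated_net:
  fixes E :: "'a set"
  assumes E: "bounded E" and s: "s > 0"
  obtains F where "finite F" "F \<subseteq> E" "\<And>x y. x \<in> F \<Longrightarrow> y \<in> F \<Longrightarrow> x \<noteq> y \<Longrightarrow> s \<le> dist x y"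
    "E \<subseteq> (\<Union>x\<in>F. ball x s)"
proof -
  obtain a R where R: "E \<subseteq> ball a R" "R > 0" by (metis E bounded_subset_ballD)
  define D where "D = \<mu> (ball a (R + s))"
  have D: "0 < D" "D < \<infinity>" using Cd(2,3)[of "R + s" a] R s by (auto simp: D_def)
  \<comment> \<open>After n doublings the radius s/2 exceeds 2R + 2s, so the enlarged ball around
    any point of E contains \<open>ball a (R + s)\<close>.\<close>
  obtain n :: nat where n: "(2 * R + 2 * s) / (s/2) < 2 ^ n"
    using real_arch_pow[of 2 "(2 * R + 2 * s) / (s/2)"] by auto
  define sep where "sep F \<longleftrightarrow> finite F \<and> F \<subseteq> E \<and> (\<forall>x\<in>F. \<forall>y\<in>F. x \<noteq> y \<longrightarrow> s \<le> dist x y)" for F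
  have bound: "real (card F) \<le> Cd ^ n" if "sep F" for F
  proof -
    have "D \<le> ennreal (Cd ^ n) * \<mu> (ball x (s/2))" if "x \<in> E" for x
    proof -
      have "ball a (R + s) \<subseteq> ball x (2 * R + 2 * s)"
      proof
        fix y assume "y \<in> ball a (R + s)"
        then show "y \<in> ball x (2 * R + 2 * s)"
          using that R s dist_triangle[of x y a] by (auto simp: dist_commute)
      qed
      also have "\<dots> \<subseteq> ball x (2 ^ n * (s/2))" using n s by (intro subset_ball) (auto simp: field_simps)
      finally have "emeasure M (ball a (R + s)) \<le> emeasure M (ball x (2 ^ n * (s/2)))"
        by (intro emeasure_mono) auto
      also have "\<dots> \<le> ennreal (Cd ^ n) * \<mu> (ball x (s/2))"
        unfolding emeasure_ball using s by (intro doubling_power) auto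
      finally show ?thesis by (simp add: D_def emeasure_ball)
    qed
    then have "(\<Sum>x\<in>F. D) \<le> (\<Sum>x\<in>F. ennreal (Cd ^ n) * \<mu> (ball x (s/2)))"
      using that by (intro sum_mono) (auto simp: sep_def)
    also have "\<dots> = ennreal (Cd ^ n) * (\<Sum>x\<in>F. emeasure M (ball x (s/2)))"
      by (simp add: sum_distrib_left emeasure_ball)
    also have "(\<Sum>x\<in>F. emeasure M (ball x (s/2))) = emeasure M (\<Union>x\<in>F. ball x (s/2))"
    proof (rule sum_emeasure)
      show "disjoint_family_on (\<lambda>x. ball x (s/2)) F"
        unfolding disjoint_family_on_def
      proof (intro ballI impI)
        fix x y assume "x \<in> F" "y \<in> F" "x \<noteq> y"
        then have "s \<le> dist x y" using that by (auto simp: sep_def)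
        then show "ball x (s/2) \<inter> ball y (s/2) = {}"
          by (intro disjoint_ballI) simp
      qed
    qed (use that in \<open>auto simp: sep_def\<close>)
    also have "\<dots> \<le> emeasure M (ball a (R + s))"
    proof (rule emeasure_mono)
      show "(\<Union>x\<in>F. ball x (s/2)) \<subseteq> ball a (R + s)"
      proof safe
        fix x y assume "x \<in> F" "y \<in> ball x (s/2)"
        then have "dist a x < R" "dist x y < s/2" using that R by (auto simp: sep_def)
        then show "y \<in> ball a (R + s)" using dist_triangle[of a y x] s by auto
      qed
    qed auto
    finally have "ennreal (real (card F)) * D \<le> ennreal (Cd ^ n) * D"
      by (simp add: D_def emeasure_ball mult_left_mono ennreal_of_nat_eq_real_of_nat)
    moreover have "D = ennreal (enn2real D)" "0 < enn2real D" using D by (auto simp: enn2real_positive_iff)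
    ultimately have "ennreal (real (card F) * enn2real D) \<le> ennreal (Cd ^ n * enn2real D)"
      using Cd(1) by (metis ennreal_mult enn2real_nonneg of_nat_0_le_iff zero_le_power order_trans zero_le_one)
    then show ?thesis using \<open>0 < enn2real D\<close> Cd(1) by (subst (asm) ennreal_le_iff) auto
  qed
  have "sep {}" by (simp add: sep_def)
  moreover have "\<forall>F. sep F \<longrightarrow> card F < nat \<lceil>Cd ^ n\<rceil> + 1"
    using bound by (metis of_nat_ceiling less_add_one le_less_trans order_trans of_nat_le_iff)
  ultimately obtain F where F: "sep F" "\<And>G. sep G \<Longrightarrow> card G \<le> card F"
    using ex_has_greatest_nat[of sep "{}" card] by blast
  have "x \<in> (\<Union>y\<in>F. ball y s)" if x: "x \<in> E" for x
  proof (rule ccontr)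
    assume *: "x \<notin> (\<Union>y\<in>F. ball y s)"
    then have "sep (insert x F)" using F(1) x by (auto simp: sep_def dist_commute not_less)
    moreover have "x \<notin> F" using * s by auto
    ultimately show False using F(2)[of "insert x F"] F(1) by (simp add: sep_def)
  qed
  then show thesis using F(1) by (intro that[of F]) (auto simp: sep_def)
qed

text \<open>Finite nets give total boundedness, and the space is complete.\<close>

lemma compact_bounded_closed: "bounded (S::'a set) \<Longrightarrow> closed S \<Longrightarrow> compact S"
  unfolding compact_eq_totally_bounded complete_eq_closed using separated_net by metis

lemma cc_ball:
  assumes "open U" "x \<in> (U::'a set)"
  obtains r where "r > 0" "compactly_contained (ball x r) U"
proof -
  obtain e where e: "e > 0" "cball x e \<subseteq> U" using assms by (auto simp: open_contains_cball)
  have "closure (ball x e) \<subseteq> cball x e" by (simp add: closure_minimal)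
  then have "compactly_contained (ball x e) U"
    using e by (auto simp: compactly_contained_def intro!: compact_bounded_closed bounded_closure)
  with e that show thesis by blast
qed

lemma cc_compact:
  assumes "open (U::'a set)" "compact K" "K \<subseteq> U"
  obtains V where "compactly_contained V U" "K \<subseteq> V"
proof -
  have "\<exists>r>0. compactly_contained (ball x r) U" if "x \<in> K" for x
    using cc_ball[of U x] assms that by blast
  then obtain r where r: "\<And>x. x \<in> K \<Longrightarrow> r x > 0 \<and> compactly_contained (ball x (r x)) U" by metis
  have "K \<subseteq> (\<Union>x\<in>K. ball x (r x))" using r by force
  then obtain F where F: "F \<subseteq> K" "finite F" "K \<subseteq> (\<Union>x\<in>F. ball x (r x))"
    by (rule compactE_image[OF assms(2), rotated]) auto
  have "compactly_contained (\<Union>x\<in>F. ball x (r x)) U"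
    using F r by (intro cc_UN) auto
  with F that show thesis by blast
qed

text \<open>For the direction that is not a compactness argument on the set V: small balls are
  compactly contained in U, because closed balls are compact.\<close>

lemma lip_loc_iff:
  assumes "open U"
  shows "lip_loc U u \<longleftrightarrow> loc_lip U (u :: 'a \<Rightarrow> real)"
proof
  assume u: "lip_loc U u"
  show "loc_lip U u" unfolding loc_lip_def
  proof
    fix x assume "x \<in> U"
    from cc_ball[OF assms this] obtain r where r: "r > 0" "compactly_contained (ball x r) U" .
    then obtain L where "L-lipschitz_on (ball x r) u" using u by (auto simp: lip_loc_def)
    then show "\<exists>r>0. \<exists>L. L-lipschitz_on (ball x r \<inter> U) u"
      using r(1) by (meson Int_lower1 lipschitz_on_subset)
  qed
qed (rule loc_lip_imp_lip_loc)

text \<open>In \<open>rho\<close> the junk value \<open>infdist x {} = 0\<close> together with \<open>1 / 0 = 0\<close> makes the first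
  summand vanish for \<open>U = UNIV\<close>, as it should.\<close>

definition rho :: "'a set \<Rightarrow> 'a \<Rightarrow> real" where
  "rho U x = 1 / infdist x (- U) + dist undefined x"

lemma infdist_compl_pos: "open U \<Longrightarrow> x \<in> U \<Longrightarrow> U \<noteq> UNIV \<Longrightarrow> 0 < infdist x (- U)"
  by (rule infdist_pos_not_in_closed) auto

lemma infdist_ge_rho:
  assumes "open U" "x \<in> U" "rho U x \<le> t" "0 < t" "U \<noteq> UNIV"
  shows "1 / t \<le> infdist x (- U)"
proof -
  have "1 / infdist x (- U) \<le> t" using assms(3) by (simp add: rho_def) (smt (verit) zero_le_dist)
  then show ?thesis using infdist_compl_pos[OF assms(1,2,5)] assms(4) by (simp add: field_simps)
qed

text \<open>Where \<open>rho U x \<le> t\<close>, the distance to the complement is at least 1/t,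
  and the reciprocal has slope at most \<open>t^2\<close> there. The summand 1 comes from the
  distance to the base point \<open>undefined\<close>.\<close>

lemma rho_lipschitz:
  assumes U: "open U" and t: "0 < t"
  shows "(t^2 + 1)-lipschitz_on {x\<in>U. rho U x \<le> t} (rho U)"
proof (rule lipschitz_onI)
  fix x y assume x: "x \<in> {x\<in>U. rho U x \<le> t}" and y: "y \<in> {x\<in>U. rho U x \<le> t}"
  have *: "\<bar>1 / infdist x (- U) - 1 / infdist y (- U)\<bar> \<le> t^2 * dist x y"
  proof (cases "U = UNIV")
    case False
    let ?a = "infdist x (- U)" and ?b = "infdist y (- U)"
    have ab: "1 / t \<le> ?a" "1 / t \<le> ?b" using x y U t False by (auto intro: infdist_ge_rho)
    moreover have "1 / t > 0" using t by simp
    ultimately have ab0: "0 < ?a" "0 < ?b" by linarith+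
    have "1 / ?a \<le> t" "1 / ?b \<le> t" using ab ab0 t by (simp_all add: field_simps)
    then have "(1 / ?a) * (1 / ?b) \<le> t * t" using ab0 t by (intro mult_mono) auto
    then have "\<bar>?b - ?a\<bar> * ((1 / ?a) * (1 / ?b)) \<le> dist x y * (t * t)"
      using infdist_triangle_abs[of y "- U" x] ab0 by (intro mult_mono[of _ _ _ "t * t"]) (simp_all add: dist_commute)
    moreover have "\<bar>1 / ?a - 1 / ?b\<bar> = \<bar>?b - ?a\<bar> * ((1 / ?a) * (1 / ?b))"
    proof -
      have "1 / ?a - 1 / ?b = (?b - ?a) * ((1 / ?a) * (1 / ?b))" using ab0 by (simp add: field_simps)
      then show ?thesis using ab0 by (simp add: abs_mult)
    qed
    ultimately show ?thesis by (simp add: power2_eq_square mult_ac)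
  qed (simp add: infdist_def)
  have "dist (rho U x) (rho U y) \<le> \<bar>1 / infdist x (- U) - 1 / infdist y (- U)\<bar> + \<bar>dist undefined x - dist undefined y\<bar>"
    by (simp add: rho_def dist_real_def)
  also have "\<dots> \<le> t^2 * dist x y + dist x y"
    using * dist_triangle[of undefined x y] dist_triangle[of undefined y x] by (simp add: dist_commute)
  finally show "dist (rho U x) (rho U y) \<le> (t^2 + 1) * dist x y" by (simp add: algebra_simps)
qed simp

lemma rho_continuous: "open U \<Longrightarrow> continuous_on U (rho U)"
proof (cases "U = UNIV")
  case False
  assume "open U"
  then show ?thesis unfolding rho_def
    using infdist_compl_pos[OF \<open>open U\<close> _ False] by (intro continuous_intros) (metis less_irrefl)
qed (auto simp: rho_def infdist_def intro!: continuous_intros)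

lemma open_rho: "open U \<Longrightarrow> open S \<Longrightarrow> open {x\<in>U. rho U x \<in> S}"
  using continuous_open_preimage[OF rho_continuous, of U S] by (simp add: vimage_def Int_def)

text \<open>\<open>rho\<close> is an exhaustion function. On a sublevel set the distance to the
  complement is bounded below, so the set is closed in the whole space and not only in U; the
  distance to the base point is bounded, so it is compact.\<close>

lemma closed_rho:
  assumes U: "open U" and S: "closed S" "S \<subseteq> {..t}"
  shows "compact {x\<in>U. rho U x \<in> S}"
proof -
  \<comment> \<open>The bound t may be negative, whereas \<open>1 / t'\<close> has to be a positive
    distance.\<close>
  define t' where "t' = max t 1"
  have t': "S \<subseteq> {..t'}" "0 < t'" using S by (auto simp: t'_def)
  have "closed {x\<in>U. rho U x \<in> S}"
  proof (cases "U = UNIV")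
    case True
    then show ?thesis using continuous_closed_preimage[OF rho_continuous[OF U], of S] S
      by (auto simp: vimage_def Int_def)
  next
    case False
    define T where "T = {x. 1 / t' \<le> infdist x (- U)}"
    have [simp]: "closed T" unfolding T_def by (intro closed_Collect_le continuous_intros)
    have "0 < 1 / t'" using t' by simp
    have "T \<subseteq> U"
    proof
      fix x assume "x \<in> T"
      then have "infdist x (- U) \<noteq> 0" using \<open>0 < 1 / t'\<close> by (auto simp: T_def)
      then show "x \<in> U" by (metis ComplI infdist_zero)
    qed
    have "closed (T \<inter> rho U -` S)"
      using continuous_closed_preimage[OF continuous_on_subset[OF rho_continuous[OF U]], of T S] S \<open>T \<subseteq> U\<close> by auto
    moreover from \<open>T \<subseteq> U\<close> have "T \<inter> rho U -` S = {x\<in>U. rho U x \<in> S}"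
      using infdist_ge_rho[OF U _ _ t'(2) False] t' \<open>T \<subseteq> U\<close> by (auto simp: T_def)
    ultimately show ?thesis by simp
  qed
  moreover have "bounded {x\<in>U. rho U x \<in> S}"
  proof (rule bounded_subset[of "cball undefined t'"])
    show "{x\<in>U. rho U x \<in> S} \<subseteq> cball undefined t'"
    proof
      fix x assume "x \<in> {x\<in>U. rho U x \<in> S}"
      then have "rho U x \<le> t'" using t' by auto
      moreover have "0 \<le> 1 / infdist x (- U)" by (simp add: infdist_nonneg)
      ultimately show "x \<in> cball undefined t'" unfolding rho_def mem_cball by linarith
    qed
  qed simp
  ultimately show ?thesis by (intro compact_bounded_closed)
qed

definition lev :: "'a set \<Rightarrow> real \<Rightarrow> 'a set" where "lev U t = {x\<in>U. rho U x < t}"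

lemma cc_lev: "open U \<Longrightarrow> compactly_contained (lev U t) U"
proof -
  assume U: "open U"
  have "compact {x\<in>U. rho U x \<in> {..t}}" by (rule closed_rho[OF U]) auto
  moreover from this have "closure (lev U t) \<subseteq> {x\<in>U. rho U x \<in> {..t}}"
    by (intro closure_minimal) (auto simp: lev_def compact_imp_closed)
  moreover have "open (lev U t)" using open_rho[OF U, of "{..<t}"] by (simp add: lev_def)
  ultimately show ?thesis
    unfolding compactly_contained_def
    by (auto dest: compact_Int_closed[of _ "closure (lev U t)"] simp: inf.absorb2)
qed

lemma cc_sub_lev:
  assumes U: "open U" "compactly_contained V U"
  obtains n :: nat where "V \<subseteq> lev U (real n)"
proof -
  have "compact (rho U ` closure V)" using U by (intro compact_continuous_image continuous_on_subset[OF rho_continuous])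
      (auto simp: compactly_contained_def)
  then obtain B where B: "\<And>x. x \<in> closure V \<Longrightarrow> \<bar>rho U x\<bar> \<le> B"
    using compact_imp_bounded bounded_iff by (metis (no_types, lifting) imageI real_norm_def)
  obtain n :: nat where "B < n" using reals_Archimedean2 by blast
  with B have "V \<subseteq> lev U (real n)"
    using cc_subset[OF U(2)] closure_subset[of V] unfolding lev_def by force
  then show thesis by (rule that)
qed

lemma lev_mono: "s \<le> t \<Longrightarrow> lev U s \<subseteq> lev U t"
  by (auto simp: lev_def)

section \<open>Measurability on a set and the L1 seminorm\<close>

abbreviation mble :: "'a set \<Rightarrow> ('a \<Rightarrow> real) \<Rightarrow> bool" where "mble U u \<equiv> set_borel_measurable M U u"

abbreviation L1 :: "'a set \<Rightarrow> ('a \<Rightarrow> real) \<Rightarrow> ennreal" where "L1 V f \<equiv> \<integral>\<^sup>+ x \<in> V. ennreal \<bar>f x\<bar> \<partial>M"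

lemma mble_add: "mble U u \<Longrightarrow> mble U v \<Longrightarrow> mble U (\<lambda>x. u x + v x)"
  unfolding set_borel_measurable_def scaleR_add_right by (rule borel_measurable_add)

lemma mble_diff: "mble U u \<Longrightarrow> mble U v \<Longrightarrow> mble U (\<lambda>x. u x - v x)"
  unfolding set_borel_measurable_def scaleR_diff_right by (rule borel_measurable_diff)

lemma mble_cmult: "mble U u \<Longrightarrow> mble U (\<lambda>x. k * u x)"
  unfolding set_borel_measurable_def by (simp add: mult.left_commute)

lemma mble_abs: "mble U u \<Longrightarrow> mble U (\<lambda>x. \<bar>u x\<bar>)"
  unfolding set_borel_measurable_def by (drule borel_measurable_abs) (simp add: abs_mult)

lemma mble_mult: "mble U u \<Longrightarrow> mble U v \<Longrightarrow> mble U (\<lambda>x. u x * v x)"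
proof -
  assume "mble U u" "mble U v"
  then have "(\<lambda>x. (indicator U x *\<^sub>R u x) * (indicator U x *\<^sub>R v x)) \<in> borel_measurable M"
    unfolding set_borel_measurable_def by (rule borel_measurable_times)
  also have "(\<lambda>x. (indicator U x *\<^sub>R u x) * (indicator U x *\<^sub>R v x)) = (\<lambda>x. indicator U x *\<^sub>R (u x * v x))"
    by (auto simp: indicator_def)
  finally show ?thesis by (simp add: set_borel_measurable_def)
qed

lemma mble_subset: "mble U u \<Longrightarrow> V \<subseteq> U \<Longrightarrow> V \<in> sets M \<Longrightarrow> mble V u"
  by (rule set_borel_measurable_subset)

lemma mble_continuous: "continuous_on U u \<Longrightarrow> open U \<Longrightarrow> mble U u"
  unfolding set_borel_measurable_def
  using borel_measurable_continuous_on_indicator[of U u] by (auto intro: borel_measurable_M)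

lemma mble_loc_lip: "open U \<Longrightarrow> loc_lip U u \<Longrightarrow> mble U u"
  by (intro mble_continuous loc_lip_continuous)

lemma mble_borel: "u \<in> borel_measurable borel \<Longrightarrow> U \<in> sets M \<Longrightarrow> mble U u"
  unfolding set_borel_measurable_def by (intro borel_measurable_scaleR borel_measurable_M[of u]) auto

lemma mble_const: "U \<in> sets M \<Longrightarrow> mble U (\<lambda>_. k)"
  by (rule mble_borel) auto

lemma mble_L1: "mble V f \<Longrightarrow> (\<lambda>x. ennreal \<bar>f x\<bar> * indicator V x) \<in> borel_measurable M"
proof -
  assume "mble V f"
  then have "(\<lambda>x. ennreal \<bar>indicator V x *\<^sub>R f x\<bar>) \<in> borel_measurable M"
    unfolding set_borel_measurable_def by (intro measurable_compose[OF _ measurable_ennreal] borel_measurable_abs)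
  also have "(\<lambda>x. ennreal \<bar>indicator V x *\<^sub>R f x\<bar>) = (\<lambda>x. ennreal \<bar>f x\<bar> * indicator V x)"
    by (auto simp: indicator_def)
  finally show ?thesis .
qed

lemma L1_mono: "(\<And>x. x \<in> V \<Longrightarrow> \<bar>f x\<bar> \<le> \<bar>g x\<bar>) \<Longrightarrow> L1 V f \<le> L1 V g"
  by (intro nn_integral_mono) (auto simp: indicator_def intro!: ennreal_leI)

lemma L1_cong: "(\<And>x. x \<in> V \<Longrightarrow> \<bar>f x\<bar> = \<bar>g x\<bar>) \<Longrightarrow> L1 V f = L1 V g"
  by (intro nn_integral_cong) (auto simp: indicator_def)

lemma L1_mono_set: "V \<subseteq> W \<Longrightarrow> L1 V f \<le> L1 W f"
  by (intro nn_integral_mono) (auto simp: indicator_def)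

lemma L1_triangle:
  assumes "mble V g" "mble V h" "\<And>x. x \<in> V \<Longrightarrow> \<bar>f x\<bar> \<le> \<bar>g x\<bar> + \<bar>h x\<bar>"
  shows "L1 V f \<le> L1 V g + L1 V h"
proof -
  have "L1 V f \<le> (\<integral>\<^sup>+ x. ennreal \<bar>g x\<bar> * indicator V x + ennreal \<bar>h x\<bar> * indicator V x \<partial>M)"
    using assms(3) by (intro nn_integral_mono) (auto simp: indicator_def intro!: ennreal_le_add)
  also have "\<dots> = L1 V g + L1 V h"
    using assms by (intro nn_integral_add mble_L1)
  finally show ?thesis .
qed

lemma L1_cmult: "mble V f \<Longrightarrow> L1 V (\<lambda>x. k * f x) = ennreal \<bar>k\<bar> * L1 V f"
  by (subst nn_integral_cmult[symmetric]) (auto simp: abs_mult ennreal_mult mult_ac dest: mble_L1)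

lemma L1_le_measure:
  assumes "\<And>x. x \<in> V \<Longrightarrow> \<bar>f x\<bar> \<le> B" "V \<in> sets M"
  shows "L1 V f \<le> ennreal B * emeasure M V"
proof -
  have "L1 V f \<le> (\<integral>\<^sup>+ x. ennreal B * indicator V x \<partial>M)"
    using assms by (intro nn_integral_mono) (auto simp: indicator_def intro!: ennreal_leI)
  also have "\<dots> = ennreal B * emeasure M V" using assms by (simp add: nn_integral_cmult_indicator)
  finally show ?thesis .
qed

text \<open>One approximation for each V and \<epsilon> is enough: those for \<open>lev U n\<close>
  and 1/(n+1) form a sequence that converges locally in L1, because every compactly contained set
  lies in some level. With \<open>TV_D\<close> as its converse, this removes sequences from most
  arguments about \<open>TV\<close>.\<close>

lemma TV_leI:
  assumes U: "open U" and *: "\<And>V \<epsilon>. compactly_contained V U \<Longrightarrow> \<epsilon> > 0 \<Longrightarrow>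
     \<exists>w g. loc_lip U w \<and> ug U w g \<and> L1 V (\<lambda>x. w x - u x) \<le> ennreal \<epsilon> \<and> (\<integral>\<^sup>+ x \<in> U. g x \<partial>M) \<le> c + ennreal \<epsilon>"
  shows "TV u U \<le> c"
proof -
  have "\<exists>w g. loc_lip U w \<and> ug U w g \<and> L1 (lev U (real n)) (\<lambda>x. w x - u x) \<le> ennreal (1 / Suc n) \<and>
     (\<integral>\<^sup>+ x \<in> U. g x \<partial>M) \<le> c + ennreal (1 / Suc n)" for n :: nat
    by (rule *[OF cc_lev[OF U]]) auto
  then obtain w g where w: "\<And>n. loc_lip U (w n)" "\<And>n. ug U (w n) (g n)"
    "\<And>n. L1 (lev U (real n)) (\<lambda>x. w n x - u x) \<le> ennreal (1 / Suc n)"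
    "\<And>n. (\<integral>\<^sup>+ x \<in> U. g n x \<partial>M) \<le> c + ennreal (1 / Suc n)"
    by atomize_elim ((subst all_conj_distrib[symmetric])+, (subst choice_iff[symmetric])+, blast)
  have lim: "(\<lambda>n. ennreal (1 / Suc n)) \<longlonglongrightarrow> 0"
    using tendsto_ennrealI[OF LIMSEQ_inverse_real_of_nat] by (simp add: inverse_eq_divide)
  have "tendsto_L1_loc \<mu> U w u"
    unfolding tendsto_L1_loc_def
  proof (intro allI impI)
    fix V assume V: "compactly_contained V U"
    obtain m where m: "V \<subseteq> lev U (real m)" using cc_sub_lev[OF U V] .
    show "(\<lambda>i. L1 V (\<lambda>x. w i x - u x)) \<longlonglongrightarrow> 0"
    proof (rule tendsto_sandwich[OF _ _ tendsto_const lim])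
      have "L1 V (\<lambda>x. w n x - u x) \<le> ennreal (1 / Suc n)" if "n \<ge> m" for n
      proof -
        have "V \<subseteq> lev U (real n)" using m lev_mono[of "real m" "real n" U] that by auto
        then show ?thesis by (rule order_trans[OF L1_mono_set w(3)])
      qed
      then show "\<forall>\<^sub>F n in sequentially. L1 V (\<lambda>x. w n x - u x) \<le> ennreal (1 / Suc n)"
        unfolding eventually_sequentially by blast
    qed auto
  qed
  then have "TV u U \<le> liminf (\<lambda>i. \<integral>\<^sup>+ x \<in> U. g i x \<partial>M)"
    unfolding total_variation_open_def using w
    by (intro Inf_lower CollectI exI[of _ w] exI[of _ g]) (auto intro: loc_lip_imp_lip_loc)
  also have "\<dots> \<le> liminf (\<lambda>n. c + ennreal (1 / Suc n))"
    using w(4) by (intro Liminf_mono always_eventually) auto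
  also have "\<dots> = c"
  proof (rule lim_imp_Liminf)
    show "(\<lambda>n. c + ennreal (1 / Suc n)) \<longlonglongrightarrow> c" using tendsto_add[OF tendsto_const lim, of c] by simp
  qed simp
  finally show ?thesis .
qed

text \<open>A liminf below a number gives infinitely many indices, while local convergence holds for
  all large ones; a common index is taken.\<close>

lemma TV_D:
  assumes U: "open U" and fin: "TV u U < \<infinity>" and V: "compactly_contained V U" and \<epsilon>: "\<epsilon> > 0"
  obtains w g where "loc_lip U w" "ug U w g" "L1 V (\<lambda>x. w x - u x) \<le> ennreal \<epsilon>" "(\<integral>\<^sup>+ x \<in> U. g x \<partial>M) \<le> TV u U + ennreal \<epsilon>"
proof -
  have "TV u U < TV u U + ennreal \<epsilon>" using fin \<epsilon> by (simp add: ennreal_add_left_cancel_less less_top)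
  then obtain us g where us: "\<And>i. lip_loc U (us i)" "\<And>i. ug U (us i) (g i)" "tendsto_L1_loc \<mu> U us u"
    "liminf (\<lambda>i. \<integral>\<^sup>+ x \<in> U. g i x \<partial>M) < TV u U + ennreal \<epsilon>"
    unfolding total_variation_open_def[of \<mu> u U] Inf_less_iff by blast
  have "\<exists>\<^sub>F i in sequentially. (\<integral>\<^sup>+ x \<in> U. g i x \<partial>M) < TV u U + ennreal \<epsilon>"
    using us(4) by (rule frequently_less_liminf)
  moreover have "\<forall>\<^sub>F i in sequentially. L1 V (\<lambda>x. us i x - u x) < ennreal \<epsilon>"
    using us(3) V \<epsilon> unfolding tendsto_L1_loc_def by (intro order_tendstoD) auto
  ultimately have "\<exists>\<^sub>F i in sequentially. (\<integral>\<^sup>+ x \<in> U. g i x \<partial>M) < TV u U + ennreal \<epsilon> \<and> L1 V (\<lambda>x. us i x - u x) < ennreal \<epsilon>"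
    by (rule frequently_eventually_frequently)
  then obtain i where "(\<integral>\<^sup>+ x \<in> U. g i x \<partial>M) < TV u U + ennreal \<epsilon> \<and> L1 V (\<lambda>x. us i x - u x) < ennreal \<epsilon>"
    using frequently_ex by blast
  with us show thesis by (intro that[of "us i" "g i"]) (auto simp: lip_loc_iff[OF U])
qed

text \<open>Truncation to [a, b] is a contraction that fixes the values of u, so it preserves the
  upper gradient and does not increase the distance to u.\<close>

lemma TV_D_bounded:
  assumes U: "open U" and fin: "TV u U < \<infinity>" and V: "compactly_contained V U" and \<epsilon>: "\<epsilon> > 0"
    and ab: "\<And>x. x \<in> U \<Longrightarrow> a \<le> u x \<and> u x \<le> b" "a \<le> b"
  obtains w g where "loc_lip U w" "ug U w g" "L1 V (\<lambda>x. w x - u x) \<le> ennreal \<epsilon>"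
    "(\<integral>\<^sup>+ x \<in> U. g x \<partial>M) \<le> TV u U + ennreal \<epsilon>" "\<And>x. a \<le> w x \<and> w x \<le> b"
proof -
  obtain w g where w: "loc_lip U w" "ug U w g" "L1 V (\<lambda>x. w x - u x) \<le> ennreal \<epsilon>" "(\<integral>\<^sup>+ x \<in> U. g x \<partial>M) \<le> TV u U + ennreal \<epsilon>"
    using TV_D[OF U fin V \<epsilon>] .
  have "loc_lip U (\<lambda>x. max a (min b (w x)))" "ug U (\<lambda>x. max a (min b (w x))) g"
    using w by (intro loc_lip_contraction[of U w "\<lambda>t. max a (min b t)"] ug_contraction[of U w g "\<lambda>t. max a (min b t)"]; auto)+
  moreover have "L1 V (\<lambda>x. max a (min b (w x)) - u x) \<le> ennreal \<epsilon>"
    by (rule order_trans[OF L1_mono w(3)]) (use cc_subset[OF V] ab in \<open>force simp: max_def min_def\<close>)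
  ultimately show thesis using w ab by (intro that[of "\<lambda>x. max a (min b (w x))" g]) auto
qed

lemma TV_mono: "open U \<Longrightarrow> open V \<Longrightarrow> V \<subseteq> U \<Longrightarrow> TV u V \<le> TV u U"
proof (cases "TV u U = \<infinity>")
  case False
  assume U: "open U" "open V" "V \<subseteq> U"
  from False have fin: "TV u U < \<infinity>" by (simp add: less_top)
  show ?thesis
  proof (rule TV_leI[OF U(2)])
    fix W and \<epsilon> :: real assume W: "compactly_contained W V" "\<epsilon> > 0"
    obtain w g where w: "loc_lip U w" "ug U w g" "L1 W (\<lambda>x. w x - u x) \<le> ennreal \<epsilon>" "(\<integral>\<^sup>+ x \<in> U. g x \<partial>M) \<le> TV u U + ennreal \<epsilon>"
      using TV_D[OF U(1) fin cc_mono[OF W(1) U(3)] W(2)] .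
    have "(\<integral>\<^sup>+ x \<in> V. g x \<partial>M) \<le> (\<integral>\<^sup>+ x \<in> U. g x \<partial>M)"
      using U(3) by (intro nn_integral_mono) (auto simp: indicator_def)
    then show "\<exists>w g. loc_lip V w \<and> ug V w g \<and> L1 W (\<lambda>x. w x - u x) \<le> ennreal \<epsilon> \<and> (\<integral>\<^sup>+ x \<in> V. g x \<partial>M) \<le> TV u U + ennreal \<epsilon>"
      using w U(3) order_trans by (blast intro: loc_lip_subset ug_subset)
  qed
qed simp

lemma TV_cong: "(\<And>x. x \<in> U \<Longrightarrow> u x = v x) \<Longrightarrow> TV u U = TV v U"
proof -
  assume *: "\<And>x. x \<in> U \<Longrightarrow> u x = v x"
  have "tendsto_L1_loc \<mu> U us u = tendsto_L1_loc \<mu> U us v" for us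
  proof -
    have "L1 V (\<lambda>x. us i x - u x) = L1 V (\<lambda>x. us i x - v x)" if "compactly_contained V U" for V i
      using * cc_subset[OF that] by (intro L1_cong) auto
    then show ?thesis unfolding tendsto_L1_loc_def by simp
  qed
  then show ?thesis by (simp add: total_variation_open_def)
qed

lemma nn_integral_ug_add:
  assumes "ug U u g" "ug U v h" "open U"
  shows "(\<integral>\<^sup>+ x \<in> U. (g x + h x) \<partial>M) = (\<integral>\<^sup>+ x \<in> U. g x \<partial>M) + (\<integral>\<^sup>+ x \<in> U. h x \<partial>M)"
proof -
  have "(\<lambda>x. g x * indicator U x) \<in> borel_measurable M" if "ug U u g" for u g
    using ug_measurable[OF that] assms(3)
    by (subst (asm) borel_measurable_restrict_space_iff_ennreal) (auto intro: borel_measurable_M)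
  then show ?thesis unfolding distrib_right using assms by (intro nn_integral_add) auto
qed

lemma ug_measurable_M: "ug U u g \<Longrightarrow> open U \<Longrightarrow> (\<lambda>x. g x * indicator U x) \<in> borel_measurable M"
  by (drule ug_measurable, subst (asm) borel_measurable_restrict_space_iff_ennreal) (auto intro: borel_measurable_M)

lemma TV_add:
  assumes U: "open U" and m: "mble U u" "mble U v"
  shows "TV (\<lambda>x. u x + v x) U \<le> TV u U + TV v U"
proof (cases "TV u U = \<infinity> \<or> TV v U = \<infinity>")
  case False
  then have fin: "TV u U < \<infinity>" "TV v U < \<infinity>" by (auto simp: less_top)
  show ?thesis
  proof (rule TV_leI[OF U])
    fix W and \<epsilon> :: real assume W: "compactly_contained W U" and \<epsilon>: "\<epsilon> > 0"
    then have \<epsilon>2: "\<epsilon>/2 > 0" by simp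
    obtain w g where w: "loc_lip U w" "ug U w g" "L1 W (\<lambda>x. w x - u x) \<le> ennreal (\<epsilon>/2)" "(\<integral>\<^sup>+ x \<in> U. g x \<partial>M) \<le> TV u U + ennreal (\<epsilon>/2)"
      using TV_D[OF U fin(1) W \<epsilon>2] .
    obtain z h where z: "loc_lip U z" "ug U z h" "L1 W (\<lambda>x. z x - v x) \<le> ennreal (\<epsilon>/2)" "(\<integral>\<^sup>+ x \<in> U. h x \<partial>M) \<le> TV v U + ennreal (\<epsilon>/2)"
      using TV_D[OF U fin(2) W \<epsilon>2] .
    have sub: "W \<subseteq> U" "open W" using W cc_subset cc_open by auto
    have mb: "mble W (\<lambda>x. w x - u x)" "mble W (\<lambda>x. z x - v x)"
      using mble_loc_lip[OF U w(1)] mble_loc_lip[OF U z(1)] m sub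
      by (auto intro!: mble_diff intro: mble_subset[OF _ sub(1)])
    have e: "ennreal \<epsilon> = ennreal (\<epsilon>/2) + ennreal (\<epsilon>/2)" using \<epsilon> by (simp flip: ennreal_plus)
    have "L1 W (\<lambda>x. (w x + z x) - (u x + v x)) \<le> L1 W (\<lambda>x. w x - u x) + L1 W (\<lambda>x. z x - v x)"
      by (rule L1_triangle[OF mb]) auto
    also have "\<dots> \<le> ennreal \<epsilon>" unfolding e by (intro add_mono w z)
    finally have 1: "L1 W (\<lambda>x. (w x + z x) - (u x + v x)) \<le> ennreal \<epsilon>" .
    have "(\<integral>\<^sup>+ x \<in> U. (g x + h x) \<partial>M) \<le> (TV u U + ennreal (\<epsilon>/2)) + (TV v U + ennreal (\<epsilon>/2))"
      unfolding nn_integral_ug_add[OF w(2) z(2) U] by (intro add_mono w z)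
    also have "\<dots> = TV u U + TV v U + ennreal \<epsilon>" unfolding e by (simp only: add_ac)
    finally show "\<exists>w g. loc_lip U w \<and> ug U w g \<and> L1 W (\<lambda>x. w x - (u x + v x)) \<le> ennreal \<epsilon> \<and> (\<integral>\<^sup>+ x \<in> U. g x \<partial>M) \<le> TV u U + TV v U + ennreal \<epsilon>"
      using 1 loc_lip_add[OF w(1) z(1)] ug_add[OF w(2) z(2)] by blast
  qed
qed auto

lemma TV_cmult:
  assumes U: "open U" and m: "mble U u"
  shows "TV (\<lambda>x. k * u x) U \<le> ennreal \<bar>k\<bar> * TV u U"
proof (cases "TV u U = \<infinity> \<and> k \<noteq> 0")
  case True
  then show ?thesis by (simp add: ennreal_mult_top)
next
  case False
  define K where "K = \<bar>k\<bar> + 1"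
  have K: "K > 0" "\<bar>k\<bar> \<le> K" by (auto simp: K_def)
  show ?thesis
  proof (cases "k = 0")
    \<comment> \<open>Here the variation of u may be infinite, so there may be no useful
      approximations of u; the constant 0 is taken instead.\<close>
    case True
    have "TV (\<lambda>x. k * u x) U \<le> 0"
    proof (rule TV_leI[OF U])
      fix W and \<epsilon> :: real assume "compactly_contained W U" and "\<epsilon> > 0"
      then show "\<exists>w g. loc_lip U w \<and> ug U w g \<and> L1 W (\<lambda>x. w x - k * u x) \<le> ennreal \<epsilon> \<and> (\<integral>\<^sup>+ x \<in> U. g x \<partial>M) \<le> 0 + ennreal \<epsilon>"
        using True by (intro exI[of _ "\<lambda>_. 0"] conjI loc_lip_const ug_const) auto
    qed
    then show ?thesis by simp
  next
    case k: False
    with False have fin: "TV u U < \<infinity>" by (simp add: less_top)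
    show ?thesis
    proof (rule TV_leI[OF U])
      fix W and \<epsilon> :: real assume W: "compactly_contained W U" and \<epsilon>: "\<epsilon> > 0"
      then have \<epsilon>2: "\<epsilon>/K > 0" using K by simp
      obtain w g where w: "loc_lip U w" "ug U w g" "L1 W (\<lambda>x. w x - u x) \<le> ennreal (\<epsilon>/K)" "(\<integral>\<^sup>+ x \<in> U. g x \<partial>M) \<le> TV u U + ennreal (\<epsilon>/K)"
        using TV_D[OF U fin W \<epsilon>2] .
      have sub: "W \<subseteq> U" "open W" using W cc_subset cc_open by auto
      have mb: "mble W (\<lambda>x. w x - u x)"
        using mble_loc_lip[OF U w(1)] m sub
        by (auto intro!: mble_diff intro: mble_subset[OF _ sub(1)])
      have e: "ennreal \<bar>k\<bar> * ennreal (\<epsilon>/K) \<le> ennreal \<epsilon>"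
      proof -
        have "\<bar>k\<bar> * (\<epsilon>/K) \<le> \<epsilon>" using K \<epsilon> by (simp add: field_simps)
        then show ?thesis using \<epsilon> K by (simp add: ennreal_mult[symmetric] ennreal_leI)
      qed
      have "L1 W (\<lambda>x. k * w x - k * u x) = ennreal \<bar>k\<bar> * L1 W (\<lambda>x. w x - u x)"
        using L1_cmult[OF mb, of k] by (simp add: right_diff_distrib)
      also have "\<dots> \<le> ennreal \<epsilon>" using w(3) e by (meson mult_left_mono order_trans zero_le)
      finally have 1: "L1 W (\<lambda>x. k * w x - k * u x) \<le> ennreal \<epsilon>" .
      have "(\<integral>\<^sup>+ x \<in> U. (ennreal \<bar>k\<bar> * g x) \<partial>M) = ennreal \<bar>k\<bar> * (\<integral>\<^sup>+ x \<in> U. g x \<partial>M)"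
        unfolding mult.assoc by (rule nn_integral_cmult) (rule ug_measurable_M[OF w(2) U])
      also have "\<dots> \<le> ennreal \<bar>k\<bar> * (TV u U + ennreal (\<epsilon>/K))" by (intro mult_left_mono w) auto
      also have "\<dots> \<le> ennreal \<bar>k\<bar> * TV u U + ennreal \<epsilon>" unfolding distrib_left by (intro add_left_mono e)
      finally show "\<exists>w g. loc_lip U w \<and> ug U w g \<and> L1 W (\<lambda>x. w x - k * u x) \<le> ennreal \<epsilon> \<and> (\<integral>\<^sup>+ x \<in> U. g x \<partial>M) \<le> ennreal \<bar>k\<bar> * TV u U + ennreal \<epsilon>"
        using 1 loc_lip_mult[OF loc_lip_const w(1)] ug_cmult[OF w(2)] by blast
    qed
  qed
qed

lemma TV_const: "open U \<Longrightarrow> TV (\<lambda>_. k) U = 0"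
proof -
  assume U: "open U"
  have "TV (\<lambda>_. k) U \<le> 0"
  proof (rule TV_leI[OF U])
    fix W and \<epsilon> :: real assume "compactly_contained W U" and "\<epsilon> > 0"
    then show "\<exists>w g. loc_lip U w \<and> ug U w g \<and> L1 W (\<lambda>x. w x - k) \<le> ennreal \<epsilon> \<and> (\<integral>\<^sup>+ x \<in> U. g x \<partial>M) \<le> 0 + ennreal \<epsilon>"
      by (intro exI[of _ "\<lambda>_. k"] exI[of _ "\<lambda>_. 0"] conjI loc_lip_const ug_const) auto
  qed
  then show ?thesis by simp
qed

lemma TV_contraction:
  assumes U: "open U" and h: "\<And>a b :: real. \<bar>h a - h b\<bar> \<le> \<bar>a - b\<bar>"
  shows "TV (\<lambda>x. h (u x)) U \<le> TV u U"
proof (cases "TV u U = \<infinity>")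
  case False
  then have fin: "TV u U < \<infinity>" by (simp add: less_top)
  show ?thesis
  proof (rule TV_leI[OF U])
    fix W and \<epsilon> :: real assume W: "compactly_contained W U" and \<epsilon>: "\<epsilon> > 0"
    obtain w g where w: "loc_lip U w" "ug U w g" "L1 W (\<lambda>x. w x - u x) \<le> ennreal \<epsilon>" "(\<integral>\<^sup>+ x \<in> U. g x \<partial>M) \<le> TV u U + ennreal \<epsilon>"
      using TV_D[OF U fin W \<epsilon>] .
    have "L1 W (\<lambda>x. h (w x) - h (u x)) \<le> ennreal \<epsilon>"
      using h by (intro order_trans[OF L1_mono w(3)])
    then show "\<exists>w g. loc_lip U w \<and> ug U w g \<and> L1 W (\<lambda>x. w x - h (u x)) \<le> ennreal \<epsilon> \<and> (\<integral>\<^sup>+ x \<in> U. g x \<partial>M) \<le> TV u U + ennreal \<epsilon>"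
      using w loc_lip_contraction[OF w(1), of h] ug_contraction[OF w(2), of h] h by blast
  qed
qed simp

text \<open>Lower semicontinuity without sequences: an approximation of v within \<epsilon>/2, where
  v is within \<epsilon>/2 of u, is an approximation of u.\<close>

lemma TV_lsc:
  assumes U: "open U" and m: "mble U u"
    and *: "\<And>V \<epsilon>. compactly_contained V U \<Longrightarrow> \<epsilon> > 0 \<Longrightarrow>
      \<exists>v. mble U v \<and> L1 V (\<lambda>x. v x - u x) \<le> ennreal \<epsilon> \<and> TV v U \<le> c + ennreal \<epsilon>"
  shows "TV u U \<le> c"
proof (cases "c = \<infinity>")
  case False
  show ?thesis
  proof (rule TV_leI[OF U])
    fix W and \<epsilon> :: real assume W: "compactly_contained W U" and \<epsilon>: "\<epsilon> > 0"
    then have \<epsilon>2: "\<epsilon>/2 > 0" by simp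
    obtain v where v: "mble U v" "L1 W (\<lambda>x. v x - u x) \<le> ennreal (\<epsilon>/2)" "TV v U \<le> c + ennreal (\<epsilon>/2)"
      using *[OF W \<epsilon>2] by blast
    have fin: "TV v U < \<infinity>" using v(3) False by (auto simp: less_top[symmetric] top_unique)
    obtain w g where w: "loc_lip U w" "ug U w g" "L1 W (\<lambda>x. w x - v x) \<le> ennreal (\<epsilon>/2)" "(\<integral>\<^sup>+ x \<in> U. g x \<partial>M) \<le> TV v U + ennreal (\<epsilon>/2)"
      using TV_D[OF U fin W \<epsilon>2] .
    have sub: "W \<subseteq> U" "open W" using W cc_subset cc_open by auto
    have mb: "mble W (\<lambda>x. w x - v x)" "mble W (\<lambda>x. v x - u x)"
      using mble_loc_lip[OF U w(1)] v(1) m sub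
      by (auto intro!: mble_diff intro: mble_subset[OF _ sub(1)])
    have e: "ennreal \<epsilon> = ennreal (\<epsilon>/2) + ennreal (\<epsilon>/2)" using \<epsilon> by (simp flip: ennreal_plus)
    have "L1 W (\<lambda>x. w x - u x) \<le> L1 W (\<lambda>x. w x - v x) + L1 W (\<lambda>x. v x - u x)"
      by (rule L1_triangle[OF mb]) auto
    also have "\<dots> \<le> ennreal \<epsilon>" unfolding e by (intro add_mono w v)
    finally have 1: "L1 W (\<lambda>x. w x - u x) \<le> ennreal \<epsilon>" .
    have "(\<integral>\<^sup>+ x \<in> U. g x \<partial>M) \<le> (c + ennreal (\<epsilon>/2)) + ennreal (\<epsilon>/2)"
      using w(4) v(3) by (meson add_right_mono order_trans)
    also have "\<dots> = c + ennreal \<epsilon>" unfolding e by (simp only: add_ac)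
    finally show "\<exists>w g. loc_lip U w \<and> ug U w g \<and> L1 W (\<lambda>x. w x - u x) \<le> ennreal \<epsilon> \<and> (\<integral>\<^sup>+ x \<in> U. g x \<partial>M) \<le> c + ennreal \<epsilon>"
      using 1 w by blast
  qed
qed simp

text \<open>One approximating sequence on the union restricts to both parts, and liminf is
  superadditive.\<close>

lemma TV_superadd:
  assumes "open A" "open B" "A \<inter> B = {}"
  shows "TV u A + TV u B \<le> TV u (A \<union> B)"
  unfolding total_variation_open_def[of \<mu> u "A \<union> B"]
proof (rule Inf_greatest, clarify)
  fix us g assume us: "\<forall>i. lip_loc (A \<union> B) (us i) \<and> ug (A \<union> B) (us i) (g i)" "tendsto_L1_loc \<mu> (A \<union> B) us u"
  have *: "TV u C \<le> liminf (\<lambda>i. \<integral>\<^sup>+ x \<in> C. g i x \<partial>M)" if "C \<subseteq> A \<union> B" for C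
    unfolding total_variation_open_def
  proof (intro Inf_lower CollectI exI[of _ us] exI[of _ g] conjI allI refl)
    show "lip_loc C (us i)" for i using us(1) that by (auto simp: lip_loc_def intro: cc_mono)
    show "ug C (us i) (g i)" for i using us(1) that by (auto intro: ug_subset)
    show "tendsto_L1_loc \<mu> C us u" using us(2) that by (auto simp: tendsto_L1_loc_def intro: cc_mono)
  qed
  have "TV u A + TV u B \<le> liminf (\<lambda>i. \<integral>\<^sup>+ x \<in> A. g i x \<partial>M) + liminf (\<lambda>i. \<integral>\<^sup>+ x \<in> B. g i x \<partial>M)"
    by (intro add_mono *) auto
  also have "\<dots> \<le> liminf (\<lambda>i. (\<integral>\<^sup>+ x \<in> A. g i x \<partial>M) + (\<integral>\<^sup>+ x \<in> B. g i x \<partial>M))"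
    by (rule ennreal_liminf_add)
  also have "(\<lambda>i. (\<integral>\<^sup>+ x \<in> A. g i x \<partial>M) + (\<integral>\<^sup>+ x \<in> B. g i x \<partial>M)) = (\<lambda>i. \<integral>\<^sup>+ x \<in> A \<union> B. g i x \<partial>M)"
  proof
    fix i
    have "ug A (us i) (g i)" "ug B (us i) (g i)" using us(1) by (auto intro: ug_subset)
    then have "(\<integral>\<^sup>+ x \<in> A. g i x \<partial>M) + (\<integral>\<^sup>+ x \<in> B. g i x \<partial>M) = (\<integral>\<^sup>+ x. (g i x * indicator A x + g i x * indicator B x) \<partial>M)"
      using assms by (intro nn_integral_add[symmetric] ug_measurable_M)
    also have "\<dots> = (\<integral>\<^sup>+ x \<in> A \<union> B. g i x \<partial>M)"
      using assms(3) by (intro nn_integral_cong) (auto simp: indicator_def)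
    finally show "(\<integral>\<^sup>+ x \<in> A. g i x \<partial>M) + (\<integral>\<^sup>+ x \<in> B. g i x \<partial>M) = (\<integral>\<^sup>+ x \<in> A \<union> B. g i x \<partial>M)" .
  qed
  finally show "TV u A + TV u B \<le> liminf (\<lambda>i. \<integral>\<^sup>+ x \<in> A \<union> B. g i x \<partial>M)" .
qed

lemma TV_superadd_finite:
  assumes "finite I" "\<And>i. i \<in> I \<Longrightarrow> open (A i)" "disjoint_family_on A I"
  shows "(\<Sum>i\<in>I. TV u (A i)) \<le> TV u (\<Union>i\<in>I. A i)"
  using assms
proof (induction I rule: finite_induct)
  case (insert i I)
  have "(\<Sum>j\<in>insert i I. TV u (A j)) = TV u (A i) + (\<Sum>j\<in>I. TV u (A j))" using insert by simp
  also have "\<dots> \<le> TV u (A i) + TV u (\<Union>j\<in>I. A j)"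
    using insert by (intro add_left_mono) (auto simp: disjoint_family_on_def)
  also have "\<dots> \<le> TV u (A i \<union> (\<Union>j\<in>I. A j))"
    using insert by (intro TV_superadd) (auto simp: disjoint_family_on_def)
  finally show ?case by simp
qed simp

end

section \<open>Gluing, and the variation measure\<close>

lemma suminf_half_ennreal: "0 \<le> \<epsilon> \<Longrightarrow> (\<Sum>j. ennreal (\<epsilon> * (1/2) ^ Suc j)) = ennreal \<epsilon>"
proof -
  assume "0 \<le> \<epsilon>"
  have "(\<lambda>j. \<epsilon> * (1/2) ^ Suc j) sums (\<epsilon> * 1)" by (intro sums_mult power_half_series)
  then show ?thesis using \<open>0 \<le> \<epsilon>\<close> by (intro suminf_ennreal_eq) auto
qed

lemma suminf_pair_le: "a i + a (Suc i) \<le> (\<Sum>j. a j)" for a :: "nat \<Rightarrow> ennreal"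
  using sum_le_suminf[of a "{i, Suc i}"] by (simp add: summableI)

lemma suminf_ge: "a i \<le> (\<Sum>j. a j)" for a :: "nat \<Rightarrow> ennreal"
  using sum_le_suminf[of a "{i}"] by (simp add: summableI)

text \<open>In families of sets where only neighbours interact, superadditivity controls the even
  and the odd terms separately. This applies to the annuli in Caratheodory's criterion and to the
  bands between levels of \<open>rho\<close>.\<close>

lemma even_odd_tail:
  fixes a :: "nat \<Rightarrow> ennreal"
  assumes "\<And>n. (\<Sum>i<n. a (2 * i)) \<le> c" "\<And>n. (\<Sum>i<n. a (Suc (2 * i))) \<le> c" "c < \<infinity>" "\<epsilon> > 0"
  obtains N where "\<And>n. n \<ge> N \<Longrightarrow> (\<Sum>j. a (j + n)) \<le> ennreal \<epsilon>"
proof -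
  have s: "(\<Sum>i<2 * n. a i) = (\<Sum>i<n. a (2 * i)) + (\<Sum>i<n. a (Suc (2 * i)))" for n
    by (induction n) (simp_all add: add_ac)
  have "(\<Sum>i<n. a i) \<le> c + c" for n
  proof -
    have "(\<Sum>i<n. a i) \<le> (\<Sum>i<2 * n. a i)" by (intro sum_mono2) auto
    then show ?thesis unfolding s using assms(1,2)[of n] add_mono order_trans by blast
  qed
  then have "(\<Sum>i. a i) \<le> c + c" unfolding suminf_eq_SUP by (intro SUP_least)
  then have fin: "(\<Sum>i. a i) < \<infinity>" using assms(3) by (auto simp: less_top[symmetric] top_unique)
  define r where "r i = enn2real (a i)" for i
  have ar: "a i = ennreal (r i)" "0 \<le> r i" for i
    using le_less_trans[OF suminf_ge[of a i] fin] by (auto simp: r_def)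
  have sr: "summable r"
  proof (rule bounded_imp_summable[of _ "enn2real (\<Sum>i. a i)"])
    fix n
    have "ennreal (sum r {..n}) = sum a {..n}" using ar by (simp add: sum_ennreal)
    also have "\<dots> \<le> (\<Sum>i. a i)" by (intro sum_le_suminf) (auto intro: summableI)
    also have "\<dots> = ennreal (enn2real (\<Sum>i. a i))" using fin by simp
    finally show "sum r {..n} \<le> enn2real (\<Sum>i. a i)" by (subst (asm) ennreal_le_iff) auto
  qed (rule ar)
  then obtain N where N: "\<And>n. n \<ge> N \<Longrightarrow> norm (\<Sum>i. r (i + n)) < \<epsilon>"
    using suminf_exist_split[OF assms(4) sr] by blast
  have "(\<Sum>j. a (j + n)) \<le> ennreal \<epsilon>" if "n \<ge> N" for n
  proof -
    have "(\<Sum>j. a (j + n)) = ennreal (\<Sum>j. r (j + n))"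
      unfolding ar using sr ar(2) by (intro suminf_ennreal2) (auto simp: summable_iff_shift)
    also have "\<dots> \<le> ennreal \<epsilon>" using N[OF that] by (intro ennreal_leI) auto
    finally show ?thesis .
  qed
  then show thesis by (rule that)
qed

lemma outer_measureD:
  assumes "outer_measure_space UNIV \<phi>"
  shows "\<phi> {} = 0" "A \<subseteq> B \<Longrightarrow> \<phi> A \<le> \<phi> B" "\<phi> (A \<union> B) \<le> \<phi> A + \<phi> B" "\<phi> (\<Union>i::nat. C i) \<le> (\<Sum>i. \<phi> (C i))"
proof -
  have p: "positive UNIV \<phi>" "increasing UNIV \<phi>" "countably_subadditive UNIV \<phi>"
    using assms by (auto simp: outer_measure_space_def)
  show "\<phi> {} = 0" using p(1) by (simp add: positive_def)
  show mono: "A \<subseteq> B \<Longrightarrow> \<phi> A \<le> \<phi> B" for A B using p(2) by (simp add: increasing_def)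
  interpret sigma_algebra UNIV "UNIV :: 'a set set" using sigma_algebra_Pow[of UNIV] by simp
  show "\<phi> (A \<union> B) \<le> \<phi> A + \<phi> B"
  proof -
    have "subadditive UNIV \<phi>" using p countably_subadditive_subadditive by blast
    then have "\<phi> (A \<union> (B - A)) \<le> \<phi> A + \<phi> (B - A)" by (intro subadditiveD) auto
    also have "\<dots> \<le> \<phi> A + \<phi> B" by (intro add_left_mono mono) auto
    finally show ?thesis by simp
  qed
  show "\<phi> (\<Union>i. C i) \<le> (\<Sum>i. \<phi> (C i))"
  proof -
    \<comment> \<open>\<open>countably_subadditive\<close> speaks of disjoint families only, so the
      family is made disjoint and monotonicity is used.\<close>
    have "\<phi> (\<Union>i. disjointed C i) \<le> (\<Sum>i. \<phi> (disjointed C i))"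
      using p(3) disjoint_family_disjointed[of C] by (auto simp: countably_subadditive_def)
    also have "\<dots> \<le> (\<Sum>i. \<phi> (C i))"
      by (intro suminf_le mono disjointed_subset summableI)
    finally show ?thesis by (simp add: UN_disjointed_eq)
  qed
qed

lemma outer_measureI:
  fixes \<phi> :: "'a set \<Rightarrow> ennreal"
  assumes "\<phi> {} = 0" "\<And>A B. A \<subseteq> B \<Longrightarrow> \<phi> A \<le> \<phi> B" "\<And>C :: nat \<Rightarrow> 'a set. \<phi> (\<Union>i. C i) \<le> (\<Sum>i. \<phi> (C i))"
  shows "outer_measure_space UNIV \<phi>"
  using assms by (auto simp: outer_measure_space_def positive_def increasing_def countably_subadditive_def)

text \<open>Caratheodory's criterion. For closed F the part of X off F is approximated by the sets
  \<open>Y n\<close>, at positive distance from F. The remainder consists of annuli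
  \<open>R j\<close>, and annuli of equal parity are at positive distance from each other, so their
  values have a convergent sum with small tails.\<close>

lemma metric_outer_measure_borel:
  fixes \<phi> :: "'a::metric_space set \<Rightarrow> ennreal"
  assumes o: "outer_measure_space UNIV \<phi>"
    and sep: "\<And>A B r. r > 0 \<Longrightarrow> (\<And>x y. x \<in> A \<Longrightarrow> y \<in> B \<Longrightarrow> r \<le> dist x y) \<Longrightarrow> \<phi> A + \<phi> B \<le> \<phi> (A \<union> B)"
  shows "sets borel \<subseteq> lambda_system UNIV UNIV \<phi>"
proof -
  note \<phi> = outer_measureD[OF o]
  interpret Pw: sigma_algebra UNIV "UNIV :: 'a set set" using sigma_algebra_Pow[of UNIV] by simp
  have "measure_space UNIV (lambda_system UNIV UNIV \<phi>) \<phi>"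
    using Pw.caratheodory_lemma[OF o] .
  then interpret L: sigma_algebra UNIV "lambda_system UNIV UNIV \<phi>" by (simp add: measure_space_def)
  have closed: "F \<in> lambda_system UNIV UNIV \<phi>" if F: "closed F" "F \<noteq> {}" for F
  proof -
    have key: "\<phi> (F \<inter> X) + \<phi> (X - F) \<le> \<phi> X" for X
    proof (cases "\<phi> X = \<infinity>")
      case False
      then have fin: "\<phi> X < \<infinity>" by (simp add: less_top)
      define Y where "Y n = {x\<in>X. 1 / Suc n \<le> infdist x F}" for n :: nat
      define R where "R n = {x\<in>X. 1 / real (n + 2) \<le> infdist x F \<and> infdist x F < 1 / real (n + 1)}" for n :: nat
      have Rfar: "1 / real (m + 2) - 1 / real (n + 1) \<le> dist x y" if "x \<in> R m" "y \<in> R n" "m < n" for x y m n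
        using that infdist_triangle[of x F y] unfolding R_def by auto
      have Rsum: "(\<Sum>i<n. \<phi> (R (2 * i + k))) \<le> \<phi> (\<Union>i<n. R (2 * i + k))" for n k
      proof (induction n)
        case (Suc n)
        have "\<phi> (\<Union>i<n. R (2 * i + k)) + \<phi> (R (2 * n + k)) \<le> \<phi> ((\<Union>i<n. R (2 * i + k)) \<union> R (2 * n + k))"
        proof (rule sep)
          \<comment> \<open>A lower bound for the distance of the annulus 2n + k to those with
            smaller index of the same parity. For n = 0 there are none, and the first denominator
            may be 0, hence the value 1 in that case.\<close>
          define r where "r = (1::real) / (2 * n + k) - 1 / (2 * n + k + 1)"
          have "1 / (2 * n + k + 1) < (1::real) / (2 * n + k)" if "n > 0"
            using that by (intro divide_strict_left_mono) (auto intro!: mult_pos_pos add_pos_nonneg)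
          then show "(if n = 0 then 1 else r) > 0" by (auto simp: r_def)
          fix x y assume x: "x \<in> (\<Union>i<n. R (2 * i + k))" and y: "y \<in> R (2 * n + k)"
          then obtain i where i: "i < n" "x \<in> R (2 * i + k)" by auto
          have "(1::real) / (2 * n + k) \<le> 1 / real (2 * i + k + 2)"
            using i by (intro divide_left_mono) auto
          then have "r \<le> 1 / real (2 * i + k + 2) - 1 / real (2 * n + k + 1)"
            unfolding r_def by simp
          also have "\<dots> \<le> dist x y" using i y by (intro Rfar) auto
          finally show "(if n = 0 then 1 else r) \<le> dist x y" using i by auto
        qed
        then have "\<phi> (\<Union>i<n. R (2 * i + k)) + \<phi> (R (2 * n + k)) \<le> \<phi> (\<Union>i<Suc n. R (2 * i + k))"
          by (simp add: lessThan_Suc Un_commute)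
        then show ?case
          unfolding sum.lessThan_Suc by (rule order_trans[OF add_right_mono[OF Suc]])
      qed (simp add: \<phi>)
      have Rle: "(\<Sum>i<n. \<phi> (R (2 * i + k))) \<le> \<phi> X" for n k
        by (rule order_trans[OF Rsum]) (auto intro!: \<phi>(2) simp: R_def)
      show ?thesis
      proof (rule ennreal_le_epsilon)
        fix e :: real assume "e > 0"
        obtain N where N: "\<And>n. n \<ge> N \<Longrightarrow> (\<Sum>j. \<phi> (R (j + n))) \<le> ennreal e"
        proof -
          have "(\<Sum>i<n. \<phi> (R (2 * i))) \<le> \<phi> X" "(\<Sum>i<n. \<phi> (R (Suc (2 * i)))) \<le> \<phi> X" for n
            using Rle[where n = n and k = 0] Rle[where n = n and k = 1] by simp_all
          from even_odd_tail[of "\<lambda>j. \<phi> (R j)", OF this fin \<open>e > 0\<close>] show ?thesis using that by blast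
        qed
        have cover: "X - F \<subseteq> Y N \<union> (\<Union>j. R (j + N))"
        proof
          fix x assume x: "x \<in> X - F"
          then have d: "0 < infdist x F" using F infdist_pos_not_in_closed by blast
          show "x \<in> Y N \<union> (\<Union>j. R (j + N))"
          proof (cases "1 / Suc N \<le> infdist x F")
            case False
            define m where "m = (LEAST m. 1 / real (m + 2) \<le> infdist x F)"
            obtain m0 :: nat where "1 / real (Suc m0) < infdist x F" using d nat_approx_posE by blast
            moreover have "1 / real (m0 + 2) \<le> 1 / real (Suc m0)" by (simp add: field_simps)
            ultimately have ex: "1 / real (m0 + 2) \<le> infdist x F" by linarith
            have m: "1 / real (m + 2) \<le> infdist x F" unfolding m_def using ex by (rule LeastI)
            have "m \<ge> N"
            proof (rule ccontr)
              assume "\<not> m \<ge> N"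
              then have "1 / real (Suc N) \<le> 1 / real (m + 2)" by (intro divide_left_mono) auto
              then show False using m False by linarith
            qed
            moreover have "infdist x F < 1 / real (m + 1)"
            proof (cases "m = N")
              case False
              then obtain m' where m': "m = Suc m'" using \<open>m \<ge> N\<close> by (cases m) auto
              then have "m' < (LEAST m. 1 / real (m + 2) \<le> infdist x F)" by (simp only: m_def[symmetric] lessI)
              then have "\<not> 1 / real (m' + 2) \<le> infdist x F" by (rule not_less_Least)
              then show ?thesis using m' by (simp add: add_ac)
            qed (use False in auto)
            ultimately have "x \<in> R ((m - N) + N)" using m x by (simp add: R_def)
            then show ?thesis by blast
          qed (use x in \<open>auto simp: Y_def\<close>)
        qed
        have "\<phi> (X - F) \<le> \<phi> (Y N) + \<phi> (\<Union>j. R (j + N))"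
          using \<phi>(2)[OF cover] \<phi>(3)[of "Y N" "\<Union>j. R (j + N)"] by (rule order_trans)
        also have "\<dots> \<le> \<phi> (Y N) + ennreal e"
          using N[of N] \<phi>(4)[of "\<lambda>j. R (j + N)"] by (intro add_left_mono) auto
        finally have "\<phi> (F \<inter> X) + \<phi> (X - F) \<le> (\<phi> (F \<inter> X) + \<phi> (Y N)) + ennreal e"
          by (simp add: add.assoc add_left_mono)
        also have "\<phi> (F \<inter> X) + \<phi> (Y N) \<le> \<phi> ((F \<inter> X) \<union> Y N)"
        proof (rule sep)
          show "1 / real (Suc N) > 0" by simp
          fix x y assume "x \<in> F \<inter> X" "y \<in> Y N"
          then show "1 / real (Suc N) \<le> dist x y" using infdist_le[of x F y] by (auto simp: Y_def dist_commute)
        qed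
        also have "\<dots> \<le> \<phi> X" by (intro \<phi>(2)) (auto simp: Y_def)
        finally show "\<phi> (F \<inter> X) + \<phi> (X - F) \<le> \<phi> X + ennreal e" by (simp add: add_right_mono)
      qed
    qed simp
    have "\<phi> (F \<inter> X) + \<phi> ((UNIV - F) \<inter> X) = \<phi> X" for X
    proof (rule antisym)
      have "\<phi> X \<le> \<phi> (F \<inter> X) + \<phi> ((UNIV - F) \<inter> X)"
        using \<phi>(3)[of "F \<inter> X" "(UNIV - F) \<inter> X"] by (simp add: Int_Un_distrib2[symmetric] Diff_eq Compl_partition)
      then show "\<phi> X \<le> \<phi> (F \<inter> X) + \<phi> ((UNIV - F) \<inter> X)" .
      show "\<phi> (F \<inter> X) + \<phi> ((UNIV - F) \<inter> X) \<le> \<phi> X"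
        using key[of X] by (simp add: Diff_eq Int_commute)
    qed
    then show ?thesis by (simp add: lambda_system_def)
  qed
  have "sigma_sets UNIV (Collect closed) \<subseteq> lambda_system UNIV UNIV \<phi>"
  proof (rule L.sigma_sets_subset)
    show "Collect closed \<subseteq> lambda_system UNIV UNIV \<phi>"
      using closed L.empty_sets by blast
  qed
  then show ?thesis by (simp add: borel_eq_closed)
qed

section \<open>Gluing of approximations\<close>

context doubling_measure
begin

lemma TV_empty [simp]: "TV u {} = 0"
  using TV_cong[of "{}" u "\<lambda>_. 0"] TV_const[of "{}" 0] by simp

lemma compact_level:
  assumes W: "compactly_contained W U" and \<rho>: "continuous_on U \<rho>" and S: "closed S"
  shows "compact {x\<in>closure W. \<rho> x \<in> (S::real set)}"
proof -
  have "closed (closure W \<inter> \<rho> -` S)"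
    using W S by (intro continuous_closed_preimage continuous_on_subset[OF \<rho>]) (auto simp: compactly_contained_def)
  then have "compact (closure W \<inter> (closure W \<inter> \<rho> -` S))"
    using W by (intro compact_Int_closed) (auto simp: compactly_contained_def)
  moreover have "closure W \<inter> (closure W \<inter> \<rho> -` S) = {x\<in>closure W. \<rho> x \<in> S}" by auto
  ultimately show ?thesis by simp
qed

text \<open>Approximations on the sets \<open>A j\<close> are glued into one on \<open>U\<close>; the \<open>j\<close>-th transition takes
  place where \<open>j + 4/3 \<le> \<rho> \<le> j + 5/3\<close>, inside \<open>V j\<close>.\<close>

lemma TV_glue:
  fixes A V :: "nat \<Rightarrow> 'a set" and K :: "nat \<Rightarrow> real"
  assumes U: "open U" and \<rho>: "continuous_on U \<rho>"
    and A: "\<And>j. open (A j)" and m: "\<And>j. mble (A j) u"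
    and h1: "\<And>x j. x \<in> U \<Longrightarrow> j = 0 \<or> real j + 1/3 \<le> \<rho> x \<Longrightarrow> \<rho> x \<le> real j + 5/3 \<Longrightarrow> x \<in> A j"
    and V: "\<And>j. compactly_contained (V j) (A j \<inter> A (Suc j))"
    and h2: "\<And>x j. x \<in> U \<Longrightarrow> real j + 4/3 \<le> \<rho> x \<Longrightarrow> \<rho> x \<le> real j + 5/3 \<Longrightarrow> x \<in> V j"
    and lip: "\<And>j. (K j)-lipschitz_on (U \<inter> V j) \<rho>"
  shows "TV u U \<le> (\<Sum>j. TV u (A j))"
proof (cases "\<exists>j. TV u (A j) = \<infinity>")
  case True
  then obtain j where "TV u (A j) = \<infinity>" by blast
  then have "(\<Sum>j. TV u (A j)) = \<infinity>" using suminf_ge[of "\<lambda>j. TV u (A j)" j] by (simp add: top_unique)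
  then show ?thesis by simp
next
  case False
  then have fin: "TV u (A j) < \<infinity>" for j by (simp add: less_top)
  have K: "0 \<le> K j" for j using lip lipschitz_on_nonneg by blast
  show ?thesis
  proof (rule TV_leI[OF U])
    fix W and \<epsilon> :: real assume W: "compactly_contained W U" and \<epsilon>: "\<epsilon> > 0"
    define R where "R j = {x\<in>closure W. \<rho> x \<in> (if j = 0 then {..5/3} else {real j + 1/3..real j + 5/3})}" for j
    have WU: "closure W \<subseteq> U" "W \<subseteq> closure W" using W closure_subset[of W] by (auto simp: compactly_contained_def)
    have "compact (R j)" for j unfolding R_def by (rule compact_level[OF W \<rho>]) auto
    moreover have "R j \<subseteq> A j" for j using WU by (auto simp: R_def split: if_splits intro!: h1)
    ultimately have "\<exists>X. compactly_contained X (A j) \<and> R j \<subseteq> X" for j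
      using cc_compact[OF A[of j]] by metis
    then obtain X0 where X0: "\<And>j. compactly_contained (X0 j) (A j)" "\<And>j. R j \<subseteq> X0 j" by metis
    \<comment> \<open>The functions \<open>w j\<close> and u have to be close in L1 wherever
      \<open>w j\<close> enters the glued function within W, and in both transition zones in which
      \<open>w j\<close> takes part.\<close>
    define X where "X j = X0 j \<union> V j \<union> (if j = 0 then {} else V (j - 1))" for j
    have X: "compactly_contained (X j) (A j)" for j
      using X0(1)[of j] cc_mono[OF V[of j], of "A j"] cc_mono[OF V[of "j - 1"], of "A j"]
      by (cases j) (auto simp: X_def intro!: cc_Un cc_empty)
    have XV: "V j \<subseteq> X j" "V j \<subseteq> X (Suc j)" "R j \<subseteq> X j" for j using X0(2) by (auto simp: X_def)
    \<comment> \<open>The error of \<open>w j\<close> is divided by the slopes 3K of the transitions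
      j and j - 1, in which it takes part, so that all transition terms together are at most
      \<epsilon>/2. For j = 0 the truncated subtraction merely counts \<open>K 0\<close>
      twice.\<close>
    define e where "e j = (\<epsilon>/4) * (1/2) ^ Suc j / (1 + 3 * K j + 3 * K (j - 1))" for j
    have e: "e j > 0" "e j \<le> (\<epsilon>/4) * (1/2) ^ Suc j" "3 * K j * (e j + e (Suc j)) \<le> (\<epsilon>/2) * (1/2) ^ Suc j" for j
    proof -
      show "e j > 0" using \<epsilon> K[of j] K[of "j-1"] by (auto simp: e_def intro!: divide_pos_pos mult_pos_pos add_pos_nonneg)
      have b: "e i \<le> (\<epsilon>/4) * (1/2) ^ Suc i / q" if "1 + 3 * K i + 3 * K (i - 1) \<ge> q" "q > 0" for i q
        unfolding e_def using that \<epsilon> by (intro divide_left_mono) auto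
      show "e j \<le> (\<epsilon>/4) * (1/2) ^ Suc j" using b[of 1 j] K[of j] K[of "j-1"] by simp
      have "e j \<le> (\<epsilon>/4) * (1/2) ^ Suc j / (1 + 3 * K j)" using b[of "1 + 3 * K j" j] K[of j] K[of "j-1"] by simp
      moreover have "e (Suc j) \<le> (\<epsilon>/4) * (1/2) ^ Suc (Suc j) / (1 + 3 * K j)"
        using b[of "1 + 3 * K j" "Suc j"] K[of j] K[of "Suc j"] by simp
      moreover have "(\<epsilon>/4) * (1/2) ^ Suc (Suc j) / (1 + 3 * K j) \<le> (\<epsilon>/4) * (1/2) ^ Suc j / (1 + 3 * K j)"
        using \<epsilon> K[of j] by (intro divide_right_mono mult_left_mono) auto
      moreover have "(\<epsilon>/2) * (1/2) ^ Suc j / (1 + 3 * K j) = 2 * ((\<epsilon>/4) * (1/2) ^ Suc j / (1 + 3 * K j))"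
      proof -
        have "(\<epsilon>/2) * b / c = 2 * ((\<epsilon>/4) * b / c)" for b c :: real by (cases "c = 0") (auto simp: field_simps)
        then show ?thesis .
      qed
      ultimately have "e j + e (Suc j) \<le> (\<epsilon>/2) * (1/2) ^ Suc j / (1 + 3 * K j)" by linarith
      then have "3 * K j * (e j + e (Suc j)) \<le> 3 * K j * ((\<epsilon>/2) * (1/2) ^ Suc j / (1 + 3 * K j))"
        using K[of j] by (intro mult_left_mono) auto
      also have "\<dots> = (3 * K j / (1 + 3 * K j)) * ((\<epsilon>/2) * (1/2) ^ Suc j)" by simp
      also have "\<dots> \<le> 1 * ((\<epsilon>/2) * (1/2) ^ Suc j)" using K[of j] \<epsilon> by (intro mult_right_mono) (auto simp: divide_le_eq_1)
      finally show "3 * K j * (e j + e (Suc j)) \<le> (\<epsilon>/2) * (1/2) ^ Suc j" by simp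
    qed
    have "\<exists>w g. loc_lip (A j) w \<and> ug (A j) w g \<and> L1 (X j) (\<lambda>x. w x - u x) \<le> ennreal (e j) \<and>
       (\<integral>\<^sup>+ x \<in> A j. g x \<partial>M) \<le> TV u (A j) + ennreal (e j)" for j
      by (rule TV_D[OF A fin X e(1)[of j]]) blast
    from choice[OF allI[OF this]] obtain w where "\<forall>j. \<exists>g. loc_lip (A j) (w j) \<and> ug (A j) (w j) g \<and>
       L1 (X j) (\<lambda>x. w j x - u x) \<le> ennreal (e j) \<and> (\<integral>\<^sup>+ x \<in> A j. g x \<partial>M) \<le> TV u (A j) + ennreal (e j)" ..
    from choice[OF this] obtain g where wg: "\<forall>j. loc_lip (A j) (w j) \<and> ug (A j) (w j) (g j) \<and> L1 (X j) (\<lambda>x. w j x - u x) \<le> ennreal (e j) \<and>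
       (\<integral>\<^sup>+ x \<in> A j. g j x \<partial>M) \<le> TV u (A j) + ennreal (e j)"
      ..
    then have w: "loc_lip (A j) (w j)" "ug (A j) (w j) (g j)" "L1 (X j) (\<lambda>x. w j x - u x) \<le> ennreal (e j)"
       "(\<integral>\<^sup>+ x \<in> A j. g j x \<partial>M) \<le> TV u (A j) + ennreal (e j)" for j by auto
    have wc: "continuous_on (A j) (w j)" for j using loc_lip_continuous[OF w(1) A] .
    define \<theta> where "\<theta> j x = max 0 (min 1 (3 * (\<rho> x - real j - 1) - 1))" for j x
    \<comment> \<open>The function \<open>\<theta> j\<close> rises from 0 at j + 4/3 to 1 at j +
      5/3, and the pair with index j is blended for \<rho> in [j + 1, j + 2). The truncated
      subtraction gives j = 0 for all \<rho> < 2.\<close>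
    define F where "F x = (let j = nat \<lfloor>\<rho> x\<rfloor> - 1 in (1 - \<theta> j x) * w j x + \<theta> j x * w (Suc j) x)" for x
    have F_idx: "F x = (1 - \<theta> j x) * w j x + \<theta> j x * w (Suc j) x" if "j = 0 \<or> real j + 1 \<le> \<rho> x" "\<rho> x < real j + 2" for j x
    proof -
      have "nat \<lfloor>\<rho> x\<rfloor> - 1 = j"
      proof (cases "real j + 1 \<le> \<rho> x")
        case True
        then have "\<lfloor>\<rho> x\<rfloor> = int j + 1" using that by (intro floor_unique) auto
        then show ?thesis by simp
      next
        case False
        then have "j = 0" "\<rho> x < 1" using that by auto
        then have "\<lfloor>\<rho> x\<rfloor> \<le> 0" by (simp add: floor_le_iff)
        then show ?thesis using \<open>j = 0\<close> by simp
      qed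
      then show ?thesis by (simp add: F_def)
    qed
    have F_w: "F x = w j x" if "j = 0 \<or> real j + 2/3 \<le> \<rho> x" "\<rho> x \<le> real j + 4/3" for j x
    proof (cases "j = 0 \<or> real j + 1 \<le> \<rho> x")
      case True
      then show ?thesis using F_idx[of j x] that by (auto simp: \<theta>_def)
    next
      case False
      then obtain i where i: "j = Suc i" by (cases j) auto
      have "F x = (1 - \<theta> i x) * w i x + \<theta> i x * w (Suc i) x" using False that i by (intro F_idx) auto
      moreover have "\<theta> i x = 1" using that i by (auto simp: \<theta>_def)
      ultimately show ?thesis using i by simp
    qed
    \<comment> \<open>All upper gradients and all transition terms are added up, whether active at x
      or not. This makes h a Borel function on the whole space, and the sum of their integrals is
      just what is allowed.\<close>
    define h where "h x = (\<Sum>j. g j x * indicator (A j) x) + (\<Sum>j. ennreal (3 * K j * \<bar>w j x - w (Suc j) x\<bar>) * indicator (V j) x)" for x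
    have hm1: "(\<lambda>x. g j x * indicator (A j) x) \<in> borel_measurable borel" for j
      using ug_measurable[OF w(2)[of j]] A[of j] by (subst (asm) borel_measurable_restrict_space_iff_ennreal) auto
    have VA: "V j \<subseteq> A j" "V j \<subseteq> A (Suc j)" "open (V j)" for j
      using cc_subset[OF V[of j]] cc_open[OF V[of j]] by auto
    have cV: "continuous_on (V j) (\<lambda>x. 3 * K j * \<bar>w j x - w (Suc j) x\<bar>)" for j
      using VA[of j] by (intro continuous_intros continuous_on_subset[OF wc])
    have hm2: "(\<lambda>x. ennreal (3 * K j * \<bar>w j x - w (Suc j) x\<bar>) * indicator (V j) x) \<in> borel_measurable borel" for j
      using measurable_abs_restrict[OF cV[of j]] VA[of j] by (subst (asm) borel_measurable_restrict_space_iff_ennreal) auto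
    have hm: "h \<in> borel_measurable borel" unfolding h_def
      by (intro borel_measurable_add borel_measurable_suminf_order hm1 hm2)
    have hmr: "h \<in> borel_measurable (restrict_space borel S)" for S
      using hm by (rule measurable_restrict_space1)
    have local: "\<exists>O'. open O' \<and> x \<in> O' \<and> loc_lip (O' \<inter> U) F \<and> ug (O' \<inter> U) F h" if x: "x \<in> U" for x
    proof -
      have opn: "open {y\<in>U. \<rho> y \<in> S}" if "open S" for S
        using continuous_open_preimage[OF \<rho> U that] by (simp add: vimage_def Int_def)
      \<comment> \<open>Between the transitions F is a single \<open>w j\<close>. The complementary
        case \<open>caseB\<close> is a neighbourhood of a transition.\<close>
      have caseO: ?thesis if "j = 0 \<or> real j + 2/3 < \<rho> x" "\<rho> x < real j + 4/3" for j
      proof -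
        define O' where "O' = {y\<in>U. \<rho> y \<in> (if j = 0 then {..<4/3} else {real j + 2/3<..<real j + 4/3})}"
        have "open O'" unfolding O'_def by (rule opn) auto
        moreover have "x \<in> O'" using that x by (auto simp: O'_def)
        moreover have OA: "O' \<inter> U \<subseteq> A j" by (auto simp: O'_def split: if_splits intro!: h1)
        moreover have FO: "F y = w j y" if "y \<in> O' \<inter> U" for y
          using that by (intro F_w) (auto simp: O'_def split: if_splits)
        moreover have "loc_lip (O' \<inter> U) F"
          by (rule loc_lip_cong[OF loc_lip_subset[OF w(1) OA]]) (simp add: FO)
        moreover have "ug (O' \<inter> U) F h"
        proof (rule ug_cong[OF ug_mono[OF ug_subset[OF w(2) OA] _ hmr]])
          fix y assume "y \<in> O' \<inter> U"
          then have "g j y = g j y * indicator (A j) y" using OA by (auto simp: indicator_def)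
          also have "\<dots> \<le> h y" unfolding h_def using suminf_ge[of "\<lambda>j. g j y * indicator (A j) y" j] by (simp add: add_increasing2)
          finally show "g j y \<le> h y" .
        qed (use FO in auto)
        ultimately show ?thesis by blast
      qed
      have caseB: ?thesis if "real j + 4/3 \<le> \<rho> x" "\<rho> x \<le> real j + 5/3" for j
      proof -
        define O' where "O' = {y\<in>U. \<rho> y \<in> {real j + 1<..<real j + 2}} \<inter> V j"
        have "open O'" unfolding O'_def using VA by (intro open_Int opn) auto
        moreover have "x \<in> O'" using that x h2[of x j] by (auto simp: O'_def)
        moreover have OU: "O' \<inter> U = O'" by (auto simp: O'_def)
        have OA: "O' \<subseteq> A j" "O' \<subseteq> A (Suc j)" using VA[of j] by (auto simp: O'_def)
        have FO: "F y = (1 - \<theta> j y) * w j y + \<theta> j y * w (Suc j) y" if "y \<in> O'" for y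
          using that by (intro F_idx) (auto simp: O'_def)
        have lip\<theta>: "(3 * K j)-lipschitz_on O' (\<theta> j)"
        proof (rule lipschitz_onI)
          fix y z assume yz: "y \<in> O'" "z \<in> O'"
          have "dist (\<theta> j y) (\<theta> j z) \<le> 3 * \<bar>\<rho> y - \<rho> z\<bar>" by (auto simp: \<theta>_def dist_real_def max_def min_def abs_if)
          also have "\<dots> \<le> 3 * (K j * dist y z)"
            using yz lipschitz_onD[OF lip[of j], of y z] by (auto simp: O'_def dist_real_def)
          finally show "dist (\<theta> j y) (\<theta> j z) \<le> 3 * K j * dist y z" by simp
        qed (use K in auto)
        have "loc_lip O' (\<lambda>y. (1 + (-1) * \<theta> j y) * w j y + \<theta> j y * w (Suc j) y)"
          by (intro loc_lip_add loc_lip_mult loc_lip_const lipschitz_imp_loc_lip[OF lip\<theta>] loc_lip_subset[OF w(1)] OA)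
        then have "loc_lip (O' \<inter> U) F" unfolding OU by (rule loc_lip_cong) (simp add: FO)
        moreover have "ug O' (\<lambda>y. (1 - \<theta> j y) * w j y + \<theta> j y * w (Suc j) y) (\<lambda>y. g j y + g (Suc j) y + ennreal (3 * K j * \<bar>w j y - w (Suc j) y\<bar>))"
          by (intro ug_blend ug_subset[OF w(2)] OA continuous_on_subset[OF wc] lip\<theta>) (auto simp: \<theta>_def)
        then have "ug (O' \<inter> U) F h" unfolding OU
        proof (rule ug_cong[OF ug_mono[OF _ _ hmr]])
          fix y assume y: "y \<in> O'"
          then have yy: "y \<in> A j" "y \<in> A (Suc j)" "y \<in> V j" using OA by (auto simp: O'_def)
          have "g j y + g (Suc j) y \<le> (\<Sum>j. g j y * indicator (A j) y)"
            using suminf_pair_le[of "\<lambda>j. g j y * indicator (A j) y" j] yy by simp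
          moreover have "ennreal (3 * K j * \<bar>w j y - w (Suc j) y\<bar>) \<le> (\<Sum>j. ennreal (3 * K j * \<bar>w j y - w (Suc j) y\<bar>) * indicator (V j) y)"
            using suminf_ge[of "\<lambda>j. ennreal (3 * K j * \<bar>w j y - w (Suc j) y\<bar>) * indicator (V j) y" j] yy by simp
          ultimately show "g j y + g (Suc j) y + ennreal (3 * K j * \<bar>w j y - w (Suc j) y\<bar>) \<le> h y"
            unfolding h_def by (rule add_mono)
        qed (use FO in auto)
        ultimately show ?thesis using \<open>open O'\<close> \<open>x \<in> O'\<close> by blast
      qed
      show ?thesis
      proof (cases "\<rho> x < 4/3")
        case True
        then show ?thesis by (intro caseO[of 0]) auto
      next
        case False
        define j where "j = nat \<lfloor>\<rho> x\<rfloor> - 1"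
        have "1 \<le> \<lfloor>\<rho> x\<rfloor>" using False by (simp add: le_floor_iff)
        then have "\<lfloor>\<rho> x\<rfloor> = int j + 1" unfolding j_def by arith
        then have "real_of_int \<lfloor>\<rho> x\<rfloor> = real j + 1" by simp
        then have j: "real j + 1 \<le> \<rho> x" "\<rho> x < real j + 2"
          using of_int_floor_le[of "\<rho> x"] floor_correct[of "\<rho> x"] by linarith+
        then consider "\<rho> x < real j + 4/3" | "real j + 4/3 \<le> \<rho> x \<and> \<rho> x \<le> real j + 5/3" | "real j + 5/3 < \<rho> x" by linarith
        then show ?thesis
        proof cases
          case 1 then show ?thesis using j by (intro caseO[of j]) auto
        next
          case 2 then show ?thesis by (intro caseB[of j]) auto
        next
          case 3 then show ?thesis using j by (intro caseO[of "Suc j"]) auto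
        qed
      qed
    qed
    have "loc_lip U F" by (rule loc_lip_local) (use local in blast)
    moreover have "ug U F h" by (rule ug_local[OF hmr]) (use local in blast)
    moreover have "L1 W (\<lambda>x. F x - u x) \<le> ennreal \<epsilon>"
    proof -
      \<comment> \<open>At most two consecutive approximations occur at a point, and one that is not
        inside its \<open>X j\<close> has weight 0.\<close>
      have pw: "ennreal \<bar>F x - u x\<bar> * indicator W x \<le> (\<Sum>j. ennreal \<bar>w j x - u x\<bar> * indicator (X j) x)" for x
      proof (cases "x \<in> W")
        case True
        then have xW: "x \<in> closure W" "x \<in> U" using WU by auto
        define j where "j = nat \<lfloor>\<rho> x\<rfloor> - 1"
        have j: "j = 0 \<or> real j + 1 \<le> \<rho> x" "\<rho> x < real j + 2"
        proof -
          have "j = 0 \<or> \<lfloor>\<rho> x\<rfloor> = int j + 1" "\<lfloor>\<rho> x\<rfloor> \<le> int j + 1" unfolding j_def by arith+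
          then show "j = 0 \<or> real j + 1 \<le> \<rho> x" "\<rho> x < real j + 2" by linarith+
        qed
        have \<theta>01: "0 \<le> \<theta> j x" "\<theta> j x \<le> 1" by (auto simp: \<theta>_def)
        have 1: "(1 - \<theta> j x) * \<bar>w j x - u x\<bar> \<le> \<bar>w j x - u x\<bar> * indicator (X j) x"
        proof (cases "\<theta> j x = 1")
          case False
          then have "\<rho> x < real j + 5/3" by (auto simp: \<theta>_def)
          then have "x \<in> X j" using j XV(3)[of j] xW by (auto simp: R_def)
          then show ?thesis using \<theta>01 by (simp add: mult_left_le_one_le)
        qed simp
        have 2: "\<theta> j x * \<bar>w (Suc j) x - u x\<bar> \<le> \<bar>w (Suc j) x - u x\<bar> * indicator (X (Suc j)) x"
        proof (cases "\<theta> j x = 0")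
          case False
          then have "\<rho> x > real j + 4/3" by (auto simp: \<theta>_def split: if_splits)
          then have "x \<in> X (Suc j)" using j XV(3)[of "Suc j"] xW by (auto simp: R_def)
          then show ?thesis using \<theta>01 by (simp add: mult_left_le_one_le)
        qed simp
        have "F x - u x = (1 - \<theta> j x) * (w j x - u x) + \<theta> j x * (w (Suc j) x - u x)"
          unfolding F_idx[OF j] by (simp add: algebra_simps)
        then have "\<bar>F x - u x\<bar> \<le> \<bar>(1 - \<theta> j x) * (w j x - u x)\<bar> + \<bar>\<theta> j x * (w (Suc j) x - u x)\<bar>"
          by linarith
        also have "\<dots> = (1 - \<theta> j x) * \<bar>w j x - u x\<bar> + \<theta> j x * \<bar>w (Suc j) x - u x\<bar>"
          using \<theta>01 by (simp add: abs_mult)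
        finally have "\<bar>F x - u x\<bar> \<le> \<bar>w j x - u x\<bar> * indicator (X j) x + \<bar>w (Suc j) x - u x\<bar> * indicator (X (Suc j)) x"
          using 1 2 by linarith
        then have "ennreal \<bar>F x - u x\<bar> \<le> ennreal (\<bar>w j x - u x\<bar> * indicator (X j) x) + ennreal (\<bar>w (Suc j) x - u x\<bar> * indicator (X (Suc j)) x)"
          by (rule ennreal_le_add) auto
        also have "\<dots> = ennreal \<bar>w j x - u x\<bar> * indicator (X j) x + ennreal \<bar>w (Suc j) x - u x\<bar> * indicator (X (Suc j)) x"
          by (auto simp: indicator_def)
        also have "\<dots> \<le> (\<Sum>j. ennreal \<bar>w j x - u x\<bar> * indicator (X j) x)"
          by (rule suminf_pair_le)
        finally show ?thesis using True by simp
      qed simp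
      have mX: "mble (X j) (\<lambda>x. w j x - u x)" for j
        using mble_subset[OF mble_loc_lip[OF A w(1)] cc_subset[OF X]] mble_subset[OF m cc_subset[OF X]] cc_open[OF X]
        by (intro mble_diff) auto
      have "L1 W (\<lambda>x. F x - u x) \<le> (\<integral>\<^sup>+ x. (\<Sum>j. ennreal \<bar>w j x - u x\<bar> * indicator (X j) x) \<partial>M)"
        by (rule nn_integral_mono) (rule pw)
      also have "\<dots> = (\<Sum>j. L1 (X j) (\<lambda>x. w j x - u x))"
        by (intro nn_integral_suminf mble_L1 mX)
      also have "\<dots> \<le> (\<Sum>j. ennreal (\<epsilon>/4 * (1/2) ^ Suc j))"
        by (intro suminf_le summableI) (use w(3) e(2) ennreal_leI order_trans in blast)
      also have "\<dots> = ennreal (\<epsilon>/4)" using \<epsilon> by (intro suminf_half_ennreal) auto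
      also have "\<dots> \<le> ennreal \<epsilon>" using \<epsilon> by (intro ennreal_leI) auto
      finally show ?thesis .
    qed
    moreover have "(\<integral>\<^sup>+ x \<in> U. h x \<partial>M) \<le> (\<Sum>j. TV u (A j)) + ennreal \<epsilon>"
    proof -
      have VL: "(\<integral>\<^sup>+ x. ennreal (3 * K j * \<bar>w j x - w (Suc j) x\<bar>) * indicator (V j) x \<partial>M) \<le> ennreal ((\<epsilon>/2) * (1/2) ^ Suc j)" for j
      proof -
        have mV: "mble (V j) (\<lambda>x. w j x - u x)" "mble (V j) (\<lambda>x. w (Suc j) x - u x)"
          using mble_subset[OF mble_loc_lip[OF A w(1)] VA(1)] mble_subset[OF m VA(1)]
            mble_subset[OF mble_loc_lip[OF A w(1)] VA(2)] VA(3) by (auto intro!: mble_diff)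
        have mV': "mble (V j) (\<lambda>x. w j x - w (Suc j) x)" using mble_diff[OF mV] by simp
        have "L1 (V j) (\<lambda>x. w j x - w (Suc j) x) \<le> L1 (V j) (\<lambda>x. w j x - u x) + L1 (V j) (\<lambda>x. w (Suc j) x - u x)"
          by (rule L1_triangle[OF mV]) auto
        also have "\<dots> \<le> L1 (X j) (\<lambda>x. w j x - u x) + L1 (X (Suc j)) (\<lambda>x. w (Suc j) x - u x)"
          using XV by (intro add_mono L1_mono_set)
        also have "\<dots> \<le> ennreal (e j) + ennreal (e (Suc j))" by (intro add_mono w)
        also have "\<dots> = ennreal (e j + e (Suc j))" using e(1)[of j] e(1)[of "Suc j"] by simp
        finally have "ennreal \<bar>3 * K j\<bar> * L1 (V j) (\<lambda>x. w j x - w (Suc j) x) \<le> ennreal (3 * K j) * ennreal (e j + e (Suc j))"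
          using K[of j] by (simp add: mult_left_mono)
        also have "\<dots> = ennreal (3 * K j * (e j + e (Suc j)))"
          using K[of j] e(1)[of j] e(1)[of "Suc j"] by (intro ennreal_mult[symmetric]) auto
        also have "\<dots> \<le> ennreal ((\<epsilon>/2) * (1/2) ^ Suc j)" by (intro ennreal_leI e)
        finally show ?thesis using L1_cmult[OF mV', of "3 * K j"] K[of j] by (simp add: abs_mult)
      qed
      have "(\<integral>\<^sup>+ x \<in> U. h x \<partial>M) \<le> (\<integral>\<^sup>+ x. h x \<partial>M)" by (intro nn_integral_mono) (auto simp: indicator_def)
      also have "\<dots> = (\<integral>\<^sup>+ x. (\<Sum>j. g j x * indicator (A j) x) \<partial>M) + (\<integral>\<^sup>+ x. (\<Sum>j. ennreal (3 * K j * \<bar>w j x - w (Suc j) x\<bar>) * indicator (V j) x) \<partial>M)"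
        unfolding h_def by (intro nn_integral_add borel_measurable_suminf_order borel_measurable_M hm1 hm2)
      also have "\<dots> = (\<Sum>j. \<integral>\<^sup>+ x \<in> A j. g j x \<partial>M) + (\<Sum>j. \<integral>\<^sup>+ x. ennreal (3 * K j * \<bar>w j x - w (Suc j) x\<bar>) * indicator (V j) x \<partial>M)"
        by (intro arg_cong2[where f = plus] nn_integral_suminf borel_measurable_M hm1 hm2)
      also have "\<dots> \<le> (\<Sum>j. TV u (A j) + ennreal ((\<epsilon>/4) * (1/2) ^ Suc j)) + (\<Sum>j. ennreal ((\<epsilon>/2) * (1/2) ^ Suc j))"
      proof (intro add_mono suminf_le summableI VL)
        fix j
        show "(\<integral>\<^sup>+ x \<in> A j. g j x \<partial>M) \<le> TV u (A j) + ennreal ((\<epsilon>/4) * (1/2) ^ Suc j)"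
          using w(4)[of j] e(2)[of j] by (meson add_left_mono ennreal_leI order_trans)
      qed
      also have "(\<Sum>j. TV u (A j) + ennreal ((\<epsilon>/4) * (1/2) ^ Suc j)) = (\<Sum>j. TV u (A j)) + (\<Sum>j. ennreal ((\<epsilon>/4) * (1/2) ^ Suc j))"
        by (intro suminf_add[symmetric] summableI)
      also have "(\<Sum>j. ennreal ((\<epsilon>/4) * (1/2) ^ Suc j)) = ennreal (\<epsilon>/4)" using \<epsilon> by (intro suminf_half_ennreal) auto
      also have "(\<Sum>j. ennreal ((\<epsilon>/2) * (1/2) ^ Suc j)) = ennreal (\<epsilon>/2)" using \<epsilon> by (intro suminf_half_ennreal) auto
      also have "(\<Sum>j. TV u (A j)) + ennreal (\<epsilon>/4) + ennreal (\<epsilon>/2) = (\<Sum>j. TV u (A j)) + ennreal (3 * \<epsilon> / 4)"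
        using \<epsilon> by (simp add: add.assoc ennreal_plus[symmetric] del: ennreal_plus)
      also have "\<dots> \<le> (\<Sum>j. TV u (A j)) + ennreal \<epsilon>" using \<epsilon> by (intro add_left_mono ennreal_leI) auto
      finally show ?thesis .
    qed
    ultimately show "\<exists>w g. loc_lip U w \<and> ug U w g \<and> L1 W (\<lambda>x. w x - u x) \<le> ennreal \<epsilon> \<and>
        (\<integral>\<^sup>+ x \<in> U. g x \<partial>M) \<le> (\<Sum>j. TV u (A j)) + ennreal \<epsilon>" by blast
  qed
qed

text \<open>Only the transition with index 0 is used: for \<rho> = \<open>\<zeta> + 1\<close> it
  takes place where 1/3 \<le> \<zeta> \<le> 2/3, and \<zeta> \<le> 1 keeps \<rho> below 7/3, where
  the next one would begin.\<close>

lemma TV_glue2: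
  fixes A B V :: "'a set" and K :: real and \<zeta> :: "'a \<Rightarrow> real"
  assumes U: "open U" and \<zeta>: "continuous_on U \<zeta>" "\<And>x. x \<in> U \<Longrightarrow> \<zeta> x \<le> 1"
    and AB: "open A" "open B" and m: "mble A u" "mble B u"
    and hA: "\<And>x. x \<in> U \<Longrightarrow> \<zeta> x \<le> 2/3 \<Longrightarrow> x \<in> A" and hB: "\<And>x. x \<in> U \<Longrightarrow> 1/3 \<le> \<zeta> x \<Longrightarrow> x \<in> B"
    and V: "compactly_contained V (A \<inter> B)" "\<And>x. x \<in> U \<Longrightarrow> 1/3 \<le> \<zeta> x \<Longrightarrow> \<zeta> x \<le> 2/3 \<Longrightarrow> x \<in> V"
    and lip: "K-lipschitz_on (U \<inter> V) \<zeta>"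
  shows "TV u U \<le> TV u A + TV u B"
proof -
  define A' where "A' j = (if j = 0 then A else if j = 1 then B else {})" for j :: nat
  have "TV u U \<le> (\<Sum>j. TV u (A' j))"
  proof (rule TV_glue[of U "\<lambda>x. \<zeta> x + 1" A' u "\<lambda>j. if j = 0 then V else {}" "\<lambda>j. if j = 0 then K else 0"])
    show "mble (A' j) u" for j using m by (auto simp: A'_def set_borel_measurable_def)
    fix x j assume x: "x \<in> U"
    show "x \<in> A' j" if "j = 0 \<or> real j + 1/3 \<le> \<zeta> x + 1" "\<zeta> x + 1 \<le> real j + 5/3"
    proof -
      have "j < 2"
      proof (rule ccontr)
        assume "\<not> j < 2"
        then have "real j \<ge> 2" "j \<noteq> 0" by auto
        then show False using that(1) \<zeta>(2)[OF x] by auto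
      qed
      then consider "j = 0" | "j = 1" by linarith
      then show ?thesis using hA[OF x] hB[OF x] that by cases (auto simp: A'_def)
    qed
    show "x \<in> (if j = 0 then V else {})" if "real j + 4/3 \<le> \<zeta> x + 1" "\<zeta> x + 1 \<le> real j + 5/3"
      using V(2)[OF x] that \<zeta>(2)[OF x] by (cases j) auto
  next
    fix j show "(if j = 0 then K else 0)-lipschitz_on (U \<inter> (if j = 0 then V else {})) (\<lambda>x. \<zeta> x + 1)"
      using lip unfolding lipschitz_on_def by (simp add: dist_real_def)
  qed (use assms in \<open>auto simp: A'_def cc_empty intro!: continuous_intros\<close>)
  also have "(\<Sum>j. TV u (A' j)) = (\<Sum>j\<in>{0,1}. TV u (A' j))"
    by (rule suminf_finite) (auto simp: A'_def)
  finally show ?thesis by (simp add: A'_def)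
qed

section \<open>Tails of the variation and inner regularity\<close>

lemma rho_band:
  assumes U: "open U" and st: "s' < s" "t < t'"
  shows "compactly_contained {x\<in>U. s < rho U x \<and> rho U x < t} {x\<in>U. s' < rho U x \<and> rho U x < t'}"
  unfolding compactly_contained_def
proof (intro conjI)
  have "open {x\<in>U. rho U x \<in> {s<..<t}}" by (intro open_rho U) auto
  then show "open {x\<in>U. s < rho U x \<and> rho U x < t}" by simp
  have c: "compact {x\<in>U. rho U x \<in> {s..t}}" by (rule closed_rho[OF U, of _ t]) auto
  have sub: "closure {x\<in>U. s < rho U x \<and> rho U x < t} \<subseteq> {x\<in>U. rho U x \<in> {s..t}}"
    using c by (intro closure_minimal) (auto intro: compact_imp_closed)
  show "compact (closure {x\<in>U. s < rho U x \<and> rho U x < t})"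
    using compact_Int_closed[OF c closed_closure, of "{x\<in>U. s < rho U x \<and> rho U x < t}"] unfolding inf.absorb2[OF sub] .
  show "closure {x\<in>U. s < rho U x \<and> rho U x < t} \<subseteq> {x\<in>U. s' < rho U x \<and> rho U x < t'}"
    using sub st by force
qed

text \<open>Bands of width 2 at integer offsets overlap their neighbours in width 1, with room for a
  transition inside. Subadditivity for this particular cover comes first, since the general case is
  reduced to it through \<open>TV_inner\<close>. The condition on t makes t + j + 2 positive, as
  \<open>rho_lipschitz\<close> requires.\<close>

lemma TV_bands:
  assumes U: "open U" and m: "mble U u" and t: "-1 \<le> t"
  shows "TV u {x\<in>U. t < rho U x} \<le> (\<Sum>j. TV u {x\<in>U. t + real j < rho U x \<and> rho U x < t + real j + 2})"
proof (rule TV_glue[of "{x\<in>U. t < rho U x}" "\<lambda>x. rho U x - t" _ u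
    "\<lambda>j. {x\<in>U. t + real j + 7/6 < rho U x \<and> rho U x < t + real j + 11/6}" "\<lambda>j. (t + real j + 2)^2 + 1"])
  show o: "open {x\<in>U. t < rho U x}" using open_rho[OF U, of "{t<..}"] by simp
  have band_open: "open {x\<in>U. a < rho U x \<and> rho U x < b}" for a b using open_rho[OF U, of "{a<..<b}"] by simp
  show "continuous_on {x\<in>U. t < rho U x} (\<lambda>x. rho U x - t)"
    by (intro continuous_intros continuous_on_subset[OF rho_continuous[OF U]]) auto
  show "open {x\<in>U. t + real j < rho U x \<and> rho U x < t + real j + 2}" for j by (rule band_open)
  then show "mble {x\<in>U. t + real j < rho U x \<and> rho U x < t + real j + 2} u" for j
    by (intro mble_subset[OF m]) auto
  show "compactly_contained {x\<in>U. t + real j + 7/6 < rho U x \<and> rho U x < t + real j + 11/6}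
     ({x\<in>U. t + real j < rho U x \<and> rho U x < t + real j + 2} \<inter>
      {x\<in>U. t + real (Suc j) < rho U x \<and> rho U x < t + real (Suc j) + 2})" for j
    by (rule cc_mono[OF rho_band[OF U, of "t + real j + 1" _ _ "t + real j + 2"]]) auto
  show "((t + real j + 2)^2 + 1)-lipschitz_on ({x\<in>U. t < rho U x} \<inter>
    {x\<in>U. t + real j + 7/6 < rho U x \<and> rho U x < t + real j + 11/6}) (\<lambda>x. rho U x - t)" for j
  proof -
    have "((t + real j + 2)^2 + 1)-lipschitz_on {x\<in>U. rho U x \<le> t + real j + 2} (rho U)"
      using t by (intro rho_lipschitz U) auto
    then have "((t + real j + 2)^2 + 1)-lipschitz_on ({x\<in>U. t < rho U x} \<inter>
      {x\<in>U. t + real j + 7/6 < rho U x \<and> rho U x < t + real j + 11/6}) (rho U)"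
      by (rule lipschitz_on_subset) auto
    then show ?thesis unfolding lipschitz_on_def by (simp add: dist_real_def)
  qed
qed auto

text \<open>Bands of equal parity are disjoint and finitely many of them lie in one level, so their
  variations sum to at most c. Hence the series over all bands converges, and its tail bounds the
  variation beyond a level. The bound c concerns levels only, because in \<open>TV_inner\<close> the
  finiteness of \<open>TV u U\<close> is still to be shown.\<close>

lemma TV_tail_aux:
  assumes U: "open U" and m: "mble U u" and c: "\<And>s. TV u (lev U s) \<le> c" "c < \<infinity>" and \<epsilon>: "\<epsilon> > 0"
  obtains N :: nat where "TV u {x\<in>U. real N < rho U x} \<le> ennreal \<epsilon>"
proof -
  define a where "a j = TV u {x\<in>U. real j < rho U x \<and> rho U x < real j + 2}" for j :: nat
  have band_open: "open {x\<in>U. a < rho U x \<and> rho U x < b}" for a b using open_rho[OF U, of "{a<..<b}"] by simp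
  have le: "(\<Sum>i<n. a (2 * i + k)) \<le> c" for n k
  proof -
    have "(\<Sum>i<n. a (2 * i + k)) \<le> TV u (\<Union>i<n. {x\<in>U. real (2 * i + k) < rho U x \<and> rho U x < real (2 * i + k) + 2})"
      unfolding a_def
    proof (rule TV_superadd_finite)
      show "disjoint_family_on (\<lambda>i. {x\<in>U. real (2 * i + k) < rho U x \<and> rho U x < real (2 * i + k) + 2}) {..<n}"
        unfolding disjoint_family_on_def
      proof (intro ballI impI)
        fix i j :: nat assume "i \<noteq> j"
        then have "real (2 * i + k) + 2 \<le> real (2 * j + k) \<or> real (2 * j + k) + 2 \<le> real (2 * i + k)" by linarith
        then show "{x\<in>U. real (2 * i + k) < rho U x \<and> rho U x < real (2 * i + k) + 2} \<inter>
           {x\<in>U. real (2 * j + k) < rho U x \<and> rho U x < real (2 * j + k) + 2} = {}" by auto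
      qed
    qed (auto intro: band_open[unfolded of_nat_add])
    also have "\<dots> \<le> TV u (lev U (real (2 * n + k) + 2))"
      by (intro TV_mono open_UN ballI band_open cc_open[OF cc_lev[OF U]]) (auto simp: lev_def)
    finally show ?thesis using c(1) order_trans by blast
  qed
  have "(\<Sum>i<n. a (2 * i)) \<le> c" "(\<Sum>i<n. a (Suc (2 * i))) \<le> c" for n using le[where n = n and k = 0] le[where n = n and k = 1] by simp_all
  from even_odd_tail[of a, OF this c(2) \<epsilon>] obtain N where N: "\<And>n. n \<ge> N \<Longrightarrow> (\<Sum>j. a (j + n)) \<le> ennreal \<epsilon>" by blast
  have "TV u {x\<in>U. real N < rho U x} \<le> (\<Sum>j. a (j + N))"
    using TV_bands[OF U m, of "real N"] by (simp add: a_def add_ac)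
  also have "\<dots> \<le> ennreal \<epsilon>" by (rule N) simp
  finally show thesis by (rule that)
qed

lemma TV_tail:
  assumes "open U" "mble U u" "TV u U < \<infinity>" "\<epsilon> > 0"
  obtains N :: nat where "TV u {x\<in>U. real N < rho U x} \<le> ennreal \<epsilon>"
proof (rule TV_tail_aux[OF assms(1,2) _ assms(3,4)])
  show "TV u (lev U s) \<le> TV u U" for s
    using assms(1) cc_lev[of U s] by (intro TV_mono) (auto intro: cc_open cc_subset dest: cc_subset)
qed (rule that)

lemma TV_lev_tail:
  assumes U: "open U" and m: "mble U u"
  shows "TV u U \<le> TV u (lev U (real N + 2)) + TV u {x\<in>U. real N < rho U x}"
proof (rule TV_glue2[of U "\<lambda>x. min 1 (rho U x - real N - 1/2 - 1/2)" _ _ u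
     "{x\<in>U. real N + 7/6 < rho U x \<and> rho U x < real N + 11/6}" "(real N + 2)^2 + 1"])
  have o: "open (lev U (real N + 2))" "open {x\<in>U. real N < rho U x}"
    using cc_open[OF cc_lev[OF U]] open_rho[OF U, of "{real N<..}"] by auto
  then show "open (lev U (real N + 2))" "open {x\<in>U. real N < rho U x}" by auto
  show "mble (lev U (real N + 2)) u" "mble {x\<in>U. real N < rho U x} u"
    using o by (auto intro!: mble_subset[OF m] simp: lev_def)
  show "continuous_on U (\<lambda>x. min 1 (rho U x - real N - 1/2 - 1/2))"
    by (intro continuous_intros rho_continuous U)
  show "compactly_contained {x\<in>U. real N + 7/6 < rho U x \<and> rho U x < real N + 11/6}
     (lev U (real N + 2) \<inter> {x\<in>U. real N < rho U x})"
    by (rule cc_mono[OF rho_band[OF U, of "real N" _ _ "real N + 2"]]) (auto simp: lev_def)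
  have "((real N + 2)^2 + 1)-lipschitz_on {x\<in>U. rho U x \<le> real N + 2} (rho U)"
    by (intro rho_lipschitz U) auto
  then have *: "((real N + 2)^2 + 1)-lipschitz_on (U \<inter> {x\<in>U. real N + 7/6 < rho U x \<and> rho U x < real N + 11/6}) (rho U)"
    by (rule lipschitz_on_subset) auto
  show "((real N + 2)^2 + 1)-lipschitz_on (U \<inter> {x\<in>U. real N + 7/6 < rho U x \<and> rho U x < real N + 11/6})
     (\<lambda>x. min 1 (rho U x - real N - 1/2 - 1/2))"
  proof (rule lipschitz_onI)
    fix x y assume xy: "x \<in> U \<inter> {x\<in>U. real N + 7/6 < rho U x \<and> rho U x < real N + 11/6}"
      "y \<in> U \<inter> {x\<in>U. real N + 7/6 < rho U x \<and> rho U x < real N + 11/6}"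
    have "dist (min 1 (rho U x - real N - 1/2 - 1/2)) (min 1 (rho U y - real N - 1/2 - 1/2)) \<le> dist (rho U x) (rho U y)"
      by (auto simp: dist_real_def)
    also have "\<dots> \<le> ((real N + 2)^2 + 1) * dist x y" by (rule lipschitz_onD[OF * xy])
    finally show "dist (min 1 (rho U x - real N - 1/2 - 1/2)) (min 1 (rho U y - real N - 1/2 - 1/2)) \<le> ((real N + 2)^2 + 1) * dist x y" .
  qed simp
qed (use U in \<open>auto simp: lev_def min_def split: if_splits\<close>)

text \<open>Approximations on the levels do not by themselves yield one on U. Gluing a level to a
  tail of small variation does.\<close>

lemma TV_inner:
  assumes U: "open U" and m: "mble U u" and c: "\<And>s. TV u (lev U s) \<le> c"
  shows "TV u U \<le> c"
proof (cases "c = \<infinity>")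
  case False
  then have fin: "c < \<infinity>" by (simp add: less_top)
  show ?thesis
  proof (rule ennreal_le_epsilon)
    fix e :: real assume "e > 0"
    obtain N :: nat where N: "TV u {x\<in>U. real N < rho U x} \<le> ennreal e"
      using TV_tail_aux[OF U m c fin \<open>e > 0\<close>] .
    show "TV u U \<le> c + ennreal e"
      by (rule order_trans[OF TV_lev_tail[OF U m, of N]]) (intro add_mono c N)
  qed
qed simp

text \<open>By \<open>TV_inner\<close> it is enough to treat a level of the union. On its compact
  closure K the sum of the distances a and b to the complements is bounded below, so \<zeta> = b /
  (a + b) is Lipschitz; its middle range is a compact subset of A \<inter> B, which gives the
  transition zone of \<open>TV_glue2\<close>.\<close>

lemma TV_subadd:
  assumes AB: "open A" "open B" and m: "mble (A \<union> B) u"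
  shows "TV u (A \<union> B) \<le> TV u A + TV u B"
proof -
  \<comment> \<open>If A or B is the whole space the claim is trivial, whereas the distance to the
    empty complement would be the default value 0.\<close>
  consider "A = UNIV" | "B = UNIV" | "A \<noteq> UNIV" "B \<noteq> UNIV" by blast
  then show ?thesis
  proof cases
    case 3
    show ?thesis
    proof (rule TV_inner)
      show o: "open (A \<union> B)" using AB by auto
      show "mble (A \<union> B) u" by fact
      fix s
      define U where "U = lev (A \<union> B) s"
      have U: "compactly_contained U (A \<union> B)" unfolding U_def by (rule cc_lev[OF o])
      define K where "K = closure U"
      have K: "compact K" "K \<subseteq> A \<union> B" "U \<subseteq> K" using U closure_subset by (auto simp: K_def compactly_contained_def)
      define a b where "a x = infdist x (- A)" and "b x = infdist x (- B)" for x
      have ab0: "0 \<le> a x" "0 \<le> b x" for x by (auto simp: a_def b_def infdist_nonneg)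
      have aA: "0 < a x \<longleftrightarrow> x \<in> A" for x
        using infdist_compl_pos[OF AB(1) _ 3(1), of x] infdist_zero[of x "- A"] by (cases "x \<in> A") (auto simp: a_def)
      have bB: "0 < b x \<longleftrightarrow> x \<in> B" for x
        using infdist_compl_pos[OF AB(2) _ 3(2), of x] infdist_zero[of x "- B"] by (cases "x \<in> B") (auto simp: b_def)
      have cont: "continuous_on S a" "continuous_on S b" for S by (auto simp: a_def b_def intro!: continuous_intros)
      have pos: "0 < a x + b x" if "x \<in> K" for x
        using that K(2) aA[of x] bB[of x] ab0[of x] by fastforce
      obtain c where c: "c > 0" "\<And>x. x \<in> K \<Longrightarrow> c \<le> a x + b x"
      proof (cases "K = {}")
        case False
        have "continuous_on K (\<lambda>x. a x + b x)" using cont by (intro continuous_intros)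
        from continuous_attains_inf[OF K(1) False this] obtain x where "x \<in> K" "\<And>y. y \<in> K \<Longrightarrow> a x + b x \<le> a y + b y" by blast
        then show thesis using pos that by blast
      qed (use that[of 1] in auto)
      define \<zeta> where "\<zeta> x = b x / (a x + b x)" for x
      have \<zeta>c: "continuous_on K \<zeta>" unfolding \<zeta>_def using cont pos by (intro continuous_intros) force+
      have \<zeta>lip: "(1/c)-lipschitz_on K \<zeta>"
      proof (rule lipschitz_onI)
        fix x y assume xy: "x \<in> K" "y \<in> K"
        note p = pos[OF xy(1)] pos[OF xy(2)]
        have "\<zeta> x - \<zeta> y = (b x * (a y - a x) + a x * (b x - b y)) / ((a x + b x) * (a y + b y))"
          unfolding \<zeta>_def using p by (simp add: divide_simps) (simp add: algebra_simps)
        then have "\<bar>\<zeta> x - \<zeta> y\<bar> = \<bar>b x * (a y - a x) + a x * (b x - b y)\<bar> / ((a x + b x) * (a y + b y))"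
          using p by (simp add: abs_mult)
        also have "\<bar>b x * (a y - a x) + a x * (b x - b y)\<bar> \<le> b x * \<bar>a y - a x\<bar> + a x * \<bar>b x - b y\<bar>"
          using ab0[of x] abs_triangle_ineq[of "b x * (a y - a x)" "a x * (b x - b y)"] by (simp add: abs_mult)
        also have "\<dots> \<le> b x * dist x y + a x * dist x y"
          using ab0[of x] infdist_triangle_abs[of y "- A" x] infdist_triangle_abs[of x "- B" y]
          by (intro add_mono mult_left_mono) (auto simp: a_def b_def dist_commute)
        also have "(b x * dist x y + a x * dist x y) / ((a x + b x) * (a y + b y)) = dist x y / (a y + b y)"
          using p by (simp add: divide_simps) (simp add: algebra_simps)
        also have "\<dots> \<le> dist x y / c" using c xy by (intro divide_left_mono) (auto intro!: mult_pos_pos p)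
        finally show "dist (\<zeta> x) (\<zeta> y) \<le> 1/c * dist x y" using p by (simp add: dist_real_def divide_right_mono)
      qed (use c in auto)
      define C where "C = {x\<in>K. \<zeta> x \<in> {1/3..2/3}}"
      have "compact C"
      proof -
        have "closed (K \<inter> \<zeta> -` {1/3..2/3})" using K(1) \<zeta>c by (intro continuous_closed_preimage) (auto intro: compact_imp_closed)
        then have "compact (K \<inter> (K \<inter> \<zeta> -` {1/3..2/3}))" using K(1) by (intro compact_Int_closed)
        moreover have "K \<inter> (K \<inter> \<zeta> -` {1/3..2/3}) = C" by (auto simp: C_def)
        ultimately show ?thesis by simp
      qed
      have inA: "x \<in> A" if "x \<in> K" "\<zeta> x \<le> 2/3" for x
      proof -
        have "3 * b x \<le> 2 * (a x + b x)" using that(2) pos[OF that(1)] by (simp add: \<zeta>_def divide_le_eq)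
        then have "a x \<noteq> 0" using pos[OF that(1)] by auto
        then have "0 < a x" using ab0[of x] by simp
        then show ?thesis using aA by simp
      qed
      have inB: "x \<in> B" if "x \<in> K" "1/3 \<le> \<zeta> x" for x
      proof -
        have "a x + b x \<le> 3 * b x" using that(2) pos[OF that(1)] by (simp add: \<zeta>_def le_divide_eq)
        then have "b x \<noteq> 0" using pos[OF that(1)] by auto
        then have "0 < b x" using ab0[of x] by simp
        then show ?thesis using bB by simp
      qed
      have "C \<subseteq> A \<inter> B" using inA inB by (auto simp: C_def)
      then obtain V where V: "compactly_contained V (A \<inter> B)" "C \<subseteq> V"
        using cc_compact[OF _ \<open>compact C\<close>] AB by (metis open_Int)
      have "TV u U \<le> TV u A + TV u B"
      proof (rule TV_glue2[of U \<zeta> A B u V "1/c"])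
        show "open U" using U by (rule cc_open)
        show "continuous_on U \<zeta>" using \<zeta>c K(3) by (rule continuous_on_subset)
        show "\<zeta> x \<le> 1" if "x \<in> U" for x
          using pos[of x] that K(3) ab0[of x] by (auto simp: \<zeta>_def divide_le_eq)
        show "mble A u" "mble B u" using AB m by (auto intro: mble_subset)
        show "(1/c)-lipschitz_on (U \<inter> V) \<zeta>" using \<zeta>lip by (rule lipschitz_on_subset) (use K in auto)
        show "x \<in> V" if "x \<in> U" "1/3 \<le> \<zeta> x" "\<zeta> x \<le> 2/3" for x
          using that K(3) V(2) by (auto simp: C_def)
      qed (use AB V inA inB K(3) in auto)
      then show "TV u (lev (A \<union> B) s) \<le> TV u A + TV u B" by (simp add: U_def)
    qed
  qed auto
qed

lemma TV_subadd_finite: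
  assumes "finite I" "\<And>i. i \<in> I \<Longrightarrow> open (A i)" "mble (\<Union>i\<in>I. A i) u"
  shows "TV u (\<Union>i\<in>I. A i) \<le> (\<Sum>i\<in>I. TV u (A i))"
  using assms
proof (induction I rule: finite_induct)
  case (insert i I)
  have "mble (\<Union>i\<in>I. A i) u"
    using insert.prems by (intro mble_subset[OF insert.prems(2)] sets_M_open open_UN) auto
  then have "TV u (\<Union>j\<in>I. A j) \<le> (\<Sum>j\<in>I. TV u (A j))" using insert by auto
  moreover have "TV u (A i \<union> (\<Union>j\<in>I. A j)) \<le> TV u (A i) + TV u (\<Union>j\<in>I. A j)"
    using insert by (intro TV_subadd) auto
  ultimately have "TV u (A i \<union> (\<Union>j\<in>I. A j)) \<le> TV u (A i) + (\<Sum>j\<in>I. TV u (A j))"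
    by (meson add_left_mono order_trans)
  then show ?case using insert by simp
qed simp

text \<open>By \<open>TV_inner\<close> only levels have to be covered, and compactness leaves
  finitely many of the sets.\<close>

lemma TV_subadd_countable:
  fixes A :: "nat \<Rightarrow> 'a set"
  assumes A: "\<And>i. open (A i)" and m: "mble (\<Union>i. A i) u"
  shows "TV u (\<Union>i. A i) \<le> (\<Sum>i. TV u (A i))"
proof (rule TV_inner)
  show o: "open (\<Union>i. A i)" using A by auto
  fix s
  have cc: "compactly_contained (lev (\<Union>i. A i) s) (\<Union>i. A i)" by (rule cc_lev[OF o])
  then have "compact (closure (lev (\<Union>i. A i) s))" "closure (lev (\<Union>i. A i) s) \<subseteq> (\<Union>i\<in>UNIV. A i)"
    by (auto simp: compactly_contained_def)
  then obtain I where I: "finite I" "closure (lev (\<Union>i. A i) s) \<subseteq> (\<Union>i\<in>I. A i)"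
    by - (rule compactE_image[of _ UNIV A]; use A in blast)
  have "TV u (lev (\<Union>i. A i) s) \<le> TV u (\<Union>i\<in>I. A i)"
    using A order_trans[OF closure_subset I(2)] cc_open[OF cc] by (intro TV_mono) auto
  also have "\<dots> \<le> (\<Sum>i\<in>I. TV u (A i))"
    using A I by (intro TV_subadd_finite mble_subset[OF m]) auto
  also have "\<dots> \<le> (\<Sum>i. TV u (A i))" using I by (intro sum_le_suminf) (auto intro: summableI)
  finally show "TV u (lev (\<Union>i. A i) s) \<le> (\<Sum>i. TV u (A i))" .
qed fact

section \<open>The variation as a Borel measure\<close>

abbreviation TVo :: "('a \<Rightarrow> real) \<Rightarrow> 'a set \<Rightarrow> ennreal" where "TVo \<equiv> total_variation \<mu>"

lemma TVo_open: "open U \<Longrightarrow> TVo u U = TV u U"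
  unfolding total_variation_def
  by (rule antisym) (auto intro!: INF_lower2[of U] INF_greatest TV_mono)

lemma TVo_mono: "A \<subseteq> B \<Longrightarrow> TVo u A \<le> TVo u B"
  unfolding total_variation_def by (rule INF_superset_mono) auto

lemma TVo_le: "open U \<Longrightarrow> A \<subseteq> U \<Longrightarrow> TVo u A \<le> TV u U"
  unfolding total_variation_def by (rule INF_lower) auto

lemma TVo_approx:
  assumes "TVo u A < \<infinity>" "\<epsilon> > 0"
  obtains U where "open U" "A \<subseteq> U" "TV u U \<le> TVo u A + ennreal \<epsilon>"
proof -
  have "TVo u A < TVo u A + ennreal \<epsilon>" using assms by (simp add: ennreal_add_left_cancel_less less_top)
  then have "(INF U \<in> {U. open U \<and> A \<subseteq> U}. TV u U) < TVo u A + ennreal \<epsilon>"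
    by (subst total_variation_def[symmetric])
  then show thesis unfolding INF_less_iff using that by (auto intro: less_imp_le)
qed

lemma TVo_outer:
  assumes m: "mble UNIV u"
  shows "outer_measure_space UNIV (TVo u)"
proof (rule outer_measureI)
  show "TVo u {} = 0" by (simp add: TVo_open)
  show "TVo u A \<le> TVo u B" if "A \<subseteq> B" for A B by (rule TVo_mono[OF that])
  fix C :: "nat \<Rightarrow> 'a set"
  show "TVo u (\<Union>i. C i) \<le> (\<Sum>i. TVo u (C i))"
  proof (cases "\<exists>i. TVo u (C i) = \<infinity>")
    case True
    then obtain i where "TVo u (C i) = \<infinity>" by blast
    then have "(\<Sum>i. TVo u (C i)) = \<infinity>" using suminf_ge[of "\<lambda>i. TVo u (C i)" i] by (simp add: top_unique)
    then show ?thesis by simp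
  next
    case False
    then have fin: "TVo u (C i) < \<infinity>" for i by (simp add: less_top)
    show ?thesis
    proof (rule ennreal_le_epsilon)
      fix e :: real assume e: "e > 0"
      have "\<exists>U. open U \<and> C i \<subseteq> U \<and> TV u U \<le> TVo u (C i) + ennreal (e * (1/2) ^ Suc i)" for i
      proof -
        have "e * (1/2) ^ Suc i > 0" using e by simp
        then obtain U where "open U" "C i \<subseteq> U" "TV u U \<le> TVo u (C i) + ennreal (e * (1/2) ^ Suc i)"
          by (rule TVo_approx[OF fin])
        then show ?thesis by auto
      qed
      then obtain U where U: "\<And>i. open (U i)" "\<And>i. C i \<subseteq> U i" "\<And>i. TV u (U i) \<le> TVo u (C i) + ennreal (e * (1/2) ^ Suc i)"
        by metis
      have "TVo u (\<Union>i. C i) \<le> TV u (\<Union>i. U i)" using U by (intro TVo_le) auto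
      also have "\<dots> \<le> (\<Sum>i. TV u (U i))" using U by (intro TV_subadd_countable mble_subset[OF m]) auto
      also have "\<dots> \<le> (\<Sum>i. TVo u (C i) + ennreal (e * (1/2) ^ Suc i))" by (intro suminf_le summableI U)
      also have "\<dots> = (\<Sum>i. TVo u (C i)) + (\<Sum>i. ennreal (e * (1/2) ^ Suc i))" by (intro suminf_add[symmetric] summableI)
      also have "(\<Sum>i. ennreal (e * (1/2) ^ Suc i)) = ennreal e" using e by (intro suminf_half_ennreal) auto
      finally show "TVo u (\<Union>i. C i) \<le> (\<Sum>i. TVo u (C i)) + ennreal e" .
    qed
  qed
qed

text \<open>The neighbourhoods of radius r/2 of A and B are disjoint open sets, on which the
  variation is superadditive.\<close>

lemma TVo_metric:
  assumes r: "r > 0" and sep: "\<And>x y. x \<in> A \<Longrightarrow> y \<in> B \<Longrightarrow> r \<le> dist x y"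
  shows "TVo u A + TVo u B \<le> TVo u (A \<union> B)"
  unfolding total_variation_def[of \<mu> u "A \<union> B"]
proof (rule INF_greatest)
  fix U assume "U \<in> {U. open U \<and> A \<union> B \<subseteq> U}"
  then have U: "open U" "A \<subseteq> U" "B \<subseteq> U" by auto
  define A' B' where "A' = U \<inter> (\<Union>x\<in>A. ball x (r/2))" and "B' = U \<inter> (\<Union>x\<in>B. ball x (r/2))"
  have o: "open A'" "open B'" using U by (auto simp: A'_def B'_def)
  have "A' \<inter> B' = {}"
  proof (rule ccontr)
    assume "A' \<inter> B' \<noteq> {}"
    then obtain z x y where z: "x \<in> A" "y \<in> B" "dist x z < r/2" "dist y z < r/2" by (auto simp: A'_def B'_def)
    then show False using sep[OF z(1,2)] dist_triangle[of x y z] by (simp add: dist_commute)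
  qed
  have "TVo u A + TVo u B \<le> TV u A' + TV u B'"
    using o U r by (intro add_mono TVo_le) (auto simp: A'_def B'_def)
  also have "\<dots> \<le> TV u (A' \<union> B')" by (rule TV_superadd) fact+
  also have "\<dots> \<le> TV u U" using o U by (intro TV_mono) (auto simp: A'_def B'_def)
  finally show "TVo u A + TVo u B \<le> TV u U" .
qed

lemma TVo_borel: "mble UNIV u \<Longrightarrow> sets borel \<subseteq> lambda_system UNIV UNIV (TVo u)"
  by (rule metric_outer_measure_borel[OF TVo_outer TVo_metric])

end

section \<open>The Hausdorff measure and Lipschitz approximation\<close>

text \<open>Sums over finite and infinite index sets become series, so that both kinds of covers are
  treated alike.\<close>

lemma infsum_ennreal_suminf:
  fixes f :: "nat \<Rightarrow> ennreal"
  shows "infsum f I = (\<Sum>n. f n * indicator I n)"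
proof -
  have "infsum f I = infsum (\<lambda>n. f n * indicator I n) UNIV"
    by (rule infsum_cong_neutral) auto
  moreover have "((\<lambda>n. f n * indicator I n) has_sum infsum (\<lambda>n. f n * indicator I n) UNIV) UNIV"
    by (rule has_sum_infsum) (rule nonneg_summable_on_complete, simp)
  then have "(\<lambda>n. f n * indicator I n) sums infsum (\<lambda>n. f n * indicator I n) UNIV"
    by (rule has_sum_imp_sums)
  ultimately show ?thesis by (simp add: sums_unique)
qed

context doubling_measure
begin

abbreviation H :: "'a set \<Rightarrow> ennreal" where "H \<equiv> codim1_hausdorff \<mu>"

lemma content_le:
  assumes "\<And>i. i \<in> I \<Longrightarrow> 0 < r i \<and> r i \<le> R" "A \<subseteq> (\<Union>i\<in>I. ball (x i) (r i))"
  shows "codim1_content \<mu> R A \<le> (\<Sum>n. \<mu> (ball (x n) (r n)) / ennreal (r n) * indicator I n)"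
  unfolding codim1_content_def infsum_ennreal_suminf[symmetric]
  by (rule Inf_lower) (use assms in blast)

lemma content_ge:
  assumes "\<And>I x r. (\<And>i. i \<in> I \<Longrightarrow> 0 < r i \<and> r i \<le> R) \<Longrightarrow> A \<subseteq> (\<Union>i\<in>I. ball (x i) (r i)) \<Longrightarrow>
    c \<le> (\<Sum>n. \<mu> (ball (x n) (r n)) / ennreal (r n) * indicator I n)"
  shows "c \<le> codim1_content \<mu> R A"
  unfolding codim1_content_def infsum_ennreal_suminf
  by (rule Inf_greatest) (use assms in blast)

lemma content_cover:
  assumes "codim1_content \<mu> R A < \<infinity>" "\<epsilon> > 0"
  obtains I x r where "\<And>i. i \<in> I \<Longrightarrow> 0 < r i \<and> r i \<le> R" "A \<subseteq> (\<Union>i\<in>I. ball (x i) (r i))"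
    "(\<Sum>n. \<mu> (ball (x n) (r n)) / ennreal (r n) * indicator I n) \<le> codim1_content \<mu> R A + ennreal \<epsilon>"
proof -
  define c where "c = codim1_content \<mu> R A + ennreal \<epsilon>"
  have "codim1_content \<mu> R A < c"
    unfolding c_def using assms by (simp add: ennreal_add_left_cancel_less less_top)
  then show thesis
    unfolding codim1_content_def Inf_less_iff
  proof (elim bexE CollectE exE conjE)
    fix z x r and I :: "nat set"
    assume "z < c" "z = infsum (\<lambda>i. \<mu> (ball (x i) (r i)) / ennreal (r i)) I"
      "\<forall>i\<in>I. 0 < r i \<and> r i \<le> R" "A \<subseteq> (\<Union>i\<in>I. ball (x i) (r i))"
    then show thesis by (intro that[of I r x]) (auto simp: infsum_ennreal_suminf c_def)
  qed
qed

lemma content_mono: "A \<subseteq> B \<Longrightarrow> codim1_content \<mu> R A \<le> codim1_content \<mu> R B"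
  by (rule content_ge, rule content_le) auto

lemma content_antimono: "R \<le> R' \<Longrightarrow> codim1_content \<mu> R' A \<le> codim1_content \<mu> R A"
  by (rule content_ge, rule content_le) force+

lemma content_empty: "codim1_content \<mu> R {} = 0"
proof -
  have "codim1_content \<mu> R {} \<le> (\<Sum>n. \<mu> (ball (undefined n) (undefined n)) / ennreal (undefined n) * indicator {} n)"
    by (rule content_le) auto
  then show ?thesis by simp
qed

lemma content_countable:
  fixes A :: "nat \<Rightarrow> 'a set"
  shows "codim1_content \<mu> R (\<Union>i. A i) \<le> (\<Sum>i. codim1_content \<mu> R (A i))"
proof (cases "\<exists>i. codim1_content \<mu> R (A i) = \<infinity>")
  case True
  then obtain i where "codim1_content \<mu> R (A i) = \<infinity>" by blast
  then have "(\<Sum>i. codim1_content \<mu> R (A i)) = \<infinity>" using suminf_ge[of "\<lambda>i. codim1_content \<mu> R (A i)" i] by (simp add: top_unique)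
  then show ?thesis by simp
next
  case False
  then have fin: "codim1_content \<mu> R (A i) < \<infinity>" for i by (simp add: less_top)
  show ?thesis
  proof (rule ennreal_le_epsilon)
    fix e :: real assume e: "e > 0"
    let ?P = "\<lambda>i (I, x, r). (\<forall>j\<in>I. 0 < r j \<and> r j \<le> R) \<and> A i \<subseteq> (\<Union>j\<in>I. ball (x j) (r j)) \<and>
       (\<Sum>n. \<mu> (ball (x n) (r n)) / ennreal (r n) * indicator I n) \<le> codim1_content \<mu> R (A i) + ennreal (e * (1/2) ^ Suc i)"
    have "\<exists>p. ?P i p" for i
    proof -
      have "e * (1/2) ^ Suc i > 0" using e by simp
      then obtain I x r where "\<And>j. j \<in> I \<Longrightarrow> 0 < r j \<and> r j \<le> R" "A i \<subseteq> (\<Union>j\<in>I. ball (x j) (r j))"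
       "(\<Sum>n. \<mu> (ball (x n) (r n)) / ennreal (r n) * indicator I n) \<le> codim1_content \<mu> R (A i) + ennreal (e * (1/2) ^ Suc i)"
        by (rule content_cover[OF fin[of i]]) blast
      then show ?thesis by (intro exI[of _ "(I, x, r)"]) auto
    qed
    then obtain p where p: "\<forall>i. ?P i (p i)" using choice[of ?P] by blast
    define I x r where "I i = fst (p i)" and "x i = fst (snd (p i))" and "r i = snd (snd (p i))" for i
    have P: "\<And>i j. j \<in> I i \<Longrightarrow> 0 < r i j \<and> r i j \<le> R" "\<And>i. A i \<subseteq> (\<Union>j\<in>I i. ball (x i j) (r i j))"
      "\<And>i. (\<Sum>n. \<mu> (ball (x i n) (r i n)) / ennreal (r i n) * indicator (I i) n) \<le> codim1_content \<mu> R (A i) + ennreal (e * (1/2) ^ Suc i)"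
      using p by (auto simp: I_def x_def r_def case_prod_beta)
    \<comment> \<open>The covers of the sets \<open>A i\<close> are merged into one cover along the
      pairing of indices.\<close>
    define x' r' where "x' n = (case prod_decode n of (i, j) \<Rightarrow> x i j)" and "r' n = (case prod_decode n of (i, j) \<Rightarrow> r i j)" for n
    define I' where "I' = {n. case prod_decode n of (i, j) \<Rightarrow> j \<in> I i}"
    have "codim1_content \<mu> R (\<Union>i. A i) \<le> (\<Sum>n. \<mu> (ball (x' n) (r' n)) / ennreal (r' n) * indicator I' n)"
    proof (rule content_le)
      show "0 < r' n \<and> r' n \<le> R" if "n \<in> I'" for n using that P(1) by (auto simp: I'_def r'_def split: prod.splits)
      show "(\<Union>i. A i) \<subseteq> (\<Union>n\<in>I'. ball (x' n) (r' n))"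
      proof
        fix y assume "y \<in> (\<Union>i. A i)"
        then obtain i j where "j \<in> I i" "y \<in> ball (x i j) (r i j)" using P(2) by blast
        then show "y \<in> (\<Union>n\<in>I'. ball (x' n) (r' n))"
          by (intro UN_I[of "prod_encode (i, j)"]) (auto simp: I'_def x'_def r'_def)
      qed
    qed
    also have "\<dots> = (\<Sum>n. case prod_decode n of (i, j) \<Rightarrow> \<mu> (ball (x i j) (r i j)) / ennreal (r i j) * indicator (I i) j)"
      by (intro arg_cong[where f = suminf]) (auto simp: fun_eq_iff x'_def r'_def I'_def indicator_def split: prod.splits)
    also have "\<dots> = (\<Sum>i. \<Sum>j. \<mu> (ball (x i j) (r i j)) / ennreal (r i j) * indicator (I i) j)"
      using suminf_ennreal_2dimen[of "\<lambda>i. \<Sum>j. \<mu> (ball (x i j) (r i j)) / ennreal (r i j) * indicator (I i) j"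
        "\<lambda>(i, j). \<mu> (ball (x i j) (r i j)) / ennreal (r i j) * indicator (I i) j"]
      by (simp add: comp_def)
    also have "\<dots> \<le> (\<Sum>i. codim1_content \<mu> R (A i) + ennreal (e * (1/2) ^ Suc i))"
      by (intro suminf_le summableI P(3))
    also have "\<dots> = (\<Sum>i. codim1_content \<mu> R (A i)) + (\<Sum>i. ennreal (e * (1/2) ^ Suc i))" by (intro suminf_add[symmetric] summableI)
    also have "(\<Sum>i. ennreal (e * (1/2) ^ Suc i)) = ennreal e" using e by (intro suminf_half_ennreal) auto
    finally show "codim1_content \<mu> R (\<Union>i. A i) \<le> (\<Sum>i. codim1_content \<mu> R (A i)) + ennreal e" .
  qed
qed

lemma H_outer: "outer_measure_space UNIV H"
proof (rule outer_measureI)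
  show "H {} = 0" by (simp add: codim1_hausdorff_def content_empty)
  show "H A \<le> H B" if "A \<subseteq> B" for A B
    unfolding codim1_hausdorff_def by (intro SUP_mono) (use content_mono[OF that] in blast)
  fix C :: "nat \<Rightarrow> 'a set"
  show "H (\<Union>i. C i) \<le> (\<Sum>i. H (C i))"
    unfolding codim1_hausdorff_def[of \<mu> "\<Union>i. C i"]
  proof (rule SUP_least)
    fix R :: real assume R: "R \<in> {0<..}"
    have "codim1_content \<mu> R (\<Union>i. C i) \<le> (\<Sum>i. codim1_content \<mu> R (C i))" by (rule content_countable)
    also have "\<dots> \<le> (\<Sum>i. H (C i))"
      unfolding codim1_hausdorff_def using R by (intro suminf_le summableI SUP_upper)
    finally show "codim1_content \<mu> R (\<Union>i. C i) \<le> (\<Sum>i. H (C i))" .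
  qed
qed

text \<open>A ball of radius at most d/2 meets at most one of A and B, because two of its points
  have distance less than d. So the content is superadditive at small scales, and these determine
  the limit.\<close>

lemma H_metric:
  assumes d: "d > 0" and sep: "\<And>x y. x \<in> A \<Longrightarrow> y \<in> B \<Longrightarrow> d \<le> dist x y"
  shows "H A + H B \<le> H (A \<union> B)"
proof -
  have small: "codim1_content \<mu> R A + codim1_content \<mu> R B \<le> codim1_content \<mu> R (A \<union> B)" if R: "R \<le> d/2" for R
  proof (rule content_ge)
    fix I :: "nat set" and x r assume r: "\<And>i. i \<in> I \<Longrightarrow> 0 < r i \<and> r i \<le> R" and cov: "A \<union> B \<subseteq> (\<Union>i\<in>I. ball (x i) (r i))"
    define IA IB where "IA = {i\<in>I. ball (x i) (r i) \<inter> A \<noteq> {}}" and "IB = {i\<in>I. ball (x i) (r i) \<inter> B \<noteq> {}}"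
    have dj: "IA \<inter> IB = {}"
    proof (rule ccontr)
      assume "IA \<inter> IB \<noteq> {}"
      then obtain i a b where "i \<in> I" "a \<in> A" "b \<in> B" "dist (x i) a < r i" "dist (x i) b < r i"
        by (auto simp: IA_def IB_def)
      then show False using sep[of a b] r[of i] R dist_triangle[of a b "x i"] by (auto simp: dist_commute)
    qed
    let ?f = "\<lambda>n. \<mu> (ball (x n) (r n)) / ennreal (r n)"
    have "codim1_content \<mu> R A + codim1_content \<mu> R B \<le> (\<Sum>n. ?f n * indicator IA n) + (\<Sum>n. ?f n * indicator IB n)"
    proof (intro add_mono content_le)
      show "A \<subseteq> (\<Union>i\<in>IA. ball (x i) (r i))" "B \<subseteq> (\<Union>i\<in>IB. ball (x i) (r i))"
        using cov unfolding IA_def IB_def by blast+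
    qed (use r in \<open>auto simp: IA_def IB_def\<close>)
    also have "\<dots> = (\<Sum>n. ?f n * indicator IA n + ?f n * indicator IB n)" by (intro suminf_add summableI)
    also have "\<dots> \<le> (\<Sum>n. ?f n * indicator I n)"
      using dj by (intro suminf_le summableI) (auto simp: IA_def IB_def indicator_def)
    finally show "codim1_content \<mu> R A + codim1_content \<mu> R B \<le> (\<Sum>n. ?f n * indicator I n)" .
  qed
  have "H A + H B = (SUP R\<in>{0<..}. codim1_content \<mu> R A + codim1_content \<mu> R B)"
    unfolding codim1_hausdorff_def
  proof (rule SUP_add_directed_ennreal[symmetric])
    fix i j :: real assume "i \<in> {0<..}" "j \<in> {0<..}"
    then show "\<exists>k\<in>{0<..}. codim1_content \<mu> i A + codim1_content \<mu> j B \<le> codim1_content \<mu> k A + codim1_content \<mu> k B"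
      by (intro bexI[of _ "min i j"] add_mono content_antimono) auto
  qed
  also have "\<dots> \<le> H (A \<union> B)"
  proof (rule SUP_least)
    fix R :: real assume R: "R \<in> {0<..}"
    have "codim1_content \<mu> R A + codim1_content \<mu> R B \<le> codim1_content \<mu> (min R (d/2)) A + codim1_content \<mu> (min R (d/2)) B"
      by (intro add_mono content_antimono) auto
    also have "\<dots> \<le> codim1_content \<mu> (min R (d/2)) (A \<union> B)" by (rule small) auto
    also have "\<dots> \<le> H (A \<union> B)" unfolding codim1_hausdorff_def using R d by (intro SUP_upper) auto
    finally show "codim1_content \<mu> R A + codim1_content \<mu> R B \<le> H (A \<union> B)" .
  qed
  finally show ?thesis .
qed

lemma H_borel: "sets borel \<subseteq> lambda_system UNIV UNIV H"
  by (rule metric_outer_measure_borel[OF H_outer H_metric])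

lemma H_zero_content: "H A = 0 \<Longrightarrow> R > 0 \<Longrightarrow> codim1_content \<mu> R A = 0"
  unfolding codim1_hausdorff_def by (metis SUP_upper greaterThan_iff le_zero_eq)

end

text \<open>The Caratheodory construction is complete. This is what makes exceptional sets of
  boundary points usable, about which only their outer measure is known.\<close>

lemma outer_null_sets:
  assumes o: "outer_measure_space UNIV \<phi>" and "\<phi> N = 0"
  shows "N \<in> null_sets (outer_to_measure \<phi>)"
proof -
  note \<phi> = outer_measureD[OF o]
  have "\<phi> (N \<inter> X) + \<phi> ((UNIV - N) \<inter> X) = \<phi> X" for X
  proof (rule antisym)
    have "\<phi> (N \<inter> X) = 0" using \<phi>(2)[of "N \<inter> X" N] assms(2) by auto
    then show "\<phi> (N \<inter> X) + \<phi> ((UNIV - N) \<inter> X) \<le> \<phi> X" using \<phi>(2)[of "(UNIV - N) \<inter> X" X] by auto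
    have "X = (N \<inter> X) \<union> ((UNIV - N) \<inter> X)" by auto
    then show "\<phi> X \<le> \<phi> (N \<inter> X) + \<phi> ((UNIV - N) \<inter> X)" using \<phi>(3) by metis
  qed
  then have l: "N \<in> lambda_system UNIV UNIV \<phi>" by (simp add: lambda_system_def)
  then show ?thesis using emeasure_outer_to_measure[OF o l] sets_outer_to_measure[OF o] assms(2) by (intro null_setsI) auto
qed

text \<open>Two finite Borel measures are treated at once, so that one Lipschitz function approximates the
  trace both in \<open>L\<^sup>1\<close> of the Hausdorff measure and in \<open>L\<^sup>1\<close> of the perimeter measure.\<close>

lemma lipschitz_dense:
  fixes N1 N2 :: "'a::metric_space measure" and \<tau> :: "'a \<Rightarrow> real"
  assumes b1: "sets borel \<subseteq> sets N1" "space N1 = UNIV" and b2: "sets borel \<subseteq> sets N2" "space N2 = UNIV"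
    and B1: "B1 \<in> sets N1" "emeasure N1 B1 < \<infinity>" and B2: "B2 \<in> sets N2" "emeasure N2 B2 < \<infinity>"
    and \<tau>: "\<tau> \<in> borel_measurable borel" "\<And>x. 0 \<le> \<tau> x \<and> \<tau> x \<le> 1" and \<epsilon>: "\<epsilon> > 0"
  obtains L \<phi> where "L-lipschitz_on UNIV \<phi>" "\<And>x. 0 \<le> \<phi> x \<and> \<phi> x \<le> (1::real)"
    "(\<integral>\<^sup>+ x \<in> B1. ennreal \<bar>\<tau> x - \<phi> x\<bar> \<partial>N1) + (\<integral>\<^sup>+ x \<in> B2. ennreal \<bar>\<tau> x - \<phi> x\<bar> \<partial>N2) \<le> ennreal \<epsilon>"
proof -
  define E where "E f = (\<integral>\<^sup>+ x \<in> B1. ennreal \<bar>f x\<bar> \<partial>N1) + (\<integral>\<^sup>+ x \<in> B2. ennreal \<bar>f x\<bar> \<partial>N2)" for f :: "'a \<Rightarrow> real"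
  have mN: "(\<lambda>x. ennreal \<bar>f x\<bar> * indicator B1 x) \<in> borel_measurable N1" "(\<lambda>x. ennreal \<bar>f x\<bar> * indicator B2 x) \<in> borel_measurable N2"
    if "f \<in> borel_measurable borel" for f :: "'a \<Rightarrow> real"
  proof -
    have "f \<in> borel_measurable N1" "f \<in> borel_measurable N2" using that b1 b2 by (auto simp: measurable_def)
    then show "(\<lambda>x. ennreal \<bar>f x\<bar> * indicator B1 x) \<in> borel_measurable N1" "(\<lambda>x. ennreal \<bar>f x\<bar> * indicator B2 x) \<in> borel_measurable N2"
      using B1 B2 by measurable
  qed
  have E_mono: "E f \<le> E g" if "\<And>x. \<bar>f x\<bar> \<le> \<bar>g x\<bar>" for f g
    unfolding E_def by (intro add_mono nn_integral_mono mult_right_mono ennreal_leI that) auto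
  have E_add: "E f \<le> E g + E h" if "g \<in> borel_measurable borel" "h \<in> borel_measurable borel" "\<And>x. \<bar>f x\<bar> \<le> \<bar>g x\<bar> + \<bar>h x\<bar>" for f g h
  proof -
    have *: "(\<integral>\<^sup>+ x \<in> B. ennreal \<bar>f x\<bar> \<partial>N) \<le> (\<integral>\<^sup>+ x. (ennreal \<bar>g x\<bar> * indicator B x + ennreal \<bar>h x\<bar> * indicator B x) \<partial>N)" for B N
      using that(3) by (intro nn_integral_mono) (simp add: ennreal_le_add flip: distrib_right, simp add: indicator_def ennreal_le_add)
    show ?thesis
      using add_mono[OF *[where B = B1 and N = N1] *[where B = B2 and N = N2]] unfolding E_def
      by (simp add: nn_integral_add mN[OF that(1)] mN[OF that(2)] add_ac)
  qed
  have E_cmult: "E (\<lambda>x. c * f x) = ennreal \<bar>c\<bar> * E f" if "f \<in> borel_measurable borel" for c f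
    unfolding E_def distrib_left by (simp add: abs_mult ennreal_mult mult.assoc nn_integral_cmult mN[OF that])
  have lipm: "\<phi> \<in> borel_measurable borel" if "L-lipschitz_on UNIV \<phi>" for L and \<phi> :: "'a \<Rightarrow> real"
    using that by (intro borel_measurable_continuous_onI lipschitz_on_continuous_on)
  define app where "app f \<longleftrightarrow> f \<in> borel_measurable borel \<and> (\<forall>e>0. \<exists>L \<phi>. L-lipschitz_on UNIV \<phi> \<and> E (\<lambda>x. f x - \<phi> x) \<le> ennreal e)" for f
  have appD: "\<exists>L \<phi>. L-lipschitz_on UNIV \<phi> \<and> \<phi> \<in> borel_measurable borel \<and> E (\<lambda>x. f x - \<phi> x) \<le> ennreal e" if "app f" "e > 0" for f e
    using that lipm unfolding app_def by blast
  have app_add: "app (\<lambda>x. f x + g x)" if fg: "app f" "app g" for f g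
    unfolding app_def
  proof (intro conjI allI impI)
    show "(\<lambda>x. f x + g x) \<in> borel_measurable borel" using fg unfolding app_def by auto
    fix e :: real assume "e > 0"
    then have e: "e/2 > 0" by simp
    obtain L \<phi> where \<phi>: "L-lipschitz_on UNIV \<phi>" "\<phi> \<in> borel_measurable borel" "E (\<lambda>x. f x - \<phi> x) \<le> ennreal (e/2)" using appD[OF fg(1) e] by blast
    obtain K \<psi> where \<psi>: "K-lipschitz_on UNIV \<psi>" "\<psi> \<in> borel_measurable borel" "E (\<lambda>x. g x - \<psi> x) \<le> ennreal (e/2)" using appD[OF fg(2) e] by blast
    have "E (\<lambda>x. f x + g x - (\<phi> x + \<psi> x)) \<le> E (\<lambda>x. f x - \<phi> x) + E (\<lambda>x. g x - \<psi> x)"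
      using fg \<phi> \<psi> unfolding app_def by (intro E_add) auto
    also have "\<dots> \<le> ennreal (e/2) + ennreal (e/2)" by (intro add_mono \<psi> \<phi>)
    also have "\<dots> = ennreal e" using e by (simp flip: ennreal_plus)
    finally show "\<exists>L \<phi>. L-lipschitz_on UNIV \<phi> \<and> E (\<lambda>x. f x + g x - \<phi> x) \<le> ennreal e"
      using lipschitz_on_add[OF \<phi>(1) \<psi>(1)] by blast
  qed
  have app_lip: "app \<phi>" if "L-lipschitz_on UNIV \<phi>" for L \<phi>
    unfolding app_def using that lipm by (intro conjI allI impI exI[of _ L] exI[of _ \<phi>]) (auto simp: E_def)
  have app_cmult: "app (\<lambda>x. c * f x)" if f: "app f" for c f
    unfolding app_def
  proof (intro conjI allI impI)
    show "(\<lambda>x. c * f x) \<in> borel_measurable borel" using f unfolding app_def by auto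
    fix e :: real assume e: "e > 0"
    obtain L \<phi> where \<phi>: "L-lipschitz_on UNIV \<phi>" "\<phi> \<in> borel_measurable borel" "E (\<lambda>x. f x - \<phi> x) \<le> ennreal (e / (\<bar>c\<bar> + 1))"
      using appD[OF f, of "e / (\<bar>c\<bar> + 1)"] e by auto
    have "E (\<lambda>x. c * f x - c * \<phi> x) = ennreal \<bar>c\<bar> * E (\<lambda>x. f x - \<phi> x)"
      using f \<phi> unfolding app_def by (subst E_cmult[symmetric]) (auto simp: right_diff_distrib)
    also have "\<dots> \<le> ennreal \<bar>c\<bar> * ennreal (e / (\<bar>c\<bar> + 1))" by (intro mult_left_mono \<phi>) auto
    also have "\<dots> \<le> ennreal e" using e by (auto simp: ennreal_mult[symmetric] field_simps intro!: ennreal_leI)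
    finally show "\<exists>L \<phi>. L-lipschitz_on UNIV \<phi> \<and> E (\<lambda>x. c * f x - \<phi> x) \<le> ennreal e"
      using lipschitz_on_cmult_real[OF \<phi>(1), of c] by blast
  qed
  \<comment> \<open>Dominated convergence, with the constant c as majorant on the sets
    \<open>B1\<close> and \<open>B2\<close> of finite measure.\<close>
  have app_lim: "app f" if g: "\<And>n::nat. app (g n)" and f: "f \<in> borel_measurable borel"
    and l: "\<And>x. (\<lambda>n. g n x) \<longlonglongrightarrow> f x" "\<And>n x. \<bar>f x - g n x\<bar> \<le> c" for f g and c :: real
    unfolding app_def
  proof (intro conjI allI impI f)
    fix e :: real assume "e > 0"
    then have e: "e/2 > 0" by simp
    have gm: "g n \<in> borel_measurable borel" for n using g unfolding app_def by blast
    have fg: "(\<lambda>x. f x - g n x) \<in> borel_measurable borel" for n using f gm by auto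
    have *: "(\<lambda>n. \<integral>\<^sup>+ x \<in> B. ennreal \<bar>f x - g n x\<bar> \<partial>N) \<longlonglongrightarrow> (\<integral>\<^sup>+ x \<in> B. 0 \<partial>N)"
      if N: "B \<in> sets N" "emeasure N B < \<infinity>" and m: "\<And>n. (\<lambda>x. ennreal \<bar>f x - g n x\<bar> * indicator B x) \<in> borel_measurable N" for N B
    proof (rule nn_integral_dominated_convergence[where w = "\<lambda>x. ennreal c * indicator B x"])
      show "AE x in N. ennreal \<bar>f x - g n x\<bar> * indicator B x \<le> ennreal c * indicator B x" for n
        by (intro AE_I2 mult_right_mono ennreal_leI l) auto
      have "(\<lambda>n. \<bar>f x - g n x\<bar>) \<longlonglongrightarrow> \<bar>f x - f x\<bar>" for x
        by (intro tendsto_intros l)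
      from tendsto_ennrealI[OF this] have "(\<lambda>n. ennreal \<bar>f x - g n x\<bar> * indicator B x) \<longlonglongrightarrow> 0" for x
        by (cases "x \<in> B") auto
      then show "AE x in N. (\<lambda>n. ennreal \<bar>f x - g n x\<bar> * indicator B x) \<longlonglongrightarrow> 0 * indicator B x"
        by (intro AE_I2) simp
      show "(\<integral>\<^sup>+ x \<in> B. ennreal c \<partial>N) < \<infinity>" using N by (simp add: nn_integral_cmult_indicator ennreal_mult_less_top)
    qed (use N m in auto)
    have "(\<lambda>n. E (\<lambda>x. f x - g n x)) \<longlonglongrightarrow> 0 + 0"
      unfolding E_def using *[OF B1 mN(1)[OF fg]] *[OF B2 mN(2)[OF fg]] by (intro tendsto_add) simp_all
    then have "\<forall>\<^sub>F n in sequentially. E (\<lambda>x. f x - g n x) < ennreal (e/2)" using e by (intro order_tendstoD) auto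
    then obtain n where n: "E (\<lambda>x. f x - g n x) \<le> ennreal (e/2)" by (meson eventually_happens less_imp_le trivial_limit_sequentially)
    obtain L \<phi> where \<phi>: "L-lipschitz_on UNIV \<phi>" "\<phi> \<in> borel_measurable borel" "E (\<lambda>x. g n x - \<phi> x) \<le> ennreal (e/2)" using appD[OF g e] by blast
    have "E (\<lambda>x. f x - \<phi> x) \<le> E (\<lambda>x. f x - g n x) + E (\<lambda>x. g n x - \<phi> x)"
      using \<phi>(2) gm by (intro E_add fg) auto
    also have "\<dots> \<le> ennreal (e/2) + ennreal (e/2)" by (intro add_mono n \<phi>)
    also have "\<dots> = ennreal e" using e by (simp flip: ennreal_plus)
    finally show "\<exists>L \<phi>. L-lipschitz_on UNIV \<phi> \<and> E (\<lambda>x. f x - \<phi> x) \<le> ennreal e" using \<phi> by blast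
  qed
  have app_closed: "app (indicator F)" if F: "closed F" for F :: "'a set"
  proof (cases "F = {}")
    case True
    then show ?thesis by (intro app_lip[of 0]) (auto simp: indicator_def intro: lipschitz_intros)
  next
    case False
    \<comment> \<open>Lipschitz functions that decrease to the indicator of F; off F the distance to
      F is positive because F is closed.\<close>
    define g where "g n x = max 0 (1 - real n * infdist x F)" for n x
    have gl: "(real n)-lipschitz_on UNIV (g n)" for n
    proof (rule lipschitz_onI)
      fix x y :: 'a
      have "dist (g n x) (g n y) \<le> \<bar>real n * infdist x F - real n * infdist y F\<bar>"
        by (auto simp: g_def dist_real_def)
      also have "\<dots> = real n * \<bar>infdist x F - infdist y F\<bar>" by (simp add: abs_mult flip: right_diff_distrib)
      also have "\<dots> \<le> real n * dist x y" using infdist_triangle_abs by (intro mult_left_mono) auto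
      finally show "dist (g n x) (g n y) \<le> real n * dist x y" .
    qed simp
    have lim: "(\<lambda>n. g n x) \<longlonglongrightarrow> indicator F x" for x
    proof (cases "x \<in> F")
      case True
      then show ?thesis by (simp add: g_def)
    next
      case xF: False
      then have d: "0 < infdist x F" using F False infdist_pos_not_in_closed by blast
      obtain m :: nat where m: "1 < real m * infdist x F" using reals_Archimedean3[OF d] by blast
      have "g n x = 0" if "n \<ge> m" for n
      proof -
        have "real m * infdist x F \<le> real n * infdist x F" using that d by (intro mult_right_mono) auto
        then show ?thesis using m by (simp add: g_def)
      qed
      then have "\<forall>\<^sub>F n in sequentially. g n x = indicator F x"
        unfolding eventually_sequentially using xF by auto
      then show ?thesis by (rule tendsto_eventually)
    qed
    show ?thesis
    proof (rule app_lim[OF app_lip[OF gl] _ lim])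
      show "\<bar>indicator F x - g n x\<bar> \<le> 1" for n x by (cases "x \<in> F") (auto simp: g_def infdist_nonneg)
    qed (use F in auto)
  qed
  have app_sum: "app (\<lambda>x. \<Sum>i<n. g i x)" if "\<And>i. app (g i)" for g and n :: nat
    by (induction n) (use app_lip[OF lipschitz_on_constant] app_add that in auto)
  \<comment> \<open>Closed sets form an intersection-stable generator, and approximability passes to
    complements and, by bounded limits, to disjoint unions.\<close>
  have app_borel: "app (indicator A)" if "A \<in> sets borel" for A :: "'a set"
  proof -
    have "Int_stable (Collect closed :: 'a set set)" by (auto simp: Int_stable_def)
    moreover have "Collect closed \<subseteq> Pow (UNIV :: 'a set)" by auto
    moreover have "A \<in> sigma_sets UNIV (Collect closed)" using that by (simp add: borel_eq_closed)
    ultimately show ?thesis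
    proof (induction rule: sigma_sets_induct_disjoint)
      case (basic A)
      then show ?case using app_closed by simp
    next
      case empty
      show ?case by (rule app_closed) simp
    next
      case (compl A)
      have "app (\<lambda>x. 1 + (-1) * indicator A x)" by (intro app_add app_cmult compl app_lip[OF lipschitz_on_constant])
      also have "(\<lambda>x. 1 + (-1) * indicator A x) = (indicator (UNIV - A) :: 'a \<Rightarrow> real)" by (auto simp: indicator_def)
      finally show ?case .
    next
      case (union A)
      have Ab: "(\<Union>i. A i) \<in> sets borel" using union(2) by (intro sets.countable_UN) (auto simp: borel_eq_closed)
      have s: "(\<lambda>i. indicator (A i) x) sums (indicator (\<Union>i. A i) x :: real)" for x
        using union(1) by (intro indicator_sums) (auto simp: disjoint_family_on_def)
      have 1: "(\<Sum>i<n. indicator (A i) x) \<le> (indicator (\<Union>i. A i) x :: real)" for n x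
        unfolding sums_unique[OF s] by (rule sum_le_suminf[OF sums_summable[OF s]]) auto
      have 2: "0 \<le> (\<Sum>i<n. indicator (A i) x :: real)" for n x by (intro sum_nonneg) auto
      have "\<bar>indicator (\<Union>i. A i) x - (\<Sum>i<n. indicator (A i) x)\<bar> \<le> (1::real)" for n x
        using 1[where x = x and n = n] 2[where x = x and n = n] by (cases "x \<in> (\<Union>i. A i)") auto
      then show ?case
        using s Ab unfolding sums_def by (intro app_lim[OF app_sum[OF union(3)]]) auto
    qed
  qed
  have "0 \<le> \<tau> x" for x using \<tau>(2) by simp
  with \<tau>(1) have "\<forall>c. (\<forall>x. \<tau> x \<le> c) \<longrightarrow> app \<tau>"
  proof (induction rule: borel_measurable_induct_real)
    case (set A)
    then show ?case using app_borel by blast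
  next
    case (mult u c)
    show ?case
    proof (cases "c = 0")
      case True
      then show ?thesis using app_lip[OF lipschitz_on_constant[of UNIV 0]] by simp
    next
      case False
      then have "u x \<le> d / c" if "\<forall>x. c * u x \<le> d" for d x using that mult(1) by (simp add: field_simps)
      then show ?thesis using mult(4) app_cmult by blast
    qed
  next
    case (add u v)
    have "u x \<le> c" "v x \<le> c" if "\<forall>x. v x + u x \<le> c" for c x
      using that[rule_format, of x] add.hyps(2)[of x] add.hyps(4)[of x] by auto
    then show ?case using add.IH app_add by blast
  next
    case (seq U)
    have b: "U i x \<le> \<tau> x" for i x
      using seq.hyps(3,4) by (intro incseq_le) (auto simp: incseq_def le_fun_def)
    have "app (U i)" for i using seq.IH b \<tau>(2) order_trans by blast
    moreover have "\<bar>\<tau> x - U i x\<bar> \<le> 1" for i x using b[of i x] seq.hyps(2)[of i x] \<tau>(2)[of x] by linarith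
    ultimately show ?case using app_lim[where g = U and f = \<tau> and c = 1] \<tau>(1) seq.hyps(4) by simp
  qed
  then have "app \<tau>" using \<tau>(2) by blast
  then obtain L \<phi> where \<phi>: "L-lipschitz_on UNIV \<phi>" "E (\<lambda>x. \<tau> x - \<phi> x) \<le> ennreal \<epsilon>" using appD[OF _ \<epsilon>] by blast
  show thesis
  proof (rule that)
    \<comment> \<open>Since \<tau> takes values in [0, 1], truncation brings \<phi> no farther from
      it.\<close>
    show "L-lipschitz_on UNIV (\<lambda>x. max 0 (min 1 (\<phi> x)))"
      using \<phi>(1) unfolding lipschitz_on_def dist_real_def by (smt (verit))
    have "E (\<lambda>x. \<tau> x - max 0 (min 1 (\<phi> x))) \<le> E (\<lambda>x. \<tau> x - \<phi> x)"
      using \<tau>(2) by (intro E_mono) (smt (verit))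
    then show "(\<integral>\<^sup>+ x \<in> B1. ennreal \<bar>\<tau> x - max 0 (min 1 (\<phi> x))\<bar> \<partial>N1) + (\<integral>\<^sup>+ x \<in> B2. ennreal \<bar>\<tau> x - max 0 (min 1 (\<phi> x))\<bar> \<partial>N2) \<le> ennreal \<epsilon>"
      using \<phi>(2) unfolding E_def by (rule order_trans)
  qed auto
qed

section \<open>Variation across the boundary\<close>

lemma ennreal_inverse_antimono: "x \<le> y \<Longrightarrow> inverse y \<le> inverse (x :: ennreal)"
proof (cases x; cases y)
  fix a b :: real assume "x \<le> y" "0 \<le> a" "x = ennreal a" "0 \<le> b" "y = ennreal b"
  then show ?thesis by (cases "a = 0") (auto simp: inverse_ennreal intro!: ennreal_leI le_imp_inverse_le)
qed (auto simp: top_unique)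

context doubling_measure
begin

definition avg :: "real \<Rightarrow> ('a \<Rightarrow> ennreal) \<Rightarrow> 'a \<Rightarrow> ennreal" where
  "avg r f x = (\<integral>\<^sup>+ y \<in> ball x r. f y \<partial>M) / \<mu> (ball x r)"

text \<open>The integral is lower semicontinuous in the centre: the balls of radius r - 1/(n+1)
  around x exhaust \<open>ball x r\<close>, and each of them lies in \<open>ball z r\<close> for all
  z near x.\<close>

lemma ball_integral_borel:
  assumes f: "f \<in> borel_measurable M"
  shows "(\<lambda>x. \<integral>\<^sup>+ y \<in> ball x r. f y \<partial>M) \<in> borel_measurable borel"
proof (rule borel_measurableI_greater)
  fix a
  have "open {x. a < (\<integral>\<^sup>+ y \<in> ball x r. f y \<partial>M)}"
    unfolding open_contains_ball
  proof
    fix x assume "x \<in> {x. a < (\<integral>\<^sup>+ y \<in> ball x r. f y \<partial>M)}"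
    then have ax: "a < (\<integral>\<^sup>+ y \<in> ball x r. f y \<partial>M)" by simp
    let ?B = "\<lambda>n::nat. ball x (r - 1 / real (Suc n))"
    have mono: "?B m \<subseteq> ?B n" if "m \<le> n" for m n
      using that by (intro subset_ball) (auto simp: field_simps)
    have "(\<integral>\<^sup>+ y. (SUP n. f y * indicator (?B n) y) \<partial>M) = (SUP n. \<integral>\<^sup>+ y \<in> ?B n. f y \<partial>M)"
    proof (rule nn_integral_monotone_convergence_SUP)
      show "incseq (\<lambda>n y. f y * indicator (?B n) y)"
        unfolding incseq_def le_fun_def using mono by (auto simp: indicator_def subset_eq)
      show "(\<lambda>y. f y * indicator (?B n) y) \<in> borel_measurable M" for n using f by measurable
    qed
    moreover have "(SUP n. f y * indicator (?B n) y) = f y * indicator (ball x r) y" for y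
    proof (rule antisym)
      show "(SUP n. f y * indicator (?B n) y) \<le> f y * indicator (ball x r) y"
        by (intro SUP_least) (auto simp: indicator_def intro: less_le_trans)
      show "f y * indicator (ball x r) y \<le> (SUP n. f y * indicator (?B n) y)"
      proof (cases "y \<in> ball x r")
        case True
        then have "0 < r - dist x y" by simp
        then obtain n :: nat where "1 / real (Suc n) < r - dist x y" using nat_approx_posE by blast
        then show ?thesis by (intro SUP_upper2[of n]) (auto simp: indicator_def)
      qed simp
    qed
    ultimately have "a < (SUP n. \<integral>\<^sup>+ y \<in> ?B n. f y \<partial>M)" using ax by simp
    then obtain n where n: "a < (\<integral>\<^sup>+ y \<in> ?B n. f y \<partial>M)" by (auto simp: less_SUP_iff)
    have "a < (\<integral>\<^sup>+ y \<in> ball z r. f y \<partial>M)" if "z \<in> ball x (1 / real (Suc n))" for z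
    proof -
      have "?B n \<subseteq> ball z r"
      proof
        fix y assume "y \<in> ?B n"
        then show "y \<in> ball z r" using that dist_triangle[of z y x] by (auto simp: dist_commute)
      qed
      then have "(\<integral>\<^sup>+ y \<in> ?B n. f y \<partial>M) \<le> (\<integral>\<^sup>+ y \<in> ball z r. f y \<partial>M)"
        by (intro nn_integral_mono) (auto simp: indicator_def)
      then show ?thesis using n by (rule less_le_trans[rotated])
    qed
    then show "\<exists>e>0. ball x e \<subseteq> {x. a < (\<integral>\<^sup>+ y \<in> ball x r. f y \<partial>M)}"
      by (intro exI[of _ "1 / real (Suc n)"]) auto
  qed
  then show "{x \<in> space borel. a < (\<integral>\<^sup>+ y \<in> ball x r. f y \<partial>M)} \<in> sets borel" by simp
qed

lemma ball_measure_borel: "A \<in> sets M \<Longrightarrow> (\<lambda>x. emeasure M (ball x r \<inter> A)) \<in> borel_measurable borel"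
proof -
  assume A: "A \<in> sets M"
  have "(\<lambda>x. \<integral>\<^sup>+ y \<in> ball x r. indicator A y \<partial>M) \<in> borel_measurable borel"
    using A by (intro ball_integral_borel) auto
  also have "(\<lambda>x. \<integral>\<^sup>+ y \<in> ball x r. indicator A y \<partial>M) = (\<lambda>x. emeasure M (ball x r \<inter> A))"
  proof
    fix x
    have "(\<integral>\<^sup>+ y \<in> ball x r. indicator A y \<partial>M) = (\<integral>\<^sup>+ y. indicator (ball x r \<inter> A) y \<partial>M)"
      by (intro nn_integral_cong) (auto simp: indicator_def)
    then show "(\<integral>\<^sup>+ y \<in> ball x r. indicator A y \<partial>M) = emeasure M (ball x r \<inter> A)" using A by simp
  qed
  finally show ?thesis .
qed

lemma avg_borel: "f \<in> borel_measurable M \<Longrightarrow> avg r f \<in> borel_measurable borel"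
proof -
  assume f: "f \<in> borel_measurable M"
  have "(\<lambda>x. \<mu> (ball x r)) \<in> borel_measurable borel"
    using ball_measure_borel[of UNIV r] by (simp add: emeasure_ball)
  then show ?thesis unfolding avg_def using ball_integral_borel[OF f] by (intro borel_measurable_divide_ennreal)
qed

lemma avg_le: "r > 0 \<Longrightarrow> (\<And>y. f y \<le> c) \<Longrightarrow> avg r f x \<le> c"
proof -
  assume r: "r > 0" and c: "\<And>y. f y \<le> c"
  have "(\<integral>\<^sup>+ y \<in> ball x r. f y \<partial>M) \<le> (\<integral>\<^sup>+ y \<in> ball x r. c \<partial>M)"
    by (intro nn_integral_mono mult_right_mono c) auto
  also have "\<dots> = c * \<mu> (ball x r)" by (simp add: nn_integral_cmult_indicator emeasure_ball)
  finally have "avg r f x \<le> c * \<mu> (ball x r) / \<mu> (ball x r)"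
    unfolding avg_def by (rule divide_right_mono_ennreal)
  also have "\<dots> = c * (\<mu> (ball x r) / \<mu> (ball x r))" by (simp add: ennreal_times_divide)
  also have "\<dots> = c" using Cd(2,3)[OF r, of x] by (simp add: ennreal_divide_self)
  finally show ?thesis .
qed

lemma lev_measure:
  assumes U: "open U" "emeasure M U < \<infinity>" and \<epsilon>: "\<epsilon> > 0"
  obtains n :: nat where "emeasure M (U - lev U (real n)) \<le> ennreal \<epsilon>"
proof -
  have o: "open (lev U t)" for t using cc_open[OF cc_lev[OF U(1)]] .
  have "(\<lambda>n. emeasure M (U - lev U (real n))) \<longlonglongrightarrow> emeasure M (\<Inter>n. U - lev U (real n))"
  proof (rule Lim_emeasure_decseq)
    show "range (\<lambda>n. U - lev U (real n)) \<subseteq> sets M" using U(1) o by auto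
    show "decseq (\<lambda>n. U - lev U (real n))" unfolding decseq_def by (intro allI impI Diff_mono order_refl lev_mono) simp
    fix n
    have "emeasure M (U - lev U (real n)) \<le> emeasure M U" using U by (intro emeasure_mono) auto
    then show "emeasure M (U - lev U (real n)) \<noteq> \<infinity>" using U(2) by auto
  qed
  moreover have "(\<Inter>n. U - lev U (real n)) = {}"
  proof -
    have "\<exists>n. x \<in> lev U (real n)" if "x \<in> U" for x using reals_Archimedean2[of "rho U x"] that by (auto simp: lev_def)
    then show ?thesis by auto
  qed
  ultimately have "(\<lambda>n. emeasure M (U - lev U (real n))) \<longlonglongrightarrow> 0"
    by (simp only: emeasure_empty)
  then have "\<forall>\<^sub>F n in sequentially. emeasure M (U - lev U (real n)) < ennreal \<epsilon>"
    by (rule order_tendstoD) (use \<epsilon> in simp)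
  then obtain n where "emeasure M (U - lev U (real n)) < ennreal \<epsilon>"
    by (meson eventually_happens trivial_limit_sequentially)
  then show thesis by (intro that[of n]) auto
qed

lemma L1_split:
  assumes "mble U f" "V \<in> sets M"
  shows "L1 U f = L1 (U \<inter> V) f + L1 (U - V) f"
proof -
  have "L1 U f = (\<integral>\<^sup>+ x. (ennreal \<bar>f x\<bar> * indicator U x) * indicator V x + (ennreal \<bar>f x\<bar> * indicator U x) * indicator (- V) x \<partial>M)"
    by (intro nn_integral_cong) (auto simp: indicator_def)
  also have "\<dots> = (\<integral>\<^sup>+ x. (ennreal \<bar>f x\<bar> * indicator U x) * indicator V x \<partial>M) + (\<integral>\<^sup>+ x. (ennreal \<bar>f x\<bar> * indicator U x) * indicator (- V) x \<partial>M)"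
    using assms(2) sets.compl_sets[OF assms(2)]
    by (intro nn_integral_add borel_measurable_times_ennreal[OF mble_L1[OF assms(1)]] borel_measurable_indicator) (auto simp: Compl_eq_Diff_UNIV)
  also have "(\<integral>\<^sup>+ x. (ennreal \<bar>f x\<bar> * indicator U x) * indicator V x \<partial>M) = L1 (U \<inter> V) f"
    by (intro nn_integral_cong) (auto simp: indicator_def)
  also have "(\<integral>\<^sup>+ x. (ennreal \<bar>f x\<bar> * indicator U x) * indicator (- V) x \<partial>M) = L1 (U - V) f"
    by (intro nn_integral_cong) (auto simp: indicator_def)
  finally show ?thesis .
qed

text \<open>Beyond a large level U has small measure, and there both functions lie in [a, b]. So
  local closeness becomes closeness in L1 on all of U.\<close>

lemma TV_D_L1:
  assumes U: "open U" and fin: "TV u U < \<infinity>" "emeasure M U < \<infinity>" and m: "mble U u" and \<epsilon>: "\<epsilon> > 0"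
    and ab: "\<And>x. x \<in> U \<Longrightarrow> a \<le> u x \<and> u x \<le> b" "a \<le> b"
  obtains w g where "loc_lip U w" "ug U w g" "L1 U (\<lambda>x. w x - u x) \<le> ennreal \<epsilon>"
    "(\<integral>\<^sup>+ x \<in> U. g x \<partial>M) \<le> TV u U + ennreal \<epsilon>" "\<And>x. a \<le> w x \<and> w x \<le> b"
proof -
  define \<epsilon>' where "\<epsilon>' = \<epsilon> / (2 * (b - a + 1))"
  have \<epsilon>': "\<epsilon>' > 0" "(b - a) * \<epsilon>' \<le> \<epsilon>/2" using \<epsilon> ab(2) by (auto simp: \<epsilon>'_def field_simps)
  obtain n :: nat where n: "emeasure M (U - lev U (real n)) \<le> ennreal \<epsilon>'" using lev_measure[OF U fin(2) \<epsilon>'(1)] .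
  define V where "V = lev U (real n)"
  have V: "compactly_contained V U" unfolding V_def by (rule cc_lev[OF U])
  have "\<epsilon>/2 > 0" using \<epsilon> by simp
  then obtain w g where w: "loc_lip U w" "ug U w g" "L1 V (\<lambda>x. w x - u x) \<le> ennreal (\<epsilon>/2)"
    "(\<integral>\<^sup>+ x \<in> U. g x \<partial>M) \<le> TV u U + ennreal (\<epsilon>/2)" "\<And>x. a \<le> w x \<and> w x \<le> b"
    by (rule TV_D_bounded[OF U fin(1) V _ ab]) (assumption, rule that)
  have mw: "mble U (\<lambda>x. w x - u x)" using mble_loc_lip[OF U w(1)] m by (rule mble_diff)
  have "L1 U (\<lambda>x. w x - u x) = L1 (U \<inter> V) (\<lambda>x. w x - u x) + L1 (U - V) (\<lambda>x. w x - u x)"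
    using cc_open[OF V] by (intro L1_split mw) auto
  also have "U \<inter> V = V" using cc_subset[OF V] by auto
  also have "L1 (U - V) (\<lambda>x. w x - u x) \<le> ennreal (b - a) * emeasure M (U - V)"
  proof (rule L1_le_measure)
    fix x assume "x \<in> U - V"
    then show "\<bar>w x - u x\<bar> \<le> b - a" using ab(1)[of x] w(5)[of x] by auto
  qed (use U cc_open[OF V] in auto)
  also have "\<dots> \<le> ennreal (b - a) * ennreal \<epsilon>'" using n by (intro mult_left_mono) (auto simp: V_def)
  also have "\<dots> \<le> ennreal (\<epsilon>/2)" using \<epsilon>' ab(2) by (simp add: ennreal_mult[symmetric] ennreal_leI)
  also have "L1 V (\<lambda>x. w x - u x) + ennreal (\<epsilon>/2) \<le> ennreal (\<epsilon>/2) + ennreal (\<epsilon>/2)" by (intro add_right_mono w)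
  also have "\<dots> = ennreal \<epsilon>" using \<epsilon> by (simp flip: ennreal_plus)
  finally have "L1 U (\<lambda>x. w x - u x) \<le> ennreal \<epsilon>" by (simp add: add_left_mono)
  moreover have "(\<integral>\<^sup>+ x \<in> U. g x \<partial>M) \<le> TV u U + ennreal \<epsilon>"
    by (rule order_trans[OF w(4)]) (intro add_left_mono ennreal_leI, use \<epsilon> in simp)
  ultimately show thesis using w that by blast
qed

end

text \<open>The boundary is taken to be nonempty, so that the distance to it is meaningful; the
  other case is settled separately in the theorem. The constant \<open>CA\<close> is a parameter
  because it enters \<open>Cb\<close>.\<close>

locale neumann_domain = doubling_measure \<mu> for \<mu> :: "'a::complete_space set \<Rightarrow> ennreal" +
  fixes \<Omega> :: "'a set" and CA :: real
  assumes Omega: "\<Omega> \<noteq> {}" "bounded \<Omega>" "open \<Omega>" and frontier_ne: "frontier \<Omega> \<noteq> {}"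
    and CA: "CA \<ge> 1"
    and lower_ahlfors: "\<And>x r. x \<in> frontier \<Omega> \<Longrightarrow> 0 < r \<Longrightarrow> r \<le> diameter \<Omega> \<Longrightarrow>
       ennreal (1 / CA) * (\<mu> (ball x r) / ennreal r) \<le> codim1_hausdorff \<mu> (ball x r \<inter> frontier \<Omega>)"
    and upper_ahlfors: "\<And>x r. x \<in> frontier \<Omega> \<Longrightarrow> 0 < r \<Longrightarrow> r \<le> diameter \<Omega> \<Longrightarrow>
       codim1_hausdorff \<mu> (ball x r \<inter> frontier \<Omega>) \<le> ennreal CA * (\<mu> (ball x r) / ennreal r)"
begin

abbreviation Bd :: "'a set" where "Bd \<equiv> frontier \<Omega>"
abbreviation HM :: "'a measure" where "HM \<equiv> outer_to_measure H"

text \<open>\<Omega> accumulates at a boundary point that does not belong to it, hence it has two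
  points. This gives the Ahlfors conditions a nonempty range of radii.\<close>

lemma diameter_pos: "0 < diameter \<Omega>"
proof -
  obtain x where x: "x \<in> Bd" using frontier_ne by blast
  then have "x \<notin> \<Omega>" "x \<in> closure \<Omega>" using Omega(3) by (auto simp: frontier_def interior_open)
  then obtain y where y: "y \<in> \<Omega>" by (metis Omega(1) ex_in_conv)
  then have "0 < dist y x" using \<open>x \<notin> \<Omega>\<close> by auto
  then obtain z where z: "z \<in> \<Omega>" "dist z x < dist y x" using \<open>x \<in> closure \<Omega>\<close> closure_approachable by blast
  then have "0 < dist y z" by auto
  also have "dist y z \<le> diameter \<Omega>" by (rule diameter_bounded_bound[OF Omega(2) y z(1)])
  finally show ?thesis .
qed

lemma compact_Bd: "compact Bd"
  using Omega(2) by (intro compact_bounded_closed) (auto simp: frontier_def intro: bounded_subset[OF bounded_closure])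

lemma Bd_sets [measurable]: "Bd \<in> sets borel" by auto

lemma finite_Omega: "emeasure M (\<Omega> \<inter> U) < \<infinity>"
  using Omega(2) by (intro finite_measure_bounded) (auto intro: bounded_subset)

lemma space_HM [simp]: "space HM = UNIV" by (rule space_outer_to_measure[OF H_outer])

lemma sets_HM: "A \<in> sets borel \<Longrightarrow> A \<in> sets HM"
  using H_borel by (auto simp: sets_outer_to_measure[OF H_outer])

lemma emeasure_HM: "A \<in> sets borel \<Longrightarrow> emeasure HM A = H A"
  using H_borel by (intro emeasure_outer_to_measure[OF H_outer]) auto

lemma measurable_HM: "f \<in> borel_measurable borel \<Longrightarrow> f \<in> borel_measurable HM"
  using sets_HM by (auto simp: measurable_def)

text \<open>Finitely many balls of the largest admissible radius cover the compact boundary, and the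
  upper Ahlfors bound applies to each.\<close>

lemma H_Bd_finite: "H Bd < \<infinity>"
proof -
  let ?D = "diameter \<Omega>"
  have "Bd \<subseteq> (\<Union>x\<in>Bd. ball x ?D)" using diameter_pos by force
  then obtain F where F: "F \<subseteq> Bd" "finite F" "Bd \<subseteq> (\<Union>x\<in>F. ball x ?D)"
    by (rule compactE_image[OF compact_Bd, rotated]) auto
  have "emeasure HM Bd \<le> emeasure HM (\<Union>x\<in>F. ball x ?D \<inter> Bd)"
    using F by (intro emeasure_mono sets_HM sets.finite_UN) auto
  also have "\<dots> \<le> (\<Sum>x\<in>F. emeasure HM (ball x ?D \<inter> Bd))"
    using F by (intro emeasure_subadditive_finite) (auto intro!: sets_HM)
  also have "\<dots> < \<infinity>"
  proof -
    have "emeasure HM (ball x ?D \<inter> Bd) < \<infinity>" if "x \<in> F" for x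
    proof -
      have "emeasure HM (ball x ?D \<inter> Bd) \<le> ennreal CA * (\<mu> (ball x ?D) / ennreal ?D)"
        using that F diameter_pos by (subst emeasure_HM) (auto intro!: upper_ahlfors)
      also have "\<dots> < \<infinity>" using Cd(3)[OF diameter_pos, of x] diameter_pos CA
        by (cases "\<mu> (ball x ?D)") (auto simp: divide_ennreal ennreal_mult[symmetric])
      finally show ?thesis .
    qed
    then show ?thesis using F(2) by simp
  qed
  finally show ?thesis by (simp add: emeasure_HM)
qed

text \<open>The lower Ahlfors bound turns \<open>\<mu> (ball x s) / s\<close> into Hausdorff measure
  of the boundary near x. For a 2s-separated net of E the balls of radius 5s = 3s + 2s catch the
  neighbourhood on the left, while those of radius s are disjoint and carry the boundary integral.
  For y in \<open>ball x s\<close> the ball of radius 5s around x lies in that of radius 6s around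
  y, which lies in that of radius 8s around x; three doublings give \<open>Cd ^ 3\<close>.\<close>

lemma net_estimate:
  assumes E: "E \<subseteq> Bd" and s: "0 < s" "s \<le> diameter \<Omega>" and f: "f \<in> borel_measurable M"
  shows "(\<integral>\<^sup>+ y \<in> (\<Union>x\<in>E. ball x (3 * s)). f y \<partial>M) / ennreal s \<le>
     ennreal (CA * Cd ^ 3) * (\<integral>\<^sup>+ x \<in> Bd \<inter> (\<Union>x\<in>E. ball x s). avg (6 * s) f x \<partial>HM)"
proof -
  have bE: "bounded E" using E compact_Bd by (meson bounded_subset compact_imp_bounded)
  obtain F where F: "finite F" "F \<subseteq> E" "\<And>x y. x \<in> F \<Longrightarrow> y \<in> F \<Longrightarrow> x \<noteq> y \<Longrightarrow> 2 * s \<le> dist x y"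
    "E \<subseteq> (\<Union>x\<in>F. ball x (2 * s))"
    by (rule separated_net[OF bE, of "2 * s"]) (use s in simp, blast)
  have am: "avg (6 * s) f \<in> borel_measurable HM" by (intro measurable_HM avg_borel f)
  let ?I = "\<lambda>x. \<integral>\<^sup>+ y \<in> ball x (5 * s). f y \<partial>M"
  have "(\<integral>\<^sup>+ y \<in> (\<Union>x\<in>E. ball x (3 * s)). f y \<partial>M) \<le> (\<integral>\<^sup>+ y. (\<Sum>x\<in>F. f y * indicator (ball x (5 * s)) y) \<partial>M)"
  proof (rule nn_integral_mono)
    fix y
    show "f y * indicator (\<Union>x\<in>E. ball x (3 * s)) y \<le> (\<Sum>x\<in>F. f y * indicator (ball x (5 * s)) y)"
    proof (cases "y \<in> (\<Union>x\<in>E. ball x (3 * s))")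
      case True
      then obtain x where x: "x \<in> E" "dist x y < 3 * s" by auto
      then obtain z where z: "z \<in> F" "dist z x < 2 * s" using F(4) by (auto simp: subset_eq)
      then have "y \<in> ball z (5 * s)" using x dist_triangle[of z y x] by auto
      then have "f y \<le> (\<Sum>x\<in>{z}. f y * indicator (ball x (5 * s)) y)" by simp
      also have "\<dots> \<le> (\<Sum>x\<in>F. f y * indicator (ball x (5 * s)) y)" using F(1) z by (intro sum_mono2) auto
      finally show ?thesis using True by simp
    qed simp
  qed
  also have "\<dots> = (\<Sum>x\<in>F. ?I x)" using f by (intro nn_integral_sum) auto
  finally have "(\<integral>\<^sup>+ y \<in> (\<Union>x\<in>E. ball x (3 * s)). f y \<partial>M) / ennreal s \<le> (\<Sum>x\<in>F. ?I x) / ennreal s"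
    by (rule divide_right_mono_ennreal)
  also have "\<dots> = (\<Sum>x\<in>F. ?I x / ennreal s)" by (simp add: divide_ennreal_def sum_distrib_right)
  also have "\<dots> \<le> (\<Sum>x\<in>F. ennreal (CA * Cd ^ 3) * (\<integral>\<^sup>+ y \<in> Bd \<inter> ball x s. avg (6 * s) f y \<partial>HM))"
  proof (rule sum_mono)
    fix x assume "x \<in> F"
    then have x: "x \<in> Bd" using F E by auto
    let ?m = "\<mu> (ball x s)"
    have m: "0 < ?m" "?m < \<infinity>" using Cd(2,3) s by auto
    have lower: "?I x / (ennreal (Cd ^ 3) * ?m) \<le> avg (6 * s) f y" if "y \<in> ball x s" for y
    proof -
      have "ball x (5 * s) \<subseteq> ball y (6 * s)" "ball y (6 * s) \<subseteq> ball x (2 ^ 3 * s)"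
      proof
        fix z assume "z \<in> ball x (5 * s)"
        then show "z \<in> ball y (6 * s)" using that dist_triangle[of y z x] by (auto simp: dist_commute)
      next
        show "ball y (6 * s) \<subseteq> ball x (2 ^ 3 * s)"
        proof
          fix z assume "z \<in> ball y (6 * s)"
          then show "z \<in> ball x (2 ^ 3 * s)" using that dist_triangle[of x z y] s by auto
        qed
      qed
      then have "?I x \<le> (\<integral>\<^sup>+ z \<in> ball y (6 * s). f z \<partial>M)" "emeasure M (ball y (6 * s)) \<le> emeasure M (ball x (2 ^ 3 * s))"
        by (auto intro!: nn_integral_mono emeasure_mono simp: indicator_def)
      moreover have "\<mu> (ball x (2 ^ 3 * s)) \<le> ennreal (Cd ^ 3) * ?m" using s by (intro doubling_power) auto
      ultimately have le: "?I x \<le> (\<integral>\<^sup>+ z \<in> ball y (6 * s). f z \<partial>M)" "\<mu> (ball y (6 * s)) \<le> ennreal (Cd ^ 3) * ?m"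
        unfolding emeasure_ball by auto
      show ?thesis unfolding avg_def divide_ennreal_def
        by (intro mult_mono le ennreal_inverse_antimono) auto
    qed
    \<comment> \<open>The quotient is expanded so that the left side of the lower Ahlfors bound
      appears as a factor; infinite integrals are treated apart because of the cancellation.\<close>
    have "?I x / ennreal s = ennreal (CA * Cd ^ 3) * (?I x / (ennreal (Cd ^ 3) * ?m) * (ennreal (1 / CA) * (?m / ennreal s)))"
    proof -
      define m' where "m' = enn2real ?m"
      have m': "?m = ennreal m'" "0 < m'" using m by (auto simp: m'_def enn2real_positive_iff)
      show ?thesis
      proof (cases "?I x")
        case (real i)
        have "CA > 0" "Cd > 0" using CA Cd(1) by auto
        then show ?thesis using real m' s unfolding real(2) m'(1)
          by (simp add: divide_ennreal ennreal_mult[symmetric] field_simps)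
      next
        case top
        have "CA > 0" "Cd > 0" using CA Cd(1) by auto
        then show ?thesis using m' s unfolding top m'(1)
          by (simp add: divide_ennreal ennreal_mult[symmetric] ennreal_top_divide ennreal_mult_top ennreal_top_mult)
      qed
    qed
    also have "\<dots> \<le> ennreal (CA * Cd ^ 3) * (?I x / (ennreal (Cd ^ 3) * ?m) * H (ball x s \<inter> Bd))"
      using x s by (intro mult_left_mono lower_ahlfors) auto
    also have "?I x / (ennreal (Cd ^ 3) * ?m) * H (ball x s \<inter> Bd) = (\<integral>\<^sup>+ y \<in> Bd \<inter> ball x s. (?I x / (ennreal (Cd ^ 3) * ?m)) \<partial>HM)"
      by (subst nn_integral_cmult_indicator) (auto intro!: sets_HM simp: emeasure_HM Int_commute)
    also have "\<dots> \<le> (\<integral>\<^sup>+ y \<in> Bd \<inter> ball x s. avg (6 * s) f y \<partial>HM)"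
      using lower by (intro nn_integral_mono) (auto simp: indicator_def)
    finally show "?I x / ennreal s \<le> ennreal (CA * Cd ^ 3) * (\<integral>\<^sup>+ y \<in> Bd \<inter> ball x s. avg (6 * s) f y \<partial>HM)"
      by (simp add: mult_left_mono)
  qed
  also have "\<dots> = ennreal (CA * Cd ^ 3) * (\<Sum>x\<in>F. \<integral>\<^sup>+ y \<in> Bd \<inter> ball x s. avg (6 * s) f y \<partial>HM)"
    by (rule sum_distrib_left[symmetric])
  also have "(\<Sum>x\<in>F. \<integral>\<^sup>+ y \<in> Bd \<inter> ball x s. avg (6 * s) f y \<partial>HM) =
     (\<integral>\<^sup>+ y. (\<Sum>x\<in>F. avg (6 * s) f y * indicator (Bd \<inter> ball x s) y) \<partial>HM)"
    using am by (intro nn_integral_sum[symmetric] borel_measurable_times_ennreal borel_measurable_indicator) (auto intro: sets_HM)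
  also have "\<dots> \<le> (\<integral>\<^sup>+ x \<in> Bd \<inter> (\<Union>x\<in>E. ball x s). avg (6 * s) f x \<partial>HM)"
  proof (rule nn_integral_mono)
    fix y
    show "(\<Sum>x\<in>F. avg (6 * s) f y * indicator (Bd \<inter> ball x s) y) \<le> avg (6 * s) f y * indicator (Bd \<inter> (\<Union>x\<in>E. ball x s)) y"
    proof (cases "\<exists>z\<in>F. y \<in> Bd \<inter> ball z s")
      case True
      then obtain z where z: "z \<in> F" "y \<in> Bd" "dist z y < s" by auto
      \<comment> \<open>By separation no point lies in two of the balls of radius s, so the sum has
        a single nonzero term.\<close>
      have "indicator (Bd \<inter> ball x s) y = (if x = z then 1 else 0 :: ennreal)" if "x \<in> F" for x
        using F(3)[OF that z(1)] z dist_triangle[of x z y] by (auto simp: indicator_def dist_commute)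
      then have "(\<Sum>x\<in>F. avg (6 * s) f y * indicator (Bd \<inter> ball x s) y) = (\<Sum>x\<in>F. if x = z then avg (6 * s) f y else 0)"
        by (intro sum.cong) auto
      also have "\<dots> = avg (6 * s) f y" using F(1) z by (simp add: sum.delta)
      finally show ?thesis using z F(2) by (auto simp: indicator_def)
    next
      case False
      then have "(\<Sum>x\<in>F. avg (6 * s) f y * indicator (Bd \<inter> ball x s) y) = 0"
        by (intro sum.neutral) (auto simp: indicator_def)
      then show ?thesis by simp
    qed
  qed
  finally show ?thesis by (simp add: mult_left_mono)
qed

end

lemma ug_lipschitz:
  assumes "K-lipschitz_on U u"
  shows "ug U u (\<lambda>_. ennreal K)"
proof (rule ugI)
  fix L and c :: "real \<Rightarrow> 'a" assume c: "unit_speed L c" "c ` {0..L} \<subseteq> U"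
  have K: "0 \<le> K" using assms by (rule lipschitz_on_nonneg)
  have L: "0 \<le> L" using c by (simp add: unit_speed_def)
  have "\<bar>u (c L) - u (c 0)\<bar> \<le> K * dist (c L) (c 0)"
    using lipschitz_onD[OF assms, of "c L" "c 0"] c L by (auto simp: dist_real_def image_subset_iff)
  also have "\<dots> \<le> K * L" using unit_speed_dist[OF c(1), of L 0] L K by (intro mult_left_mono) auto
  finally have "ennreal \<bar>u (c L) - u (c 0)\<bar> \<le> ennreal (K * L)" by (rule ennreal_leI)
  also have "\<dots> = (\<integral>\<^sup>+ s \<in> {0..L}. ennreal K \<partial>lborel)" using K L by (simp add: nn_integral_cmult_indicator ennreal_mult)
  finally show "ennreal \<bar>u (c L) - u (c 0)\<bar> \<le> (\<integral>\<^sup>+ s \<in> {0..L}. ennreal K \<partial>lborel)" .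
qed simp

lemma infdist_lessD: "infdist x A < c \<Longrightarrow> A \<noteq> {} \<Longrightarrow> \<exists>a\<in>A. dist x a < c"
  by (auto simp: infdist_def cINF_less_iff)

context doubling_measure
begin

lemma TV_lipschitz:
  assumes U: "open U" and \<phi>: "L-lipschitz_on U \<phi>"
  shows "TV \<phi> U \<le> ennreal L * emeasure M U"
proof (rule TV_leI[OF U])
  fix V and \<epsilon> :: real assume "compactly_contained V U" "\<epsilon> > 0"
  have "(\<integral>\<^sup>+ x \<in> U. ennreal L \<partial>M) = ennreal L * emeasure M U" using U by (simp add: nn_integral_cmult_indicator)
  then show "\<exists>w g. loc_lip U w \<and> ug U w g \<and> L1 V (\<lambda>x. w x - \<phi> x) \<le> ennreal \<epsilon> \<and> (\<integral>\<^sup>+ x \<in> U. g x \<partial>M) \<le> ennreal L * emeasure M U + ennreal \<epsilon>"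
    using lipschitz_imp_loc_lip[OF \<phi>] ug_lipschitz[OF \<phi>] by (intro exI[of _ \<phi>] exI[of _ "\<lambda>_. ennreal L"]) simp
qed

text \<open>The contrapositive of \<open>TV_leI\<close>: lower semicontinuity with thresholds V and
  \<delta> that are fixed before an approximation is chosen.\<close>

lemma TV_lower:
  assumes U: "open U" and c: "c < TV u U"
  obtains V \<delta> where "compactly_contained V U" "\<delta> > 0"
    "\<And>w g. loc_lip U w \<Longrightarrow> ug U w g \<Longrightarrow> L1 V (\<lambda>x. w x - u x) \<le> ennreal \<delta> \<Longrightarrow> c \<le> (\<integral>\<^sup>+ x \<in> U. g x \<partial>M)"
proof (rule ccontr)
  assume no: "\<not> thesis"
  have "TV u U \<le> c"
  proof (rule TV_leI[OF U])
    fix V and \<epsilon> :: real assume V: "compactly_contained V U" "\<epsilon> > 0"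
    have "\<exists>w g. loc_lip U w \<and> ug U w g \<and> L1 V (\<lambda>x. w x - u x) \<le> ennreal \<epsilon> \<and> \<not> c \<le> (\<integral>\<^sup>+ x \<in> U. g x \<partial>M)"
    proof (rule ccontr)
      assume *: "\<nexists>w g. loc_lip U w \<and> ug U w g \<and> L1 V (\<lambda>x. w x - u x) \<le> ennreal \<epsilon> \<and> \<not> c \<le> (\<integral>\<^sup>+ x \<in> U. g x \<partial>M)"
      have thesis by (rule that[OF V]) (use * in blast)
      with no show False by blast
    qed
    then obtain w g where w: "loc_lip U w" "ug U w g" "L1 V (\<lambda>x. w x - u x) \<le> ennreal \<epsilon>" "(\<integral>\<^sup>+ x \<in> U. g x \<partial>M) < c"
      by (auto simp: not_le)
    moreover have "(\<integral>\<^sup>+ x \<in> U. g x \<partial>M) \<le> c + ennreal \<epsilon>" using w(4) by (simp add: add_increasing2)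
    ultimately show "\<exists>w g. loc_lip U w \<and> ug U w g \<and> L1 V (\<lambda>x. w x - u x) \<le> ennreal \<epsilon> \<and> (\<integral>\<^sup>+ x \<in> U. g x \<partial>M) \<le> c + ennreal \<epsilon>" by blast
  qed
  with c show False by simp
qed

text \<open>An approximation w of W on T is multiplied by \<psi> and extended by 0. The hypothesis
  \<open>loc\<close> lists the local situations: the product vanishes, or equals w, or \<psi> is
  K-Lipschitz inside the zone N, where the product rule costs K times the mass of w. The lemma
  serves for both cutoffs, \<open>psi\<close> and \<open>eta\<close>.\<close>

lemma TV_cutoff:
  assumes U: "open U" and T: "open T" "T \<subseteq> U" "emeasure M T < \<infinity>" and N: "open N" and K: "K > 0"
    and m: "mble T W" and B: "\<And>x. x \<in> T \<Longrightarrow> - B \<le> W x \<and> W x \<le> B"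
    and psi: "\<And>x. 0 \<le> \<psi> x \<and> \<psi> x \<le> (1::real)" "\<And>x. x \<in> U - T \<Longrightarrow> \<psi> x * W x = 0"
    and loc: "\<And>x. x \<in> U \<Longrightarrow> \<exists>A. open A \<and> x \<in> A \<and> ((\<forall>y\<in>A \<inter> T. \<psi> y = 0) \<or>
      A \<subseteq> T \<and> (\<forall>y\<in>A. \<psi> y = 1) \<or> A \<subseteq> T \<inter> N \<and> K-lipschitz_on A \<psi>)"
  shows "TV (\<lambda>x. \<psi> x * W x) U \<le> TV W T + ennreal K * L1 (T \<inter> N) W"
proof (cases "TV W T = \<infinity> \<or> T = {}")
  case True
  then show ?thesis
  proof
    assume "T = {}"
    then have "TV (\<lambda>x. \<psi> x * W x) U = TV (\<lambda>_. 0) U" using psi(2) by (intro TV_cong) auto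
    then show ?thesis using TV_const[OF U] by simp
  qed simp
next
  case False
  then obtain z where "z \<in> T" by auto
  have fin: "TV W T < \<infinity>" using False by (simp add: less_top)
  have B0: "- B \<le> B" using B[OF \<open>z \<in> T\<close>] by linarith
  show ?thesis
  proof (rule TV_leI[OF U])
    fix V and \<epsilon> :: real assume V: "compactly_contained V U" and \<epsilon>: "\<epsilon> > 0"
    define e where "e = \<epsilon> / (1 + K)"
    have e: "e > 0" "e + K * e = \<epsilon>"
    proof -
      have "(1 + K) * e = \<epsilon>" using K by (simp add: e_def)
      then show "e + K * e = \<epsilon>" by (simp add: distrib_right)
    qed (use \<epsilon> K in \<open>simp add: e_def\<close>)
    then have "e \<le> \<epsilon>" using mult_pos_pos[OF K] by fastforce
    obtain w g where w: "loc_lip T w" "ug T w g" "L1 T (\<lambda>x. w x - W x) \<le> ennreal e"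
      "(\<integral>\<^sup>+ x \<in> T. g x \<partial>M) \<le> TV W T + ennreal e"
      using TV_D_L1[OF T(1) fin T(3) m e(1) B B0] by blast
    define F where "F x = (if x \<in> T then \<psi> x * w x else 0)" for x
    define h where "h x = g x * indicator T x + ennreal (K * \<bar>w x\<bar>) * indicator T x * indicator N x" for x
    have wc: "continuous_on T w" by (rule loc_lip_continuous[OF w(1) T(1)])
    have hm: "h \<in> borel_measurable borel"
    proof -
      have g: "(\<lambda>x. g x * indicator T x) \<in> borel_measurable borel"
        using ug_measurable[OF w(2)] T by (subst (asm) borel_measurable_restrict_space_iff_ennreal) auto
      have "continuous_on T (\<lambda>x. K * \<bar>w x\<bar>)" using wc by (intro continuous_intros)
      from measurable_abs_restrict[OF this] have "(\<lambda>x. ennreal (K * \<bar>w x\<bar>) * indicator T x) \<in> borel_measurable borel"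
        using T by (subst (asm) borel_measurable_restrict_space_iff_ennreal) auto
      then show ?thesis unfolding h_def[abs_def]
        by (rule borel_measurable_add[OF g borel_measurable_times_ennreal[OF _ borel_measurable_indicator]]) (use N in auto)
    qed
    have hmr: "h \<in> borel_measurable (restrict_space borel S)" for S using hm by (rule measurable_restrict_space1)
    have local: "\<exists>A. open A \<and> x \<in> A \<and> loc_lip (A \<inter> U) F \<and> ug (A \<inter> U) F h" if "x \<in> U" for x
    proof -
      obtain A where A: "open A" "x \<in> A" and c: "(\<forall>y\<in>A \<inter> T. \<psi> y = 0) \<or>
        A \<subseteq> T \<and> (\<forall>y\<in>A. \<psi> y = 1) \<or> A \<subseteq> T \<inter> N \<and> K-lipschitz_on A \<psi>" using loc[OF \<open>x \<in> U\<close>] by blast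
      from c have "loc_lip (A \<inter> U) F \<and> ug (A \<inter> U) F h"
      proof (elim disjE)
        assume "\<forall>y\<in>A \<inter> T. \<psi> y = 0"
        then have F0: "F y = 0" if "y \<in> A" for y using that by (auto simp: F_def)
        show ?thesis using F0
          by (intro conjI loc_lip_cong[OF loc_lip_const[of _ 0]] ug_cong[OF ug_const[OF hmr, of _ 0]]) auto
      next
        assume A1: "A \<subseteq> T \<and> (\<forall>y\<in>A. \<psi> y = 1)"
        then have s: "A \<inter> U \<subseteq> T" by auto
        show ?thesis
          by (intro conjI loc_lip_cong[OF loc_lip_subset[OF w(1) s]] ug_cong[OF ug_mono[OF ug_subset[OF w(2) s] _ hmr]])
            (use A1 in \<open>auto simp: F_def h_def subset_eq\<close>)
      next
        assume A1: "A \<subseteq> T \<inter> N \<and> K-lipschitz_on A \<psi>"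
        then have s: "A \<subseteq> T" "A \<inter> U = A" and l: "K-lipschitz_on A \<psi>" using T by auto
        have "loc_lip A (\<lambda>x. \<psi> x * w x)" by (intro loc_lip_mult lipschitz_imp_loc_lip[OF l] loc_lip_subset[OF w(1) s(1)])
        then have "loc_lip A F" by (rule loc_lip_cong) (use s in \<open>auto simp: F_def\<close>)
        \<comment> \<open>The product is viewed as a blend with the function 0.\<close>
        moreover have "ug A (\<lambda>x. (1 - \<psi> x) * 0 + \<psi> x * w x) (\<lambda>x. 0 + g x + ennreal (K * \<bar>0 - w x\<bar>))"
          by (intro ug_blend ug_const ug_subset[OF w(2) s(1)] continuous_on_subset[OF wc s(1)] l) (auto simp: psi)
        then have "ug A F h"
          by (rule ug_cong[OF ug_mono[OF _ _ hmr]]) (use A1 s in \<open>auto simp: F_def h_def subset_eq\<close>)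
        ultimately show ?thesis using s by simp
      qed
      then show ?thesis using A by blast
    qed
    have mw: "mble T w" "mble T (\<lambda>x. w x - W x)" using mble_loc_lip[OF T(1) w(1)] m by (auto intro: mble_diff)
    have "loc_lip U F" by (rule loc_lip_local) (use local in blast)
    moreover have "ug U F h" by (rule ug_local[OF hmr]) (use local in blast)
    moreover have "L1 V (\<lambda>x. F x - \<psi> x * W x) \<le> ennreal \<epsilon>"
    proof -
      have "L1 V (\<lambda>x. F x - \<psi> x * W x) \<le> L1 T (\<lambda>x. w x - W x)"
      proof (rule nn_integral_mono)
        fix x
        show "ennreal \<bar>F x - \<psi> x * W x\<bar> * indicator V x \<le> ennreal \<bar>w x - W x\<bar> * indicator T x"
        proof (cases "x \<in> T")
          case True
          have "\<bar>F x - \<psi> x * W x\<bar> = \<psi> x * \<bar>w x - W x\<bar>"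
            using True psi(1)[of x] by (simp add: F_def abs_mult flip: right_diff_distrib)
          also have "\<dots> \<le> \<bar>w x - W x\<bar>" using psi(1)[of x] by (simp add: mult_left_le_one_le)
          finally show ?thesis using True by (auto simp: indicator_def intro: ennreal_leI)
        next
          case False
          then have "x \<in> V \<Longrightarrow> \<psi> x * W x = 0" using cc_subset[OF V] psi(2) by auto
          then show ?thesis using False by (auto simp: indicator_def F_def)
        qed
      qed
      also have "\<dots> \<le> ennreal \<epsilon>" using w(3) \<open>e \<le> \<epsilon>\<close> by (meson ennreal_leI order_trans)
      finally show ?thesis .
    qed
    moreover have "(\<integral>\<^sup>+ x \<in> U. h x \<partial>M) \<le> TV W T + ennreal K * L1 (T \<inter> N) W + ennreal \<epsilon>"
    proof -
      have TN: "T \<inter> N \<subseteq> T" "T \<inter> N \<in> sets M" using T N by auto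
      have "(\<integral>\<^sup>+ x \<in> U. h x \<partial>M) \<le> (\<integral>\<^sup>+ x. g x * indicator T x + ennreal K * (ennreal \<bar>w x\<bar> * indicator (T \<inter> N) x) \<partial>M)"
        using K by (intro nn_integral_mono) (auto simp: indicator_def h_def ennreal_mult)
      also have "\<dots> = (\<integral>\<^sup>+ x \<in> T. g x \<partial>M) + ennreal K * L1 (T \<inter> N) w"
        using ug_measurable_M[OF w(2) T(1)] mble_L1[OF mble_subset[OF mw(1) TN]] by (subst nn_integral_add) (auto simp: nn_integral_cmult)
      also have "\<dots> \<le> (TV W T + ennreal e) + ennreal K * (L1 (T \<inter> N) W + ennreal e)"
      proof (intro add_mono w mult_left_mono)
        have "L1 (T \<inter> N) w \<le> L1 (T \<inter> N) W + L1 (T \<inter> N) (\<lambda>x. w x - W x)"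
          by (rule L1_triangle[OF mble_subset[OF m TN] mble_subset[OF mw(2) TN]]) auto
        also have "\<dots> \<le> L1 (T \<inter> N) W + ennreal e"
          by (intro add_left_mono order_trans[OF L1_mono_set[OF TN(1)] w(3)])
        finally show "L1 (T \<inter> N) w \<le> L1 (T \<inter> N) W + ennreal e" .
      qed auto
      also have "\<dots> = TV W T + ennreal K * L1 (T \<inter> N) W + (ennreal e + ennreal K * ennreal e)"
        by (simp add: distrib_left add_ac)
      also have "ennreal e + ennreal K * ennreal e = ennreal \<epsilon>"
        using e K by (simp add: ennreal_mult[symmetric] ennreal_plus[symmetric] del: ennreal_plus)
      finally show ?thesis .
    qed
    ultimately show "\<exists>w g. loc_lip U w \<and> ug U w g \<and> L1 V (\<lambda>x. w x - \<psi> x * W x) \<le> ennreal \<epsilon> \<and>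
        (\<integral>\<^sup>+ x \<in> U. g x \<partial>M) \<le> TV W T + ennreal K * L1 (T \<inter> N) W + ennreal \<epsilon>" by blast
  qed
qed

end

context neumann_domain
begin

definition psi :: "real \<Rightarrow> 'a \<Rightarrow> real" where
  "psi s x = max 0 (min 1 (infdist x Bd / s - 1))"

lemma psi_bounds: "0 \<le> psi s x" "psi s x \<le> 1" by (auto simp: psi_def)

lemma psi_lipschitz: "s > 0 \<Longrightarrow> (1/s)-lipschitz_on U (psi s)"
proof (rule lipschitz_onI)
  fix x y assume s: "s > 0"
  have "dist (psi s x) (psi s y) \<le> \<bar>infdist x Bd / s - infdist y Bd / s\<bar>" by (auto simp: psi_def dist_real_def)
  also have "\<dots> = \<bar>infdist x Bd - infdist y Bd\<bar> / s" using s by (simp flip: diff_divide_distrib)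
  also have "\<dots> \<le> dist x y / s" using s infdist_triangle_abs by (intro divide_right_mono) auto
  finally show "dist (psi s x) (psi s y) \<le> 1/s * dist x y" by simp
qed simp

lemma open_infdist_less: "open {x. infdist x Bd < c}"
  by (intro open_Collect_less continuous_intros)

lemma open_infdist_greater: "open {x. c < infdist x Bd}"
  by (intro open_Collect_less continuous_intros)

lemma frontier_cases: "x \<in> \<Omega> \<or> x \<in> Bd \<or> x \<in> - closure \<Omega>"
  using Omega(3) by (auto simp: frontier_def interior_open)

text \<open>As \<open>psi s\<close> vanishes within distance s of the boundary, the cut function
  does not jump there. The price is the slope 1/s on a collar, which is taken of width 3s although
  \<open>psi s\<close> is already 1 beyond 2s, so that the local cases overlap.\<close>

lemma TV_cut:
  assumes U: "open U" and m: "mble UNIV W" and B: "\<And>x. \<bar>W x\<bar> \<le> B" and W0: "\<And>x. x \<notin> \<Omega> \<Longrightarrow> W x = 0" and s: "s > 0"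
  shows "TV (\<lambda>x. psi s x * W x) U \<le> TV W (\<Omega> \<inter> U) + L1 (\<Omega> \<inter> U \<inter> {x. infdist x Bd < 3 * s}) W / ennreal s"
proof -
  have O: "open (\<Omega> \<inter> U)" using U Omega(3) by auto
  have "TV (\<lambda>x. psi s x * W x) U \<le> TV W (\<Omega> \<inter> U) + ennreal (1/s) * L1 (\<Omega> \<inter> U \<inter> {x. infdist x Bd < 3 * s}) W"
  proof (rule TV_cutoff[OF U O _ finite_Omega open_infdist_less])
    show "mble (\<Omega> \<inter> U) W" using m O by (auto intro: mble_subset)
    show "- B \<le> W x \<and> W x \<le> B" for x using B[of x] by linarith
    fix x assume "x \<in> U"
    then consider "x \<in> \<Omega> \<inter> U" "infdist x Bd < 3 * s" | "x \<in> \<Omega> \<inter> U" "2 * s < infdist x Bd" | "x \<in> Bd" | "x \<in> - closure \<Omega>"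
      using frontier_cases[of x] s by (cases "infdist x Bd < 3 * s") auto
    then show "\<exists>A. open A \<and> x \<in> A \<and> ((\<forall>y\<in>A \<inter> (\<Omega> \<inter> U). psi s y = 0) \<or> A \<subseteq> \<Omega> \<inter> U \<and> (\<forall>y\<in>A. psi s y = 1) \<or>
      A \<subseteq> \<Omega> \<inter> U \<inter> {x. infdist x Bd < 3 * s} \<and> (1/s)-lipschitz_on A (psi s))"
    proof cases
      case 1
      then show ?thesis using psi_lipschitz[OF s] O open_infdist_less
        by (intro exI[of _ "\<Omega> \<inter> U \<inter> {x. infdist x Bd < 3 * s}"]) auto
    next
      case 2
      then show ?thesis using s O open_infdist_greater
        by (intro exI[of _ "\<Omega> \<inter> U \<inter> {x. 2 * s < infdist x Bd}"]) (auto simp: psi_def field_simps)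
    next
      case 3
      then show ?thesis using s open_infdist_less
        by (intro exI[of _ "{x. infdist x Bd < s}"]) (auto simp: psi_def field_simps)
    next
      case 4
      then show ?thesis using closure_subset[of \<Omega>] by (intro exI[of _ "- closure \<Omega>"]) (auto simp: open_Compl)
    qed
  qed (use s psi_bounds W0 in auto)
  also have "ennreal (1/s) * L1 (\<Omega> \<inter> U \<inter> {x. infdist x Bd < 3 * s}) W = L1 (\<Omega> \<inter> U \<inter> {x. infdist x Bd < 3 * s}) W / ennreal s"
    using s by (simp add: divide_ennreal_def inverse_ennreal mult.commute inverse_eq_divide)
  finally show ?thesis .
qed

definition Cb :: real where "Cb = CA * Cd ^ 3"

lemma Cb_ge1: "1 \<le> Cb"
  unfolding Cb_def using mult_mono[OF CA one_le_power[OF Cd(1), of 3]] CA by simp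

text \<open>The averages run over full balls, as \<open>net_estimate\<close> provides them. For W
  vanishing outside \<Omega> they are at most the averages over
  \<open>ball x r \<inter> \<Omega>\<close> that define traces.\<close>

definition upper_avg :: "('a \<Rightarrow> real) \<Rightarrow> 'a \<Rightarrow> ennreal" where
  "upper_avg W x = limsup (\<lambda>k. avg (1 / real (Suc k)) (\<lambda>y. ennreal \<bar>W y\<bar>) x)"

lemma mble_UNIV: "mble UNIV W \<longleftrightarrow> W \<in> borel_measurable M"
  by (simp add: set_borel_measurable_def)

lemma upper_avg_le: "(\<And>x. \<bar>W x\<bar> \<le> B) \<Longrightarrow> upper_avg W x \<le> ennreal B"
  unfolding upper_avg_def by (intro Limsup_bounded always_eventually allI avg_le ennreal_leI) auto

lemma near_Bd_vanishes:
  "(\<lambda>k. emeasure M (\<Omega> \<inter> {x. infdist x Bd < c / real (Suc k)})) \<longlonglongrightarrow> 0"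
proof (cases "c \<le> 0")
  case True
  have "\<not> infdist x Bd < c / real (Suc k)" for x k
    using infdist_nonneg[of x Bd] divide_nonpos_pos[OF True, of "real (Suc k)"] by simp
  then have "\<Omega> \<inter> {x. infdist x Bd < c / real (Suc k)} = {}" for k by simp
  then show ?thesis by simp
next
  case False
  have "(\<lambda>k. emeasure M (\<Omega> \<inter> {x. infdist x Bd < c / real (Suc k)})) \<longlonglongrightarrow> emeasure M (\<Inter>k. \<Omega> \<inter> {x. infdist x Bd < c / real (Suc k)})"
  proof (rule Lim_emeasure_decseq)
    show "range (\<lambda>k. \<Omega> \<inter> {x. infdist x Bd < c / real (Suc k)}) \<subseteq> sets M"
      using Omega(3) open_infdist_less by (auto intro!: sets_M_open)
    show "decseq (\<lambda>k. \<Omega> \<inter> {x. infdist x Bd < c / real (Suc k)})"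
      unfolding decseq_def using False by (auto intro: less_le_trans simp: frac_le)
    show "emeasure M (\<Omega> \<inter> {x. infdist x Bd < c / real (Suc k)}) \<noteq> \<infinity>" for k using finite_Omega by (metis less_irrefl)
  qed
  moreover have "(\<Inter>k. \<Omega> \<inter> {x. infdist x Bd < c / real (Suc k)}) = {}"
  proof -
    have "\<exists>k. \<not> infdist x Bd < c / real (Suc k)" if "x \<in> \<Omega>" for x
    proof -
      have "x \<notin> Bd" using that Omega(3) by (auto simp: frontier_def interior_open)
      then have d: "0 < infdist x Bd" using frontier_ne by (intro infdist_pos_not_in_closed) auto
      then have "0 < infdist x Bd / c" using False by simp
      then obtain k :: nat where "1 / real (Suc k) < infdist x Bd / c" using nat_approx_posE by blast
      then have "c / real (Suc k) < infdist x Bd" using False by (simp add: field_simps)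
      then show ?thesis by (intro exI[of _ k]) auto
    qed
    then show ?thesis by auto
  qed
  ultimately show ?thesis by (simp only: emeasure_empty)
qed

text \<open>The functions \<open>psi s x * W x\<close> tend to W as s tends to 0. By
  \<open>TV_cut\<close> their variation exceeds that of W in \<open>\<Omega> \<inter> U\<close> by
  at most the mass of W in a collar divided by s, which \<open>net_estimate\<close> bounds by
  boundary averages of radius 6s. The reverse Fatou lemma, with the majorant B on the boundary of
  finite Hausdorff measure, leads to \<open>upper_avg\<close>.\<close>

lemma TV_boundary:
  assumes U: "open U" and m: "mble UNIV W" and B: "\<And>x. \<bar>W x\<bar> \<le> B" and W0: "\<And>x. x \<notin> \<Omega> \<Longrightarrow> W x = 0" and \<tau>: "\<tau> > 0"
  shows "TV W U \<le> TV W (\<Omega> \<inter> U) + ennreal Cb * (\<integral>\<^sup>+ x \<in> Bd \<inter> (\<Union>y\<in>U. ball y \<tau>). upper_avg W x \<partial>HM)"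
proof (rule TV_lsc[OF U])
  define G where "G = Bd \<inter> (\<Union>y\<in>U. ball y \<tau>)"
  have Gb: "G \<in> sets borel" unfolding G_def by (intro sets.Int[OF Bd_sets] borel_open open_UN) auto
  define a where "a k = avg (1 / real (Suc k)) (\<lambda>y. ennreal \<bar>W y\<bar>)" for k :: nat
  have Wm: "(\<lambda>y. ennreal \<bar>W y\<bar>) \<in> borel_measurable M"
    using m unfolding mble_UNIV by measurable
  have am: "a k \<in> borel_measurable HM" for k unfolding a_def by (intro measurable_HM avg_borel Wm)
  have lim: "limsup (\<lambda>k. \<integral>\<^sup>+ x \<in> G. a k x \<partial>HM) \<le> (\<integral>\<^sup>+ x \<in> G. upper_avg W x \<partial>HM)"
  proof -
    have "limsup (\<lambda>k. \<integral>\<^sup>+ x \<in> G. a k x \<partial>HM) \<le> (\<integral>\<^sup>+ x. limsup (\<lambda>k. a k x * indicator G x) \<partial>HM)"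
    proof (rule nn_integral_limsup[where w = "\<lambda>x. ennreal B * indicator G x"])
      show "(\<lambda>x. a k x * indicator G x) \<in> borel_measurable HM" for k using am Gb by (intro borel_measurable_times_ennreal borel_measurable_indicator sets_HM)
      show "(\<lambda>x. ennreal B * indicator G x) \<in> borel_measurable HM" using Gb by (intro borel_measurable_times_ennreal borel_measurable_indicator sets_HM) auto
      have "a k x \<le> ennreal B" for k x unfolding a_def using B by (intro avg_le ennreal_leI) auto
      then show "AE x in HM. a k x * indicator G x \<le> ennreal B * indicator G x" for k
        by (intro AE_I2 mult_right_mono) auto
      have "(\<integral>\<^sup>+ x. ennreal B * indicator G x \<partial>HM) = ennreal B * H G" using Gb by (simp add: nn_integral_cmult_indicator sets_HM emeasure_HM)
      also have "\<dots> \<le> ennreal B * H Bd" using outer_measureD(2)[OF H_outer, of G Bd] by (intro mult_left_mono) (auto simp: G_def)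
      also have "\<dots> < \<infinity>" using H_Bd_finite by (simp add: ennreal_mult_less_top)
      finally show "(\<integral>\<^sup>+ x. ennreal B * indicator G x \<partial>HM) < \<infinity>" .
    qed
    also have "\<dots> = (\<integral>\<^sup>+ x \<in> G. upper_avg W x \<partial>HM)"
      by (intro nn_integral_cong) (auto simp: indicator_def upper_avg_def a_def Limsup_const)
    finally show ?thesis .
  qed
  fix V and \<epsilon> :: real assume V: "compactly_contained V U" and \<epsilon>: "\<epsilon> > 0"
  define \<epsilon>' where "\<epsilon>' = \<epsilon> / Cb"
  have \<epsilon>': "\<epsilon>' > 0" "Cb * \<epsilon>' = \<epsilon>" using \<epsilon> Cb_ge1 by (auto simp: \<epsilon>'_def)
  have Gfin: "(\<integral>\<^sup>+ x \<in> G. upper_avg W x \<partial>HM) < \<infinity>"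
  proof -
    have "(\<integral>\<^sup>+ x \<in> G. upper_avg W x \<partial>HM) \<le> (\<integral>\<^sup>+ x \<in> G. ennreal B \<partial>HM)" using B by (intro nn_integral_mono mult_right_mono upper_avg_le) auto
    also have "\<dots> = ennreal B * H G" using Gb by (simp add: nn_integral_cmult_indicator sets_HM emeasure_HM)
    also have "\<dots> \<le> ennreal B * H Bd" using outer_measureD(2)[OF H_outer, of G Bd] by (intro mult_left_mono) (auto simp: G_def)
    also have "\<dots> < \<infinity>" using H_Bd_finite by (simp add: ennreal_mult_less_top)
    finally show ?thesis .
  qed
  have "\<forall>\<^sub>F k in sequentially. (\<integral>\<^sup>+ x \<in> G. a k x \<partial>HM) < (\<integral>\<^sup>+ x \<in> G. upper_avg W x \<partial>HM) + ennreal \<epsilon>'"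
  proof -
    have "(\<integral>\<^sup>+ x \<in> G. upper_avg W x \<partial>HM) < (\<integral>\<^sup>+ x \<in> G. upper_avg W x \<partial>HM) + ennreal \<epsilon>'"
      using Gfin \<epsilon>' by (simp add: ennreal_add_left_cancel_less less_top)
    with lim show ?thesis unfolding Limsup_le_iff by blast
  qed
  moreover have "\<forall>\<^sub>F k in sequentially. ennreal B * emeasure M (\<Omega> \<inter> {x. infdist x Bd < (1/3) / real (Suc k)}) < ennreal \<epsilon>"
  proof -
    have "(\<lambda>k. ennreal B * emeasure M (\<Omega> \<inter> {x. infdist x Bd < (1/3) / real (Suc k)})) \<longlonglongrightarrow> ennreal B * 0"
      by (intro ennreal_tendsto_cmult near_Bd_vanishes) auto
    then show ?thesis using \<epsilon> by (intro order_tendstoD) auto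
  qed
  moreover have "\<forall>\<^sub>F k in sequentially. 1 / real (Suc k) < min \<tau> (diameter \<Omega>)"
  proof -
    have "(\<lambda>k. 1 / real (Suc k)) \<longlonglongrightarrow> 0" using LIMSEQ_inverse_real_of_nat by (simp add: inverse_eq_divide)
    then show ?thesis by (rule order_tendstoD) (use \<tau> diameter_pos in auto)
  qed
  ultimately have "\<forall>\<^sub>F k in sequentially. (\<integral>\<^sup>+ x \<in> G. a k x \<partial>HM) < (\<integral>\<^sup>+ x \<in> G. upper_avg W x \<partial>HM) + ennreal \<epsilon>' \<and>
      ennreal B * emeasure M (\<Omega> \<inter> {x. infdist x Bd < (1/3) / real (Suc k)}) < ennreal \<epsilon> \<and> 1 / real (Suc k) < min \<tau> (diameter \<Omega>)"
    by (auto elim: eventually_elim2 intro: eventually_conj)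
  then obtain k where k: "(\<integral>\<^sup>+ x \<in> G. a k x \<partial>HM) < (\<integral>\<^sup>+ x \<in> G. upper_avg W x \<partial>HM) + ennreal \<epsilon>'"
      "ennreal B * emeasure M (\<Omega> \<inter> {x. infdist x Bd < (1/3) / real (Suc k)}) < ennreal \<epsilon>" "1 / real (Suc k) < min \<tau> (diameter \<Omega>)"
    by (auto dest: eventually_happens)
  \<comment> \<open>Now 6s is the radius of the k-th average. Boundary points within 3s of U, and
    then s farther, stay within 4s \<le> \<tau> of U.\<close>
  define s where "s = 1 / (6 * real (Suc k))"
  have s: "0 < s" "6 * s = 1 / real (Suc k)" "2 * s = (1/3) / real (Suc k)" by (simp_all add: s_def field_simps)
  have s': "4 * s \<le> \<tau>" "s \<le> diameter \<Omega>" using k(3) s by auto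
  have pm: "mble UNIV (\<lambda>x. psi s x * W x)"
    by (intro mble_mult m mble_continuous lipschitz_on_continuous_on[OF psi_lipschitz[OF s(1)]]) auto
  show "\<exists>v. mble U v \<and> L1 V (\<lambda>x. v x - W x) \<le> ennreal \<epsilon> \<and>
     TV v U \<le> TV W (\<Omega> \<inter> U) + ennreal Cb * (\<integral>\<^sup>+ x \<in> Bd \<inter> (\<Union>y\<in>U. ball y \<tau>). upper_avg W x \<partial>HM) + ennreal \<epsilon>"
  proof (intro exI[of _ "\<lambda>x. psi s x * W x"] conjI)
    show "mble U (\<lambda>x. psi s x * W x)" using pm U by (auto intro: mble_subset)
    define A where "A = \<Omega> \<inter> {x. infdist x Bd < 2 * s}"
    have "L1 V (\<lambda>x. psi s x * W x - W x) \<le> L1 A (\<lambda>x. psi s x * W x - W x)"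
    proof (rule nn_integral_mono)
      fix x
      have "psi s x * W x - W x = 0" if "x \<notin> A"
      proof (cases "x \<in> \<Omega>")
        case True
        then have "2 * s \<le> infdist x Bd" using that by (auto simp: A_def)
        then have "psi s x = 1" using s(1) by (auto simp: psi_def field_simps)
        then show ?thesis by simp
      qed (simp add: W0)
      then show "ennreal \<bar>psi s x * W x - W x\<bar> * indicator V x \<le> ennreal \<bar>psi s x * W x - W x\<bar> * indicator A x"
        by (auto simp: indicator_def)
    qed
    also have "\<dots> \<le> ennreal B * emeasure M A"
    proof (rule L1_le_measure)
      show "A \<in> sets M" unfolding A_def using Omega(3) open_infdist_less by (auto intro!: sets_M_open)
      fix x
      have "\<bar>psi s x * W x - W x\<bar> = (1 - psi s x) * \<bar>W x\<bar>"
      proof -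
        have "psi s x * W x - W x = - ((1 - psi s x) * W x)" by (simp add: algebra_simps)
        then show ?thesis using psi_bounds[of s x] by (simp add: abs_mult)
      qed
      also have "\<dots> \<le> 1 * B" using psi_bounds[of s x] B[of x] by (intro mult_mono) auto
      finally show "\<bar>psi s x * W x - W x\<bar> \<le> B" by simp
    qed
    also have "\<dots> \<le> ennreal \<epsilon>" using k(2) s(3) by (simp add: A_def)
    finally show "L1 V (\<lambda>x. psi s x * W x - W x) \<le> ennreal \<epsilon>" .
    define E where "E = {x\<in>Bd. \<exists>y\<in>U. dist x y < 3 * s}"
    have "TV (\<lambda>x. psi s x * W x) U \<le> TV W (\<Omega> \<inter> U) + L1 (\<Omega> \<inter> U \<inter> {x. infdist x Bd < 3 * s}) W / ennreal s"
      by (rule TV_cut[OF U m B W0 s(1)])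
    also have "L1 (\<Omega> \<inter> U \<inter> {x. infdist x Bd < 3 * s}) W \<le> L1 (\<Union>x\<in>E. ball x (3 * s)) W"
    proof (rule L1_mono_set)
      show "\<Omega> \<inter> U \<inter> {x. infdist x Bd < 3 * s} \<subseteq> (\<Union>x\<in>E. ball x (3 * s))"
      proof
        fix y assume y: "y \<in> \<Omega> \<inter> U \<inter> {x. infdist x Bd < 3 * s}"
        then obtain x where "x \<in> Bd" "dist y x < 3 * s" using infdist_lessD[of y Bd "3 * s"] frontier_ne by auto
        then show "y \<in> (\<Union>x\<in>E. ball x (3 * s))" using y by (auto simp: E_def dist_commute)
      qed
    qed
    then have "L1 (\<Omega> \<inter> U \<inter> {x. infdist x Bd < 3 * s}) W / ennreal s \<le> L1 (\<Union>x\<in>E. ball x (3 * s)) W / ennreal s"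
      by (rule divide_right_mono_ennreal)
    also have "\<dots> \<le> ennreal Cb * (\<integral>\<^sup>+ x \<in> Bd \<inter> (\<Union>x\<in>E. ball x s). avg (6 * s) (\<lambda>y. ennreal \<bar>W y\<bar>) x \<partial>HM)"
      unfolding Cb_def by (rule net_estimate[OF _ s(1) s'(2) Wm]) (auto simp: E_def)
    also have "(\<integral>\<^sup>+ x \<in> Bd \<inter> (\<Union>x\<in>E. ball x s). avg (6 * s) (\<lambda>y. ennreal \<bar>W y\<bar>) x \<partial>HM) \<le> (\<integral>\<^sup>+ x \<in> G. a k x \<partial>HM)"
    proof (rule nn_integral_mono)
      fix y
      have "y \<in> G" if yE: "y \<in> Bd \<inter> (\<Union>x\<in>E. ball x s)"
      proof -
        obtain x u where x: "u \<in> U" "dist x u < 3 * s" "dist x y < s" "y \<in> Bd" using yE by (auto simp: E_def)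
        then have "dist u y < \<tau>" using dist_triangle[of u y x] s' by (simp add: dist_commute)
        then show ?thesis using x by (auto simp: G_def)
      qed
      then show "avg (6 * s) (\<lambda>y. ennreal \<bar>W y\<bar>) y * indicator (Bd \<inter> (\<Union>x\<in>E. ball x s)) y \<le> a k y * indicator G y"
        unfolding a_def s(2) by (auto simp: indicator_def)
    qed
    also have "\<dots> \<le> (\<integral>\<^sup>+ x \<in> G. upper_avg W x \<partial>HM) + ennreal \<epsilon>'" using k(1) by simp
    also have "ennreal Cb * ((\<integral>\<^sup>+ x \<in> G. upper_avg W x \<partial>HM) + ennreal \<epsilon>') = ennreal Cb * (\<integral>\<^sup>+ x \<in> G. upper_avg W x \<partial>HM) + ennreal \<epsilon>"
      using \<epsilon>' Cb_ge1 by (simp add: distrib_left ennreal_mult[symmetric])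
    finally show "TV (\<lambda>x. psi s x * W x) U \<le> TV W (\<Omega> \<inter> U) + ennreal Cb * (\<integral>\<^sup>+ x \<in> Bd \<inter> (\<Union>y\<in>U. ball y \<tau>). upper_avg W x \<partial>HM) + ennreal \<epsilon>"
      unfolding G_def by (simp add: add_left_mono mult_left_mono add.assoc)
  qed
qed (use m U in \<open>auto intro: mble_subset\<close>)

section \<open>The perimeter measure\<close>

abbreviation chi :: "'a \<Rightarrow> real" where "chi \<equiv> indicator \<Omega>"
abbreviation P :: "'a set \<Rightarrow> ennreal" where "P \<equiv> perimeter \<mu> \<Omega>"
abbreviation PM :: "'a measure" where "PM \<equiv> perimeter_measure \<mu> \<Omega>"

lemma chi_mble: "mble UNIV chi"
  using Omega(3) by (intro mble_borel) auto

lemma P_eq_TVo: "P A = TVo chi A" by (simp add: perimeter_def)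

lemma P_outer: "outer_measure_space UNIV P"
  using TVo_outer[OF chi_mble] by (simp add: P_eq_TVo[abs_def])

lemma P_borel: "sets borel \<subseteq> lambda_system UNIV UNIV P"
  using TVo_borel[OF chi_mble] by (simp add: P_eq_TVo[abs_def])

lemma space_PM [simp]: "space PM = UNIV"
  unfolding perimeter_measure_def by (rule space_outer_to_measure[OF P_outer])

lemma sets_PM: "A \<in> sets borel \<Longrightarrow> A \<in> sets PM"
  unfolding perimeter_measure_def using P_borel by (auto simp: sets_outer_to_measure[OF P_outer])

lemma emeasure_PM: "A \<in> sets PM \<Longrightarrow> emeasure PM A = P A"
  unfolding perimeter_measure_def by (intro emeasure_outer_to_measure[OF P_outer]) (simp add: sets_outer_to_measure[OF P_outer])

lemma measurable_PM: "f \<in> borel_measurable borel \<Longrightarrow> f \<in> borel_measurable PM"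
  using sets_PM by (auto simp: measurable_def)

lemma P_open: "open U \<Longrightarrow> P U = TV chi U"
  by (simp add: P_eq_TVo TVo_open)

lemma TV_chi_Omega: "TV chi (\<Omega> \<inter> U) = 0" if "open U"
proof -
  have "TV chi (\<Omega> \<inter> U) = TV (\<lambda>_. 1) (\<Omega> \<inter> U)" by (rule TV_cong) auto
  then show ?thesis using that Omega(3) by (simp add: TV_const open_Int)
qed

lemma TV_exterior: "(\<And>x. x \<notin> \<Omega> \<Longrightarrow> W x = 0) \<Longrightarrow> TV W (- closure \<Omega>) = 0"
proof -
  assume W: "\<And>x. x \<notin> \<Omega> \<Longrightarrow> W x = 0"
  have "TV W (- closure \<Omega>) = TV (\<lambda>_. 0) (- closure \<Omega>)"
    using closure_subset[of \<Omega>] by (intro TV_cong W) auto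
  also have "\<dots> = 0" by (rule TV_const) auto
  finally show ?thesis .
qed

text \<open>The characteristic function has no variation inside \<Omega>, and its upper averages are
  at most 1, so \<open>TV_boundary\<close> leaves the Hausdorff measure.\<close>

lemma P_le_H:
  assumes U: "open U" and \<tau>: "\<tau> > 0"
  shows "P U \<le> ennreal Cb * H (Bd \<inter> (\<Union>y\<in>U. ball y \<tau>))"
proof -
  define G where "G = Bd \<inter> (\<Union>y\<in>U. ball y \<tau>)"
  have Gb: "G \<in> sets borel" unfolding G_def by (intro sets.Int[OF Bd_sets] borel_open open_UN) auto
  have "P U = TV chi U" by (rule P_open[OF U])
  also have "\<dots> \<le> TV chi (\<Omega> \<inter> U) + ennreal Cb * (\<integral>\<^sup>+ x \<in> G. upper_avg chi x \<partial>HM)"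
    unfolding G_def by (rule TV_boundary[OF U chi_mble, of 1]) (use \<tau> in \<open>auto simp: indicator_def\<close>)
  also have "TV chi (\<Omega> \<inter> U) = 0" by (rule TV_chi_Omega[OF U])
  also have "(\<integral>\<^sup>+ x \<in> G. upper_avg chi x \<partial>HM) \<le> (\<integral>\<^sup>+ x \<in> G. ennreal 1 \<partial>HM)"
    by (intro nn_integral_mono mult_right_mono upper_avg_le) (auto simp: indicator_def)
  also have "\<dots> = H G" using Gb by (simp add: sets_HM emeasure_HM)
  finally show ?thesis by (simp add: mult_left_mono G_def)
qed

lemma P_finite: "P A < \<infinity>"
proof -
  have "P A \<le> P UNIV" using outer_measureD(2)[OF P_outer] by auto
  also have "\<dots> \<le> ennreal Cb * H (Bd \<inter> (\<Union>y\<in>UNIV. ball y 1))" by (rule P_le_H) auto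
  also have "\<dots> \<le> ennreal Cb * H Bd" using outer_measureD(2)[OF H_outer] by (intro mult_left_mono) auto
  also have "\<dots> < \<infinity>" using H_Bd_finite by (simp add: ennreal_mult_less_top)
  finally show ?thesis .
qed

text \<open>A cover of N of small content is thinned out to the balls that meet N. In such a ball
  \<open>P_le_H\<close> and the upper Ahlfors bound give a perimeter of order
  \<open>\<mu> (ball x r) / r\<close>. Exceptional sets for the Hausdorff measure thereby become
  null sets of the perimeter measure.\<close>

lemma P_null:
  assumes N: "N \<subseteq> Bd" "H N = 0"
  shows "P N = 0"
proof -
  let ?D = "diameter \<Omega>"
  \<comment> \<open>Radii up to a quarter of the diameter, since the upper Ahlfors bound is used for
    the radius 4r around a point of N.\<close>
  have c0: "codim1_content \<mu> (?D / 4) N = 0" using H_zero_content[OF N(2)] diameter_pos by simp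
  define C where "C = Cb * CA * Cd ^ 3"
  have C: "C > 0" using Cb_ge1 CA Cd(1) by (auto simp: C_def intro!: mult_pos_pos)
  have "P N \<le> 0 + ennreal e" if e: "e > 0" for e
  proof -
    have "codim1_content \<mu> (?D / 4) N < \<infinity>" "e / C > 0" using c0 e C by auto
    then obtain I x r where cov: "\<And>i. i \<in> I \<Longrightarrow> 0 < r i \<and> r i \<le> ?D / 4" "N \<subseteq> (\<Union>i\<in>I. ball (x i) (r i))"
      "(\<Sum>n. \<mu> (ball (x n) (r n)) / ennreal (r n) * indicator I n) \<le> codim1_content \<mu> (?D / 4) N + ennreal (e / C)"
      by (rule content_cover) blast
    define A where "A i = (if i \<in> I \<and> ball (x i) (r i) \<inter> N \<noteq> {} then ball (x i) (r i) else {})" for i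
    have "N \<subseteq> (\<Union>i. A i)" using cov(2) by (force simp: A_def)
    then have "P N \<le> P (\<Union>i. A i)" using outer_measureD(2)[OF P_outer] by blast
    also have "\<dots> \<le> (\<Sum>i. P (A i))" by (rule outer_measureD(4)[OF P_outer])
    also have "\<dots> \<le> (\<Sum>i. ennreal C * (\<mu> (ball (x i) (r i)) / ennreal (r i) * indicator I i))"
    proof (intro suminf_le summableI)
      fix i
      show "P (A i) \<le> ennreal C * (\<mu> (ball (x i) (r i)) / ennreal (r i) * indicator I i)"
      proof (cases "i \<in> I \<and> ball (x i) (r i) \<inter> N \<noteq> {}")
        case True
        then obtain y where "y \<in> N" and y2: "dist (x i) y < r i" by auto
        then have y: "y \<in> Bd" "dist (x i) y < r i" using N by auto
        have r: "0 < r i" "4 * r i \<le> ?D" using cov(1)[of i] True by auto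
        have sub: "Bd \<inter> (\<Union>z\<in>ball (x i) (r i). ball z (r i)) \<subseteq> ball y (4 * r i) \<inter> Bd"
        proof
          fix w assume "w \<in> Bd \<inter> (\<Union>z\<in>ball (x i) (r i). ball z (r i))"
          then obtain z where z: "w \<in> Bd" "dist (x i) z < r i" "dist z w < r i" by auto
          then have "dist y w < 4 * r i"
            using y r(1) dist_triangle[of y w "x i"] dist_triangle[of "x i" w z] by (simp add: dist_commute)
          then show "w \<in> ball y (4 * r i) \<inter> Bd" using z by auto
        qed
        have "ball y (4 * r i) \<subseteq> ball (x i) (2 ^ 3 * r i)"
        proof
          fix z assume "z \<in> ball y (4 * r i)"
          then show "z \<in> ball (x i) (2 ^ 3 * r i)" using y r dist_triangle[of "x i" z y] by auto
        qed
        then have "emeasure M (ball y (4 * r i)) \<le> emeasure M (ball (x i) (2 ^ 3 * r i))" by (intro emeasure_mono) auto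
        also have "\<dots> \<le> ennreal (Cd ^ 3) * \<mu> (ball (x i) (r i))" unfolding emeasure_ball by (rule doubling_power[OF r(1)])
        finally have mb: "\<mu> (ball y (4 * r i)) \<le> ennreal (Cd ^ 3) * \<mu> (ball (x i) (r i))" by (simp add: emeasure_ball)
        have "P (A i) \<le> ennreal Cb * H (Bd \<inter> (\<Union>z\<in>ball (x i) (r i). ball z (r i)))"
          using True P_le_H[of "ball (x i) (r i)" "r i"] r by (simp add: A_def)
        also have "\<dots> \<le> ennreal Cb * H (ball y (4 * r i) \<inter> Bd)"
          by (intro mult_left_mono outer_measureD(2)[OF H_outer] sub) auto
        also have "\<dots> \<le> ennreal Cb * (ennreal CA * (\<mu> (ball y (4 * r i)) / ennreal (4 * r i)))"
          using y r by (intro mult_left_mono upper_ahlfors) auto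
        also have "\<dots> \<le> ennreal Cb * (ennreal CA * ((ennreal (Cd ^ 3) * \<mu> (ball (x i) (r i))) / ennreal (r i)))"
          unfolding divide_ennreal_def using r by (intro mult_left_mono mult_mono mb ennreal_inverse_antimono ennreal_leI) auto
        also have "\<dots> = ennreal C * (\<mu> (ball (x i) (r i)) / ennreal (r i))"
          using Cb_ge1 CA Cd(1) by (simp add: C_def ennreal_mult divide_ennreal_def mult_ac)
        finally show ?thesis using True by simp
      next
        case False
        then have "A i = {}" by (auto simp: A_def)
        then show ?thesis using outer_measureD(1)[OF P_outer] by simp
      qed
    qed
    also have "\<dots> = ennreal C * (\<Sum>i. \<mu> (ball (x i) (r i)) / ennreal (r i) * indicator I i)" by (rule ennreal_suminf_cmult)
    also have "\<dots> \<le> ennreal C * ennreal (e / C)" using cov(3) c0 by (intro mult_left_mono) auto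
    also have "\<dots> = ennreal e" using C e by (simp add: ennreal_mult[symmetric])
    finally show ?thesis by simp
  qed
  then have "P N \<le> 0" by (rule ennreal_le_epsilon)
  then show ?thesis by simp
qed

text \<open>The mass that almost optimal upper gradients put on the sets
  \<open>{1 - \<phi> > j / n}\<close> is bounded below by lower semicontinuity.\<close>

lemma TV_weight:
  assumes U: "open U" "emeasure M U < \<infinity>" and \<phi>: "L-lipschitz_on UNIV \<phi>" "\<And>x. 0 \<le> \<phi> x \<and> \<phi> x \<le> 1"
  shows "TV (\<lambda>x. \<phi> x * chi x) U \<le> (\<integral>\<^sup>+ x \<in> U. ennreal (\<phi> x) \<partial>PM) + ennreal L * emeasure M (\<Omega> \<inter> U)"
proof (rule TV_leI[OF U(1)])
  fix V0 and \<epsilon> :: real assume V0: "compactly_contained V0 U" and \<epsilon>: "\<epsilon> > 0"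
  have L: "0 \<le> L" using \<phi>(1) by (rule lipschitz_on_nonneg)
  have \<phi>c: "continuous_on UNIV \<phi>" by (rule lipschitz_on_continuous_on[OF \<phi>(1)])
  have \<phi>b [measurable]: "\<phi> \<in> borel_measurable borel" using \<phi>c by (rule borel_measurable_continuous_onI)
  define p where "p = enn2real (P U)"
  have p: "P U = ennreal p" "0 \<le> p" using P_finite[of U] by (auto simp: p_def)
  \<comment> \<open>The total error will be \<open>\<delta> * (4 + L)\<close>: three times \<delta>
    from \<open>aP\<close>, once from the slack \<eta>, and L times from the mass of w.\<close>
  define \<delta> where "\<delta> = \<epsilon> / (4 + p + L)"
  have q: "0 < 4 + p + L" using p(2) L by simp
  have \<delta>: "\<delta> > 0" "\<delta> * (4 + p + L) = \<epsilon>" using \<epsilon> q by (simp_all add: \<delta>_def)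
  define \<eta> where "\<eta> = \<delta> / (1 + p + \<delta>)"
  have q2: "0 < 1 + p + \<delta>" using p(2) \<delta> by simp
  have \<eta>: "\<eta> > 0" "\<eta> * (p + \<delta>) \<le> \<delta>"
  proof -
    show "\<eta> > 0" using \<delta> q2 by (simp add: \<eta>_def)
    have "\<eta> * (p + \<delta>) = \<delta> * ((p + \<delta>) / (1 + p + \<delta>))" by (simp add: \<eta>_def)
    also have "\<dots> \<le> \<delta> * 1" using q2 \<delta> by (intro mult_left_mono) (auto simp: divide_le_eq_1)
    finally show "\<eta> * (p + \<delta>) \<le> \<delta>" by simp
  qed
  \<comment> \<open>The staircase below has error 1/n, to be integrated against g, whose integral is
    at most p + \<delta>.\<close>
  obtain n :: nat where n: "(p + \<delta>) / \<delta> < real n" using reals_Archimedean2 by blast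
  have "0 \<le> (p + \<delta>) / \<delta>" using p(2) \<delta> by simp
  then have n0: "0 < real n" using n by linarith
  have nd: "(p + \<delta>) / real n \<le> \<delta>" using n n0 \<delta> by (simp add: field_simps)
  define O' where "O' j = {x\<in>U. real j / n < 1 - \<phi> x}" for j :: nat
  have O': "open (O' j)" for j
  proof -
    have "open {x. real j / n < 1 - \<phi> x}" by (intro open_Collect_less continuous_intros \<phi>c)
    then have "open (U \<inter> {x. real j / n < 1 - \<phi> x})" using U by auto
    then show ?thesis by (simp add: O'_def Int_def)
  qed
  \<comment> \<open>Layer cake: on U the indicators of the sets \<open>O' j\<close>, each with
    weight 1/n, add up to \<open>1 - \<phi>\<close> rounded up to a multiple of 1/n.\<close>
  have stair1: "1 - \<phi> x \<le> (\<Sum>j<n. if x \<in> O' j then 1 / real n else 0)"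
    and stair2: "(\<Sum>j<n. if x \<in> O' j then 1 / real n else 0) \<le> 1 - \<phi> x + 1 / real n" if "x \<in> U" for x
  proof -
    define t where "t = real n * (1 - \<phi> x)"
    have t: "0 \<le> t" "t \<le> real n" using \<phi>(2)[of x] n0 by (auto simp: t_def mult_left_le)
    define m where "m = nat \<lceil>t\<rceil>"
    have m: "t \<le> real m" "real m < t + 1" using t(1) ceiling_correct[of t] by (auto simp: m_def)
    have mn: "m \<le> n" using m(2) t(2) by linarith
    have mem: "x \<in> O' j \<longleftrightarrow> j < m" for j
    proof -
      have "x \<in> O' j \<longleftrightarrow> real j < t" using that n0 by (simp add: O'_def t_def divide_less_eq mult.commute)
      also have "\<dots> \<longleftrightarrow> j < m" using m by (metis less_ceiling_iff m_def of_int_of_nat_eq of_nat_less_iff zless_nat_conj zless_nat_eq_int_zless)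
      finally show ?thesis .
    qed
    have "(\<Sum>j<n. if x \<in> O' j then 1 / real n else 0) = (\<Sum>j<m. 1 / real n)"
      unfolding mem using mn by (intro sum.mono_neutral_cong_right) auto
    then have S: "(\<Sum>j<n. if x \<in> O' j then 1 / real n else 0) = real m / real n" by simp
    have tx: "1 - \<phi> x = t / real n" using n0 by (simp add: t_def)
    show "1 - \<phi> x \<le> (\<Sum>j<n. if x \<in> O' j then 1 / real n else 0)"
      unfolding S tx using m n0 by (intro divide_right_mono) auto
    have "real m / real n \<le> (t + 1) / real n" using m n0 by (intro divide_right_mono) auto
    then show "(\<Sum>j<n. if x \<in> O' j then 1 / real n else 0) \<le> 1 - \<phi> x + 1 / real n"
      unfolding S tx by (simp add: add_divide_distrib)
  qed
  \<comment> \<open>Thresholds for all the sets \<open>O' j\<close> are fixed in advance, so that a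
    single w can meet them all. If the perimeter of \<open>O' j\<close> is at most \<delta>, the
    conclusion holds for every w, and V is taken to be empty.\<close>
  have low: "\<exists>V d. compactly_contained V (O' j) \<and> d > 0 \<and>
     (\<forall>w g. loc_lip (O' j) w \<longrightarrow> ug (O' j) w g \<longrightarrow> L1 V (\<lambda>x. w x - chi x) \<le> ennreal d \<longrightarrow> P (O' j) \<le> (\<integral>\<^sup>+ x \<in> O' j. g x \<partial>M) + ennreal \<delta>)" for j
  proof (cases "P (O' j) \<le> ennreal \<delta>")
    case True
    then show ?thesis by (intro exI[of _ "{}"] exI[of _ 1]) (auto simp: cc_empty add_increasing)
  next
    case False
    then have "P (O' j) - ennreal \<delta> < P (O' j)" using P_finite[of "O' j"] \<delta>
      by (intro ennreal_between) (auto simp: zero_less_iff_neq_zero)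
    then have "P (O' j) - ennreal \<delta> < TV chi (O' j)" by (simp add: P_open[OF O'])
    from TV_lower[OF O' this] obtain V d where V: "compactly_contained V (O' j)" "d > 0"
       "\<And>w g. loc_lip (O' j) w \<Longrightarrow> ug (O' j) w g \<Longrightarrow> L1 V (\<lambda>x. w x - chi x) \<le> ennreal d \<Longrightarrow> P (O' j) - ennreal \<delta> \<le> (\<integral>\<^sup>+ x \<in> O' j. g x \<partial>M)"
      by blast
    have "P (O' j) \<le> (\<integral>\<^sup>+ x \<in> O' j. g x \<partial>M) + ennreal \<delta>" if "loc_lip (O' j) w" "ug (O' j) w g" "L1 V (\<lambda>x. w x - chi x) \<le> ennreal d" for w g
      using V(3)[OF that] by (simp add: ennreal_minus_le_iff add.commute)
    with V show ?thesis by blast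
  qed
  from choice[OF allI[OF low]] obtain V where "\<forall>j. \<exists>d. compactly_contained (V j) (O' j) \<and> d > 0 \<and>
     (\<forall>w g. loc_lip (O' j) w \<longrightarrow> ug (O' j) w g \<longrightarrow> L1 (V j) (\<lambda>x. w x - chi x) \<le> ennreal d \<longrightarrow> P (O' j) \<le> (\<integral>\<^sup>+ x \<in> O' j. g x \<partial>M) + ennreal \<delta>)" ..
  from choice[OF this] obtain d where "\<forall>j. compactly_contained (V j) (O' j) \<and> d j > 0 \<and>
     (\<forall>w g. loc_lip (O' j) w \<longrightarrow> ug (O' j) w g \<longrightarrow> L1 (V j) (\<lambda>x. w x - chi x) \<le> ennreal (d j) \<longrightarrow> P (O' j) \<le> (\<integral>\<^sup>+ x \<in> O' j. g x \<partial>M) + ennreal \<delta>)" ..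
  then have Vd: "\<And>j. compactly_contained (V j) (O' j)" "\<And>j. d j > 0"
     "\<And>j w g. loc_lip (O' j) w \<Longrightarrow> ug (O' j) w g \<Longrightarrow> L1 (V j) (\<lambda>x. w x - chi x) \<le> ennreal (d j) \<Longrightarrow> P (O' j) \<le> (\<integral>\<^sup>+ x \<in> O' j. g x \<partial>M) + ennreal \<delta>"
    by auto
  define e where "e = Min (insert \<delta> (d ` {..<n}))"
  have e: "e > 0" "e \<le> \<delta>" "\<And>j. j < n \<Longrightarrow> e \<le> d j" using Vd(2) \<delta> by (auto simp: e_def)
  have mU: "mble U chi" using chi_mble U by (auto intro: mble_subset)
  have TVU: "TV chi U < \<infinity>" using P_finite[of U] P_open[OF U(1)] by simp
  have c01: "0 \<le> chi x \<and> chi x \<le> 1" for x by (auto simp: indicator_def)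
  obtain w g where w: "loc_lip U w" "ug U w g" "L1 U (\<lambda>x. w x - chi x) \<le> ennreal e"
    "(\<integral>\<^sup>+ x \<in> U. g x \<partial>M) \<le> TV chi U + ennreal e" "\<And>x. 0 \<le> w x \<and> w x \<le> 1"
    using TV_D_L1[OF U(1) TVU U(2) mU e(1) c01 zero_le_one] by blast
  have gm: "(\<lambda>x. g x * indicator U x) \<in> borel_measurable M" by (rule ug_measurable_M[OF w(2) U(1)])
  have G: "(\<integral>\<^sup>+ x \<in> U. g x \<partial>M) \<le> ennreal (p + \<delta>)"
    using w(4) e(2) p \<delta> P_open[OF U(1)] by (auto simp: ennreal_leI intro: order_trans add_left_mono)
  have \<phi>M: "(\<lambda>x. ennreal (\<phi> x)) \<in> borel_measurable M" "(\<lambda>x. ennreal (1 - \<phi> x)) \<in> borel_measurable M"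
    by (intro borel_measurable_M; measurable)+
  define a where "a = (\<integral>\<^sup>+ x. ennreal (\<phi> x) * (g x * indicator U x) \<partial>M)"
  define b where "b = (\<integral>\<^sup>+ x. ennreal (1 - \<phi> x) * (g x * indicator U x) \<partial>M)"
  have ab: "a + b \<le> ennreal (p + \<delta>)"
  proof -
    have "a + b = (\<integral>\<^sup>+ x. ennreal (\<phi> x) * (g x * indicator U x) + ennreal (1 - \<phi> x) * (g x * indicator U x) \<partial>M)"
      unfolding a_def b_def by (intro nn_integral_add[symmetric] borel_measurable_times_ennreal[OF _ gm] \<phi>M)
    also have "\<dots> = (\<integral>\<^sup>+ x \<in> U. g x \<partial>M)"
      using \<phi>(2) by (intro nn_integral_cong) (simp add: distrib_right[symmetric] ennreal_plus[symmetric] del: ennreal_plus)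
    finally show ?thesis using G by simp
  qed
  have PO: "P (O' j) \<le> (\<integral>\<^sup>+ x \<in> O' j. g x \<partial>M) + ennreal \<delta>" if "j < n" for j
  proof (rule Vd(3))
    have "O' j \<subseteq> U" by (auto simp: O'_def)
    then show "loc_lip (O' j) w" "ug (O' j) w g" using w by (auto intro: loc_lip_subset ug_subset)
    have "V j \<subseteq> U" using cc_subset[OF Vd(1)[of j]] \<open>O' j \<subseteq> U\<close> by auto
    then have "L1 (V j) (\<lambda>x. w x - chi x) \<le> L1 U (\<lambda>x. w x - chi x)" by (rule L1_mono_set)
    also have "\<dots> \<le> ennreal (d j)" using w(3) e(3)[OF that] by (meson ennreal_leI order_trans)
    finally show "L1 (V j) (\<lambda>x. w x - chi x) \<le> ennreal (d j)" .
  qed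
  have PI: "(\<integral>\<^sup>+ x \<in> U. ennreal (1 - \<phi> x) \<partial>PM) \<le> b + ennreal ((p + \<delta>) / n) + ennreal \<delta>"
  proof -
    have "(\<integral>\<^sup>+ x \<in> U. ennreal (1 - \<phi> x) \<partial>PM) \<le> (\<integral>\<^sup>+ x. (\<Sum>j<n. ennreal (1 / n) * indicator (O' j) x) \<partial>PM)"
    proof (rule nn_integral_mono)
      fix x
      show "ennreal (1 - \<phi> x) * indicator U x \<le> (\<Sum>j<n. ennreal (1 / n) * indicator (O' j) x)"
      proof (cases "x \<in> U")
        case True
        have "ennreal (1 - \<phi> x) \<le> ennreal (\<Sum>j<n. if x \<in> O' j then 1 / real n else 0)" by (intro ennreal_leI stair1 True)
        also have "\<dots> = (\<Sum>j<n. ennreal (if x \<in> O' j then 1 / real n else 0))" by (intro sum_ennreal[symmetric]) auto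
        also have "\<dots> = (\<Sum>j<n. ennreal (1 / n) * indicator (O' j) x)" by (intro sum.cong) (auto simp: indicator_def)
        finally show ?thesis using True by simp
      qed simp
    qed
    also have "\<dots> = (\<Sum>j<n. \<integral>\<^sup>+ x. ennreal (1 / n) * indicator (O' j) x \<partial>PM)"
      using O' by (intro nn_integral_sum) (auto intro!: borel_measurable_times_ennreal borel_measurable_indicator sets_PM)
    also have "\<dots> = (\<Sum>j<n. ennreal (1 / n) * P (O' j))"
    proof (rule sum.cong[OF refl])
      fix j
      have "O' j \<in> sets PM" using O' by (intro sets_PM) auto
      then show "(\<integral>\<^sup>+ x. ennreal (1 / n) * indicator (O' j) x \<partial>PM) = ennreal (1 / n) * P (O' j)"
        by (subst nn_integral_cmult_indicator) (auto simp: emeasure_PM)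
    qed
    also have "\<dots> \<le> (\<Sum>j<n. ennreal (1 / n) * ((\<integral>\<^sup>+ x \<in> O' j. g x \<partial>M) + ennreal \<delta>))"
      using PO by (intro sum_mono mult_left_mono) auto
    also have "\<dots> = (\<Sum>j<n. ennreal (1 / n) * (\<integral>\<^sup>+ x \<in> O' j. g x \<partial>M)) + ennreal \<delta>"
    proof -
      have "(\<Sum>j<n. ennreal (1 / n) * ennreal \<delta>) = ennreal \<delta>"
        using n0 \<delta> by (simp add: ennreal_of_nat_eq_real_of_nat ennreal_mult[symmetric])
      then show ?thesis by (simp only: distrib_left sum.distrib)
    qed
    also have "(\<Sum>j<n. ennreal (1 / n) * (\<integral>\<^sup>+ x \<in> O' j. g x \<partial>M)) =
       (\<integral>\<^sup>+ x. (\<Sum>j<n. ennreal (1 / n) * ((g x * indicator U x) * indicator (O' j) x)) \<partial>M)"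
    proof -
      have mj: "(\<lambda>x. (g x * indicator U x) * indicator (O' j) x) \<in> borel_measurable M" for j
        using gm O' by (intro borel_measurable_times_ennreal[OF gm] borel_measurable_indicator) auto
      have "(\<integral>\<^sup>+ x \<in> O' j. g x \<partial>M) = (\<integral>\<^sup>+ x. (g x * indicator U x) * indicator (O' j) x \<partial>M)" for j
        by (intro nn_integral_cong) (auto simp: indicator_def O'_def)
      then show ?thesis using mj by (subst nn_integral_sum) (auto simp: nn_integral_cmult)
    qed
    also have "\<dots> \<le> (\<integral>\<^sup>+ x. ennreal (1 - \<phi> x) * (g x * indicator U x) + ennreal (1 / n) * (g x * indicator U x) \<partial>M)"
    proof (rule nn_integral_mono)
      fix x
      show "(\<Sum>j<n. ennreal (1 / n) * ((g x * indicator U x) * indicator (O' j) x)) \<le> ennreal (1 - \<phi> x) * (g x * indicator U x) + ennreal (1 / n) * (g x * indicator U x)"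
      proof (cases "x \<in> U")
        case True
        have "(\<Sum>j<n. ennreal (1 / n) * (g x * indicator (O' j) x)) = g x * (\<Sum>j<n. ennreal (1 / n) * indicator (O' j) x)"
          unfolding sum_distrib_left by (intro sum.cong refl) (simp only: mult.left_commute)
        also have "(\<Sum>j<n. ennreal (1 / n) * indicator (O' j) x) = (\<Sum>j<n. ennreal (if x \<in> O' j then 1 / real n else 0))"
          by (intro sum.cong) (auto simp: indicator_def)
        also have "\<dots> = ennreal (\<Sum>j<n. if x \<in> O' j then 1 / real n else 0)" by (intro sum_ennreal) auto
        also have "\<dots> \<le> ennreal (1 - \<phi> x + 1 / n)" by (intro ennreal_leI stair2 True)
        also have "\<dots> = ennreal (1 - \<phi> x) + ennreal (1 / n)" using \<phi>(2)[of x] by (intro ennreal_plus) auto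
        finally have "(\<Sum>j<n. ennreal (1 / n) * (g x * indicator (O' j) x)) \<le> g x * (ennreal (1 - \<phi> x) + ennreal (1 / n))"
          by (simp add: mult_left_mono)
        then show ?thesis using True by (simp add: distrib_left mult.commute)
      qed simp
    qed
    also have "\<dots> = b + ennreal (1 / n) * (\<integral>\<^sup>+ x \<in> U. g x \<partial>M)"
      unfolding b_def using gm \<phi>M by (subst nn_integral_add) (auto simp: nn_integral_cmult intro!: borel_measurable_times_ennreal)
    also have "\<dots> \<le> b + ennreal (1 / n) * ennreal (p + \<delta>)" using G by (intro add_left_mono mult_left_mono) auto
    also have "ennreal (1 / n) * ennreal (p + \<delta>) = ennreal ((p + \<delta>) / n)"
      using p(2) \<delta> by (simp add: ennreal_mult[symmetric] del: ennreal_plus)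
    finally show ?thesis by (simp add: add_right_mono)
  qed
  \<comment> \<open>Lower semicontinuity gives lower bounds only, so it was applied to the weight
    \<open>1 - \<phi>\<close>. Subtraction from the total mass, which is almost p, gives the upper
    bound for the weight \<phi>.\<close>
  have aP: "a \<le> (\<integral>\<^sup>+ x \<in> U. ennreal (\<phi> x) \<partial>PM) + ennreal (3 * \<delta>)"
  proof -
    have sum1: "(\<integral>\<^sup>+ x \<in> U. ennreal (\<phi> x) \<partial>PM) + (\<integral>\<^sup>+ x \<in> U. ennreal (1 - \<phi> x) \<partial>PM) = ennreal p"
    proof -
      have "(\<lambda>x. ennreal (\<phi> x) * indicator U x) \<in> borel_measurable PM" "(\<lambda>x. ennreal (1 - \<phi> x) * indicator U x) \<in> borel_measurable PM"
        using U by (intro measurable_PM; measurable)+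
      then have "(\<integral>\<^sup>+ x \<in> U. ennreal (\<phi> x) \<partial>PM) + (\<integral>\<^sup>+ x \<in> U. ennreal (1 - \<phi> x) \<partial>PM) =
         (\<integral>\<^sup>+ x. ennreal (\<phi> x) * indicator U x + ennreal (1 - \<phi> x) * indicator U x \<partial>PM)"
        by (rule nn_integral_add[symmetric])
      also have "\<dots> = (\<integral>\<^sup>+ x. indicator U x \<partial>PM)"
        using \<phi>(2) by (intro nn_integral_cong) (simp add: distrib_right[symmetric] ennreal_plus[symmetric] del: ennreal_plus)
      also have "\<dots> = P U" using U by (simp add: emeasure_PM sets_PM)
      finally show ?thesis using p by simp
    qed
    have fin: "(\<integral>\<^sup>+ x \<in> U. ennreal (1 - \<phi> x) \<partial>PM) \<noteq> \<infinity>" using sum1 by (auto simp: add_top)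
    have "(\<integral>\<^sup>+ x \<in> U. ennreal (1 - \<phi> x) \<partial>PM) + a \<le> (b + ennreal \<delta> + ennreal \<delta>) + a"
      using PI nd by (meson add_left_mono add_right_mono ennreal_leI order_trans)
    also have "\<dots> = (a + b) + (ennreal \<delta> + ennreal \<delta>)" by (simp add: add_ac)
    also have "\<dots> \<le> ennreal (p + \<delta>) + (ennreal \<delta> + ennreal \<delta>)" using ab by (rule add_right_mono)
    also have "\<dots> = ennreal p + ennreal (3 * \<delta>)" using p \<delta> by (simp flip: ennreal_plus)
    also have "\<dots> = (\<integral>\<^sup>+ x \<in> U. ennreal (1 - \<phi> x) \<partial>PM) + ((\<integral>\<^sup>+ x \<in> U. ennreal (\<phi> x) \<partial>PM) + ennreal (3 * \<delta>))"
      unfolding sum1[symmetric] by (simp add: add_ac)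
    finally show ?thesis using fin by (subst (asm) ennreal_add_left_cancel_le) auto
  qed
  show "\<exists>w g. loc_lip U w \<and> ug U w g \<and> L1 V0 (\<lambda>x. w x - \<phi> x * chi x) \<le> ennreal \<epsilon> \<and>
     (\<integral>\<^sup>+ x \<in> U. g x \<partial>M) \<le> (\<integral>\<^sup>+ x \<in> U. ennreal (\<phi> x) \<partial>PM) + ennreal L * emeasure M (\<Omega> \<inter> U) + ennreal \<epsilon>"
  proof (intro exI conjI)
    show "loc_lip U (\<lambda>x. \<phi> x * w x)"
      by (intro loc_lip_mult w lipschitz_imp_loc_lip[OF lipschitz_on_subset[OF \<phi>(1)]]) auto
    show "ug U (\<lambda>x. \<phi> x * w x) (\<lambda>x. ennreal (\<phi> x + \<eta>) * g x + ennreal (L * \<bar>w x\<bar>))"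
      by (intro ug_weight w loc_lip_continuous[OF w(1) U(1)] lipschitz_on_subset[OF \<phi>(1)] \<eta>) (auto simp: \<phi>)
    have "L1 V0 (\<lambda>x. \<phi> x * w x - \<phi> x * chi x) \<le> L1 V0 (\<lambda>x. w x - chi x)"
    proof (rule L1_mono)
      fix x
      have "\<bar>\<phi> x * w x - \<phi> x * chi x\<bar> = \<phi> x * \<bar>w x - chi x\<bar>" using \<phi>(2)[of x] by (simp add: abs_mult flip: right_diff_distrib)
      also have "\<dots> \<le> 1 * \<bar>w x - chi x\<bar>" using \<phi>(2)[of x] by (intro mult_right_mono) auto
      finally show "\<bar>\<phi> x * w x - \<phi> x * chi x\<bar> \<le> \<bar>w x - chi x\<bar>" by simp
    qed
    also have "\<dots> \<le> L1 U (\<lambda>x. w x - chi x)" by (rule L1_mono_set[OF cc_subset[OF V0]])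
    also have "\<dots> \<le> ennreal \<epsilon>"
    proof -
      have "\<delta> * 1 \<le> \<delta> * (4 + p + L)" using \<delta> p(2) L by (intro mult_left_mono) auto
      then show ?thesis using w(3) e(2) \<delta>(2) by (auto intro: order_trans ennreal_leI)
    qed
    finally show "L1 V0 (\<lambda>x. \<phi> x * w x - \<phi> x * chi x) \<le> ennreal \<epsilon>" .
    have mw: "mble U w" "mble U (\<lambda>x. w x - chi x)" using mble_loc_lip[OF U(1) w(1)] mU by (auto intro: mble_diff)
    have "(\<integral>\<^sup>+ x \<in> U. (ennreal (\<phi> x + \<eta>) * g x + ennreal (L * \<bar>w x\<bar>)) \<partial>M) =
       (\<integral>\<^sup>+ x. (ennreal (\<phi> x) * (g x * indicator U x) + ennreal \<eta> * (g x * indicator U x)) + ennreal L * (ennreal \<bar>w x\<bar> * indicator U x) \<partial>M)"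
      using \<phi>(2) \<eta>(1) L by (intro nn_integral_cong) (auto simp: indicator_def ennreal_mult ennreal_plus distrib_right)
    also have "\<dots> = (a + ennreal \<eta> * (\<integral>\<^sup>+ x \<in> U. g x \<partial>M)) + ennreal L * L1 U w"
      unfolding a_def using gm \<phi>M mble_L1[OF mw(1)]
      by (subst nn_integral_add; (subst nn_integral_add)?; auto simp: nn_integral_cmult intro!: borel_measurable_times_ennreal borel_measurable_add)
    also have "\<dots> \<le> (((\<integral>\<^sup>+ x \<in> U. ennreal (\<phi> x) \<partial>PM) + ennreal (3 * \<delta>)) + ennreal \<delta>) + ennreal L * (emeasure M (\<Omega> \<inter> U) + ennreal \<delta>)"
    proof (intro add_mono aP mult_left_mono)
      have "ennreal \<eta> * (\<integral>\<^sup>+ x \<in> U. g x \<partial>M) \<le> ennreal \<eta> * ennreal (p + \<delta>)" by (intro mult_left_mono G) auto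
      also have "\<dots> = ennreal (\<eta> * (p + \<delta>))" using \<eta>(1) p(2) \<delta>(1) by (simp add: ennreal_mult)
      also have "\<dots> \<le> ennreal \<delta>" by (rule ennreal_leI[OF \<eta>(2)])
      finally show "ennreal \<eta> * (\<integral>\<^sup>+ x \<in> U. g x \<partial>M) \<le> ennreal \<delta>" .
      have "L1 U w \<le> L1 U chi + L1 U (\<lambda>x. w x - chi x)" by (rule L1_triangle[OF mU mw(2)]) linarith
      also have "L1 U chi = emeasure M (\<Omega> \<inter> U)"
      proof -
        have "L1 U chi = (\<integral>\<^sup>+ x. indicator (\<Omega> \<inter> U) x \<partial>M)" by (intro nn_integral_cong) (auto simp: indicator_def)
        then show ?thesis using Omega(3) U(1) by auto
      qed
      also have "L1 U (\<lambda>x. w x - chi x) \<le> ennreal \<delta>" using w(3) e(2) by (auto intro: order_trans ennreal_leI)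
      finally show "L1 U w \<le> emeasure M (\<Omega> \<inter> U) + ennreal \<delta>" by (simp add: add_left_mono)
    qed auto
    also have "\<dots> = (\<integral>\<^sup>+ x \<in> U. ennreal (\<phi> x) \<partial>PM) + ennreal L * emeasure M (\<Omega> \<inter> U) + (ennreal (3 * \<delta>) + ennreal \<delta> + ennreal L * ennreal \<delta>)"
      by (simp add: distrib_left add_ac)
    also have "ennreal (3 * \<delta>) + ennreal \<delta> + ennreal L * ennreal \<delta> = ennreal (\<delta> * (4 + L))"
      using \<delta>(1) L by (simp add: ennreal_mult[symmetric] ennreal_plus[symmetric] algebra_simps del: ennreal_plus)
    also have "\<dots> \<le> ennreal \<epsilon>"
    proof (rule ennreal_leI)
      have "\<delta> * (4 + L) \<le> \<delta> * (4 + p + L)" using \<delta>(1) p(2) by (intro mult_left_mono) auto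
      then show "\<delta> * (4 + L) \<le> \<epsilon>" using \<delta>(2) by simp
    qed
    finally show "(\<integral>\<^sup>+ x \<in> U. (ennreal (\<phi> x + \<eta>) * g x + ennreal (L * \<bar>w x\<bar>)) \<partial>M) \<le>
       (\<integral>\<^sup>+ x \<in> U. ennreal (\<phi> x) \<partial>PM) + ennreal L * emeasure M (\<Omega> \<inter> U) + ennreal \<epsilon>" by (simp add: add_left_mono)
  qed
qed

text \<open>A sublevel set of \<open>rho\<close> is a compact subset of \<Omega>, hence at positive
  distance from the boundary.\<close>

lemma near_Bd_rho:
  obtains \<delta> where "\<delta> > 0" "\<And>x. x \<in> \<Omega> \<Longrightarrow> infdist x Bd < \<delta> \<Longrightarrow> t < rho \<Omega> x"
proof -
  define K where "K = {x\<in>\<Omega>. rho \<Omega> x \<in> {..t}}"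
  have K: "compact K" unfolding K_def by (rule closed_rho[OF Omega(3)]) auto
  show thesis
  proof (cases "K = {}")
    case True
    then show thesis by (intro that[of 1]) (auto simp: K_def not_le)
  next
    case False
    have "continuous_on K (\<lambda>x. infdist x Bd)" by (intro continuous_intros)
    from continuous_attains_inf[OF K False this] obtain x where x: "x \<in> K" "\<And>y. y \<in> K \<Longrightarrow> infdist x Bd \<le> infdist y Bd" by blast
    have "x \<notin> Bd" using x(1) Omega(3) by (auto simp: K_def frontier_def interior_open)
    then have "0 < infdist x Bd" using frontier_ne by (intro infdist_pos_not_in_closed) auto
    moreover have "t < rho \<Omega> y" if "y \<in> \<Omega>" "infdist y Bd < infdist x Bd" for y
      using x(2)[of y] that by (auto simp: K_def not_le[symmetric])
    ultimately show thesis using that by blast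
  qed
qed

lemma bounded_near_Bd: "bounded {x. infdist x Bd < c}"
proof -
  obtain a R where R: "Bd \<subseteq> ball a R" by (meson bounded_subset_ballD compact_Bd compact_imp_bounded)
  have "{x. infdist x Bd < c} \<subseteq> ball a (R + c)"
  proof
    fix x assume "x \<in> {x. infdist x Bd < c}"
    then obtain b where "b \<in> Bd" "dist x b < c" using infdist_lessD[of x Bd c] frontier_ne by auto
    then show "x \<in> ball a (R + c)" using R dist_triangle[of a x b] by (auto simp: dist_commute subset_eq)
  qed
  then show ?thesis by (rule bounded_subset[OF bounded_ball])
qed

lemma avg_add:
  assumes "f \<in> borel_measurable M" "g \<in> borel_measurable M"
  shows "avg r (\<lambda>y. f y + g y) x = avg r f x + avg r g x"
  unfolding avg_def distrib_right using assms
  by (subst nn_integral_add) (auto simp: add_divide_distrib_ennreal)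

lemma avg_mono: "(\<And>y. y \<in> ball x r \<Longrightarrow> f y \<le> g y) \<Longrightarrow> avg r f x \<le> avg r g x"
  unfolding avg_def by (intro divide_right_mono_ennreal nn_integral_mono) (auto simp: indicator_def)

text \<open>Two ways in which the averages at x are under control: \<Omega> has density 0 at x along
  the radii 1/(k+1), or the averages of \<open>\<bar>V y - \<tau> x\<bar>\<close> over
  \<Omega>-parts of balls vanish in the limit, as they do when \<open>\<tau> x\<close> is the trace.
  The first alternative is for boundary points outside \<open>mt\<close>, where no trace is
  available and the value of \<tau> is arbitrary.\<close>

definition good :: "('a \<Rightarrow> real) \<Rightarrow> ('a \<Rightarrow> real) \<Rightarrow> 'a \<Rightarrow> bool" where
  "good V \<tau> x \<longleftrightarrow> (\<lambda>k. avg (1 / real (Suc k)) (indicator \<Omega>) x) \<longlonglongrightarrow> 0 \<or>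
     (\<lambda>k. avg (1 / real (Suc k)) (\<lambda>y. ennreal (\<bar>V y - \<tau> x\<bar> * chi y)) x) \<longlonglongrightarrow> 0"

text \<open>At points of density 0 the bound \<open>\<bar>V y - \<phi> y\<bar> \<le> 1\<close>
  suffices. At the others \<open>\<phi> y\<close> is replaced by \<open>\<phi> x\<close> with the
  help of the Lipschitz constant, which costs L times the radius.\<close>

lemma upper_avg_good:
  assumes m: "mble UNIV V" and V: "\<And>x. 0 \<le> V x \<and> V x \<le> 1" and \<phi>: "L-lipschitz_on UNIV \<phi>" "\<And>x. 0 \<le> \<phi> x \<and> \<phi> x \<le> 1"
    and x: "good V \<tau> x"
  shows "upper_avg (\<lambda>y. (V y - \<phi> y) * chi y) x \<le> ennreal \<bar>\<tau> x - \<phi> x\<bar>"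
proof (rule ennreal_le_epsilon)
  fix e :: real assume e: "e > 0"
  have L: "0 \<le> L" using \<phi>(1) by (rule lipschitz_on_nonneg)
  let ?r = "\<lambda>k::nat. 1 / real (Suc k)"
  let ?W = "\<lambda>y. ennreal \<bar>(V y - \<phi> y) * chi y\<bar>"
  have Vm: "V \<in> borel_measurable M" using m by (simp add: mble_UNIV)
  have "\<forall>\<^sub>F k in sequentially. avg (?r k) ?W x \<le> ennreal \<bar>\<tau> x - \<phi> x\<bar> + ennreal e"
    using x unfolding good_def
  proof
    assume "(\<lambda>k. avg (?r k) (indicator \<Omega>) x) \<longlonglongrightarrow> 0"
    then have "\<forall>\<^sub>F k in sequentially. avg (?r k) (indicator \<Omega>) x < ennreal e" using e by (intro order_tendstoD) auto
    then show ?thesis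
    proof eventually_elim
      case (elim k)
      have "avg (?r k) ?W x \<le> avg (?r k) (indicator \<Omega>) x"
      proof (rule avg_mono)
        fix y
        have "\<bar>V y - \<phi> y\<bar> \<le> 1" using V[of y] \<phi>(2)[of y] by auto
        then show "?W y \<le> indicator \<Omega> y" by (auto simp: indicator_def abs_mult ennreal_le_1)
      qed
      with elim have "avg (?r k) ?W x \<le> ennreal e" by simp
      then show ?case by (rule order_trans) simp
    qed
  next
    assume *: "(\<lambda>k. avg (?r k) (\<lambda>y. ennreal (\<bar>V y - \<tau> x\<bar> * chi y)) x) \<longlonglongrightarrow> 0"
    have "\<forall>\<^sub>F k in sequentially. avg (?r k) (\<lambda>y. ennreal (\<bar>V y - \<tau> x\<bar> * chi y)) x < ennreal (e/2)"
      using * by (rule order_tendstoD) (use e in simp)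
    moreover have "(\<lambda>k. L * ?r k) \<longlonglongrightarrow> L * 0"
      using LIMSEQ_inverse_real_of_nat by (intro tendsto_mult tendsto_const) (simp add: inverse_eq_divide)
    then have "\<forall>\<^sub>F k in sequentially. L * ?r k < e/2" by (rule order_tendstoD) (use e in simp)
    ultimately show ?thesis
    proof eventually_elim
      case (elim k)
      have "avg (?r k) ?W x \<le> avg (?r k) (\<lambda>y. ennreal (\<bar>V y - \<tau> x\<bar> * chi y) + ennreal (\<bar>\<tau> x - \<phi> x\<bar> + e/2)) x"
      proof (rule avg_mono)
        fix y assume y: "y \<in> ball x (?r k)"
        have "\<bar>\<phi> x - \<phi> y\<bar> \<le> L * dist x y" using lipschitz_onD[OF \<phi>(1), of x y] by (simp add: dist_real_def)
        also have "\<dots> \<le> L * ?r k" using y L by (intro mult_left_mono) auto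
        finally have "\<bar>\<phi> x - \<phi> y\<bar> \<le> e/2" using elim(2) by linarith
        then have "\<bar>(V y - \<phi> y) * chi y\<bar> \<le> \<bar>V y - \<tau> x\<bar> * chi y + (\<bar>\<tau> x - \<phi> x\<bar> + e/2)"
        proof (cases "y \<in> \<Omega>")
          case True
          have "\<bar>V y - \<phi> y\<bar> \<le> \<bar>V y - \<tau> x\<bar> + \<bar>\<tau> x - \<phi> x\<bar> + \<bar>\<phi> x - \<phi> y\<bar>" by linarith
          then have "\<bar>V y - \<phi> y\<bar> \<le> \<bar>V y - \<tau> x\<bar> + (\<bar>\<tau> x - \<phi> x\<bar> + e/2)" using \<open>\<bar>\<phi> x - \<phi> y\<bar> \<le> e/2\<close> by linarith
          then show ?thesis using True by simp
        qed (use e in simp)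
        then show "?W y \<le> ennreal (\<bar>V y - \<tau> x\<bar> * chi y) + ennreal (\<bar>\<tau> x - \<phi> x\<bar> + e/2)"
          using e by (intro ennreal_le_add) auto
      qed
      also have "\<dots> = avg (?r k) (\<lambda>y. ennreal (\<bar>V y - \<tau> x\<bar> * chi y)) x + avg (?r k) (\<lambda>y. ennreal (\<bar>\<tau> x - \<phi> x\<bar> + e/2)) x"
      proof (rule avg_add)
        show "(\<lambda>y. ennreal (\<bar>V y - \<tau> x\<bar> * chi y)) \<in> borel_measurable M" using Vm Omega(3) by measurable
      qed simp
      also have "\<dots> \<le> ennreal (e/2) + ennreal (\<bar>\<tau> x - \<phi> x\<bar> + e/2)"
        by (rule add_mono[OF less_imp_le[OF elim(1)] avg_le]) auto
      also have "\<dots> = ennreal \<bar>\<tau> x - \<phi> x\<bar> + ennreal e"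
        using e by (simp add: ennreal_plus[symmetric] del: ennreal_plus)
      finally show ?case .
    qed
  qed
  then show "upper_avg (\<lambda>y. (V y - \<phi> y) * chi y) x \<le> ennreal \<bar>\<tau> x - \<phi> x\<bar> + ennreal e"
    unfolding upper_avg_def by (rule Limsup_bounded)
qed

text \<open>In a thin collar \<open>TV_weight\<close> is applied to \<open>\<phi> * chi\<close> and
  \<open>TV_boundary\<close> to the remainder W, whose upper averages are at most
  \<open>\<bar>\<tau> x - \<phi> x\<bar>\<close> almost everywhere. On S the function \<phi> is
  compared with \<tau>; off S only \<phi> \<le> 1 is used, which accounts for the term
  \<open>P (- S)\<close>.\<close>

lemma TV_trace_bound:
  assumes m: "mble UNIV V" and V: "\<And>x. 0 \<le> V x \<and> V x \<le> 1" "\<And>x. x \<notin> \<Omega> \<Longrightarrow> V x = 0" and fin: "TV V \<Omega> < \<infinity>"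
    and \<tau>: "\<tau> \<in> borel_measurable borel" "\<And>x. 0 \<le> \<tau> x \<and> \<tau> x \<le> 1"
    and good: "H {x\<in>Bd. \<not> good V \<tau> x} = 0" and S: "S \<in> sets PM"
  shows "TV V UNIV \<le> TV V \<Omega> + (\<integral>\<^sup>+ x \<in> S. ennreal (\<tau> x) \<partial>PM) + P (- S)"
proof (rule ennreal_le_epsilon)
  fix e :: real assume e: "e > 0"
  \<comment> \<open>Errors: the approximation of \<tau> in the perimeter measure, the term with L
    once for \<open>\<phi> * chi\<close> and once for W, the tail of V, and \<open>Cb\<close> times
    the approximation of \<tau> in the Hausdorff measure.\<close>
  define \<epsilon> where "\<epsilon> = e / (4 + Cb)"
  have q: "0 < 4 + Cb" using Cb_ge1 by simp
  have \<epsilon>: "\<epsilon> > 0" "\<epsilon> * (4 + Cb) = e" using e q by (simp_all add: \<epsilon>_def)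
  have HB: "Bd \<in> sets HM" "emeasure HM Bd < \<infinity>" using H_Bd_finite by (auto simp: sets_HM emeasure_HM)
  have PS: "emeasure PM S < \<infinity>" using P_finite S by (simp add: emeasure_PM)
  have bH: "sets borel \<subseteq> sets HM" and bP: "sets borel \<subseteq> sets PM" using sets_HM sets_PM by auto
  obtain L \<phi> where \<phi>: "L-lipschitz_on UNIV \<phi>" "\<And>x. 0 \<le> \<phi> x \<and> \<phi> x \<le> (1::real)"
    "(\<integral>\<^sup>+ x \<in> Bd. ennreal \<bar>\<tau> x - \<phi> x\<bar> \<partial>HM) + (\<integral>\<^sup>+ x \<in> S. ennreal \<bar>\<tau> x - \<phi> x\<bar> \<partial>PM) \<le> ennreal \<epsilon>"
    using lipschitz_dense[OF bH space_HM bP space_PM HB S PS \<tau> \<epsilon>(1)] by blast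
  have L: "0 \<le> L" using \<phi>(1) by (rule lipschitz_on_nonneg)
  have \<phi>b [measurable]: "\<phi> \<in> borel_measurable borel"
    by (intro borel_measurable_continuous_onI lipschitz_on_continuous_on[OF \<phi>(1)])
  note [measurable] = \<tau>(1)
  have e1: "(\<integral>\<^sup>+ x \<in> Bd. ennreal \<bar>\<tau> x - \<phi> x\<bar> \<partial>HM) \<le> ennreal \<epsilon>" "(\<integral>\<^sup>+ x \<in> S. ennreal \<bar>\<tau> x - \<phi> x\<bar> \<partial>PM) \<le> ennreal \<epsilon>"
    using \<phi>(3) by (auto intro: order_trans[rotated])
  have mO: "mble \<Omega> V" using m Omega(3) by (auto intro: mble_subset)
  obtain N :: nat where N: "TV V {x\<in>\<Omega>. real N < rho \<Omega> x} \<le> ennreal \<epsilon>"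
    using TV_tail[OF Omega(3) mO fin \<epsilon>(1)] .
  obtain \<delta> where \<delta>: "\<delta> > 0" "\<And>x. x \<in> \<Omega> \<Longrightarrow> infdist x Bd < \<delta> \<Longrightarrow> real N < rho \<Omega> x"
    using near_Bd_rho[of "real N"] by blast
  have "\<forall>\<^sub>F k in sequentially. ennreal L * emeasure M (\<Omega> \<inter> {x. infdist x Bd < 1 / real (Suc k)}) < ennreal \<epsilon>"
  proof -
    have "(\<lambda>k. ennreal L * emeasure M (\<Omega> \<inter> {x. infdist x Bd < 1 / real (Suc k)})) \<longlonglongrightarrow> ennreal L * 0"
      by (intro ennreal_tendsto_cmult near_Bd_vanishes) auto
    then show ?thesis using \<epsilon> by (intro order_tendstoD) auto
  qed
  moreover have "\<forall>\<^sub>F k in sequentially. 1 / real (Suc k) < \<delta>"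
  proof -
    have "(\<lambda>k. 1 / real (Suc k)) \<longlonglongrightarrow> 0" using LIMSEQ_inverse_real_of_nat by (simp add: inverse_eq_divide)
    then show ?thesis by (rule order_tendstoD) (rule \<delta>(1))
  qed
  ultimately have "\<forall>\<^sub>F k in sequentially. ennreal L * emeasure M (\<Omega> \<inter> {x. infdist x Bd < 1 / real (Suc k)}) < ennreal \<epsilon> \<and> 1 / real (Suc k) < \<delta>"
    by (rule eventually_conj)
  then obtain k :: nat where k: "ennreal L * emeasure M (\<Omega> \<inter> {x. infdist x Bd < 1 / real (Suc k)}) < ennreal \<epsilon>" "1 / real (Suc k) < \<delta>"
    by (auto dest: eventually_happens)
  \<comment> \<open>The collar is so thin that V varies by at most \<epsilon> in its part inside
    \<Omega>, and that L times the measure of this part is below \<epsilon>.\<close>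
  define U where "U = {x. infdist x Bd < 1 / real (Suc k)}"
  have U: "open U" "emeasure M U < \<infinity>" unfolding U_def by (rule open_infdist_less, rule finite_measure_bounded[OF bounded_near_Bd])
  have BdU: "Bd \<subseteq> U" by (auto simp: U_def)
  have OU: "open (\<Omega> \<inter> U)" "\<Omega> \<inter> U \<subseteq> {x\<in>\<Omega>. real N < rho \<Omega> x}"
    using U Omega(3) \<delta>(2) k(2) by (auto simp: U_def)
  have tail: "TV V (\<Omega> \<inter> U) \<le> ennreal \<epsilon>"
    by (rule order_trans[OF TV_mono N]) (use OU open_rho[OF Omega(3), of "{real N<..}"] in auto)
  define W where "W y = (V y - \<phi> y) * chi y" for y
  have mW: "mble UNIV W" unfolding W_def by (intro mble_mult mble_diff m chi_mble mble_borel \<phi>b) auto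
  have W1: "\<bar>W x\<bar> \<le> 1" for x using V(1)[of x] \<phi>(2)[of x] by (auto simp: W_def indicator_def)
  have W0: "W x = 0" if "x \<notin> \<Omega>" for x using that by (simp add: W_def)
  have "TV V UNIV = TV V ((\<Omega> \<union> U) \<union> - closure \<Omega>)"
    using frontier_cases BdU by (intro arg_cong[where f = "TV V"]) auto
  also have "\<dots> \<le> TV V (\<Omega> \<union> U) + TV V (- closure \<Omega>)"
    using U Omega(3) by (intro TV_subadd mble_subset[OF m] sets_M_open open_Un open_Compl) auto
  also have "TV V (- closure \<Omega>) = 0" by (rule TV_exterior[OF V(2)])
  also have "TV V (\<Omega> \<union> U) \<le> TV V \<Omega> + TV V U"
    using U Omega(3) by (intro TV_subadd mble_subset[OF m] sets_M_open open_Un) auto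
  finally have 1: "TV V UNIV \<le> TV V \<Omega> + TV V U" by simp
  have "TV V U = TV (\<lambda>x. \<phi> x * chi x + W x) U"
    using V(2) by (intro TV_cong) (auto simp: W_def indicator_def)
  also have "\<dots> \<le> TV (\<lambda>x. \<phi> x * chi x) U + TV W U"
    using U by (intro TV_add mble_subset[OF mW] mble_subset[OF mble_mult[OF mble_borel[OF \<phi>b] chi_mble]]) auto
  also have "TV (\<lambda>x. \<phi> x * chi x) U \<le> ((\<integral>\<^sup>+ x \<in> S. ennreal (\<tau> x) \<partial>PM) + ennreal \<epsilon> + P (- S)) + ennreal \<epsilon>"
  proof -
    have mS: "(\<lambda>x. ennreal (\<tau> x) * indicator S x) \<in> borel_measurable PM" "(\<lambda>x. ennreal \<bar>\<tau> x - \<phi> x\<bar> * indicator S x) \<in> borel_measurable PM"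
      using S by (intro borel_measurable_times_ennreal borel_measurable_indicator measurable_PM; measurable)+
    have mS': "(indicator (- S) :: 'a \<Rightarrow> ennreal) \<in> borel_measurable PM"
      using sets.compl_sets[OF S] by (intro borel_measurable_indicator) (simp add: Compl_eq_Diff_UNIV)
    have "(\<integral>\<^sup>+ x \<in> U. ennreal (\<phi> x) \<partial>PM) \<le> (\<integral>\<^sup>+ x. (ennreal (\<tau> x) * indicator S x + ennreal \<bar>\<tau> x - \<phi> x\<bar> * indicator S x) + indicator (- S) x \<partial>PM)"
    proof (rule nn_integral_mono)
      fix x
      have "ennreal (\<phi> x) \<le> ennreal (\<tau> x) + ennreal \<bar>\<tau> x - \<phi> x\<bar>" using \<tau>(2)[of x] by (intro ennreal_le_add) auto
      moreover have "ennreal (\<phi> x) \<le> 1" using \<phi>(2)[of x] by (simp add: ennreal_le_1)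
      ultimately show "ennreal (\<phi> x) * indicator U x \<le> (ennreal (\<tau> x) * indicator S x + ennreal \<bar>\<tau> x - \<phi> x\<bar> * indicator S x) + indicator (- S) x"
        by (auto simp: indicator_def)
    qed
    also have "\<dots> = ((\<integral>\<^sup>+ x \<in> S. ennreal (\<tau> x) \<partial>PM) + (\<integral>\<^sup>+ x \<in> S. ennreal \<bar>\<tau> x - \<phi> x\<bar> \<partial>PM)) + P (- S)"
      using mS mS' sets.compl_sets[OF S]
      by (simp add: nn_integral_add emeasure_PM Compl_eq_Diff_UNIV)
    also have "\<dots> \<le> ((\<integral>\<^sup>+ x \<in> S. ennreal (\<tau> x) \<partial>PM) + ennreal \<epsilon>) + P (- S)"
      by (intro add_mono e1) auto
    finally have "(\<integral>\<^sup>+ x \<in> U. ennreal (\<phi> x) \<partial>PM) + ennreal L * emeasure M (\<Omega> \<inter> U) \<le> ((\<integral>\<^sup>+ x \<in> S. ennreal (\<tau> x) \<partial>PM) + ennreal \<epsilon> + P (- S)) + ennreal \<epsilon>"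
      using k(1) by (intro add_mono) (auto simp: U_def)
    with TV_weight[OF U \<phi>(1,2)] show ?thesis by (rule order_trans)
  qed
  also have "TV W U \<le> (ennreal \<epsilon> + ennreal \<epsilon>) + ennreal Cb * ennreal \<epsilon>"
  proof -
    have "TV W U \<le> TV W (\<Omega> \<inter> U) + ennreal Cb * (\<integral>\<^sup>+ x \<in> Bd \<inter> (\<Union>y\<in>U. ball y 1). upper_avg W x \<partial>HM)"
      by (rule TV_boundary[OF U(1) mW W1 W0]) auto
    also have "(\<integral>\<^sup>+ x \<in> Bd \<inter> (\<Union>y\<in>U. ball y 1). upper_avg W x \<partial>HM) \<le> (\<integral>\<^sup>+ x \<in> Bd. ennreal \<bar>\<tau> x - \<phi> x\<bar> \<partial>HM)"
    proof (rule nn_integral_mono_AE)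
      have "{x\<in>Bd. \<not> good V \<tau> x} \<in> null_sets HM" by (rule outer_null_sets[OF H_outer good])
      then have "AE x in HM. x \<notin> {x\<in>Bd. \<not> good V \<tau> x}" by (rule AE_not_in)
      then show "AE x in HM. upper_avg W x * indicator (Bd \<inter> (\<Union>y\<in>U. ball y 1)) x \<le> ennreal \<bar>\<tau> x - \<phi> x\<bar> * indicator Bd x"
      proof eventually_elim
        case (elim x)
        then have "x \<in> Bd \<Longrightarrow> upper_avg W x \<le> ennreal \<bar>\<tau> x - \<phi> x\<bar>"
          unfolding W_def using upper_avg_good[OF m V(1) \<phi>(1,2), of \<tau> x] by auto
        then show ?case by (auto simp: indicator_def)
      qed
    qed
    also have "\<dots> \<le> ennreal \<epsilon>" by (rule e1)
    also have "TV W (\<Omega> \<inter> U) = TV (\<lambda>x. V x + (-1) * \<phi> x) (\<Omega> \<inter> U)"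
      by (intro TV_cong) (auto simp: W_def)
    also have "\<dots> \<le> TV V (\<Omega> \<inter> U) + TV (\<lambda>x. (-1) * \<phi> x) (\<Omega> \<inter> U)"
      using OU(1) by (intro TV_add mble_subset[OF m] mble_cmult mble_borel \<phi>b) auto
    also have "TV (\<lambda>x. (-1) * \<phi> x) (\<Omega> \<inter> U) \<le> ennreal \<bar>-1\<bar> * TV \<phi> (\<Omega> \<inter> U)"
      using OU(1) by (intro TV_cmult mble_borel \<phi>b) auto
    also have "ennreal \<bar>-1\<bar> * TV \<phi> (\<Omega> \<inter> U) \<le> ennreal L * emeasure M (\<Omega> \<inter> U)"
      using TV_lipschitz[OF OU(1) lipschitz_on_subset[OF \<phi>(1)]] by simp
    also have "\<dots> \<le> ennreal \<epsilon>" using k(1) by (simp add: U_def)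
    finally have "TV W U \<le> (TV V (\<Omega> \<inter> U) + ennreal \<epsilon>) + ennreal Cb * ennreal \<epsilon>"
      by (simp add: add_mono mult_left_mono)
    also have "\<dots> \<le> (ennreal \<epsilon> + ennreal \<epsilon>) + ennreal Cb * ennreal \<epsilon>" by (intro add_mono tail order_refl)
    finally show ?thesis .
  qed
  also have "((\<integral>\<^sup>+ x \<in> S. ennreal (\<tau> x) \<partial>PM) + ennreal \<epsilon> + P (- S)) + ennreal \<epsilon> + ((ennreal \<epsilon> + ennreal \<epsilon>) + ennreal Cb * ennreal \<epsilon>) =
     ((\<integral>\<^sup>+ x \<in> S. ennreal (\<tau> x) \<partial>PM) + P (- S)) + (ennreal \<epsilon> + ennreal \<epsilon> + ennreal \<epsilon> + ennreal \<epsilon> + ennreal Cb * ennreal \<epsilon>)"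
    by (simp add: add_ac)
  also have "ennreal \<epsilon> + ennreal \<epsilon> + ennreal \<epsilon> + ennreal \<epsilon> + ennreal Cb * ennreal \<epsilon> = ennreal e"
  proof -
    have "ennreal Cb * ennreal \<epsilon> = ennreal (Cb * \<epsilon>)" using Cb_ge1 \<epsilon> by (simp add: ennreal_mult)
    then show ?thesis using Cb_ge1 \<epsilon>
      by (simp add: ennreal_plus[symmetric] algebra_simps del: ennreal_plus)
  qed
  finally have 2: "TV V U \<le> ((\<integral>\<^sup>+ x \<in> S. ennreal (\<tau> x) \<partial>PM) + P (- S)) + ennreal e"
    by (simp add: add_mono add_left_mono add_right_mono)
  have "TV V UNIV \<le> TV V \<Omega> + (((\<integral>\<^sup>+ x \<in> S. ennreal (\<tau> x) \<partial>PM) + P (- S)) + ennreal e)"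
    using 1 2 add_left_mono order_trans by blast
  then show "TV V UNIV \<le> TV V \<Omega> + (\<integral>\<^sup>+ x \<in> S. ennreal (\<tau> x) \<partial>PM) + P (- S) + ennreal e"
    by (simp add: add_ac)
qed

end

section \<open>Traces\<close>

lemma Limsup_null_bound:
  fixes f :: "real \<Rightarrow> ennreal"
  assumes "\<forall>\<^sub>F r in at_right 0. f r = 0"
  shows "\<not> Limsup (at_right 0) f > 0"
  using Limsup_bounded[of f 0 "at_right 0"] assms by (auto simp: eventually_mono)

lemma eventually_small_radius:
  assumes "d > 0" "\<And>r. 0 < r \<Longrightarrow> r \<le> d \<Longrightarrow> Q r"
  shows "\<forall>\<^sub>F r in at_right (0::real). Q r"
  unfolding eventually_at_right_field using assms by (intro exI[of _ d]) auto

context doubling_measure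
begin

text \<open>Otherwise infinitely many \<open>w i\<close> would have variation below
  \<open>TV u U - \<epsilon>\<close>, and lower semicontinuity along them would bound
  \<open>TV u U\<close> by this number.\<close>

lemma eventually_TV_le:
  assumes U: "open U" and m: "mble U u" "\<And>i::nat. mble U (w i)" and fin: "TV u U < \<infinity>"
    and lim: "(\<lambda>i. L1 U (\<lambda>x. w i x - u x)) \<longlonglongrightarrow> 0" and \<epsilon>: "\<epsilon> > 0"
  shows "\<forall>\<^sub>F i in sequentially. TV u U \<le> TV (w i) U + ennreal \<epsilon>"
proof (rule ccontr)
  assume "\<not> ?thesis"
  then have fr: "\<exists>\<^sub>F i in sequentially. TV (w i) U + ennreal \<epsilon> < TV u U"
    by (simp add: frequently_def not_less)
  define c where "c = TV u U - ennreal \<epsilon>"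
  have "TV u U \<le> c"
  proof (rule TV_lsc[OF U m(1)])
    fix V and \<delta> :: real assume V: "compactly_contained V U" "\<delta> > 0"
    have "\<forall>\<^sub>F i in sequentially. L1 U (\<lambda>x. w i x - u x) < ennreal \<delta>" using lim V by (intro order_tendstoD) auto
    from frequently_eventually_frequently[OF fr this] obtain i where i: "TV (w i) U + ennreal \<epsilon> < TV u U" "L1 U (\<lambda>x. w i x - u x) < ennreal \<delta>"
      by (auto dest: frequently_ex)
    have "L1 V (\<lambda>x. w i x - u x) \<le> L1 U (\<lambda>x. w i x - u x)" by (rule L1_mono_set[OF cc_subset[OF V(1)]])
    then have "L1 V (\<lambda>x. w i x - u x) \<le> ennreal \<delta>" using i(2) by (meson less_imp_le order_trans)
    moreover have "TV (w i) U \<le> c"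
      unfolding c_def using i(1) by (simp add: ennreal_le_minus_iff add.commute less_imp_le)
    then have "TV (w i) U \<le> c + ennreal \<delta>" by (simp add: add_increasing2)
    ultimately show "\<exists>v. mble U v \<and> L1 V (\<lambda>x. v x - u x) \<le> ennreal \<delta> \<and> TV v U \<le> c + ennreal \<delta>" using m(2) by blast
  qed
  moreover have "0 < TV u U" using frequently_ex[OF fr] by (auto intro: le_less_trans)
  then have "c < TV u U" unfolding c_def using fin \<epsilon> by (intro ennreal_between) auto
  ultimately show False by simp
qed

text \<open>At interior and at exterior points one of the two density quotients is 0 for all small
  radii.\<close>

lemma mt_boundary_subset_frontier:
  assumes O: "open U"
  shows "mt_boundary \<mu> U \<subseteq> frontier U"
proof
  fix x assume x: "x \<in> mt_boundary \<mu> U"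
  show "x \<in> frontier U"
  proof (rule ccontr)
    assume "x \<notin> frontier U"
    then consider "x \<in> U" | "x \<in> - closure U" using O by (auto simp: frontier_def interior_open)
    then show False
    proof cases
      case 1
      then obtain d where d: "d > 0" "ball x d \<subseteq> U" using O by (auto simp: open_contains_ball)
      have "\<forall>\<^sub>F r in at_right 0. \<mu> (ball x r - U) / \<mu> (ball x r) = 0"
      proof (rule eventually_small_radius[OF d(1)])
        fix r :: real assume "0 < r" "r \<le> d"
        then have "ball x r - U = {}" using d by auto
        then show "\<mu> (ball x r - U) / \<mu> (ball x r) = 0" using outer_measureD(1)[OF outer_measure_mu] by (simp only:) simp
      qed
      from Limsup_null_bound[OF this] show False using x by (simp add: mt_boundary_def)
    next
      case 2
      then obtain d where d: "d > 0" "ball x d \<subseteq> - closure U" using open_Compl[OF closed_closure] by (metis open_contains_ball)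
      have "\<forall>\<^sub>F r in at_right 0. \<mu> (ball x r \<inter> U) / \<mu> (ball x r) = 0"
      proof (rule eventually_small_radius[OF d(1)])
        fix r :: real assume "0 < r" "r \<le> d"
        then have "ball x r \<inter> U = {}" using d closure_subset[of U] by force
        then show "\<mu> (ball x r \<inter> U) / \<mu> (ball x r) = 0" using outer_measureD(1)[OF outer_measure_mu] by (simp only:) simp
      qed
      from Limsup_null_bound[OF this] show False using x by (simp add: mt_boundary_def)
    qed
  qed
qed

end

section \<open>Pointwise traces\<close>

context neumann_domain
begin

abbreviation mt :: "'a set" where "mt \<equiv> mt_boundary \<mu> \<Omega>"

lemma ball_Omega_sets [measurable]: "ball x r \<inter> \<Omega> \<in> sets M"
  using Omega(3) by auto

lemma mt_subset_Bd: "mt \<subseteq> Bd"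
  using mt_boundary_subset_frontier[OF Omega(3)] .

lemma closure_Omega_Bd: "x \<in> Bd \<Longrightarrow> x \<in> closure \<Omega>"
  by (simp add: frontier_def)

text \<open>The denominators in the definition of the trace are positive and finite, because a ball
  around a point of the closure contains a small ball of \<Omega>.\<close>

lemma mu_ball_Omega:
  assumes "x \<in> closure \<Omega>" "r > 0"
  shows "0 < \<mu> (ball x r \<inter> \<Omega>)" "\<mu> (ball x r \<inter> \<Omega>) < \<infinity>"
proof -
  obtain y where y: "y \<in> \<Omega>" "dist y x < r" using assms closure_approachable by blast
  then have "y \<in> ball x r \<inter> \<Omega>" "open (ball x r \<inter> \<Omega>)" using Omega(3) by (auto simp: dist_commute)
  then obtain d where d: "d > 0" "ball y d \<subseteq> ball x r \<inter> \<Omega>" by (metis open_contains_ball)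
  have "0 < \<mu> (ball y d)" using Cd(2)[OF d(1)] .
  also have "\<dots> \<le> \<mu> (ball x r \<inter> \<Omega>)" by (rule outer_measureD(2)[OF outer_measure_mu d(2)])
  finally show "0 < \<mu> (ball x r \<inter> \<Omega>)" .
  have "\<mu> (ball x r \<inter> \<Omega>) \<le> \<mu> (ball x r)" by (rule outer_measureD(2)[OF outer_measure_mu]) auto
  then show "\<mu> (ball x r \<inter> \<Omega>) < \<infinity>" using Cd(3)[OF assms(2)] by (rule le_less_trans)
qed

definition trace_quotient :: "('a \<Rightarrow> real) \<Rightarrow> real \<Rightarrow> 'a \<Rightarrow> real \<Rightarrow> ennreal" where
  "trace_quotient u t x r = (\<integral>\<^sup>+ y \<in> ball x r \<inter> \<Omega>. ennreal \<bar>u y - t\<bar> \<partial>M) / \<mu> (ball x r \<inter> \<Omega>)"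

lemma is_trace_iff_quotient: "is_trace \<mu> \<Omega> u x t \<longleftrightarrow> (trace_quotient u t x \<longlongrightarrow> 0) (at_right 0)"
  by (simp add: is_trace_def trace_quotient_def[abs_def])

lemma is_trace_sequence: "is_trace \<mu> \<Omega> u x t \<Longrightarrow> (\<lambda>k. trace_quotient u t x (1 / real (Suc k))) \<longlonglongrightarrow> 0"
proof -
  assume "is_trace \<mu> \<Omega> u x t"
  moreover have "filterlim (\<lambda>k. 1 / real (Suc k)) (at_right 0) sequentially"
  proof -
    have "(\<lambda>k. 1 / real (Suc k)) \<longlonglongrightarrow> 0" using LIMSEQ_inverse_real_of_nat by (simp add: inverse_eq_divide)
    then show ?thesis by (rule tendsto_imp_filterlim_at_right) auto
  qed
  ultimately show ?thesis unfolding is_trace_iff_quotient by (rule filterlim_compose)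
qed

lemma trace_quotient_const: "x \<in> closure \<Omega> \<Longrightarrow> r > 0 \<Longrightarrow> trace_quotient (\<lambda>_. s) t x r = ennreal \<bar>s - t\<bar>"
proof -
  assume x: "x \<in> closure \<Omega>" "r > 0"
  have m: "emeasure M (ball x r \<inter> \<Omega>) = \<mu> (ball x r \<inter> \<Omega>)" using Omega(3) by (intro emeasure_M) auto
  have "trace_quotient (\<lambda>_. s) t x r = ennreal \<bar>s - t\<bar> * \<mu> (ball x r \<inter> \<Omega>) / \<mu> (ball x r \<inter> \<Omega>)"
    unfolding trace_quotient_def by (subst nn_integral_cmult_indicator) (auto simp: m)
  also have "\<dots> = ennreal \<bar>s - t\<bar> * (\<mu> (ball x r \<inter> \<Omega>) / \<mu> (ball x r \<inter> \<Omega>))" by (simp add: ennreal_times_divide)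
  also have "\<dots> = ennreal \<bar>s - t\<bar>" using mu_ball_Omega[OF x] by (simp add: ennreal_divide_self)
  finally show ?thesis .
qed

lemma is_trace_const: "x \<in> closure \<Omega> \<Longrightarrow> is_trace \<mu> \<Omega> (\<lambda>_. s) x t \<Longrightarrow> s = t"
proof -
  assume x: "x \<in> closure \<Omega>" and "is_trace \<mu> \<Omega> (\<lambda>_. s) x t"
  then have "(\<lambda>k::nat. ennreal \<bar>s - t\<bar>) \<longlonglongrightarrow> 0" using is_trace_sequence[of "\<lambda>_. s" x t] by (simp add: trace_quotient_const)
  then have "ennreal \<bar>s - t\<bar> = 0" by (simp add: LIMSEQ_const_iff)
  then show "s = t" by simp
qed

text \<open>The one comparison behind uniqueness, bounds, affine combinations and absolute values of
  traces. The inequality is required near x only, so that cutoffs which are constant near the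
  boundary do no harm.\<close>

lemma is_trace_combine:
  assumes m: "mble \<Omega> u" "mble \<Omega> v" and u: "is_trace \<mu> \<Omega> u x s" and v: "is_trace \<mu> \<Omega> v x t"
    and d: "d > 0" and le: "\<And>y. y \<in> \<Omega> \<Longrightarrow> y \<in> ball x d \<Longrightarrow> \<bar>w y - z\<bar> \<le> \<bar>u y - s\<bar> + \<bar>v y - t\<bar>"
  shows "is_trace \<mu> \<Omega> w x z"
  unfolding is_trace_iff_quotient
proof (rule tendsto_sandwich[OF _ _ tendsto_const])
  have "((\<lambda>r. trace_quotient u s x r + trace_quotient v t x r) \<longlongrightarrow> 0 + 0) (at_right 0)"
    using u v unfolding is_trace_iff_quotient by (rule tendsto_add)
  then show "((\<lambda>r. trace_quotient u s x r + trace_quotient v t x r) \<longlongrightarrow> 0) (at_right 0)" by simp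
  show "\<forall>\<^sub>F r in at_right 0. trace_quotient w z x r \<le> trace_quotient u s x r + trace_quotient v t x r"
  proof (rule eventually_small_radius[OF d])
    fix r :: real assume r: "0 < r" "r \<le> d"
    have mm: "mble (ball x r \<inter> \<Omega>) (\<lambda>y. u y - s)" "mble (ball x r \<inter> \<Omega>) (\<lambda>y. v y - t)"
      using m by (auto intro!: mble_diff mble_const intro: mble_subset)
    have "L1 (ball x r \<inter> \<Omega>) (\<lambda>y. w y - z) \<le> L1 (ball x r \<inter> \<Omega>) (\<lambda>y. u y - s) + L1 (ball x r \<inter> \<Omega>) (\<lambda>y. v y - t)"
      using r by (intro L1_triangle[OF mm] le) auto
    then show "trace_quotient w z x r \<le> trace_quotient u s x r + trace_quotient v t x r"
      unfolding trace_quotient_def add_divide_distrib_ennreal[symmetric] by (rule divide_right_mono_ennreal)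
  qed
qed auto

text \<open>Comparison with u, used twice, shows that the constant function s has the trace
  t.\<close>

lemma is_trace_unique:
  assumes "x \<in> closure \<Omega>" "mble \<Omega> u" "is_trace \<mu> \<Omega> u x s" "is_trace \<mu> \<Omega> u x t"
  shows "s = t"
  by (rule is_trace_const[OF assms(1) is_trace_combine[OF assms(2,2,3,4), of 1]]) auto

lemma bv_trace_eq: "x \<in> closure \<Omega> \<Longrightarrow> mble \<Omega> u \<Longrightarrow> is_trace \<mu> \<Omega> u x t \<Longrightarrow> bv_trace \<mu> \<Omega> u x = t"
  unfolding bv_trace_def using is_trace_unique by (intro the_equality) auto

text \<open>If t exceeded b, the constant b would be at least as close to t as u is at every point
  of \<Omega>, and so would have the trace t as well; similarly for a.\<close>

lemma is_trace_bounds: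
  assumes "x \<in> closure \<Omega>" "mble \<Omega> u" "is_trace \<mu> \<Omega> u x t" "\<And>y. y \<in> \<Omega> \<Longrightarrow> a \<le> u y \<and> u y \<le> b"
  shows "a \<le> t" "t \<le> b"
proof -
  show "t \<le> b"
  proof (rule ccontr)
    assume "\<not> t \<le> b"
    then have "is_trace \<mu> \<Omega> (\<lambda>_. b) x t"
      using assms(4) by (intro is_trace_combine[OF assms(2,2,3,3), of 1]) force+
    from is_trace_const[OF assms(1) this] show False using \<open>\<not> t \<le> b\<close> by simp
  qed
  show "a \<le> t"
  proof (rule ccontr)
    assume "\<not> a \<le> t"
    then have "is_trace \<mu> \<Omega> (\<lambda>_. a) x t"
      using assms(4) by (intro is_trace_combine[OF assms(2,2,3,3), of 1]) force+
    from is_trace_const[OF assms(1) this] show False using \<open>\<not> a \<le> t\<close> by simp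
  qed
qed

text \<open>The trace is only determined almost everywhere; \<open>borel_trace\<close> is a Borel function that agrees
  with it wherever it exists, provided that \<open>V\<close> takes values in \<open>[0, 1]\<close>.\<close>

definition borel_trace :: "('a \<Rightarrow> real) \<Rightarrow> 'a \<Rightarrow> real" where
  "borel_trace V x = enn2real (min 1 (limsup (\<lambda>k. (\<integral>\<^sup>+ y \<in> ball x (1 / real (Suc k)). ennreal (V y * chi y) \<partial>M) / emeasure M (ball x (1 / real (Suc k)) \<inter> \<Omega>))))"

lemma borel_trace_measurable: "mble UNIV V \<Longrightarrow> borel_trace V \<in> borel_measurable borel"
proof -
  assume "mble UNIV V"
  then have V: "(\<lambda>y. ennreal (V y * chi y)) \<in> borel_measurable M"
    unfolding mble_UNIV using Omega(3) by measurable
  show ?thesis unfolding borel_trace_def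
    by (intro borel_measurable_enn2real borel_measurable_min borel_measurable_const borel_measurable_limsup
      borel_measurable_divide_ennreal ball_integral_borel V ball_measure_borel) (use Omega(3) in auto)
qed

lemma borel_trace_bounds: "0 \<le> borel_trace V x \<and> borel_trace V x \<le> 1"
proof -
  have "enn2real (min 1 c) \<le> enn2real 1" for c by (intro enn2real_mono) auto
  then show ?thesis by (simp add: borel_trace_def)
qed

text \<open>The averages differ from t by at most the trace quotient, so their limsup is t. The
  truncation at 1 has no effect, since t lies in [0, 1].\<close>

lemma borel_trace_eq:
  assumes x: "x \<in> closure \<Omega>" and m: "mble \<Omega> V" and V: "\<And>y. y \<in> \<Omega> \<Longrightarrow> 0 \<le> V y \<and> V y \<le> 1" and t: "is_trace \<mu> \<Omega> V x t"
  shows "borel_trace V x = t"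
proof -
  let ?r = "\<lambda>k::nat. 1 / real (Suc k)"
  define a where "a k = (\<integral>\<^sup>+ y \<in> ball x (?r k). ennreal (V y * chi y) \<partial>M) / \<mu> (ball x (?r k) \<inter> \<Omega>)" for k
  have t01: "0 \<le> t" "t \<le> 1" using is_trace_bounds[OF x m t V] by auto
  have a_eq: "a k = L1 (ball x (?r k) \<inter> \<Omega>) V / \<mu> (ball x (?r k) \<inter> \<Omega>)" for k
    unfolding a_def using V by (intro arg_cong2[where f = divide] nn_integral_cong) (auto simp: indicator_def)
  have mm: "mble (ball x r \<inter> \<Omega>) V" "mble (ball x r \<inter> \<Omega>) (\<lambda>y. V y - t)" "mble (ball x r \<inter> \<Omega>) (\<lambda>_. t)" for r
    using m by (auto intro!: mble_diff mble_const intro: mble_subset)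
  have c: "L1 (ball x (?r k) \<inter> \<Omega>) (\<lambda>_. t) / \<mu> (ball x (?r k) \<inter> \<Omega>) = ennreal t" for k
    using trace_quotient_const[OF x, of "?r k" t 0] t01 by (simp add: trace_quotient_def)
  have up: "a k \<le> trace_quotient V t x (?r k) + ennreal t" for k
  proof -
    have "L1 (ball x (?r k) \<inter> \<Omega>) V \<le> L1 (ball x (?r k) \<inter> \<Omega>) (\<lambda>y. V y - t) + L1 (ball x (?r k) \<inter> \<Omega>) (\<lambda>_. t)"
      by (rule L1_triangle[OF mm(2,3)]) auto
    then have "a k \<le> (L1 (ball x (?r k) \<inter> \<Omega>) (\<lambda>y. V y - t) + L1 (ball x (?r k) \<inter> \<Omega>) (\<lambda>_. t)) / \<mu> (ball x (?r k) \<inter> \<Omega>)"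
      unfolding a_eq by (rule divide_right_mono_ennreal)
    then show ?thesis unfolding add_divide_distrib_ennreal c trace_quotient_def .
  qed
  have lo: "ennreal t \<le> trace_quotient V t x (?r k) + a k" for k
  proof -
    have "L1 (ball x (?r k) \<inter> \<Omega>) (\<lambda>_. t) \<le> L1 (ball x (?r k) \<inter> \<Omega>) (\<lambda>y. V y - t) + L1 (ball x (?r k) \<inter> \<Omega>) V"
      by (rule L1_triangle[OF mm(2,1)]) auto
    then have "L1 (ball x (?r k) \<inter> \<Omega>) (\<lambda>_. t) / \<mu> (ball x (?r k) \<inter> \<Omega>) \<le>
      (L1 (ball x (?r k) \<inter> \<Omega>) (\<lambda>y. V y - t) + L1 (ball x (?r k) \<inter> \<Omega>) V) / \<mu> (ball x (?r k) \<inter> \<Omega>)"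
      by (rule divide_right_mono_ennreal)
    then show ?thesis unfolding add_divide_distrib_ennreal c a_eq trace_quotient_def .
  qed
  have ev: "\<forall>\<^sub>F k in sequentially. trace_quotient V t x (?r k) < ennreal e" if "e > 0" for e
    using is_trace_sequence[OF t] that by (intro order_tendstoD) auto
  have "limsup a = ennreal t"
  proof (rule antisym)
    show "limsup a \<le> ennreal t"
    proof (rule ennreal_le_epsilon)
      fix e :: real assume "e > 0"
      have "\<forall>\<^sub>F k in sequentially. a k \<le> ennreal t + ennreal e"
        using ev[OF \<open>e > 0\<close>]
      proof eventually_elim
        case (elim k)
        have "a k \<le> trace_quotient V t x (?r k) + ennreal t" by (rule up)
        also have "\<dots> \<le> ennreal e + ennreal t" using elim by (intro add_right_mono) simp
        finally show ?case by (simp add: add.commute)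
      qed
      then show "limsup a \<le> ennreal t + ennreal e" by (rule Limsup_bounded)
    qed
    show "ennreal t \<le> limsup a"
    proof (rule ennreal_le_epsilon)
      fix e :: real assume "e > 0"
      have "\<forall>\<^sub>F k in sequentially. ennreal t \<le> a k + ennreal e"
        using ev[OF \<open>e > 0\<close>]
      proof eventually_elim
        case (elim k)
        have "ennreal t \<le> trace_quotient V t x (?r k) + a k" by (rule lo)
        also have "\<dots> \<le> ennreal e + a k" using elim by (intro add_right_mono) simp
        finally show ?case by (simp add: add.commute)
      qed
      then have "\<forall>\<^sub>F k in sequentially. ennreal t - ennreal e \<le> a k"
        by eventually_elim (simp add: ennreal_minus_le_iff add.commute)
      then have "ennreal t - ennreal e \<le> limsup a" by (rule le_Limsup[rotated]) simp
      then show "ennreal t \<le> limsup a + ennreal e" by (simp add: ennreal_minus_le_iff add.commute)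
    qed
  qed
  moreover have "borel_trace V x = enn2real (min 1 (limsup a))"
  proof -
    have "emeasure M (ball x (?r k) \<inter> \<Omega>) = \<mu> (ball x (?r k) \<inter> \<Omega>)" for k
      using Omega(3) by (intro emeasure_M) auto
    then show ?thesis unfolding borel_trace_def a_def by simp
  qed
  ultimately show ?thesis using t01 by (simp add: min_def ennreal_le_1)
qed

text \<open>Passing from \<open>ball x r \<inter> \<Omega>\<close> to \<open>ball x r\<close>
  enlarges the denominator and leaves the integral unchanged.\<close>

lemma is_trace_good:
  assumes x: "x \<in> closure \<Omega>" and t: "is_trace \<mu> \<Omega> V x (\<tau> x)"
  shows "good V \<tau> x"
  unfolding good_def
proof (rule disjI2, rule tendsto_sandwich[OF _ _ tendsto_const is_trace_sequence[OF t]])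
  show "\<forall>\<^sub>F k in sequentially. avg (1 / real (Suc k)) (\<lambda>y. ennreal (\<bar>V y - \<tau> x\<bar> * chi y)) x \<le> trace_quotient V (\<tau> x) x (1 / real (Suc k))"
  proof (intro always_eventually allI)
    fix k :: nat
    let ?r = "1 / real (Suc k)"
    have "(\<integral>\<^sup>+ y \<in> ball x ?r. ennreal (\<bar>V y - \<tau> x\<bar> * chi y) \<partial>M) = L1 (ball x ?r \<inter> \<Omega>) (\<lambda>y. V y - \<tau> x)"
      by (intro nn_integral_cong) (auto simp: indicator_def)
    moreover have "\<mu> (ball x ?r \<inter> \<Omega>) \<le> \<mu> (ball x ?r)" by (rule outer_measureD(2)[OF outer_measure_mu]) auto
    ultimately show "avg ?r (\<lambda>y. ennreal (\<bar>V y - \<tau> x\<bar> * chi y)) x \<le> trace_quotient V (\<tau> x) x ?r"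
      unfolding avg_def trace_quotient_def divide_ennreal_def by (simp add: mult_left_mono ennreal_inverse_antimono)
  qed
qed auto

text \<open>Outside \<open>mt\<close> one of the two upper densities is 0, and the hypothesis says
  that it is not that of the complement.\<close>

lemma zero_density_good:
  assumes "x \<notin> mt" "Limsup (at_right 0) (\<lambda>r. \<mu> (ball x r - \<Omega>) / \<mu> (ball x r)) > 0"
  shows "good V \<tau> x"
proof -
  have "\<not> Limsup (at_right 0) (\<lambda>r. \<mu> (ball x r \<inter> \<Omega>) / \<mu> (ball x r)) > 0"
    using assms by (simp add: mt_boundary_def)
  then have "Limsup (at_right 0) (\<lambda>r. \<mu> (ball x r \<inter> \<Omega>) / \<mu> (ball x r)) \<le> 0" by simp
  then have "\<forall>y>0. \<forall>\<^sub>F r in at_right 0. \<mu> (ball x r \<inter> \<Omega>) / \<mu> (ball x r) < y" unfolding Limsup_le_iff .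
  then have "((\<lambda>r. \<mu> (ball x r \<inter> \<Omega>) / \<mu> (ball x r)) \<longlongrightarrow> 0) (at_right 0)"
    by (intro order_tendstoI) auto
  moreover have "filterlim (\<lambda>k. 1 / real (Suc k)) (at_right 0) sequentially"
  proof -
    have "(\<lambda>k. 1 / real (Suc k)) \<longlonglongrightarrow> 0" using LIMSEQ_inverse_real_of_nat by (simp add: inverse_eq_divide)
    then show ?thesis by (rule tendsto_imp_filterlim_at_right) auto
  qed
  ultimately have "(\<lambda>k. \<mu> (ball x (1 / real (Suc k)) \<inter> \<Omega>) / \<mu> (ball x (1 / real (Suc k)))) \<longlonglongrightarrow> 0"
    by (rule filterlim_compose)
  moreover have "avg r (indicator \<Omega>) x = \<mu> (ball x r \<inter> \<Omega>) / \<mu> (ball x r)" for r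
  proof -
    have "(\<integral>\<^sup>+ y \<in> ball x r. indicator \<Omega> y \<partial>M) = (\<integral>\<^sup>+ y. indicator (ball x r \<inter> \<Omega>) y \<partial>M)"
      by (intro nn_integral_cong) (auto simp: indicator_def)
    then show ?thesis using Omega(3) by (simp add: avg_def emeasure_M)
  qed
  ultimately show ?thesis unfolding good_def by simp
qed

text \<open>It is 0 up to the level N + 1/3 of \<open>rho\<close> and 1 from N + 2/3 on, hence 1
  near the boundary. Levels of \<open>rho\<close> are used instead of distances because
  \<open>TV_tail\<close> measures tails of the variation by them.\<close>

definition eta :: "nat \<Rightarrow> 'a \<Rightarrow> real" where
  "eta N x = max 0 (min 1 (3 * (rho \<Omega> x - real N) - 1))"

lemma eta_bounds: "0 \<le> eta N x" "eta N x \<le> 1" by (auto simp: eta_def)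

text \<open>The constant is the slope 3 of the cutoff times the Lipschitz constant of
  \<open>rho\<close> below the level N + 1. It depends on N, but multiplies an L1 norm that tends to
  0 for fixed N.\<close>

lemma TV_cut_rho:
  assumes m: "mble \<Omega> y" and y: "\<And>x. x \<in> \<Omega> \<Longrightarrow> 0 \<le> y x \<and> y x \<le> 1"
  shows "TV (\<lambda>x. eta N x * y x) \<Omega> \<le> TV y {x\<in>\<Omega>. real N < rho \<Omega> x} + ennreal (3 * ((real N + 1)^2 + 1)) * L1 \<Omega> y"
proof -
  define T where "T = {x\<in>\<Omega>. real N < rho \<Omega> x}"
  define K where "K = 3 * ((real N + 1)^2 + 1)"
  have K: "K > 0" by (simp add: K_def add_nonneg_pos)
  have orho: "open {x\<in>\<Omega>. rho \<Omega> x \<in> S}" if "open S" for S by (rule open_rho[OF Omega(3) that])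
  have T: "open T" "T \<subseteq> \<Omega>" unfolding T_def using orho[of "{real N<..}"] by auto
  have "TV (\<lambda>x. eta N x * y x) \<Omega> \<le> TV y T + ennreal K * L1 (T \<inter> UNIV) y"
  proof (rule TV_cutoff[OF Omega(3) T _ open_UNIV K])
    show "emeasure M T < \<infinity>" using finite_Omega[of T] T by (simp add: inf.absorb2)
    show "mble T y" using T by (intro mble_subset[OF m]) auto
    show "- 1 \<le> y x \<and> y x \<le> 1" if "x \<in> T" for x using y[of x] T that by auto
    show "eta N x * y x = 0" if "x \<in> \<Omega> - T" for x using that by (auto simp: T_def eta_def)
    fix x assume x: "x \<in> \<Omega>"
    consider "rho \<Omega> x < real N + 1/3" | "real N < rho \<Omega> x" "rho \<Omega> x < real N + 1" | "real N + 2/3 < rho \<Omega> x" by linarith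
    then show "\<exists>A. open A \<and> x \<in> A \<and> ((\<forall>y\<in>A \<inter> T. eta N y = 0) \<or> A \<subseteq> T \<and> (\<forall>y\<in>A. eta N y = 1) \<or>
      A \<subseteq> T \<inter> UNIV \<and> K-lipschitz_on A (eta N))"
    proof cases
      case 1
      then show ?thesis using x orho[of "{..<real N + 1/3}"]
        by (intro exI[of _ "{x\<in>\<Omega>. rho \<Omega> x \<in> {..<real N + 1/3}}"]) (auto simp: eta_def)
    next
      case 2
      define A where "A = {x\<in>\<Omega>. rho \<Omega> x \<in> {real N<..<real N + 1}}"
      have "((real N + 1)^2 + 1)-lipschitz_on {x\<in>\<Omega>. rho \<Omega> x \<le> real N + 1} (rho \<Omega>)" by (intro rho_lipschitz Omega) auto
      then have rl: "((real N + 1)^2 + 1)-lipschitz_on A (rho \<Omega>)" by (rule lipschitz_on_subset) (auto simp: A_def)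
      have "K-lipschitz_on A (eta N)"
      proof (rule lipschitz_onI)
        fix z z' assume z: "z \<in> A" "z' \<in> A"
        have "dist (eta N z) (eta N z') \<le> 3 * \<bar>rho \<Omega> z - rho \<Omega> z'\<bar>" by (auto simp: eta_def dist_real_def max_def min_def abs_if)
        also have "\<dots> \<le> 3 * (((real N + 1)^2 + 1) * dist z z')"
          using lipschitz_onD[OF rl z] by (simp add: dist_real_def)
        finally show "dist (eta N z) (eta N z') \<le> K * dist z z'" by (simp only: K_def mult.assoc)
      qed (use K in simp)
      then show ?thesis using 2 x orho[of "{real N<..<real N + 1}"] by (intro exI[of _ A]) (auto simp: A_def T_def)
    next
      case 3
      then show ?thesis using x orho[of "{real N + 2/3<..}"]
        by (intro exI[of _ "{x\<in>\<Omega>. rho \<Omega> x \<in> {real N + 2/3<..}}"]) (auto simp: T_def eta_def)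
    qed
  qed (auto simp: eta_bounds)
  also have "\<dots> \<le> TV y T + ennreal K * L1 \<Omega> y" using T by (intro add_left_mono mult_left_mono L1_mono_set) auto
  finally show ?thesis by (simp add: T_def K_def)
qed

end

section \<open>The minimization problem\<close>

locale neumann_problem = neumann_domain \<mu> \<Omega> CA
  for \<mu> :: "'a::complete_space set \<Rightarrow> ennreal" and \<Omega> CA +
  fixes f :: "'a \<Rightarrow> real"
  assumes density: "codim1_hausdorff \<mu> {x \<in> frontier \<Omega>.
         \<not> Limsup (at_right 0) (\<lambda>r. \<mu> (ball x r - \<Omega>) / \<mu> (ball x r)) > 0} = 0"
    and traces: "\<And>u. u \<in> BV \<mu> \<Omega> \<Longrightarrow>
         codim1_hausdorff \<mu> {x \<in> mt_boundary \<mu> \<Omega>. \<not> (\<exists>t. is_trace \<mu> \<Omega> u x t)} = 0"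
    and f_integrable: "set_integrable (perimeter_measure \<mu> \<Omega>) (mt_boundary \<mu> \<Omega>) f"
    and f_bounds: "\<And>x. x \<in> mt_boundary \<mu> \<Omega> \<Longrightarrow> -1 \<le> f x \<and> f x \<le> 1"
begin

text \<open>With f extended by 0, boundary integrals run over the whole space, and measurability is
  drawn from the integrability of F and not from the set \<open>mt\<close>.\<close>

definition F :: "'a \<Rightarrow> real" where "F x = indicator mt x * f x"

abbreviation Tr :: "('a \<Rightarrow> real) \<Rightarrow> 'a \<Rightarrow> real" where "Tr \<equiv> bv_trace \<mu> \<Omega>"

definition admissible :: "('a \<Rightarrow> real) set" where
  "admissible = {v \<in> BV \<mu> \<Omega>. \<forall>x\<in>\<Omega>. -1 \<le> v x \<and> v x \<le> 1}"

definition boundary_energy :: "('a \<Rightarrow> real) \<Rightarrow> real" where "boundary_energy u = (LINT x|PM. Tr u x * F x)"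

definition energy :: "('a \<Rightarrow> real) \<Rightarrow> real" where "energy u = enn2real (TV u \<Omega>) + boundary_energy u"

lemma energy_eq_functional: "energy u = neumann_functional \<mu> \<Omega> f u"
proof -
  have "(LINT x:mt|PM. Tr u x * f x) = boundary_energy u"
    unfolding boundary_energy_def set_lebesgue_integral_def F_def by (intro Bochner_Integration.integral_cong) (auto simp: indicator_def)
  then show ?thesis by (simp add: energy_def neumann_functional_def)
qed

lemma F_integrable: "integrable PM F"
  using f_integrable unfolding set_integrable_def F_def[abs_def] by simp

lemma F_measurable [measurable]: "F \<in> borel_measurable PM"
  using F_integrable by (rule borel_measurable_integrable)

lemma F_bound: "\<bar>F x\<bar> \<le> 1" "x \<notin> mt \<Longrightarrow> F x = 0"
  using f_bounds[of x] by (auto simp: F_def indicator_def)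

lemma mble_Omega_I: "v \<in> BV \<mu> \<Omega> \<Longrightarrow> mble \<Omega> v"
  by (auto simp: BV_def set_integrable_def set_borel_measurable_def)

lemma BV_I:
  assumes "mble \<Omega> v" "\<And>x. x \<in> \<Omega> \<Longrightarrow> \<bar>v x\<bar> \<le> B" "TV v \<Omega> < \<infinity>"
  shows "v \<in> BV \<mu> \<Omega>"
proof -
  have "integrable M (\<lambda>x. indicator \<Omega> x *\<^sub>R v x)"
  proof (rule integrableI_bounded_set[where A = \<Omega> and B = B])
    show "\<Omega> \<in> sets M" using Omega(3) by auto
    show "(\<lambda>x. indicator \<Omega> x *\<^sub>R v x) \<in> borel_measurable M" using assms(1) by (simp add: set_borel_measurable_def)
    show "emeasure M \<Omega> < \<infinity>" using finite_Omega[of UNIV] by simp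
  qed (use assms(2) in auto)
  then show ?thesis using assms(3) by (simp add: BV_def set_integrable_def)
qed

lemma admissibleD: "v \<in> admissible \<Longrightarrow> mble \<Omega> v" "v \<in> admissible \<Longrightarrow> TV v \<Omega> < \<infinity>" "v \<in> admissible \<Longrightarrow> x \<in> \<Omega> \<Longrightarrow> -1 \<le> v x \<and> v x \<le> 1"
    "v \<in> admissible \<Longrightarrow> v \<in> BV \<mu> \<Omega>"
  using mble_Omega_I by (auto simp: admissible_def BV_def)

lemma admissibleI: "mble \<Omega> v \<Longrightarrow> TV v \<Omega> < \<infinity> \<Longrightarrow> (\<And>x. x \<in> \<Omega> \<Longrightarrow> -1 \<le> v x \<and> v x \<le> 1) \<Longrightarrow> v \<in> admissible"
  unfolding admissible_def using BV_I[of v 1] by (auto simp: abs_le_iff)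

lemma PM_null: "N \<subseteq> Bd \<Longrightarrow> H N = 0 \<Longrightarrow> N \<in> null_sets PM"
  unfolding perimeter_measure_def by (rule outer_null_sets[OF P_outer P_null])

text \<open>Traces exist up to a set of Hausdorff measure 0, which \<open>P_null\<close> makes null
  for the perimeter measure; uniqueness identifies them with \<open>bv_trace\<close>.\<close>

lemma trace_AE:
  assumes u: "u \<in> BV \<mu> \<Omega>"
  shows "AE x in PM. x \<in> mt \<longrightarrow> is_trace \<mu> \<Omega> u x (Tr u x)"
proof -
  have "{x \<in> mt. \<not> (\<exists>t. is_trace \<mu> \<Omega> u x t)} \<in> null_sets PM"
    using mt_subset_Bd by (intro PM_null traces u) auto
  then have "AE x in PM. x \<notin> {x \<in> mt. \<not> (\<exists>t. is_trace \<mu> \<Omega> u x t)}" by (rule AE_not_in)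
  then show ?thesis
  proof eventually_elim
    case (elim x)
    show ?case
    proof
      assume x: "x \<in> mt"
      then obtain t where t: "is_trace \<mu> \<Omega> u x t" using elim by auto
      have "x \<in> closure \<Omega>" using x mt_subset_Bd closure_Omega_Bd by auto
      with t bv_trace_eq[OF this mble_Omega_I[OF u] t] show "is_trace \<mu> \<Omega> u x (Tr u x)" by simp
    qed
  qed
qed

text \<open>Completeness of the perimeter measure: every subset of a null set has outer measure 0
  and is measurable.\<close>

lemma PM_measurable_AE:
  fixes g h :: "'a \<Rightarrow> real"
  assumes g: "g \<in> borel_measurable PM" and ae: "AE x in PM. h x = g x"
  shows "h \<in> borel_measurable PM"
proof -
  obtain N where N: "N \<in> null_sets PM" "{x \<in> space PM. h x \<noteq> g x} \<subseteq> N" using ae by (auto elim!: AE_E simp: null_sets_def)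
  have sub: "A \<in> sets PM" if "A \<subseteq> N" for A
  proof -
    have "P N = 0" using N(1) by (simp add: emeasure_PM[symmetric] null_sets_def)
    then have "P A = 0" using outer_measureD(2)[OF P_outer that] by simp
    then show ?thesis unfolding perimeter_measure_def using outer_null_sets[OF P_outer] by blast
  qed
  show ?thesis
  proof (rule measurableI)
    fix B :: "real set" assume B: "B \<in> sets borel"
    have "g -` B \<inter> space PM \<in> sets PM" using g B by (rule measurable_sets)
    moreover have "N \<in> sets PM" using N(1) by auto
    moreover have "h -` B \<inter> N \<in> sets PM" by (rule sub) auto
    ultimately have "((g -` B \<inter> space PM) - N) \<union> (h -` B \<inter> N) \<in> sets PM" by auto
    moreover have "((g -` B \<inter> space PM) - N) \<union> (h -` B \<inter> N) = h -` B \<inter> space PM" using N(2) by auto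
    ultimately show "h -` B \<inter> space PM \<in> sets PM" by simp
  qed simp
qed

lemma Bd_of_mt: "x \<in> mt \<Longrightarrow> x \<in> closure \<Omega>"
  using mt_subset_Bd closure_Omega_Bd by auto

lemma Tr_bounds_AE:
  assumes "u \<in> admissible"
  shows "AE x in PM. x \<in> mt \<longrightarrow> \<bar>Tr u x\<bar> \<le> 1"
  using trace_AE[OF admissibleD(4)[OF assms]]
proof eventually_elim
  case (elim x)
  then show ?case using is_trace_bounds[OF Bd_of_mt admissibleD(1)[OF assms] _ admissibleD(3)[OF assms]] by (auto simp: abs_le_iff)
qed

text \<open>As a definite description \<open>bv_trace\<close> carries no measurability. Almost
  everywhere on \<open>mt\<close> it agrees with an affine image of \<open>borel_trace V\<close>,
  where V rescales u from [-1, 1] to [0, 1].\<close>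

lemma TrF_measurable:
  assumes u: "u \<in> admissible"
  shows "(\<lambda>x. Tr u x * F x) \<in> borel_measurable PM"
proof -
  define V where "V x = (u x + 1) / 2 * chi x" for x
  note mu = admissibleD(1)[OF u]
  have mV: "mble UNIV V"
  proof -
    have "mble \<Omega> (\<lambda>x. 1/2 * (u x + 1))" using Omega(3) by (intro mble_cmult mble_add mu mble_const) auto
    also have "mble \<Omega> (\<lambda>x. 1/2 * (u x + 1)) \<longleftrightarrow> mble UNIV V"
      unfolding set_borel_measurable_def V_def[abs_def] by (simp add: mult.commute)
    finally show ?thesis .
  qed
  have mVO: "mble \<Omega> V" by (rule mble_subset[OF mV]) (use Omega(3) in auto)
  have V01: "0 \<le> V y \<and> V y \<le> 1" if "y \<in> \<Omega>" for y
    using admissibleD(3)[OF u that] that unfolding V_def by simp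
  show ?thesis
  proof (rule PM_measurable_AE)
    show "(\<lambda>x. (2 * borel_trace V x - 1) * F x) \<in> borel_measurable PM"
      using measurable_PM[OF borel_trace_measurable[OF mV]] by measurable
    show "AE x in PM. Tr u x * F x = (2 * borel_trace V x - 1) * F x"
      using trace_AE[OF admissibleD(4)[OF u]]
    proof eventually_elim
      case (elim x)
      show ?case
      proof (cases "x \<in> mt")
        case True
        then have t: "is_trace \<mu> \<Omega> u x (Tr u x)" using elim by simp
        have "is_trace \<mu> \<Omega> V x ((Tr u x + 1) / 2)"
          by (rule is_trace_combine[OF mu mu t t, of 1]) (auto simp: V_def abs_if field_simps)
        then have "borel_trace V x = (Tr u x + 1) / 2"
          using V01 by (intro borel_trace_eq[OF Bd_of_mt[OF True] mVO])
        then show ?thesis by simp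
      qed (simp add: F_bound)
    qed
  qed
qed

lemma TrF_integrable:
  assumes u: "u \<in> admissible"
  shows "integrable PM (\<lambda>x. Tr u x * F x)" "\<bar>boundary_energy u\<bar> \<le> (LINT x|PM. \<bar>F x\<bar>)"
proof -
  have ae: "AE x in PM. norm (Tr u x * F x) \<le> norm \<bar>F x\<bar>"
    using Tr_bounds_AE[OF u]
  proof eventually_elim
    case (elim x)
    then show ?case by (cases "x \<in> mt") (auto simp: abs_mult F_bound intro: mult_left_le_one_le)
  qed
  have Fi: "integrable PM (\<lambda>x. \<bar>F x\<bar>)" using F_integrable by simp
  show i: "integrable PM (\<lambda>x. Tr u x * F x)"
    by (rule Bochner_Integration.integrable_bound[OF Fi TrF_measurable[OF u] ae])
  have "\<bar>boundary_energy u\<bar> \<le> (LINT x|PM. \<bar>Tr u x * F x\<bar>)"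
    unfolding boundary_energy_def using integral_norm_bound[of PM "\<lambda>x. Tr u x * F x"] by simp
  also have "\<dots> \<le> (LINT x|PM. \<bar>F x\<bar>)"
    using i Fi ae by (intro integral_mono_AE) auto
  finally show "\<bar>boundary_energy u\<bar> \<le> (LINT x|PM. \<bar>F x\<bar>)" .
qed

text \<open>Convexity in the only form that the parallelogram law requires. The boundary term is
  affine because traces of midpoints are midpoints of traces.\<close>

lemma midpoint_admissible:
  assumes v: "v \<in> admissible" and w: "w \<in> admissible"
  defines "z \<equiv> \<lambda>x. 1/2 * v x + 1/2 * w x"
  shows "z \<in> admissible" "energy z \<le> (energy v + energy w) / 2"
proof -
  note m = admissibleD(1)[OF v] admissibleD(1)[OF w]
  have mz: "mble \<Omega> z" unfolding z_def by (intro mble_add mble_cmult m)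
  have "TV z \<Omega> \<le> TV (\<lambda>x. 1/2 * v x) \<Omega> + TV (\<lambda>x. 1/2 * w x) \<Omega>"
    unfolding z_def by (intro TV_add Omega mble_cmult m)
  also have "\<dots> \<le> ennreal \<bar>1/2\<bar> * TV v \<Omega> + ennreal \<bar>1/2\<bar> * TV w \<Omega>"
    by (intro add_mono TV_cmult Omega m)
  also have "\<dots> = ennreal ((enn2real (TV v \<Omega>) + enn2real (TV w \<Omega>)) / 2)"
  proof -
    have "TV v \<Omega> = ennreal (enn2real (TV v \<Omega>))" "TV w \<Omega> = ennreal (enn2real (TV w \<Omega>))"
      using admissibleD(2)[OF v] admissibleD(2)[OF w] by simp_all
    then have "ennreal \<bar>1/2\<bar> * TV v \<Omega> + ennreal \<bar>1/2\<bar> * TV w \<Omega> =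
       ennreal (1/2) * ennreal (enn2real (TV v \<Omega>)) + ennreal (1/2) * ennreal (enn2real (TV w \<Omega>))" by simp
    also have "\<dots> = ennreal (1/2 * enn2real (TV v \<Omega>) + 1/2 * enn2real (TV w \<Omega>))"
      by (subst (1 2) ennreal_mult[symmetric]) (simp_all del: ennreal_plus add: ennreal_plus[symmetric])
    finally show ?thesis by (simp add: add_divide_distrib)
  qed
  finally have tv: "TV z \<Omega> \<le> ennreal ((enn2real (TV v \<Omega>) + enn2real (TV w \<Omega>)) / 2)" .
  have "TV z \<Omega> < \<infinity>" using tv by (rule le_less_trans) simp
  then show zA: "z \<in> admissible"
  proof (rule admissibleI[OF mz])
    fix x assume "x \<in> \<Omega>"
    then show "-1 \<le> z x \<and> z x \<le> 1" using admissibleD(3)[OF v, of x] admissibleD(3)[OF w, of x] by (auto simp: z_def)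
  qed
  have "enn2real (TV z \<Omega>) \<le> (enn2real (TV v \<Omega>) + enn2real (TV w \<Omega>)) / 2"
    using enn2real_mono[OF tv] by simp
  moreover have "boundary_energy z = (boundary_energy v + boundary_energy w) / 2"
  proof -
    have "boundary_energy z = (LINT x|PM. 1/2 * (Tr v x * F x) + 1/2 * (Tr w x * F x))"
      unfolding boundary_energy_def
    proof (rule integral_cong_AE)
      show "AE x in PM. Tr z x * F x = 1/2 * (Tr v x * F x) + 1/2 * (Tr w x * F x)"
        using trace_AE[OF admissibleD(4)[OF v]] trace_AE[OF admissibleD(4)[OF w]]
      proof eventually_elim
        case (elim x)
        show ?case
        proof (cases "x \<in> mt")
          case True
          then have t: "is_trace \<mu> \<Omega> v x (Tr v x)" "is_trace \<mu> \<Omega> w x (Tr w x)" using elim by auto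
          have "is_trace \<mu> \<Omega> z x (1/2 * Tr v x + 1/2 * Tr w x)"
            by (rule is_trace_combine[OF m t, of 1]) (auto simp: z_def)
          then have "Tr z x = 1/2 * Tr v x + 1/2 * Tr w x" by (rule bv_trace_eq[OF Bd_of_mt[OF True] mz])
          then show ?thesis by (simp add: algebra_simps)
        qed (simp add: F_bound)
      qed
      show "(\<lambda>x. 1/2 * (Tr v x * F x) + 1/2 * (Tr w x * F x)) \<in> borel_measurable PM"
        using TrF_measurable[OF v] TrF_measurable[OF w] by measurable
    qed (rule TrF_measurable[OF zA])
    also have "\<dots> = 1/2 * boundary_energy v + 1/2 * boundary_energy w"
      unfolding boundary_energy_def using TrF_integrable(1)[OF v] TrF_integrable(1)[OF w]
      by (subst Bochner_Integration.integral_add) auto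
    finally show ?thesis by simp
  qed
  ultimately show "energy z \<le> (energy v + energy w) / 2" by (simp add: energy_def add_divide_distrib)
qed

text \<open>The part of \<open>mt\<close> that contributes to the boundary term; it is measurable
  because F is.\<close>

definition S :: "'a set" where "S = {x. F x \<noteq> 0}"

lemma S_sets: "S \<in> sets PM"
proof -
  have "S = F -` (- {0}) \<inter> space PM" by (auto simp: S_def)
  then show ?thesis using measurable_sets[OF F_measurable, of "- {0}"] by simp
qed

lemma S_mt: "S \<subseteq> mt" using F_bound(2) by (auto simp: S_def)

abbreviation T :: "nat \<Rightarrow> 'a set" where "T N \<equiv> {x\<in>\<Omega>. real N < rho \<Omega> x}"

lemma open_T: "open (T N)" using open_rho[OF Omega(3), of "{real N<..}"] by simp

text \<open>No trace mass is lost in the limit beyond the variation near the boundary: the functions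
  \<open>V i\<close> below converge to the characteristic function of the domain, whose total variation is lower
  semicontinuous.\<close>

lemma trace_difference_bound:
  assumes u: "u \<in> admissible" and w: "\<And>i::nat. w i \<in> admissible" and lim: "(\<lambda>i. L1 \<Omega> (\<lambda>x. w i x - u x)) \<longlonglongrightarrow> 0" and \<epsilon>: "\<epsilon> > 0"
  shows "\<forall>\<^sub>F i in sequentially. (\<integral>\<^sup>+ x \<in> S. ennreal \<bar>Tr (w i) x - Tr u x\<bar> \<partial>PM) \<le> TV (w i) (T N) + TV u (T N) + ennreal \<epsilon>"
proof -
  \<comment> \<open>Half the distance of two functions with values in [-1, 1] is at most 1, so that
    \<open>V i\<close> takes values in [0, 1].\<close>
  define y where "y i x = \<bar>1/2 * w i x + (-(1/2)) * u x\<bar>" for i x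
  define V where "V i x = (1 - eta N x * y i x) * chi x" for i x
  define K where "K = 3 * ((real N + 1)^2 + 1)"
  note mu = admissibleD(1)[OF u] and mw = admissibleD(1)[OF w]
  have etam: "mble \<Omega> (eta N)"
    unfolding eta_def by (intro mble_continuous continuous_intros rho_continuous Omega)
  have my: "mble \<Omega> (y i)" for i unfolding y_def by (intro mble_abs mble_add mble_cmult mu mw)
  have y01: "0 \<le> y i x \<and> y i x \<le> 1" if "x \<in> \<Omega>" for i x
    using admissibleD(3)[OF u that] admissibleD(3)[OF w that, of i] by (auto simp: y_def abs_le_iff)
  have L1y: "L1 \<Omega> (y i) \<le> L1 \<Omega> (\<lambda>x. w i x - u x)" for i
    by (rule L1_mono) (simp add: y_def flip: right_diff_distrib)
  have mVO: "mble \<Omega> (\<lambda>x. 1 - eta N x * y i x)" for i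
    using Omega(3) by (intro mble_diff mble_mult mble_const etam my) auto
  have mV: "mble UNIV (V i)" for i
    using mVO[of i] unfolding set_borel_measurable_def V_def[abs_def] by (simp add: mult.commute)
  have mVO': "mble \<Omega> (V i)" for i by (rule mble_subset[OF mV]) (use Omega(3) in auto)
  have V01: "0 \<le> V i x \<and> V i x \<le> 1" for i x
  proof (cases "x \<in> \<Omega>")
    case True
    have "eta N x * y i x \<le> 1 * 1" using y01[OF True] eta_bounds by (intro mult_mono) auto
    then show ?thesis using True y01[OF True, of i] eta_bounds[of N x] by (simp add: V_def)
  qed (simp add: V_def)
  have V0: "V i x = 0" if "x \<notin> \<Omega>" for i x using that by (simp add: V_def)
  have TVw: "TV (w i) (T N) < \<infinity>" "TV u (T N) < \<infinity>" for i
    using TV_mono[OF Omega(3) open_T, of N "w i"] TV_mono[OF Omega(3) open_T, of N u] admissibleD(2)[OF w, of i] admissibleD(2)[OF u]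
    by (auto intro: le_less_trans)
  \<comment> \<open>Half of both variations in the tail, and a cutoff term that tends to 0 because N
    is fixed.\<close>
  have TVV: "TV (V i) \<Omega> \<le> ennreal (1/2) * TV (w i) (T N) + ennreal (1/2) * TV u (T N) + ennreal K * L1 \<Omega> (\<lambda>x. w i x - u x)" for i
  proof -
    have mT: "mble (T N) (w i)" "mble (T N) u" using open_T by (auto intro!: mble_subset[OF mu] mble_subset[OF mw])
    have "TV (V i) \<Omega> = TV (\<lambda>x. 1 + (-1) * (eta N x * y i x)) \<Omega>" by (intro TV_cong) (simp add: V_def)
    also have "\<dots> \<le> TV (\<lambda>_. 1) \<Omega> + TV (\<lambda>x. (-1) * (eta N x * y i x)) \<Omega>"
      using Omega(3) by (intro TV_add mble_const mble_cmult mble_mult etam my) auto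
    also have "TV (\<lambda>_. 1) \<Omega> = 0" by (rule TV_const[OF Omega(3)])
    also have "TV (\<lambda>x. (-1) * (eta N x * y i x)) \<Omega> \<le> ennreal \<bar>-1\<bar> * TV (\<lambda>x. eta N x * y i x) \<Omega>"
      by (intro TV_cmult Omega mble_mult etam my)
    also have "ennreal \<bar>-1\<bar> * TV (\<lambda>x. eta N x * y i x) \<Omega> = TV (\<lambda>x. eta N x * y i x) \<Omega>" by simp
    also have "\<dots> \<le> TV (y i) (T N) + ennreal K * L1 \<Omega> (y i)"
      unfolding K_def by (rule TV_cut_rho[OF my y01])
    also have "TV (y i) (T N) \<le> TV (\<lambda>x. 1/2 * w i x + (-(1/2)) * u x) (T N)"
      unfolding y_def by (rule TV_contraction[OF open_T]) auto
    also have "\<dots> \<le> TV (\<lambda>x. 1/2 * w i x) (T N) + TV (\<lambda>x. (-(1/2)) * u x) (T N)"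
      by (intro TV_add open_T mble_cmult mT)
    also have "\<dots> \<le> ennreal \<bar>1/2\<bar> * TV (w i) (T N) + ennreal \<bar>-(1/2)\<bar> * TV u (T N)"
      by (intro add_mono TV_cmult open_T mT)
    also have "ennreal K * L1 \<Omega> (y i) \<le> ennreal K * L1 \<Omega> (\<lambda>x. w i x - u x)" by (intro mult_left_mono L1y) auto
    finally show ?thesis by (simp add: add_mono)
  qed
  have L1fin: "L1 \<Omega> (\<lambda>x. w i x - u x) < \<infinity>" for i
  proof -
    have "L1 \<Omega> (\<lambda>x. w i x - u x) \<le> ennreal 2 * emeasure M \<Omega>"
    proof (rule L1_le_measure)
      show "\<bar>w i x - u x\<bar> \<le> 2" if "x \<in> \<Omega>" for x using admissibleD(3)[OF u that] admissibleD(3)[OF w that, of i] by (auto simp: abs_le_iff)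
    qed (use Omega(3) in auto)
    also have "\<dots> < \<infinity>" using finite_Omega[of UNIV] by (simp add: ennreal_mult_less_top)
    finally show ?thesis .
  qed
  have TVV_fin: "TV (V i) \<Omega> < \<infinity>" for i
    by (rule le_less_trans[OF TVV]) (use TVw L1fin ennreal_less_top[of "1/2"] in \<open>simp add: ennreal_mult_less_top\<close>)
  have VBV: "V i \<in> BV \<mu> \<Omega>" for i
    using V01 by (intro BV_I[of "V i" 1] mVO' TVV_fin) (auto simp: abs_le_iff intro: order_trans[of _ 0])
  \<comment> \<open>Almost every boundary point lies in \<open>mt\<close> and has a trace of
    \<open>V i\<close>, or is a point where \<Omega> has density 0.\<close>
  have goodV: "H {x\<in>Bd. \<not> good (V i) (borel_trace (V i)) x} = 0" for i
  proof -
    have "{x\<in>Bd. \<not> good (V i) (borel_trace (V i)) x} \<subseteq>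
      {x \<in> Bd. \<not> Limsup (at_right 0) (\<lambda>r. \<mu> (ball x r - \<Omega>) / \<mu> (ball x r)) > 0} \<union> {x \<in> mt. \<not> (\<exists>t. is_trace \<mu> \<Omega> (V i) x t)}"
    proof
      fix x assume x: "x \<in> {x\<in>Bd. \<not> good (V i) (borel_trace (V i)) x}"
      show "x \<in> {x \<in> Bd. \<not> Limsup (at_right 0) (\<lambda>r. \<mu> (ball x r - \<Omega>) / \<mu> (ball x r)) > 0} \<union> {x \<in> mt. \<not> (\<exists>t. is_trace \<mu> \<Omega> (V i) x t)}"
      proof (cases "x \<in> mt")
        case True
        have "\<not> is_trace \<mu> \<Omega> (V i) x t" for t
        proof
          assume t: "is_trace \<mu> \<Omega> (V i) x t"
          have "borel_trace (V i) x = t" using V01 by (intro borel_trace_eq[OF Bd_of_mt[OF True] mVO' _ t])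
          then have "good (V i) (borel_trace (V i)) x" using t by (intro is_trace_good[OF Bd_of_mt[OF True]]) simp
          then show False using x by simp
        qed
        then show ?thesis using True by auto
      next
        case False
        then show ?thesis using x zero_density_good[OF False, of "V i" "borel_trace (V i)"] by blast
      qed
    qed
    then have "H {x\<in>Bd. \<not> good (V i) (borel_trace (V i)) x} \<le> H ({x \<in> Bd. \<not> Limsup (at_right 0) (\<lambda>r. \<mu> (ball x r - \<Omega>) / \<mu> (ball x r)) > 0} \<union> {x \<in> mt. \<not> (\<exists>t. is_trace \<mu> \<Omega> (V i) x t)})"
      by (rule outer_measureD(2)[OF H_outer])
    also have "\<dots> \<le> H {x \<in> Bd. \<not> Limsup (at_right 0) (\<lambda>r. \<mu> (ball x r - \<Omega>) / \<mu> (ball x r)) > 0} + H {x \<in> mt. \<not> (\<exists>t. is_trace \<mu> \<Omega> (V i) x t)}"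
      by (rule outer_measureD(3)[OF H_outer])
    also have "\<dots> = 0" using density traces[OF VBV] by simp
    finally show ?thesis by simp
  qed
  define e where "e = \<epsilon>/4"
  have e: "e > 0" using \<epsilon> by (simp add: e_def)
  have limV: "(\<lambda>i. L1 UNIV (\<lambda>x. V i x - chi x)) \<longlonglongrightarrow> 0"
  proof (rule tendsto_sandwich[OF _ _ tendsto_const lim])
    have "L1 UNIV (\<lambda>x. V i x - chi x) \<le> L1 \<Omega> (\<lambda>x. w i x - u x)" for i
    proof -
      have "L1 UNIV (\<lambda>x. V i x - chi x) \<le> L1 \<Omega> (y i)"
      proof (rule nn_integral_mono)
        fix x
        show "ennreal \<bar>V i x - chi x\<bar> * indicator UNIV x \<le> ennreal \<bar>y i x\<bar> * indicator \<Omega> x"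
        proof (cases "x \<in> \<Omega>")
          case True
          have "\<bar>V i x - chi x\<bar> = eta N x * y i x" using True y01[OF True, of i] eta_bounds[of N x] by (simp add: V_def)
          also have "\<dots> \<le> 1 * y i x" using y01[OF True, of i] eta_bounds[of N x] by (intro mult_right_mono) auto
          finally show ?thesis using True y01[OF True, of i] by (auto intro!: ennreal_leI)
        qed (simp add: V_def)
      qed
      then show ?thesis using L1y by (rule order_trans)
    qed
    then show "\<forall>\<^sub>F i in sequentially. L1 UNIV (\<lambda>x. V i x - chi x) \<le> L1 \<Omega> (\<lambda>x. w i x - u x)" by simp
  qed auto
  have Pfin: "TV chi UNIV < \<infinity>" using P_finite[of UNIV] by (simp add: P_open)
  have "\<forall>\<^sub>F i in sequentially. TV chi UNIV \<le> TV (V i) UNIV + ennreal e"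
    by (rule eventually_TV_le[OF open_UNIV chi_mble mV Pfin limV e])
  moreover have "\<forall>\<^sub>F i in sequentially. ennreal K * L1 \<Omega> (\<lambda>x. w i x - u x) < ennreal e"
  proof -
    have "(\<lambda>i. ennreal K * L1 \<Omega> (\<lambda>x. w i x - u x)) \<longlonglongrightarrow> ennreal K * 0"
      by (intro ennreal_tendsto_cmult lim) auto
    then show ?thesis by (rule order_tendstoD) (use e in simp)
  qed
  ultimately show ?thesis
  proof eventually_elim
    case (elim i)
    define \<tau> where "\<tau> = borel_trace (V i)"
    have \<tau>b: "\<tau> \<in> borel_measurable borel" unfolding \<tau>_def by (rule borel_trace_measurable[OF mV])
    have \<tau>01: "0 \<le> \<tau> x \<and> \<tau> x \<le> 1" for x unfolding \<tau>_def by (rule borel_trace_bounds)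
    let ?A = "\<integral>\<^sup>+ x \<in> S. ennreal (\<tau> x) \<partial>PM" and ?B = "\<integral>\<^sup>+ x \<in> S. ennreal (1 - \<tau> x) \<partial>PM"
    have mS: "(\<lambda>x. ennreal (\<tau> x) * indicator S x) \<in> borel_measurable PM" "(\<lambda>x. ennreal (1 - \<tau> x) * indicator S x) \<in> borel_measurable PM"
      using measurable_PM[OF \<tau>b] S_sets by measurable
    have AB: "?A + ?B = P S"
    proof -
      have "?A + ?B = (\<integral>\<^sup>+ x. ennreal (\<tau> x) * indicator S x + ennreal (1 - \<tau> x) * indicator S x \<partial>PM)"
        using mS by (rule nn_integral_add[symmetric])
      also have "\<dots> = (\<integral>\<^sup>+ x. indicator S x \<partial>PM)"
        using \<tau>01 by (intro nn_integral_cong) (simp add: distrib_right[symmetric] ennreal_plus[symmetric] del: ennreal_plus)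
      finally show ?thesis using S_sets by (simp add: emeasure_PM)
    qed
    have Afin: "?A + P (- S) \<noteq> \<infinity>"
    proof -
      have "?A \<le> P S" using AB by (metis le_iff_add)
      then show ?thesis using P_finite[of S] P_finite[of "- S"] by (auto simp: top_unique)
    qed
    \<comment> \<open>The perimeter consists of the trace integral \<open>?A\<close>, the deficit
      \<open>?B\<close> and the part off S. Comparison with \<open>TV_trace_bound\<close> cancels
      the first and the last, and the deficit is left against the variation of \<open>V i\<close>
      inside \<Omega>.\<close>
    have "(?A + P (- S)) + ?B = P S + P (- S)" unfolding AB[symmetric] by (simp add: add_ac)
    also have "\<dots> = TV chi UNIV"
    proof -
      have "P S + P (- S) = emeasure PM S + emeasure PM (- S)"
        using S_sets sets.compl_sets[OF S_sets] by (simp add: emeasure_PM Compl_eq_Diff_UNIV)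
      also have "\<dots> = emeasure PM (S \<union> - S)"
        using S_sets sets.compl_sets[OF S_sets] by (intro plus_emeasure) (auto simp: Compl_eq_Diff_UNIV)
      also have "S \<union> - S = UNIV" by auto
      also have "emeasure PM UNIV = P UNIV" by (intro emeasure_PM sets_PM) auto
      finally show ?thesis by (simp add: P_open)
    qed
    also have "\<dots> \<le> TV (V i) UNIV + ennreal e" by (rule elim(1))
    also have "TV (V i) UNIV \<le> TV (V i) \<Omega> + ?A + P (- S)"
      unfolding \<tau>_def by (rule TV_trace_bound[OF mV V01 V0 TVV_fin borel_trace_measurable[OF mV] borel_trace_bounds goodV S_sets])
    finally have "(?A + P (- S)) + ?B \<le> (?A + P (- S)) + (TV (V i) \<Omega> + ennreal e)"
      by (simp add: add_right_mono add_ac)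
    then have B: "?B \<le> TV (V i) \<Omega> + ennreal e" using Afin by (subst (asm) ennreal_add_left_cancel_le) auto
    have "(\<integral>\<^sup>+ x \<in> S. ennreal \<bar>Tr (w i) x - Tr u x\<bar> \<partial>PM) = (\<integral>\<^sup>+ x. ennreal 2 * (ennreal (1 - \<tau> x) * indicator S x) \<partial>PM)"
    proof (rule nn_integral_cong_AE)
      show "AE x in PM. ennreal \<bar>Tr (w i) x - Tr u x\<bar> * indicator S x = ennreal 2 * (ennreal (1 - \<tau> x) * indicator S x)"
        using trace_AE[OF admissibleD(4)[OF u]] trace_AE[OF admissibleD(4)[OF w[of i]]]
      proof eventually_elim
        case (elim x)
        show ?case
        proof (cases "x \<in> S")
          case True
          then have x: "x \<in> mt" using S_mt by auto
          then have t: "is_trace \<mu> \<Omega> (w i) x (Tr (w i) x)" "is_trace \<mu> \<Omega> u x (Tr u x)" using elim by auto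
          let ?d = "\<bar>1/2 * Tr (w i) x + (-(1/2)) * Tr u x\<bar>"
          obtain \<delta> where \<delta>: "\<delta> > 0" "\<And>z. z \<in> \<Omega> \<Longrightarrow> infdist z Bd < \<delta> \<Longrightarrow> real N + 1 < rho \<Omega> z"
            using near_Bd_rho[of "real N + 1"] by blast
          \<comment> \<open>Within \<delta> of the boundary the cutoff is 1, so the trace deficit of
            \<open>V i\<close> is half the distance of the traces of \<open>w i\<close> and
            u.\<close>
          have "is_trace \<mu> \<Omega> (V i) x (1 - ?d)"
          proof (rule is_trace_combine[OF mw mu t \<delta>(1)])
            fix z assume z: "z \<in> \<Omega>" "z \<in> ball x \<delta>"
            have "infdist z Bd \<le> dist z x" using x mt_subset_Bd by (intro infdist_le) auto
            then have "real N + 1 < rho \<Omega> z" using z by (intro \<delta>(2)) (auto simp: dist_commute)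
            then have "eta N z = 1" by (simp add: eta_def)
            then have "V i z - (1 - ?d) = ?d - y i z" using z by (simp add: V_def)
            moreover have "\<bar>?d - y i z\<bar> \<le> \<bar>w i z - Tr (w i) x\<bar> + \<bar>u z - Tr u x\<bar>" unfolding y_def by arith
            ultimately show "\<bar>V i z - (1 - ?d)\<bar> \<le> \<bar>w i z - Tr (w i) x\<bar> + \<bar>u z - Tr u x\<bar>" by simp
          qed
          then have "\<tau> x = 1 - ?d" unfolding \<tau>_def using V01 by (intro borel_trace_eq[OF Bd_of_mt[OF x] mVO'])
          then have "\<bar>Tr (w i) x - Tr u x\<bar> = 2 * (1 - \<tau> x)" by (simp add: abs_if)
          then have "ennreal \<bar>Tr (w i) x - Tr u x\<bar> = ennreal 2 * ennreal (1 - \<tau> x)"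
            using \<tau>01[of x] by (subst ennreal_mult[symmetric]) simp_all
          then show ?thesis using True by simp
        qed simp
      qed
    qed
    \<comment> \<open>The factor 2 undoes the halving, and the variations in the tail reappear with
      the constant 1.\<close>
    also have "\<dots> = ennreal 2 * ?B" by (rule nn_integral_cmult[OF mS(2)])
    also have "\<dots> \<le> ennreal 2 * (TV (V i) \<Omega> + ennreal e)" by (intro mult_left_mono B) auto
    also have "\<dots> \<le> ennreal 2 * ((ennreal (1/2) * TV (w i) (T N) + ennreal (1/2) * TV u (T N) + ennreal e) + ennreal e)"
      by (intro mult_left_mono add_right_mono order_trans[OF TVV] add_left_mono) (use elim(2) in auto)
    also have "\<dots> = (ennreal 2 * ennreal (1/2)) * TV (w i) (T N) + (ennreal 2 * ennreal (1/2)) * TV u (T N) + (ennreal 2 * ennreal e + ennreal 2 * ennreal e)"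
      by (simp add: distrib_left mult.assoc add.assoc)
    also have "ennreal 2 * ennreal (1/2) = 1" by (subst ennreal_mult[symmetric]) simp_all
    also have "ennreal 2 * ennreal e + ennreal 2 * ennreal e = ennreal \<epsilon>"
      using \<epsilon> unfolding e_def by (subst (1 2) ennreal_mult[symmetric], simp_all, subst ennreal_plus[symmetric], simp_all)
    finally show ?case by simp
  qed
qed

text \<open>The variation of \<open>w i\<close> is divided between an inner level L, where lower
  semicontinuity applies, and the tail \<open>T N\<close>, which pays for the change of the boundary
  term by \<open>trace_difference_bound\<close>. Superadditivity on these disjoint sets ensures that
  no part of it is spent twice.\<close>

lemma energy_lsc:
  assumes mu: "mble \<Omega> u" and ub: "\<And>x. x \<in> \<Omega> \<Longrightarrow> -1 \<le> u x \<and> u x \<le> 1" and w: "\<And>i::nat. w i \<in> admissible"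
    and lim: "(\<lambda>i. L1 \<Omega> (\<lambda>x. w i x - u x)) \<longlonglongrightarrow> 0"
    and energy: "\<And>\<delta>. \<delta> > 0 \<Longrightarrow> \<forall>\<^sub>F i in sequentially. energy (w i) \<le> m + \<delta>"
  shows "u \<in> admissible" "energy u \<le> m"
proof -
  define A where "A = (LINT x|PM. \<bar>F x\<bar>)"
  note Om = Omega(3)
  \<comment> \<open>The boundary term is at most A in absolute value, so bounded energy means
    bounded variation.\<close>
  have "TV u \<Omega> \<le> ennreal (m + 1 + A)"
  proof (rule TV_lsc[OF Om mu])
    fix V and \<epsilon> :: real assume V: "compactly_contained V \<Omega>" "\<epsilon> > 0"
    have "\<forall>\<^sub>F i in sequentially. L1 \<Omega> (\<lambda>x. w i x - u x) < ennreal \<epsilon>" using lim V by (intro order_tendstoD) auto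
    then obtain i where i: "L1 \<Omega> (\<lambda>x. w i x - u x) < ennreal \<epsilon>" "energy (w i) \<le> m + 1"
      using eventually_happens[OF eventually_conj[OF _ energy[of 1]]] by fastforce
    have "L1 V (\<lambda>x. w i x - u x) \<le> ennreal \<epsilon>"
      by (rule order_trans[OF L1_mono_set[OF cc_subset[OF V(1)]] less_imp_le[OF i(1)]])
    moreover have "TV (w i) \<Omega> \<le> ennreal (m + 1 + A)"
    proof -
      have "enn2real (TV (w i) \<Omega>) \<le> m + 1 + A"
        using i(2) TrF_integrable(2)[OF w, of i] unfolding energy_def A_def by linarith
      then have "ennreal (enn2real (TV (w i) \<Omega>)) \<le> ennreal (m + 1 + A)" by (rule ennreal_leI)
      then show ?thesis using admissibleD(2)[OF w, of i] by simp
    qed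
    ultimately show "\<exists>v. mble \<Omega> v \<and> L1 V (\<lambda>x. v x - u x) \<le> ennreal \<epsilon> \<and> TV v \<Omega> \<le> ennreal (m + 1 + A) + ennreal \<epsilon>"
      using admissibleD(1)[OF w, of i] by (intro exI[of _ "w i"]) (auto intro: add_increasing2)
  qed
  then have fin: "TV u \<Omega> < \<infinity>" by (rule le_less_trans) simp
  show uA: "u \<in> admissible" by (rule admissibleI[OF mu fin ub])
  show "energy u \<le> m"
  proof (rule field_le_epsilon)
    fix \<epsilon> :: real assume \<epsilon>: "\<epsilon> > 0"
    \<comment> \<open>Two errors e come from the variation of u, two from the boundary term and one
      from the energy of \<open>w i\<close>.\<close>
    define e where "e = \<epsilon> / 5"
    have e: "e > 0" using \<epsilon> by (simp add: e_def)
    obtain N' :: nat where N': "TV u (T N') \<le> ennreal e" using TV_tail[OF Om mu fin e] .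
    \<comment> \<open>The shift makes \<open>T N\<close> disjoint from L, while L and
      \<open>T N'\<close> still overlap as in \<open>TV_lev_tail\<close>.\<close>
    define N where "N = N' + 2"
    define L where "L = lev \<Omega> (real N' + 2)"
    have L: "open L" "L \<subseteq> \<Omega>" using cc_open[OF cc_lev[OF Om]] cc_subset[OF cc_lev[OF Om]] by (auto simp: L_def)
    have TN: "TV u (T N) \<le> ennreal e"
      by (rule order_trans[OF TV_mono[OF open_T open_T] N']) (auto simp: N_def)
    have mL: "mble L v" if "mble \<Omega> v" for v using mble_subset[OF that L(2)] L(1) by auto
    have fL: "TV v L < \<infinity>" "TV v (T N) < \<infinity>" if "TV v \<Omega> < \<infinity>" for v
      using TV_mono[OF Om L(1) L(2), of v] TV_mono[OF Om open_T, of N v] that by (auto intro: le_less_trans)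
    have "(\<lambda>i. L1 L (\<lambda>x. w i x - u x)) \<longlonglongrightarrow> 0"
      by (rule tendsto_sandwich[OF _ _ tendsto_const lim]) (auto intro!: always_eventually L1_mono_set L)
    then have "\<forall>\<^sub>F i in sequentially. TV u L \<le> TV (w i) L + ennreal e"
      by (intro eventually_TV_le L mL mu admissibleD(1)[OF w] fL fin e)
    then obtain i where i: "TV u L \<le> TV (w i) L + ennreal e"
      "(\<integral>\<^sup>+ x \<in> S. ennreal \<bar>Tr (w i) x - Tr u x\<bar> \<partial>PM) \<le> TV (w i) (T N) + TV u (T N) + ennreal e" "energy (w i) \<le> m + e"
      using eventually_happens[OF eventually_conj[OF _ eventually_conj[OF trace_difference_bound[OF uA w lim e] energy[OF e]]]]
      by fastforce
    let ?b = "enn2real (TV (w i) L)" and ?t = "enn2real (TV (w i) (T N))"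
    have b: "TV (w i) L = ennreal ?b" and t: "TV (w i) (T N) = ennreal ?t" using fL[OF admissibleD(2)[OF w, of i]] by simp_all
    have uL: "TV u L \<le> ennreal ?b + ennreal e" using i(1) by (subst b[symmetric])
    have "TV u \<Omega> \<le> TV u L + TV u (T N')" unfolding L_def by (rule TV_lev_tail[OF Om mu])
    also have "\<dots> \<le> (ennreal ?b + ennreal e) + ennreal e" by (intro add_mono N' uL)
    also have "\<dots> = ennreal (?b + e + e)" using e by (simp add: ennreal_plus[symmetric] del: ennreal_plus)
    finally have 1: "enn2real (TV u \<Omega>) \<le> ?b + 2 * e" using e by (intro enn2real_leI) (auto simp: add.assoc)
    have LT: "L \<inter> T N = {}" by (auto simp: L_def lev_def N_def)
    have "ennreal (?b + ?t) = ennreal ?b + ennreal ?t" by simp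
    also have "\<dots> = TV (w i) L + TV (w i) (T N)" by (simp only: b[symmetric] t[symmetric])
    also have "\<dots> \<le> TV (w i) (L \<union> T N)" by (intro TV_superadd L open_T LT)
    also have "\<dots> \<le> TV (w i) \<Omega>" using L open_T by (intro TV_mono Om open_Un) auto
    finally have "ennreal (?b + ?t) \<le> TV (w i) \<Omega>" .
    then have 2: "?b + ?t \<le> enn2real (TV (w i) \<Omega>)"
      using admissibleD(2)[OF w, of i] by (metis add_nonneg_nonneg enn2real_ennreal enn2real_mono enn2real_nonneg infinity_ennreal_def)
    have "ennreal \<bar>boundary_energy (w i) - boundary_energy u\<bar> \<le> (\<integral>\<^sup>+ x. ennreal (norm (Tr (w i) x * F x - Tr u x * F x)) \<partial>PM)"
      unfolding boundary_energy_def using TrF_integrable(1)[OF w] TrF_integrable(1)[OF uA]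
        integral_norm_bound_ennreal[of PM "\<lambda>x. Tr (w i) x * F x - Tr u x * F x"]
      by (simp add: Bochner_Integration.integral_diff)
    also have "\<dots> \<le> (\<integral>\<^sup>+ x \<in> S. ennreal \<bar>Tr (w i) x - Tr u x\<bar> \<partial>PM)"
    proof (rule nn_integral_mono)
      fix x
      have "\<bar>Tr (w i) x * F x - Tr u x * F x\<bar> = \<bar>Tr (w i) x - Tr u x\<bar> * \<bar>F x\<bar>"
        by (simp add: abs_mult[symmetric] left_diff_distrib)
      also have "\<dots> \<le> \<bar>Tr (w i) x - Tr u x\<bar> * 1" by (intro mult_left_mono F_bound) auto
      finally show "ennreal (norm (Tr (w i) x * F x - Tr u x * F x)) \<le> ennreal \<bar>Tr (w i) x - Tr u x\<bar> * indicator S x"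
        by (cases "x \<in> S") (auto simp: S_def intro!: ennreal_leI)
    qed
    also have "\<dots> \<le> ennreal ?t + ennreal e + ennreal e"
      unfolding t[symmetric] by (intro order_trans[OF i(2)] add_mono TN) auto
    also have "\<dots> = ennreal (?t + e + e)" using e by (simp add: ennreal_plus[symmetric] del: ennreal_plus)
    finally have "\<bar>boundary_energy (w i) - boundary_energy u\<bar> \<le> ?t + e + e" using e by (subst (asm) ennreal_le_iff) auto
    then show "energy u \<le> m + \<epsilon>" using 1 2 i(3) unfolding energy_def e_def by linarith
  qed
qed

section \<open>Minimizing sequences in L2\<close>

definition zero_ext :: "('a \<Rightarrow> real) \<Rightarrow> 'a \<Rightarrow> real" where "zero_ext v x = indicator \<Omega> x * v x"

definition sq_norm :: "('a \<Rightarrow> real) \<Rightarrow> real" where "sq_norm v = (LINT x|M. (zero_ext v x)\<^sup>2)"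

lemma zero_ext_meas: "v \<in> admissible \<Longrightarrow> zero_ext v \<in> borel_measurable M"
  using admissibleD(1) unfolding set_borel_measurable_def zero_ext_def[abs_def] by simp

lemma zero_ext_bound: "v \<in> admissible \<Longrightarrow> \<bar>zero_ext v x\<bar> \<le> 1"
  using admissibleD(3)[of v x] by (auto simp: zero_ext_def indicator_def abs_le_iff)

lemma bounded_integrable_M:
  assumes "g \<in> borel_measurable M" "\<And>x. x \<notin> \<Omega> \<Longrightarrow> g x = 0" "\<And>x. \<bar>g x\<bar> \<le> (B::real)"
  shows "integrable M g"
  using assms Omega(3) finite_Omega[of UNIV] by (intro integrableI_bounded_set[where A = \<Omega> and B = B]) auto

lemma zero_ext_integrable: "v \<in> admissible \<Longrightarrow> integrable M (zero_ext v)"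
  by (rule bounded_integrable_M[OF zero_ext_meas _ zero_ext_bound]) (auto simp: zero_ext_def)

lemma zero_ext_mult_integrable: "v \<in> admissible \<Longrightarrow> w \<in> admissible \<Longrightarrow> integrable M (\<lambda>x. zero_ext v x * zero_ext w x)"
proof (rule bounded_integrable_M[where B = 1])
  assume vw: "v \<in> admissible" "w \<in> admissible"
  show "(\<lambda>x. zero_ext v x * zero_ext w x) \<in> borel_measurable M" using zero_ext_meas vw by simp
  show "\<bar>zero_ext v x * zero_ext w x\<bar> \<le> 1" for x
    unfolding abs_mult using mult_le_one[OF zero_ext_bound _ zero_ext_bound] vw by simp
qed (simp add: zero_ext_def)

text \<open>The law is stated with the midpoint instead of the sum, because the midpoint is again
  admissible.\<close>

lemma parallelogram:
  assumes v: "v \<in> admissible" and w: "w \<in> admissible"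
  shows "(LINT x|M. (zero_ext v x - zero_ext w x)\<^sup>2) = 2 * sq_norm v + 2 * sq_norm w - 4 * sq_norm (\<lambda>x. 1/2 * v x + 1/2 * w x)"
proof -
  let ?z = "\<lambda>x. 1/2 * v x + 1/2 * w x"
  have z: "?z \<in> admissible" by (rule midpoint_admissible(1)[OF v w])
  note i = zero_ext_mult_integrable[OF v v] zero_ext_mult_integrable[OF w w] zero_ext_mult_integrable[OF z z]
  have "(zero_ext v x - zero_ext w x)\<^sup>2 = 2 * (zero_ext v x * zero_ext v x) + 2 * (zero_ext w x * zero_ext w x) - 4 * (zero_ext ?z x * zero_ext ?z x)" for x
    by (simp add: zero_ext_def power2_eq_square algebra_simps)
  then have "(LINT x|M. (zero_ext v x - zero_ext w x)\<^sup>2) = (LINT x|M. 2 * (zero_ext v x * zero_ext v x) + 2 * (zero_ext w x * zero_ext w x) - 4 * (zero_ext ?z x * zero_ext ?z x))" by simp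
  also have "\<dots> = 2 * sq_norm v + 2 * sq_norm w - 4 * sq_norm ?z"
    using i by (simp add: sq_norm_def power2_eq_square)
  finally show ?thesis .
qed

lemma zero_admissible: "(\<lambda>_. 0) \<in> admissible"
  using Omega(3) TV_const[OF Omega(3)] by (intro admissibleI mble_const) auto

text \<open>The functions of almost minimal \<open>L\<^sup>2\<close> norm among the almost minimizers form a Cauchy sequence,
  because the set of almost minimizers is convex. This replaces the compactness of BV in \<open>L\<^sup>1\<close>.\<close>

lemma minimizing_sequence:
  obtains v and m :: real where "\<And>i::nat. v i \<in> admissible" "\<And>w. w \<in> admissible \<Longrightarrow> m \<le> energy w" "\<And>\<delta>. \<delta> > 0 \<Longrightarrow> \<forall>\<^sub>F i in sequentially. energy (v i) \<le> m + \<delta>"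
    "\<And>e. e > 0 \<Longrightarrow> \<exists>N. \<forall>i\<ge>N. \<forall>j\<ge>N. (LINT x|M. (zero_ext (v i) x - zero_ext (v j) x)\<^sup>2) < e"
proof -
  define A where "A = (LINT x|PM. \<bar>F x\<bar>)"
  define m where "m = (INF v\<in>admissible. energy v)"
  have "bdd_below (energy ` admissible)"
    using TrF_integrable(2) by (intro bdd_belowI2[of _ "- A"]) (force simp: energy_def A_def abs_le_iff intro: add_increasing)
  then have m: "m \<le> energy v" if "v \<in> admissible" for v unfolding m_def using that by (rule cINF_lower)
  define s where "s n = 1 / real (Suc n)" for n
  have s: "s n > 0" for n by (simp add: s_def)
  have s0: "s \<longlonglongrightarrow> 0" unfolding s_def by (rule LIMSEQ_inverse_real_of_nat[unfolded inverse_eq_divide])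
  \<comment> \<open>These sets decrease and contain the midpoints of their elements. Their minimal
    square norms d n therefore increase, and they converge, being bounded by the measure of
    \<Omega>.\<close>
  define C where "C n = {v \<in> admissible. energy v \<le> m + s n}" for n
  have Cne: "C n \<noteq> {}" for n
  proof -
    have "\<exists>v\<in>admissible. energy v < m + s n" using s[of n] zero_admissible unfolding m_def by (intro cInf_lessD[of "energy ` admissible", simplified]) auto
    then show ?thesis by (auto simp: C_def intro: less_imp_le)
  qed
  have Cmono: "C j \<subseteq> C i" if "i \<le> j" for i j
  proof -
    have "s j \<le> s i" unfolding s_def using that by (intro divide_left_mono) auto
    then show ?thesis by (auto simp: C_def)
  qed
  have q0: "0 \<le> sq_norm v" for v unfolding sq_norm_def by (intro integral_nonneg_AE) auto
  have qb: "sq_norm v \<le> measure M \<Omega>" if "v \<in> admissible" for v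
  proof -
    have "sq_norm v \<le> (LINT x|M. indicator \<Omega> x)"
      unfolding sq_norm_def
    proof (rule integral_mono)
      show "integrable M (\<lambda>x. (zero_ext v x)\<^sup>2)" using zero_ext_mult_integrable[OF that that] by (simp add: power2_eq_square)
      show "integrable M (indicator \<Omega> :: 'a \<Rightarrow> real)" using Omega(3) by (intro bounded_integrable_M[where B = 1]) auto
      show "(zero_ext v x)\<^sup>2 \<le> indicator \<Omega> x" for x
        using zero_ext_bound[OF that, of x] by (cases "x \<in> \<Omega>") (auto simp: abs_square_le_1 zero_ext_def[of v x])
    qed
    then show ?thesis by simp
  qed
  define d where "d n = (INF v\<in>C n. sq_norm v)" for n
  have bdd: "bdd_below (sq_norm ` C n)" for n using q0 by (intro bdd_belowI2[of _ 0]) auto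
  have dl: "d n \<le> sq_norm v" if "v \<in> C n" for n v unfolding d_def using bdd that by (rule cINF_lower)
  have dmono: "d i \<le> d j" if "i \<le> j" for i j
    unfolding d_def using bdd Cne Cmono[OF that] by (intro cINF_superset_mono) auto
  have db: "d n \<le> measure M \<Omega>" for n
  proof -
    obtain v where "v \<in> C n" using Cne by blast
    then show ?thesis using dl[of v n] qb[of v] by (auto simp: C_def)
  qed
  have "convergent d"
    by (rule incseq_convergent[of d "measure M \<Omega>"]) (use dmono db in \<open>auto simp: incseq_def convergent_def\<close>)
  then have dC: "Cauchy d" by (rule convergent_Cauchy)
  have "\<exists>v. v \<in> C n \<and> sq_norm v < d n + s n" for n
  proof -
    have "\<exists>v\<in>C n. sq_norm v < d n + s n" using s[of n] Cne unfolding d_def by (intro cInf_lessD[of "sq_norm ` C n", simplified]) auto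
    then show ?thesis by blast
  qed
  then obtain v where v: "\<And>n. v n \<in> C n" "\<And>n. sq_norm (v n) < d n + s n" by metis
  have vA: "v n \<in> admissible" "energy (v n) \<le> m + s n" for n using v(1)[of n] by (auto simp: C_def)
  \<comment> \<open>For i \<le> j both functions lie in \<open>C i\<close>, hence so does their
    midpoint, whose square norm is at least d i. The parallelogram law turns this into a bound for
    their distance.\<close>
  have D: "(LINT x|M. (zero_ext (v i) x - zero_ext (v j) x)\<^sup>2) \<le> 2 * (d j - d i) + 2 * s i + 2 * s j" if "i \<le> j" for i j
  proof -
    let ?z = "\<lambda>x. 1/2 * v i x + 1/2 * v j x"
    have "v j \<in> C i" using v(1) Cmono[OF that] by auto
    then have "?z \<in> C i" using midpoint_admissible[OF vA(1)[of i] vA(1)[of j]] vA(2)[of i] by (auto simp: C_def)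
    then have "d i \<le> sq_norm ?z" by (rule dl)
    moreover have "2 * a + 2 * b - 4 * c \<le> 2 * (d j - d i) + 2 * s i + 2 * s j"
      if "d i \<le> c" "a < d i + s i" "b < d j + s j" for a b c using that by argo
    ultimately show ?thesis unfolding parallelogram[OF vA(1) vA(1)] using v(2) by blast
  qed
  show ?thesis
  proof (rule that[of v m])
    show "\<forall>\<^sub>F i in sequentially. energy (v i) \<le> m + \<delta>" if "\<delta> > 0" for \<delta>
      using order_tendstoD(2)[OF s0 that]
    proof eventually_elim
      case (elim i)
      then show ?case using vA(2)[of i] by simp
    qed
    show "\<exists>N. \<forall>i\<ge>N. \<forall>j\<ge>N. (LINT x|M. (zero_ext (v i) x - zero_ext (v j) x)\<^sup>2) < e" if e: "e > 0" for e
    proof -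
      have "\<forall>\<^sub>F n in sequentially. s n < e / 8" using e by (intro order_tendstoD(2)[OF s0]) auto
      then obtain N1 where N1: "\<And>n. n \<ge> N1 \<Longrightarrow> s n < e / 8" by (auto simp: eventually_sequentially)
      have "\<exists>N. \<forall>i\<ge>N. \<forall>j\<ge>N. \<bar>d i - d j\<bar> < e / 4" using dC e unfolding Cauchy_def dist_real_def by (metis divide_pos_pos zero_less_numeral)
      then obtain N2 where N2: "\<And>i j. i \<ge> N2 \<Longrightarrow> j \<ge> N2 \<Longrightarrow> \<bar>d i - d j\<bar> < e / 4" by blast
      have main: "(LINT x|M. (zero_ext (v i) x - zero_ext (v j) x)\<^sup>2) < e" if "i \<le> j" "i \<ge> max N1 N2" for i j
        using D[OF that(1)] N1[of i] N1[of j] N2[of i j] that by (simp add: abs_if split: if_splits)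
      show ?thesis
      proof (intro exI[of _ "max N1 N2"] allI impI)
        fix i j assume "i \<ge> max N1 N2" "j \<ge> max N1 N2"
        then show "(LINT x|M. (zero_ext (v i) x - zero_ext (v j) x)\<^sup>2) < e"
          using main[of i j] main[of j i] by (cases "i \<le> j") (auto simp: power2_commute)
      qed
    qed
  qed (use vA m in auto)
qed

text \<open>On a set of finite measure a Cauchy sequence in L2 is Cauchy in L1. A subsequence
  converges almost everywhere and, being bounded, in L1, and \<open>energy_lsc\<close> applies to
  its limit.\<close>

lemma minimizer:
  obtains u where "u \<in> admissible" "\<And>w. w \<in> admissible \<Longrightarrow> energy u \<le> energy w"
proof -
  obtain v and m :: real where v: "\<And>i::nat. v i \<in> admissible" and m: "\<And>w. w \<in> admissible \<Longrightarrow> m \<le> energy w"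
    and mi: "\<And>\<delta>. \<delta> > 0 \<Longrightarrow> \<forall>\<^sub>F i in sequentially. energy (v i) \<le> m + \<delta>"
    and c: "\<And>e. e > 0 \<Longrightarrow> \<exists>N. \<forall>i\<ge>N. \<forall>j\<ge>N. (LINT x|M. (zero_ext (v i) x - zero_ext (v j) x)\<^sup>2) < e"
    by (rule minimizing_sequence) blast
  define V where "V = measure M \<Omega> + 1"
  have V: "V \<ge> 1" by (simp add: V_def)
  have iOm: "integrable M (indicator \<Omega> :: 'a \<Rightarrow> real)" using Omega(3) by (intro bounded_integrable_M[where B = 1]) auto
  have L1C: "\<exists>N. \<forall>i\<ge>N. \<forall>j\<ge>N. (LINT x|M. norm (zero_ext (v i) x - zero_ext (v j) x)) < e" if e: "e > 0" for e
  proof -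
    \<comment> \<open>The inequality \<open>\<bar>a\<bar> \<le> \<eta> + a\<^sup>2 / \<eta>\<close>
      stands in for that of Cauchy and Schwarz; with this \<eta> its first term contributes at most
      e/2.\<close>
    define \<eta> where "\<eta> = e / (2 * V)"
    have \<eta>: "\<eta> > 0" using e V by (simp add: \<eta>_def)
    obtain N where N: "\<And>i j. i \<ge> N \<Longrightarrow> j \<ge> N \<Longrightarrow> (LINT x|M. (zero_ext (v i) x - zero_ext (v j) x)\<^sup>2) < e * \<eta> / 2"
      using c[of "e * \<eta> / 2"] e \<eta> by auto
    have "(LINT x|M. norm (zero_ext (v i) x - zero_ext (v j) x)) < e" if "i \<ge> N" "j \<ge> N" for i j
    proof -
      have i2: "integrable M (\<lambda>x. (zero_ext (v i) x - zero_ext (v j) x)\<^sup>2)"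
        using zero_ext_mult_integrable[OF v v, of i i] zero_ext_mult_integrable[OF v v, of i j] zero_ext_mult_integrable[OF v v, of j j]
        by (simp add: power2_eq_square algebra_simps)
      have "(LINT x|M. norm (zero_ext (v i) x - zero_ext (v j) x)) \<le> (LINT x|M. \<eta> * indicator \<Omega> x + (zero_ext (v i) x - zero_ext (v j) x)\<^sup>2 / \<eta>)"
      proof (rule integral_mono)
        show "integrable M (\<lambda>x. norm (zero_ext (v i) x - zero_ext (v j) x))" using zero_ext_integrable[OF v] by auto
        show "integrable M (\<lambda>x. \<eta> * indicator \<Omega> x + (zero_ext (v i) x - zero_ext (v j) x)\<^sup>2 / \<eta>)" using iOm i2 by auto
        fix x
        show "norm (zero_ext (v i) x - zero_ext (v j) x) \<le> \<eta> * indicator \<Omega> x + (zero_ext (v i) x - zero_ext (v j) x)\<^sup>2 / \<eta>"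
        proof (cases "x \<in> \<Omega>")
          case True
          let ?d = "\<bar>zero_ext (v i) x - zero_ext (v j) x\<bar>"
          have "0 \<le> ?d * \<eta>" using \<eta> by simp
          then have "?d * \<eta> \<le> \<eta>\<^sup>2 + ?d\<^sup>2"
            using sum_squares_bound[of ?d \<eta>] unfolding mult.assoc by linarith
          then have "?d \<le> \<eta> + ?d\<^sup>2 / \<eta>" using \<eta> by (simp add: field_simps power2_eq_square)
          then show ?thesis using True by simp
        qed (simp add: zero_ext_def)
      qed
      also have "\<dots> = \<eta> * measure M \<Omega> + (LINT x|M. (zero_ext (v i) x - zero_ext (v j) x)\<^sup>2) / \<eta>" using iOm i2 by simp
      also have "\<dots> < \<eta> * V + (e * \<eta> / 2) / \<eta>"
        using N[OF that] \<eta> by (intro add_le_less_mono mult_left_mono divide_strict_right_mono) (auto simp: V_def)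
      also have "\<dots> = e" using \<eta> V by (simp add: \<eta>_def)
      finally show ?thesis .
    qed
    then show ?thesis by blast
  qed
  obtain r where r: "strict_mono r" and ae: "AE x in M. Cauchy (\<lambda>i. zero_ext (v (r i)) x)"
    using cauchy_L1_AE_cauchy_subseq[of M "\<lambda>i. zero_ext (v i)", OF zero_ext_integrable[OF v] L1C] by blast
  \<comment> \<open>Clipping gives the bounds at every point, also where the subsequence fails to
    converge.\<close>
  define u where "u x = max (-1) (min 1 (lim (\<lambda>i. zero_ext (v (r i)) x)))" for x
  have um: "u \<in> borel_measurable M"
    unfolding u_def using zero_ext_meas[OF v] by measurable
  then have mu: "mble \<Omega> u" unfolding set_borel_measurable_def using Omega(3) by (intro borel_measurable_scaleR) auto
  have ub: "-1 \<le> u x \<and> u x \<le> 1" for x by (simp add: u_def)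
  have lim: "(\<lambda>i. L1 \<Omega> (\<lambda>x. v (r i) x - u x)) \<longlonglongrightarrow> 0"
  proof -
    have "(\<lambda>i. \<integral>\<^sup>+ x. ennreal \<bar>v (r i) x - u x\<bar> * indicator \<Omega> x \<partial>M) \<longlonglongrightarrow> (\<integral>\<^sup>+ x. 0 \<partial>M)"
    proof (rule nn_integral_dominated_convergence[where w = "\<lambda>x. ennreal 2 * indicator \<Omega> x"])
      show "(\<lambda>x. ennreal \<bar>v (r i) x - u x\<bar> * indicator \<Omega> x) \<in> borel_measurable M" for i
        by (intro mble_L1 mble_diff admissibleD(1)[OF v] mu)
      show "AE x in M. ennreal \<bar>v (r i) x - u x\<bar> * indicator \<Omega> x \<le> ennreal 2 * indicator \<Omega> x" for i
      proof (rule AE_I2)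
        fix x
        show "ennreal \<bar>v (r i) x - u x\<bar> * indicator \<Omega> x \<le> ennreal 2 * indicator \<Omega> x"
        proof (cases "x \<in> \<Omega>")
          case True
          have "\<bar>v (r i) x - u x\<bar> \<le> 2" using admissibleD(3)[OF v True, of "r i"] ub[of x] by (auto simp: abs_le_iff)
          then have "ennreal \<bar>v (r i) x - u x\<bar> \<le> ennreal 2" by (rule ennreal_leI)
          then show ?thesis using True by simp
        qed simp
      qed
      have "(\<integral>\<^sup>+ x. ennreal 2 * indicator \<Omega> x \<partial>M) = ennreal 2 * emeasure M \<Omega>" using Omega(3) by (intro nn_integral_cmult_indicator) auto
      also have "\<dots> < \<infinity>" using finite_Omega[of UNIV] by (simp add: ennreal_mult_less_top)
      finally show "(\<integral>\<^sup>+ x. ennreal 2 * indicator \<Omega> x \<partial>M) < \<infinity>" .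
      show "AE x in M. (\<lambda>i. ennreal \<bar>v (r i) x - u x\<bar> * indicator \<Omega> x) \<longlonglongrightarrow> 0"
        using ae
      proof eventually_elim
        case (elim x)
        show ?case
        proof (cases "x \<in> \<Omega>")
          case True
          have zero_ext: "zero_ext (v (r i)) x = v (r i) x" for i using True by (simp add: zero_ext_def)
          have l: "(\<lambda>i. zero_ext (v (r i)) x) \<longlonglongrightarrow> lim (\<lambda>i. zero_ext (v (r i)) x)" using elim by (simp add: Cauchy_convergent_iff convergent_LIMSEQ_iff)
          have "-1 \<le> lim (\<lambda>i. zero_ext (v (r i)) x)" "lim (\<lambda>i. zero_ext (v (r i)) x) \<le> 1"
            using LIMSEQ_le_const[OF l, of "-1"] LIMSEQ_le_const2[OF l, of 1] zero_ext_bound[OF v] by (auto simp: abs_le_iff minus_le_iff)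
          then have "u x = lim (\<lambda>i. zero_ext (v (r i)) x)" by (simp add: u_def)
          then have "(\<lambda>i. v (r i) x) \<longlonglongrightarrow> u x" using l by (simp add: zero_ext)
          then have "(\<lambda>i. \<bar>v (r i) x - u x\<bar>) \<longlonglongrightarrow> 0" using tendsto_rabs_zero LIM_zero by blast
          then have "(\<lambda>i. ennreal \<bar>v (r i) x - u x\<bar>) \<longlonglongrightarrow> ennreal 0" by (rule tendsto_ennrealI)
          then show ?thesis using True by simp
        qed simp
      qed
    qed (use Omega(3) in auto)
    then show ?thesis by simp
  qed
  have mi': "\<forall>\<^sub>F i in sequentially. energy (v (r i)) \<le> m + \<delta>" if "\<delta> > 0" for \<delta>
    using eventually_subseq[OF r mi[OF that]] .
  have "u \<in> admissible" "energy u \<le> m" using energy_lsc[OF mu ub v lim mi'] by auto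
  then show ?thesis using m by (intro that[of u]) (auto intro: order_trans)
qed

end

theorem theorem4p15:
  fixes \<mu> :: "'a::complete_space set \<Rightarrow> ennreal"
    and \<Omega> :: "'a set"
    and f :: "'a \<Rightarrow> real"
  assumes two_points: "\<exists>x y :: 'a. x \<noteq> y"
    and regular: "borel_regular_outer_measure \<mu>"
    and doubling: "doubling \<mu>"
    and poincare: "poincare_1_1 \<mu>"
    and Omega: "\<Omega> \<noteq> {}" "bounded \<Omega>" "open \<Omega>"
    and density:
      "codim1_hausdorff \<mu> {x \<in> frontier \<Omega>.
         \<not> Limsup (at_right 0) (\<lambda>r. \<mu> (ball x r - \<Omega>) / \<mu> (ball x r)) > 0} = 0"
    and traces:
      "\<And>u. u \<in> BV \<mu> \<Omega> \<Longrightarrow>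
         codim1_hausdorff \<mu> {x \<in> mt_boundary \<mu> \<Omega>. \<not> (\<exists>t. is_trace \<mu> \<Omega> u x t)} = 0"
    and ahlfors:
      "\<exists>C\<^sub>A\<ge>1. \<forall>x\<in>frontier \<Omega>. \<forall>r. 0 < r \<and> r \<le> diameter \<Omega> \<longrightarrow>
         ennreal (1 / C\<^sub>A) * (\<mu> (ball x r) / ennreal r) \<le> codim1_hausdorff \<mu> (ball x r \<inter> frontier \<Omega>) \<and>
         codim1_hausdorff \<mu> (ball x r \<inter> frontier \<Omega>) \<le> ennreal C\<^sub>A * (\<mu> (ball x r) / ennreal r)"
    and f_integrable: "set_integrable (perimeter_measure \<mu> \<Omega>) (mt_boundary \<mu> \<Omega>) f"
    and f_bounds: "\<And>x. x \<in> mt_boundary \<mu> \<Omega> \<Longrightarrow> -1 \<le> f x \<and> f x \<le> 1"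
    and f_mean: "(LINT x:mt_boundary \<mu> \<Omega>|perimeter_measure \<mu> \<Omega>. f x) = 0"
  shows "\<exists>u \<in> BV \<mu> \<Omega>. (\<forall>x\<in>\<Omega>. -1 \<le> u x \<and> u x \<le> 1) \<and>
           (\<forall>v \<in> BV \<mu> \<Omega>. (\<forall>x\<in>\<Omega>. -1 \<le> v x \<and> v x \<le> 1) \<longrightarrow>
              neumann_functional \<mu> \<Omega> f u \<le> neumann_functional \<mu> \<Omega> f v)"
proof -
  interpret doubling_measure \<mu> by unfold_locales fact+
  show ?thesis
  proof (cases "frontier \<Omega> = {}")
    case True
    \<comment> \<open>Without boundary the functional is the variation alone, and the function 0
      minimizes it.\<close>
    have e: "mt_boundary \<mu> \<Omega> = {}" using mt_boundary_subset_frontier[OF Omega(3)] True by auto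
    have z: "TV (\<lambda>_. 0) \<Omega> = 0" by (rule TV_const[OF Omega(3)])
    show ?thesis
    proof (intro bexI[of _ "\<lambda>_. 0"] conjI ballI impI)
      show "(\<lambda>_. 0) \<in> BV \<mu> \<Omega>" using z by (simp add: BV_def set_integrable_def)
      show "neumann_functional \<mu> \<Omega> f (\<lambda>_. 0) \<le> neumann_functional \<mu> \<Omega> f v" for v
        by (simp add: neumann_functional_def e z set_lebesgue_integral_def)
    qed auto
  next
    case False
    obtain CA where CA: "CA \<ge> 1" and ahl: "\<And>x r. x \<in> frontier \<Omega> \<Longrightarrow> 0 < r \<Longrightarrow> r \<le> diameter \<Omega> \<Longrightarrow>
         ennreal (1 / CA) * (\<mu> (ball x r) / ennreal r) \<le> codim1_hausdorff \<mu> (ball x r \<inter> frontier \<Omega>) \<and>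
         codim1_hausdorff \<mu> (ball x r \<inter> frontier \<Omega>) \<le> ennreal CA * (\<mu> (ball x r) / ennreal r)"
      using ahlfors by blast
    interpret neumann_problem \<mu> \<Omega> CA f
      by unfold_locales (use Omega False CA ahl density traces f_integrable f_bounds in auto)
    obtain u where u: "u \<in> admissible" "\<And>w. w \<in> admissible \<Longrightarrow> energy u \<le> energy w" using minimizer by blast
    show ?thesis
      using u unfolding energy_eq_functional admissible_def by blast
  qed
qed

end
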